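(* Let $d\ge 2$, $T>0$, $\varepsilon>0$, and let $N\ge 1$ be an integer. Let $\widetilde\rho\in C^\infty(\mathbb{T}^d\times\mathbb{R})$ be a real-valued function such that $\operatorname{supp}_t\widetilde\rho\subset(0,T)$ and $\int_{\mathbb{T}^d}\widetilde\rho(x,t)\,dx=0$ for all $t\in\mathbb{R}$. Then there exist a divergence-free vector field $u:[0,T]\times\mathbb{T}^d\to\mathbb{R}^d$ and a density $\rho:[0,T]\times\mathbb{T}^d\to\mathbb{R}$ such that all of the following hold. 1. $u\in L^1(0,T;W^{1,p}(\mathbb{T}^d))$ and $\rho\in L^p(0,T;C^k(\mathbb{T}^d))$ for all $1\le p<\infty$ and all $k\in\mathbb{N}$. 2. $\rho u\in L^1([0,T]\times\mathbb{T}^d)$ and $(\rho,u)$ is a weak solution to the transport equation $\partial_t\rho+u\cdot\nabla\rho=0$ with initial datum $\rho_0=0$. 3. $\|\rho-\widetilde\rho\|_{L^N(0,T;C^N(\mathbb{T}^d))}\le\varepsilon$. 4. $\operatorname{supp}_t\rho\subset\operatorname{supp}_t\widetilde\rho$.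
   Context: $\mathbb{T}^d=\mathbb{R}^d/\mathbb{Z}^d$; $\nabla$ and $\operatorname{div}$ act in the space variable only, and $\operatorname{div}u=0$ is understood in the sense of distributions. The temporal support $\operatorname{supp}_t f$ of a function $f$ of $(x,t)$ is the closure of the set of times $t$ for which $f(\cdot,t)$ is not a.e. zero on $\mathbb{T}^d$ (for a function defined up to null sets, for a suitable representative). A pair $(\rho,u)$ with $\operatorname{div}u=0$ and $\rho,\rho u\in L^1([0,T]\times\mathbb{T}^d)$ is a weak solution of $\partial_t\rho+u\cdot\nabla\rho=0$ with initial datum $\rho_0$ if $$-\int_{\mathbb{T}^d}\rho_0\,\varphi(0,\cdot)\,dx=\int_0^T\int_{\mathbb{T}^d}\rho\,(\partial_t\varphi+u\cdot\nabla\varphi)\,dx\,dt\qquad\text{for all }\varphi\in C_c^\infty([0,T)\times\mathbb{T}^d).$$ *)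

theory Defs
  imports "HOL-Analysis.Analysis"
begin

section \<open>The torus\<close>

text \<open>
  Functions on the torus are functions on \<open>real^'n\<close> with period 1 in every coordinate;
  integrals over the torus are integrals over the unit cube with Lebesgue measure.
  Functions of time and space are curried, with time as the first argument.
\<close>

definition periodic :: "(real^'n \<Rightarrow> 'b) \<Rightarrow> bool" where
  "periodic f \<longleftrightarrow> (\<forall>x i. f (x + axis i 1) = f x)"

abbreviation unit_cube :: "(real^'n) set" where
  "unit_cube \<equiv> cbox 0 1"

abbreviation torus :: "(real^'n) measure" where
  "torus \<equiv> lebesgue_on unit_cube"


section \<open>Differentiability classes\<close>

text \<open>
  Derivatives are taken within \<open>S\<close>, so that they are one-sided at boundary points belonging to
  \<open>S\<close>. The definition is used only for convex \<open>S\<close> with nonempty interior, where the derivative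
  within \<open>S\<close> is unique.
\<close>

primrec Ck_on :: "nat \<Rightarrow> ('a::euclidean_space) set \<Rightarrow> ('a \<Rightarrow> real) \<Rightarrow> bool" where
  "Ck_on 0 S f \<longleftrightarrow> continuous_on S f"
| "Ck_on (Suc k) S f \<longleftrightarrow>
     (\<forall>x\<in>S. f differentiable (at x within S)) \<and>
     (\<forall>b\<in>Basis. Ck_on k S (\<lambda>x. frechet_derivative f (at x within S) b))"

definition Cinf_on :: "('a::euclidean_space) set \<Rightarrow> ('a \<Rightarrow> real) \<Rightarrow> bool" where
  "Cinf_on S f \<longleftrightarrow> (\<forall>k. Ck_on k S f)"

definition partial :: "'n \<Rightarrow> (real^'n \<Rightarrow> real) \<Rightarrow> real^'n \<Rightarrow> real" where
  "partial i f x = frechet_derivative f (at x) (axis i 1)"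

definition Ck_torus :: "nat \<Rightarrow> (real^'n \<Rightarrow> real) set" where
  "Ck_torus k = {f. periodic f \<and> Ck_on k UNIV f}"

text \<open>
  The maximum over all multi-indices of order at most \<open>k\<close> of the sup norms of the derivatives.
  A multi-index is given as a list of coordinate directions; for functions of class \<open>C^k\<close> the
  order of the list is immaterial.
\<close>

definition Ck_norm :: "nat \<Rightarrow> (real^'n \<Rightarrow> real) \<Rightarrow> ennreal" where
  "Ck_norm k f = (SUP is\<in>{is. length is \<le> k}. SUP x. ennreal \<bar>foldr partial is f x\<bar>)"


section \<open>Lebesgue and Sobolev spaces on the torus\<close>

definition enn_powr :: "ennreal \<Rightarrow> real \<Rightarrow> ennreal" where
  "enn_powr x a = (if x = \<infinity> then \<infinity> else ennreal (enn2real x powr a))"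

definition Lp_norm :: "real \<Rightarrow> (real^'n \<Rightarrow> 'b::euclidean_space) \<Rightarrow> ennreal" where
  "Lp_norm p f = enn_powr (\<integral>\<^sup>+x. ennreal (norm (f x) powr p) \<partial>torus) (1 / p)"

definition Lp_torus :: "real \<Rightarrow> (real^'n \<Rightarrow> 'b::euclidean_space) set" where
  "Lp_torus p = {f. periodic f \<and> f \<in> borel_measurable torus \<and> Lp_norm p f < \<infinity>}"

definition has_weak_partial ::
  "'n \<Rightarrow> (real^'n \<Rightarrow> 'b::euclidean_space) \<Rightarrow> (real^'n \<Rightarrow> 'b) \<Rightarrow> bool" where
  "has_weak_partial i f g \<longleftrightarrow>
     f \<in> Lp_torus 1 \<and> g \<in> Lp_torus 1 \<and>
     (\<forall>\<phi>. periodic \<phi> \<and> Cinf_on UNIV \<phi> \<longrightarrow>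
        (LINT x|torus. partial i \<phi> x *\<^sub>R f x) = - (LINT x|torus. \<phi> x *\<^sub>R g x))"

text \<open>The choice below is unique up to null sets whenever a weak derivative exists.\<close>

definition weak_partial ::
  "'n \<Rightarrow> (real^'n \<Rightarrow> 'b::euclidean_space) \<Rightarrow> real^'n \<Rightarrow> 'b" where
  "weak_partial i f = (SOME g. has_weak_partial i f g)"

definition W1p_torus :: "real \<Rightarrow> (real^'n \<Rightarrow> 'b::euclidean_space) set" where
  "W1p_torus p =
     {f. f \<in> Lp_torus p \<and> (\<forall>i. \<exists>g. has_weak_partial i f g \<and> g \<in> Lp_torus p)}"

definition W1p_norm :: "real \<Rightarrow> (real^'n \<Rightarrow> 'b::euclidean_space) \<Rightarrow> ennreal" where
  "W1p_norm p f = enn_powr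
     ((\<integral>\<^sup>+x. ennreal (norm (f x) powr p) \<partial>torus) +
      (\<Sum>i\<in>UNIV. \<integral>\<^sup>+x. ennreal (norm (weak_partial i f x) powr p) \<partial>torus)) (1 / p)"


section \<open>Bochner spaces\<close>

text \<open>
  A Banach space of functions is given by its set \<open>X\<close> of elements (representatives, where the
  elements are classes modulo null sets) and its norm \<open>nrm\<close>. Strong measurability means
  approximability almost everywhere, in norm, by \<open>X\<close>-valued simple functions.
\<close>

definition strongly_measurable ::
  "real set \<Rightarrow> ('a \<Rightarrow> 'b::real_normed_vector) set \<Rightarrow> (('a \<Rightarrow> 'b) \<Rightarrow> ennreal) \<Rightarrow>
   (real \<Rightarrow> 'a \<Rightarrow> 'b) \<Rightarrow> bool" where
  "strongly_measurable J X nrm f \<longleftrightarrow>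
     (\<exists>s. (\<forall>n::nat. simple_function (lebesgue_on J) (s n) \<and> s n ` J \<subseteq> X) \<and>
          (AE t in lebesgue_on J.
             f t \<in> X \<and> (\<lambda>n. nrm (\<lambda>x. s n t x - f t x)) \<longlonglongrightarrow> 0))"

definition bochner_norm ::
  "real \<Rightarrow> real set \<Rightarrow> (('a \<Rightarrow> 'b::real_normed_vector) \<Rightarrow> ennreal) \<Rightarrow>
   (real \<Rightarrow> 'a \<Rightarrow> 'b) \<Rightarrow> ennreal" where
  "bochner_norm p J nrm f = enn_powr (\<integral>\<^sup>+t. enn_powr (nrm (f t)) p \<partial>(lebesgue_on J)) (1 / p)"

definition bochner_space ::
  "real \<Rightarrow> real set \<Rightarrow> ('a \<Rightarrow> 'b::real_normed_vector) set \<Rightarrow> (('a \<Rightarrow> 'b) \<Rightarrow> ennreal) \<Rightarrow>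
   (real \<Rightarrow> 'a \<Rightarrow> 'b) set" where
  "bochner_space p J X nrm =
     {f. strongly_measurable J X nrm f \<and> bochner_norm p J nrm f < \<infinity>}"


section \<open>Space-time functions and the transport equation\<close>

definition L1_spacetime :: "real \<Rightarrow> (real \<Rightarrow> real^'n \<Rightarrow> 'b::euclidean_space) \<Rightarrow> bool" where
  "L1_spacetime T f \<longleftrightarrow> (\<lambda>(t, x). f t x) absolutely_integrable_on ({0..T} \<times> unit_cube)"

definition temporal_support :: "real set \<Rightarrow> (real \<Rightarrow> real^'n \<Rightarrow> real) \<Rightarrow> real set" where
  "temporal_support J f = closure {t\<in>J. \<not> (AE x in torus. f t x = 0)}"

text \<open>
  Compactly supported smooth functions on the product of the interval \<open>J\<close> with the torus,
  extended by zero to the times outside \<open>J\<close>. As the torus is compact, the support is compact iff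
  it lies over a compact set of times.
\<close>

definition test_function :: "real set \<Rightarrow> (real \<Rightarrow> real^'n \<Rightarrow> real) \<Rightarrow> bool" where
  "test_function J \<phi> \<longleftrightarrow>
     (\<forall>t. periodic (\<phi> t)) \<and> Cinf_on (J \<times> UNIV) (\<lambda>(t, x). \<phi> t x) \<and>
     (\<exists>K. compact K \<and> K \<subseteq> J \<and> (\<forall>t x. t \<notin> K \<longrightarrow> \<phi> t x = 0))"

definition dt :: "real set \<Rightarrow> (real \<Rightarrow> real^'n \<Rightarrow> real) \<Rightarrow> real \<Rightarrow> real^'n \<Rightarrow> real" where
  "dt J \<phi> t x = frechet_derivative (\<lambda>(s, y). \<phi> s y) (at (t, x) within J \<times> UNIV) (1, 0)"

definition grad :: "(real^'n \<Rightarrow> real) \<Rightarrow> real^'n \<Rightarrow> real^'n" where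
  "grad f x = (\<chi> i. partial i f x)"

definition divergence_free :: "real \<Rightarrow> (real \<Rightarrow> real^'n \<Rightarrow> real^'n) \<Rightarrow> bool" where
  "divergence_free T u \<longleftrightarrow>
     L1_spacetime T u \<and>
     (\<forall>\<phi>. test_function {0<..<T} \<phi> \<longrightarrow>
        (LINT t|lebesgue_on {0..T}. LINT x|torus. u t x \<bullet> grad (\<phi> t) x) = 0)"

definition weak_transport_solution ::
  "real \<Rightarrow> (real \<Rightarrow> real^'n \<Rightarrow> real) \<Rightarrow> (real \<Rightarrow> real^'n \<Rightarrow> real^'n) \<Rightarrow> (real^'n \<Rightarrow> real) \<Rightarrow> bool"
where
  "weak_transport_solution T \<rho> u \<rho>0 \<longleftrightarrow>
     divergence_free T u \<and>
     L1_spacetime T \<rho> \<and> L1_spacetime T (\<lambda>t x. \<rho> t x *\<^sub>R u t x) \<and>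
     (\<forall>\<phi>. test_function {0..<T} \<phi> \<longrightarrow>
        - (LINT x|torus. \<rho>0 x * \<phi> 0 x) =
        (LINT t|lebesgue_on {0..T}. LINT x|torus.
           \<rho> t x * (dt {0..<T} \<phi> t x + u t x \<bullet> grad (\<phi> t) x)))"

end

theory Submission
  imports Defs
begin

text \<open>
  On each cell of a fine time mesh that lies in the support of \<open>\<rho>'\<close>, the density is frozen at the value of
  \<open>\<rho>'\<close>; near the ends of the cell it has to be created from zero and destroyed again. Since \<open>\<rho>'(t, \<cdot>)\<close> has
  mean zero, it is a divergence \<open>\<Sum>\<^sub>k \<partial>\<^sub>k a\<^sub>k\<close>, so creation and destruction amount to finitely many jumps by some
  \<open>\<partial>\<^sub>k a\<close>, each to be performed within a given time interval.

  A jump by \<open>\<partial>\<^sub>k a\<close> is split into one exact solution, a density transported by a shear flow in direction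
  \<open>k\<close>, and three further jumps \<open>\<partial>\<^sub>j a'\<close> at shorter times. The shear has a concentrated profile, so that
  it is small in \<open>W\<^bsup>1,p\<^esup>\<close> and the functions \<open>a'\<close> are small in \<open>L\<^sup>1\<close>, while the flux of the density stays
  bounded by the \<open>L\<^sup>1\<close> norm of \<open>a\<close>. The densities may be huge, but as the durations of the three jumps are
  chosen afterwards, the time integrals of all norms needed remain small. Iterating, with \<open>p\<close> and the order of the
  norms growing along the iteration, leaves after \<open>n\<close> steps an error \<open>\<integral> \<partial>\<^sub>k a' \<phi> = - \<integral> a' \<partial>\<^sub>k \<phi>\<close> in the
  weak formulation, which tends to zero, and the exact solutions make up the pair \<open>(\<rho>, u)\<close>.
\<close>

section \<open>Smooth functions\<close>

text \<open>What can be afforded is decided by scaling in time. A shear with displacement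
  \<open>g\<close>, run for a time \<tau> with velocity \<open>g / \<tau>\<close>, costs the norm of
  \<open>g\<close> in L^1 in time whatever \<tau> is, and its flux costs the L^1 norm of density
  times \<open>g\<close>; any power of any norm of the density only costs a factor \<tau>. Hence
  only the W^(1,p) norm of \<open>g\<close>, the flux and the new errors restrict the profile. Small
  errors force the slope of \<open>g\<close> up to a large value L. Attained on a fraction 1/B of
  each period only, this slope has a p-th power integral of about L^p / B, which is small for B
  large and p bounded, though not for p = \<infinity>. The potential of the first jump is
  \<open>a\<close> times a profile divided by the amplitude h of \<open>g\<close>; in the flux this
  1/h cancels against \<open>g\<close>, which leaves the L^1 norm of \<open>a\<close> times an
  absolute constant. As the functions \<open>a\<close> of level n have L^1 norms of order 2^(-n) by
  construction, the fluxes of all levels are summable.\<close>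

abbreviation smooth :: "('a::euclidean_space \<Rightarrow> real) \<Rightarrow> bool" where
  "smooth f \<equiv> Cinf_on UNIV f"

definition dird :: "'a \<Rightarrow> ('a::euclidean_space \<Rightarrow> real) \<Rightarrow> 'a \<Rightarrow> real" where
  "dird v f x = frechet_derivative f (at x) v"

lemma partial_eq_dird: "partial i = dird (axis i 1)"
  by (simp add: fun_eq_iff partial_def dird_def)

lemma dird_eqI: "(f has_derivative f') (at x) \<Longrightarrow> dird v f x = f' v"
  unfolding dird_def using frechet_derivative_at by metis

lemma Ck_UNIV_Suc:
  "Ck_on (Suc k) UNIV f \<longleftrightarrow> (\<forall>x. f differentiable (at x)) \<and> (\<forall>b\<in>Basis. Ck_on k UNIV (dird b f))"
  by (auto simp: dird_def[abs_def])

declare Ck_on.simps(2) [simp del]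

lemma Ck_UNIV_SucD: "Ck_on (Suc k) UNIV f \<Longrightarrow> Ck_on k UNIV f"
proof (induction k arbitrary: f)
  case 0
  then show ?case
    by (auto simp: Ck_UNIV_Suc continuous_on_eq_continuous_within differentiable_imp_continuous_within)
next
  case (Suc k)
  then show ?case unfolding Ck_UNIV_Suc by (metis Ck_UNIV_Suc)
qed

lemma smooth_diff: "smooth f \<Longrightarrow> f differentiable (at x)"
  unfolding Cinf_on_def by (metis Ck_UNIV_Suc)

lemma smooth_cont: "smooth f \<Longrightarrow> continuous_on S f"
  unfolding Cinf_on_def by (metis Ck_on.simps(1) continuous_on_subset subset_UNIV)

lemma smooth_iff: "smooth f \<longleftrightarrow> (\<forall>x. f differentiable (at x)) \<and> (\<forall>b\<in>Basis. smooth (dird b f))"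
proof -
  have "smooth f \<longleftrightarrow> (\<forall>k. Ck_on (Suc k) UNIV f)"
    unfolding Cinf_on_def using Ck_UNIV_SucD by blast
  then show ?thesis unfolding Cinf_on_def Ck_UNIV_Suc by blast
qed

lemma smooth_has_derivative: "smooth f \<Longrightarrow> (f has_derivative (\<lambda>v. dird v f x)) (at x)"
  using smooth_diff frechet_derivative_works unfolding dird_def[abs_def] by metis

section \<open>Closure properties of the classes C^k and of smooth functions\<close>

lemma Ck_const: "Ck_on k UNIV (\<lambda>x. c)"
proof (induction k arbitrary: c)
  case (Suc k)
  have "dird b (\<lambda>x::'a. c) = (\<lambda>x. 0)" for b by (simp add: dird_def fun_eq_iff)
  then show ?case unfolding Ck_UNIV_Suc using Suc by auto
qed auto

lemma Ck_add: "Ck_on k UNIV f \<Longrightarrow> Ck_on k UNIV g \<Longrightarrow> Ck_on k UNIV (\<lambda>x. f x + g x)"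
proof (induction k arbitrary: f g)
  case (Suc k)
  have "dird b (\<lambda>x. f x + g x) = (\<lambda>x. dird b f x + dird b g x)" for b
  proof
    fix x
    have "f differentiable (at x)" "g differentiable (at x)" using Suc.prems Ck_UNIV_Suc by blast+
    then have "((\<lambda>x. f x + g x) has_derivative (\<lambda>v. dird v f x + dird v g x)) (at x)"
      unfolding dird_def by (intro has_derivative_add) (auto simp: frechet_derivative_works[symmetric])
    then show "dird b (\<lambda>x. f x + g x) x = dird b f x + dird b g x" by (rule dird_eqI)
  qed
  then show ?case using Suc unfolding Ck_UNIV_Suc by (auto intro!: derivative_intros)
qed (auto intro!: continuous_intros)

lemma Ck_mult: "Ck_on k UNIV f \<Longrightarrow> Ck_on k UNIV g \<Longrightarrow> Ck_on k UNIV (\<lambda>x. f x * g x)"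
proof (induction k arbitrary: f g)
  case (Suc k)
  have "dird b (\<lambda>x. f x * g x) = (\<lambda>x. f x * dird b g x + dird b f x * g x)" for b
  proof
    fix x
    have "f differentiable (at x)" "g differentiable (at x)" using Suc.prems Ck_UNIV_Suc by blast+
    then have "((\<lambda>x. f x * g x) has_derivative (\<lambda>v. f x * dird v g x + dird v f x * g x)) (at x)"
      unfolding dird_def by (intro has_derivative_mult) (auto simp: frechet_derivative_works[symmetric])
    then show "dird b (\<lambda>x. f x * g x) x = f x * dird b g x + dird b f x * g x" by (rule dird_eqI)
  qed
  moreover have "Ck_on k UNIV f" "Ck_on k UNIV g" using Suc.prems Ck_UNIV_SucD by auto
  ultimately show ?case using Suc unfolding Ck_UNIV_Suc by (auto intro!: derivative_intros Ck_add)
qed (auto intro!: continuous_intros)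

lemma Ck_sum: "finite I \<Longrightarrow> (\<And>i. i \<in> I \<Longrightarrow> Ck_on k UNIV (f i)) \<Longrightarrow> Ck_on k UNIV (\<lambda>x. \<Sum>i\<in>I. f i x)"
  by (induction I rule: finite_induct) (auto intro!: Ck_add Ck_const)

lemma differentiable_componentwise:
  fixes g :: "'a::euclidean_space \<Rightarrow> 'b::euclidean_space"
  assumes "\<And>c. c \<in> Basis \<Longrightarrow> (\<lambda>x. g x \<bullet> c) differentiable (at x)"
  shows "(g has_derivative (\<lambda>v. \<Sum>c\<in>Basis. dird v (\<lambda>x. g x \<bullet> c) x *\<^sub>R c)) (at x)"
  unfolding has_derivative_componentwise_within[of g]
proof
  fix c :: 'b assume c: "c \<in> Basis"
  have "((\<lambda>x. g x \<bullet> c) has_derivative (\<lambda>v. dird v (\<lambda>x. g x \<bullet> c) x)) (at x)"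
    using assms[OF c] unfolding dird_def by (simp add: frechet_derivative_works[symmetric])
  then show "((\<lambda>x. g x \<bullet> c) has_derivative
      (\<lambda>v. (\<Sum>c\<in>Basis. dird v (\<lambda>x. g x \<bullet> c) x *\<^sub>R c) \<bullet> c)) (at x)"
    using c by simp
qed

lemma dird_linear: "f differentiable (at x) \<Longrightarrow> linear (\<lambda>v. dird v f x)"
  unfolding dird_def by (rule linear_frechet_derivative)

text \<open>By the chain rule and induction on \<open>k\<close>. The inner map enters through its
  coordinates because the classes are defined for real-valued functions only; the outer function is
  generalised, since its partial derivatives take its place in the induction hypothesis.\<close>

lemma Ck_compose:
  fixes f :: "'b::euclidean_space \<Rightarrow> real" and g :: "'a::euclidean_space \<Rightarrow> 'b"
  assumes "Ck_on k UNIV f" "\<And>c. c \<in> Basis \<Longrightarrow> Ck_on k UNIV (\<lambda>x. g x \<bullet> c)"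
  shows "Ck_on k UNIV (\<lambda>x. f (g x))"
  using assms
proof (induction k arbitrary: f)
  case 0
  have "continuous_on UNIV g" unfolding continuous_on_componentwise[of UNIV g] using 0 by auto
  then show ?case using 0 by (auto intro: continuous_on_compose2)
next
  case (Suc k)
  have df: "f differentiable (at y)" for y using Suc.prems Ck_UNIV_Suc by blast
  have dg: "c \<in> Basis \<Longrightarrow> (\<lambda>x. g x \<bullet> c) differentiable (at x)" for x c
    using Suc.prems(2) Ck_UNIV_Suc by blast
  have D: "((\<lambda>x. f (g x)) has_derivative
      (\<lambda>v. \<Sum>c\<in>Basis. dird v (\<lambda>x. g x \<bullet> c) x * dird c f (g x))) (at x)" for x
  proof -
    have "(f has_derivative (\<lambda>v. dird v f (g x))) (at (g x))"
      using df unfolding dird_def by (simp add: frechet_derivative_works[symmetric])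
    from has_derivative_compose[OF differentiable_componentwise[OF dg] this]
    show ?thesis
      by (simp add: linear_sum[OF dird_linear[OF df]] linear_cmul[OF dird_linear[OF df]])
  qed
  have "dird b (\<lambda>x. f (g x)) = (\<lambda>x. \<Sum>c\<in>Basis. dird b (\<lambda>x. g x \<bullet> c) x * dird c f (g x))" for b
    using dird_eqI[OF D] by (simp add: fun_eq_iff)
  moreover have "Ck_on k UNIV (\<lambda>x. \<Sum>c\<in>Basis. dird b (\<lambda>x. g x \<bullet> c) x * dird c f (g x))"
    if "b \<in> Basis" for b
  proof (intro Ck_sum Ck_mult)
    fix c :: 'b assume c: "c \<in> Basis"
    show "Ck_on k UNIV (dird b (\<lambda>x. g x \<bullet> c))"
      using that c Suc.prems(2)[OF c] by (simp add: Ck_UNIV_Suc)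
    show "Ck_on k UNIV (\<lambda>x. dird c f (g x))"
    proof (rule Suc.IH)
      show "Ck_on k UNIV (dird c f)" using c Suc.prems(1) by (simp add: Ck_UNIV_Suc)
      show "Ck_on k UNIV (\<lambda>x. g x \<bullet> e)" if "e \<in> Basis" for e
        by (rule Ck_UNIV_SucD[OF Suc.prems(2)[OF that]])
    qed
  qed simp
  ultimately show ?case unfolding Ck_UNIV_Suc by (auto intro: D[THEN differentiableI])
qed

lemma smooth_const [intro]: "smooth (\<lambda>x. c)"
  and smooth_add [intro]: "smooth f \<Longrightarrow> smooth g \<Longrightarrow> smooth (\<lambda>x. f x + g x)"
  and smooth_mult [intro]: "smooth f \<Longrightarrow> smooth g \<Longrightarrow> smooth (\<lambda>x. f x * g x)"
  and smooth_sum: "finite I \<Longrightarrow> (\<And>i. i \<in> I \<Longrightarrow> smooth (h i)) \<Longrightarrow> smooth (\<lambda>x. \<Sum>i\<in>I. h i x)"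
  by (auto simp: Cinf_on_def intro: Ck_const Ck_add Ck_mult Ck_sum)

lemma smooth_compose:
  assumes "smooth f" "\<And>c. c \<in> Basis \<Longrightarrow> smooth (\<lambda>x. g x \<bullet> c)"
  shows "smooth (\<lambda>x. f (g x))"
  using assms unfolding Cinf_on_def by (blast intro: Ck_compose)

lemma smooth_compose_real: "smooth f \<Longrightarrow> smooth g \<Longrightarrow> smooth (\<lambda>x. f (g x :: real))"
  by (rule smooth_compose) auto

lemma smooth_minus [intro]: "smooth f \<Longrightarrow> smooth (\<lambda>x. - f x)"
  using smooth_mult[OF smooth_const[of "-1"], of f] by simp

lemma smooth_diff' [intro]: "smooth f \<Longrightarrow> smooth g \<Longrightarrow> smooth (\<lambda>x. f x - g x)"
  using smooth_add[OF _ smooth_minus, of f g] by simp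

lemma smooth_divide [intro]: "smooth f \<Longrightarrow> smooth (\<lambda>x. f x / c)"
  using smooth_mult[OF smooth_const[of "1/c"], of f] by simp

lemma smooth_power [intro]: "smooth f \<Longrightarrow> smooth (\<lambda>x. f x ^ n)"
  by (induction n) auto

lemma smooth_linear: "bounded_linear f \<Longrightarrow> smooth f"
  unfolding smooth_iff[of f]
proof safe
  assume f: "bounded_linear f"
  show "f differentiable at x" for x by (simp add: bounded_linear_imp_differentiable f)
  fix b
  have "dird b f = (\<lambda>x. f b)"
    using dird_eqI[OF bounded_linear_imp_has_derivative[OF f]] by (simp add: fun_eq_iff)
  then show "smooth (dird b f)" by auto
qed

lemma smooth_inner: "smooth (\<lambda>x. x \<bullet> c)"
  by (rule smooth_linear) (rule bounded_linear_inner_left)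

lemma smooth_nth: "smooth (\<lambda>x::real^'n. x $ i)"
  by (rule smooth_linear) (rule bounded_linear_vec_nth)

lemma smooth_id: "smooth (\<lambda>x::real. x)"
  by (rule smooth_linear) (rule bounded_linear_ident)

lemma smooth_fst: "smooth (\<lambda>x::real\<times>'a::euclidean_space. fst x)"
  by (rule smooth_linear) (rule bounded_linear_fst)

lemma dird_real: "(f has_real_derivative f') (at x) \<Longrightarrow> dird v f x = f' * v"
  unfolding has_field_derivative_def by (rule dird_eqI)

lemma smooth_real_deriv:
  assumes "smooth (f::real\<Rightarrow>real)"
  shows "(f has_real_derivative dird 1 f x) (at x)" "smooth (dird 1 f)"
proof -
  have eq: "dird v f x = dird 1 f x * v" for v x
    using linear_cmul[OF dird_linear[OF smooth_diff[OF assms, of x]], of v 1]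
    by (simp only: real_scaleR_def mult_1_right mult.commute[of v])
  have "(\<lambda>v. dird v f x) = (*) (dird 1 f x)" by (rule ext) (rule eq)
  then show "(f has_real_derivative dird 1 f x) (at x)"
    using smooth_has_derivative[OF assms, of x] unfolding has_field_derivative_def by (simp only:)
  show "smooth (dird 1 f)" using assms smooth_iff[of f] by simp
qed

lemma Ck_realI:
  assumes "\<And>x. (f has_real_derivative f' x) (at x)" "Ck_on k UNIV f'"
  shows "Ck_on (Suc k) UNIV f"
proof -
  have "dird 1 f = f'" using dird_real[OF assms(1)] by (simp add: fun_eq_iff)
  moreover have "f differentiable (at x)" for x
    using assms(1) real_differentiable_def by blast
  ultimately show ?thesis unfolding Ck_UNIV_Suc using assms by auto
qed

lemma smooth_exp: "smooth (exp :: real \<Rightarrow> real)"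
proof -
  have "Ck_on k UNIV (exp :: real \<Rightarrow> real)" for k
    by (induction k) (auto intro!: continuous_intros Ck_realI DERIV_exp)
  then show ?thesis by (simp add: Cinf_on_def)
qed

lemma smooth_sin: "smooth (sin :: real \<Rightarrow> real)" and smooth_cos: "smooth (cos :: real \<Rightarrow> real)"
proof -
  have "Ck_on k UNIV (sin :: real \<Rightarrow> real) \<and> Ck_on k UNIV (cos :: real \<Rightarrow> real)" for k
  proof (induction k)
    case (Suc k)
    have "Ck_on k UNIV (\<lambda>x. - sin x :: real)"
      using Ck_mult[OF Ck_const[of k "-1"], of sin] Suc by simp
    then show ?case using Suc
      by (auto intro!: Ck_realI DERIV_sin DERIV_cos)
  qed (auto intro!: continuous_intros)
  then show "smooth (sin :: real \<Rightarrow> real)" "smooth (cos :: real \<Rightarrow> real)" by (auto simp: Cinf_on_def)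
qed

lemma smooth_dird_Basis: "smooth f \<Longrightarrow> b \<in> Basis \<Longrightarrow> smooth (dird b f)"
  using smooth_iff by blast

lemma dird_expand:
  "smooth f \<Longrightarrow> dird v f x = (\<Sum>b\<in>Basis. (v \<bullet> b) * dird b f x)"
  using linear_sum[OF dird_linear[OF smooth_diff], of f "\<lambda>b. (v \<bullet> b) *\<^sub>R b" Basis x]
  by (simp add: euclidean_representation linear_cmul[OF dird_linear[OF smooth_diff]])

lemma smooth_dird: "smooth f \<Longrightarrow> smooth (dird v f)"
proof -
  assume f: "smooth f"
  have "smooth (\<lambda>x. \<Sum>b\<in>Basis. (v \<bullet> b) * dird b f x)"
    by (intro smooth_sum smooth_mult) (auto intro: smooth_dird_Basis f)
  moreover have "dird v f = (\<lambda>x. \<Sum>b\<in>Basis. (v \<bullet> b) * dird b f x)"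
    using dird_expand[OF f] by blast
  ultimately show ?thesis by simp
qed

lemma smooth_vd:
  assumes "smooth f" "(\<gamma> has_vector_derivative v) (at t within S)"
  shows "((\<lambda>t. f (\<gamma> t)) has_real_derivative dird v f (\<gamma> t)) (at t within S)"
proof -
  have "((\<lambda>t. f (\<gamma> t)) has_derivative (\<lambda>h. dird (h *\<^sub>R v) f (\<gamma> t))) (at t within S)"
    using has_derivative_compose[OF assms(2)[unfolded has_vector_derivative_def]
      smooth_has_derivative[OF assms(1), of "\<gamma> t"]] .
  then show ?thesis
    unfolding has_field_derivative_def
    by (rule has_derivative_eq_rhs)
      (simp add: fun_eq_iff linear_cmul[OF dird_linear[OF smooth_diff[OF assms(1)]]] mult.commute)
qed

lemma dird_add: "smooth f \<Longrightarrow> smooth g \<Longrightarrow> dird v (\<lambda>x. f x + g x) = (\<lambda>x. dird v f x + dird v g x)"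
  by (rule ext, rule dird_eqI) (intro has_derivative_add smooth_has_derivative)

lemma dird_diff: "smooth f \<Longrightarrow> smooth g \<Longrightarrow> dird v (\<lambda>x. f x - g x) = (\<lambda>x. dird v f x - dird v g x)"
  by (rule ext, rule dird_eqI) (intro has_derivative_diff smooth_has_derivative)

lemma dird_minus: "smooth f \<Longrightarrow> dird v (\<lambda>x. - f x) = (\<lambda>x. - dird v f x)"
  by (rule ext, rule dird_eqI) (intro has_derivative_minus smooth_has_derivative)

lemma dird_mult: "smooth f \<Longrightarrow> smooth g \<Longrightarrow>
    dird v (\<lambda>x. f x * g x) = (\<lambda>x. f x * dird v g x + dird v f x * g x)"
  by (rule ext, rule dird_eqI) (intro has_derivative_mult smooth_has_derivative)

lemma dird_const [simp]: "dird v (\<lambda>x. c) = (\<lambda>x. 0)"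
  by (simp add: dird_def fun_eq_iff)

section \<open>Differentiation under the integral and symmetry of second derivatives\<close>

lemma has_integral_parameter:
  fixes F :: "real \<times> 'a::euclidean_space \<Rightarrow> real"
  assumes F: "smooth F"
  shows "((\<lambda>x. integral {c..d} (\<lambda>s. F (s, x))) has_derivative
     (\<lambda>v. integral {c..d} (\<lambda>s. dird (0, v) F (s, x)))) (at x)"
proof -
  \<comment> \<open>\<open>leibniz_rule\<close> wants the derivative as a bounded linear function
    depending continuously on both variables. Expanded in coordinates, its continuity reduces to
    that of the directional derivatives.\<close>
  define fx where "fx x t = (\<Sum>b\<in>Basis. dird (0, b) F (t, x) *\<^sub>R blinfun_inner_left b)" for x t
  have app: "blinfun_apply (fx x t) v = dird (0, v) F (t, x)" for x t v
  proof -
    have "(0, v) = (\<Sum>b\<in>Basis. (v \<bullet> b) *\<^sub>R (0::real, b))"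
      by (simp add: prod_eq_iff fst_sum snd_sum euclidean_representation)
    then have "dird (0, v) F (t, x) = dird (\<Sum>b\<in>Basis. (v \<bullet> b) *\<^sub>R (0::real, b)) F (t, x)"
      by (rule arg_cong)
    also have "\<dots> = (\<Sum>b\<in>Basis. (v \<bullet> b) * dird (0, b) F (t, x))"
      unfolding linear_sum[OF dird_linear[OF smooth_diff[OF F]]]
        linear_cmul[OF dird_linear[OF smooth_diff[OF F]]] by simp
    finally show ?thesis by (simp add: fx_def blinfun.sum_left blinfun.scaleR_left inner_commute mult.commute)
  qed
  have c: "continuous_on UNIV (dird w F)" for w by (intro smooth_cont smooth_dird F)
  have cfx: "continuous_on S (\<lambda>z. fx (f z) (g z))" if "continuous_on S f" "continuous_on S g"
    for f g and S :: "'b::topological_space set"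
    unfolding fx_def by (intro continuous_intros continuous_on_compose2[OF c] that) auto
  have "((\<lambda>x. integral (cbox c d) (\<lambda>s. F (s, x))) has_derivative
     blinfun_apply (integral (cbox c d) (fx x))) (at x within UNIV)"
  proof (rule leibniz_rule)
    fix x t
    have "((\<lambda>x. F (t, x)) has_derivative (\<lambda>v. dird (0, v) F (t, x))) (at x)"
      by (rule has_derivative_compose[OF _ smooth_has_derivative[OF F]])
        (auto intro!: derivative_eq_intros)
    then show "((\<lambda>x. F (t, x)) has_derivative blinfun_apply (fx x t)) (at x within UNIV)"
      by (simp add: app[abs_def])
  next
    show "continuous_on (UNIV \<times> cbox c d) (\<lambda>(x, t). fx x t)"
      unfolding split_beta by (intro cfx continuous_intros)
  next
    show "(\<lambda>s. F (s, x)) integrable_on cbox c d" for x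
      by (intro integrable_continuous continuous_on_compose2[OF smooth_cont[OF F, of UNIV]]
          continuous_intros) auto
  qed auto
  moreover have "blinfun_apply (integral (cbox c d) (fx x)) = (\<lambda>v. integral (cbox c d) (\<lambda>s. dird (0, v) F (s, x)))"
    unfolding app[symmetric]
    by (rule ext, rule blinfun_apply_integral) (intro integrable_continuous cfx continuous_intros)
  ultimately show ?thesis by (simp add: cbox_interval)
qed

lemma dird_integral_parameter:
  fixes F :: "real \<times> 'a::euclidean_space \<Rightarrow> real"
  shows "smooth F \<Longrightarrow> dird v (\<lambda>x. integral {c..d} (\<lambda>s. F (s, x))) = (\<lambda>x. integral {c..d} (\<lambda>s. dird (0, v) F (s, x)))"
  by (rule ext) (rule dird_eqI[OF has_integral_parameter])

lemma smooth_integral_parameter: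
  fixes F :: "real \<times> 'a::euclidean_space \<Rightarrow> real"
  assumes "smooth F"
  shows "smooth (\<lambda>x. integral {c..d} (\<lambda>s. F (s, x)))"
proof -
  have "Ck_on k UNIV (\<lambda>x. integral {c..d} (\<lambda>s. F (s, x)))" if "smooth F" for k and F :: "real \<times> 'a \<Rightarrow> real"
    using that
  proof (induction k arbitrary: F)
    case 0
    show ?case using has_integral_parameter[OF 0]
      by (auto simp: continuous_on_eq_continuous_within intro: has_derivative_continuous)
  next
    case (Suc k)
    then show ?case unfolding Ck_UNIV_Suc
      using has_integral_parameter[OF Suc.prems] dird_integral_parameter[OF Suc.prems]
      by (auto simp: smooth_dird intro: has_integral_parameter[THEN differentiableI])
  qed
  then show ?thesis using assms by (auto simp: Cinf_on_def)
qed

text \<open>The increment of \<open>f\<close> in direction \<open>v\<close> is an integral of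
  \<open>dird v f\<close>; differentiating this integral in direction \<open>w\<close> expresses the
  increment of \<open>dird w f\<close> as an integral of \<open>dird w (dird v f)\<close>.
  Differentiating in the length \<open>s\<close> of the increment gives the claim. The integral
  formula holds for \<open>s\<close> nonnegative, so the last derivative is one-sided.\<close>

lemma dird_commute:
  assumes f: "smooth f"
  shows "dird v (dird w f) = dird w (dird v f)"
proof
  fix x
  have fv: "smooth (dird v f)" and fw: "smooth (dird w f)" and fwv: "smooth (dird w (dird v f))"
    by (intro smooth_dird f)+
  have eq: "dird w f (x + s *\<^sub>R v) - dird w f x
      = integral {0..s} (\<lambda>r. dird w (dird v f) (x + r *\<^sub>R v))" if "0 \<le> s" for s
  proof -
    define F where "F = (\<lambda>z. dird v f (x + fst z *\<^sub>R v + snd z *\<^sub>R w))"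
    have sF: "smooth F" unfolding F_def
      by (rule smooth_compose[OF fv])
        (auto simp: inner_add_left intro!: smooth_add smooth_mult smooth_fst smooth_linear[OF bounded_linear_snd])
    have I: "f (x + s *\<^sub>R v + t *\<^sub>R w) - f (x + t *\<^sub>R w) = integral {0..s} (\<lambda>r. F (r, t))" for t
    proof -
      have "((\<lambda>r. F (r, t)) has_integral f (x + s *\<^sub>R v + t *\<^sub>R w) - f (x + 0 *\<^sub>R v + t *\<^sub>R w)) {0..s}"
        by (rule fundamental_theorem_of_calculus[OF that])
          (auto simp: F_def has_real_derivative_iff_has_vector_derivative[symmetric]
            intro!: smooth_vd[OF f] derivative_eq_intros)
      then show ?thesis by (simp add: integral_unique)
    qed
    have "((\<lambda>t. f (x + s *\<^sub>R v + t *\<^sub>R w) - f (x + t *\<^sub>R w)) has_real_derivative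
        dird w f (x + s *\<^sub>R v + 0 *\<^sub>R w) - dird w f (x + 0 *\<^sub>R w)) (at 0)"
      by (intro DERIV_diff smooth_vd[OF f]) (auto intro!: derivative_eq_intros)
    then have "dird 1 (\<lambda>t. integral {0..s} (\<lambda>r. F (r, t))) 0 = dird w f (x + s *\<^sub>R v) - dird w f x"
      using dird_real[of _ _ 0 1] by (simp add: I)
    moreover have "dird (0, 1) F (r, 0) = dird w (dird v f) (x + r *\<^sub>R v)" for r
    proof -
      have "((\<lambda>t. F (r, t)) has_real_derivative dird (0,1) F (r, 0)) (at 0)"
        by (intro smooth_vd[OF sF]) (auto intro!: derivative_eq_intros)
      moreover have "((\<lambda>t. F (r, t)) has_real_derivative dird w (dird v f) (x + r *\<^sub>R v + 0 *\<^sub>R w)) (at 0)"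
        unfolding F_def fst_conv snd_conv
        by (intro smooth_vd[OF fv]) (auto intro!: derivative_eq_intros)
      ultimately show ?thesis using DERIV_unique by fastforce
    qed
    ultimately show ?thesis by (simp add: dird_integral_parameter[OF sF])
  qed
  have "((\<lambda>s. dird w f (x + s *\<^sub>R v) - dird w f x) has_real_derivative dird v (dird w f) (x + 0 *\<^sub>R v) - 0) (at 0 within {0..1})"
    by (intro DERIV_diff smooth_vd[OF fw]) (auto intro!: derivative_eq_intros)
  moreover have "((\<lambda>s. integral {0..s} (\<lambda>r. dird w (dird v f) (x + r *\<^sub>R v))) has_real_derivative dird w (dird v f) (x + 0 *\<^sub>R v)) (at 0 within {0..1})"
    unfolding has_real_derivative_iff_has_vector_derivative
    by (rule integral_has_vector_derivative[of 0 1 _ 0])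
      (auto intro!: continuous_intros continuous_on_compose2[OF smooth_cont[OF fwv, of UNIV]])
  then have "((\<lambda>s. dird w f (x + s *\<^sub>R v) - dird w f x) has_real_derivative dird w (dird v f) (x + 0 *\<^sub>R v)) (at 0 within {0..1})"
    unfolding has_real_derivative_iff_has_vector_derivative
    by (rule has_vector_derivative_transform[rotated 2]) (auto simp: eq)
  ultimately have "dird v (dird w f) (x + 0 *\<^sub>R v) - 0 = dird w (dird v f) (x + 0 *\<^sub>R v)"
    unfolding has_real_derivative_iff_has_vector_derivative
    by (intro vector_derivative_unique_within_closed_interval[of 0 1 0]) auto
  then show "dird v (dird w f) x = dird w (dird v f) x" by simp
qed

section \<open>Periodic functions\<close>

lemma periodicD: "periodic f \<Longrightarrow> f (x + axis i 1) = f x"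
  by (simp add: periodic_def)

lemma periodic_axis_int: "periodic f \<Longrightarrow> f (x + of_int n *\<^sub>R axis i 1) = f x"
proof (induction n rule: int_induct[of _ 0])
  case (step1 n)
  have "f (x + of_int (n+1) *\<^sub>R axis i 1) = f ((x + of_int n *\<^sub>R axis i 1) + axis i 1)"
    by (simp add: algebra_simps)
  then show ?case using step1 periodicD by metis
next
  case (step2 n)
  have "f (x + of_int n *\<^sub>R axis i 1) = f ((x + of_int (n-1) *\<^sub>R axis i 1) + axis i 1)"
    by (simp add: algebra_simps)
  then show ?case using step2 periodicD by metis
qed simp

lemma periodic_int:
  fixes f :: "real^'n \<Rightarrow> 'b"
  assumes "periodic f"
  shows "f (x + (\<chi> i. of_int (n i))) = f x"
proof -
  have "f (x + (\<Sum>i\<in>I. of_int (n i) *\<^sub>R axis i 1)) = f x" if "finite I" for I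
    using that
  proof (induction I arbitrary: x rule: finite_induct)
    case (insert i I)
    then show ?case
      using periodic_axis_int[OF assms, of "x + (\<Sum>i\<in>I. of_int (n i) *\<^sub>R axis i 1)" "n i" i]
      by (simp add: add_ac)
  qed simp
  from this[of UNIV] show ?thesis
    using basis_expansion[of "\<chi> i. real_of_int (n i)"] by (simp add: scalar_mult_eq_scaleR)
qed

text \<open>Bounds obtained from compactness hold on the closed cube only; composition with this map
  carries them to all points for periodic functions.\<close>

definition torus_rep :: "real^'n \<Rightarrow> real^'n" where
  "torus_rep x = (\<chi> i. frac (x $ i))"

lemma torus_rep_in: "torus_rep x \<in> unit_cube"
  by (auto simp: torus_rep_def mem_box_cart frac_ge_0 less_imp_le[OF frac_lt_1])

lemma periodic_torus_rep: "periodic f \<Longrightarrow> f (torus_rep x) = f x"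
proof -
  assume f: "periodic f"
  have "x = torus_rep x + (\<chi> i. of_int \<lfloor>x $ i\<rfloor>)"
    by (simp add: torus_rep_def vec_eq_iff frac_def)
  then show ?thesis using periodic_int[OF f, of "torus_rep x"] by metis
qed

lemma periodic_dird: "periodic f \<Longrightarrow> smooth f \<Longrightarrow> periodic (dird v f)"
  unfolding periodic_def
proof safe
  fix x i assume p: "\<forall>x i. f (x + axis i 1) = f x" and s: "smooth f"
  have "((\<lambda>x. f (x + axis i 1)) has_derivative (\<lambda>v. dird v f (x + axis i 1))) (at x)"
    by (rule has_derivative_compose[OF _ smooth_has_derivative[OF s]]) (auto intro!: derivative_eq_intros)
  then show "dird v f (x + axis i 1) = dird v f x" using dird_eqI p by (metis (no_types, lifting) ext)
qed

lemma periodic_coord: "(\<And>y. F (y + 1) = F y) \<Longrightarrow> periodic (\<lambda>x. F (x $ l))"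
  by (auto simp: periodic_def axis_def)

lemma periodic_const: "periodic (\<lambda>x. c)"
  and periodic_add: "periodic f \<Longrightarrow> periodic g \<Longrightarrow> periodic (\<lambda>x. f x + g x)"
  and periodic_diff: "periodic f \<Longrightarrow> periodic g \<Longrightarrow> periodic (\<lambda>x. f x - g x)"
  and periodic_mult: "periodic f' \<Longrightarrow> periodic g' \<Longrightarrow> periodic (\<lambda>x. f' x * g' x)"
  and periodic_minus: "periodic f \<Longrightarrow> periodic (\<lambda>x. - f x)"
  for f g :: "real^'n \<Rightarrow> 'b::ab_group_add" and f' g' :: "real^'n \<Rightarrow> 'c::times"
  by (auto simp: periodic_def)

section \<open>Integration over the torus\<close>

lemma integrable_torus: "continuous_on unit_cube (f :: _ \<Rightarrow> 'b::euclidean_space) \<Longrightarrow> integrable torus f"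
  using absolutely_integrable_continuous[of 0 1 f]
  by (simp add: set_integrable_def integrable_restrict_space)

lemma LINT_torus: "continuous_on unit_cube (f :: _ \<Rightarrow> 'b::euclidean_space) \<Longrightarrow> (LINT x|torus. f x) = integral unit_cube f"
  by (rule lebesgue_integral_eq_integral) (auto intro: integrable_torus)

lemma content_unit_cube: "measure lborel (unit_cube :: (real^'n) set) = 1"
proof -
  have "unit_cube \<noteq> ({} :: (real^'n) set)" using torus_rep_in by blast
  then show ?thesis by (simp add: content_cbox_cart)
qed

lemma mem_cbox_split_coord:
  "x \<in> cbox a b \<longleftrightarrow> (a $ k \<le> x $ k \<and> x $ k \<le> b $ k) \<and> (\<forall>i. i \<noteq> k \<longrightarrow> a $ i \<le> x $ i \<and> x $ i \<le> b $ i)"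
  for x :: "real^'n"
  unfolding mem_box_cart by metis

text \<open>The shifted cube is cut along the hyperplane where the coordinate \<open>k\<close>
  equals 1, and the protruding slab is moved back by one period; the two parts are those into which
  the hyperplane at height \<open>s\<close> cuts the unit cube.\<close>

lemma integral_torus_shift01:
  fixes f :: "real^'n \<Rightarrow> real"
  assumes f: "continuous_on UNIV f" "periodic f" and s: "0 \<le> s" "s \<le> 1"
  shows "integral unit_cube (\<lambda>x. f (x + s *\<^sub>R axis k 1)) = integral unit_cube f"
proof -
  let ?e = "axis k 1 :: real^'n"
  have fi: "f integrable_on cbox a b" for a b
    using f by (intro integrable_continuous) (auto intro: continuous_on_subset)
  have inn: "x \<bullet> ?e = x $ k" for x by (simp add: inner_axis)
  have axn: "?e $ i = (if i = k then 1 else 0)" for i by (simp add: axis_def)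
  have ax: "?e \<in> Basis" by (simp add: Basis_vec_def) blast
  have "integral unit_cube (\<lambda>x. f (x + s *\<^sub>R ?e)) = integral (cbox (0 + s *\<^sub>R ?e) (1 + s *\<^sub>R ?e)) f"
    unfolding integral_shift_cbox_plus[symmetric] by (simp add: o_def add.commute)
  also have "\<dots> = integral (cbox (0 + s *\<^sub>R ?e) (1 + s *\<^sub>R ?e) \<inter> {x. x \<bullet> ?e \<le> 1}) f
      + integral (cbox (0 + s *\<^sub>R ?e) (1 + s *\<^sub>R ?e) \<inter> {x. x \<bullet> ?e \<ge> 1}) f"
    by (rule integral_split[OF fi ax])
  also have "cbox (0 + s *\<^sub>R ?e) (1 + s *\<^sub>R ?e) \<inter> {x. x \<bullet> ?e \<le> 1} = cbox (s *\<^sub>R ?e) 1"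
    using s by (auto simp: set_eq_iff mem_cbox_split_coord[of _ _ _ k] inn axn)
  also have "cbox (0 + s *\<^sub>R ?e) (1 + s *\<^sub>R ?e) \<inter> {x. x \<bullet> ?e \<ge> 1} = cbox (0 + ?e) ((1 + (s - 1) *\<^sub>R ?e) + ?e)"
    using s by (auto simp: set_eq_iff mem_cbox_split_coord[of _ _ _ k] inn axn)
  also have "integral (cbox (0 + ?e) ((1 + (s - 1) *\<^sub>R ?e) + ?e)) f = integral (cbox 0 (1 + (s - 1) *\<^sub>R ?e)) f"
    unfolding integral_shift_cbox_plus[symmetric] using f(2) by (simp add: o_def add.commute periodicD)
  also have "integral (cbox (s *\<^sub>R ?e) 1) f + integral (cbox 0 (1 + (s - 1) *\<^sub>R ?e)) f = integral unit_cube f"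
  proof -
    have "integral unit_cube f = integral (cbox 0 1 \<inter> {x. x \<bullet> ?e \<le> s}) f + integral (cbox 0 1 \<inter> {x. x \<bullet> ?e \<ge> s}) f"
      by (rule integral_split[OF fi ax])
    also have "cbox 0 1 \<inter> {x. x \<bullet> ?e \<le> s} = cbox 0 (1 + (s - 1) *\<^sub>R ?e)"
      using s by (auto simp: set_eq_iff mem_cbox_split_coord[of _ _ _ k] inn axn)
    also have "cbox 0 1 \<inter> {x. x \<bullet> ?e \<ge> s} = cbox (s *\<^sub>R ?e) 1"
      using s by (auto simp: set_eq_iff mem_cbox_split_coord[of _ _ _ k] inn axn)
    finally show ?thesis by simp
  qed
  finally show ?thesis .
qed

lemma integral_torus_shift:
  fixes f :: "real^'n \<Rightarrow> real"
  assumes f: "continuous_on UNIV f" "periodic f"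
  shows "integral unit_cube (\<lambda>x. f (x + s *\<^sub>R axis k 1)) = integral unit_cube f"
proof -
  have "f (x + s *\<^sub>R axis k 1) = f (x + frac s *\<^sub>R axis k 1)" for x
    using periodic_axis_int[OF f(2), of "x + frac s *\<^sub>R axis k 1" "\<lfloor>s\<rfloor>" k]
    by (simp add: frac_def algebra_simps)
  then show ?thesis using integral_torus_shift01[OF f, of "frac s" k] by (simp add: frac_ge_0 less_imp_le[OF frac_lt_1])
qed

text \<open>The integral of the shifted function does not depend on the shift \<open>s\<close>,
  while its derivative at \<open>s = 0\<close> is the integral of \<open>g\<close>. Only the
  derivative along one axis is mentioned, which suits products with slices of test
  functions.\<close>

lemma integral_torus_derivative:
  fixes f g :: "real^'n \<Rightarrow> real"
  assumes f: "continuous_on UNIV f" "periodic f" and g: "continuous_on UNIV g"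
    and D: "\<And>x. ((\<lambda>s. f (x + s *\<^sub>R axis k 1)) has_real_derivative g x) (at 0)"
  shows "integral unit_cube g = 0"
proof -
  let ?e = "axis k 1 :: real^'n"
  have Ds: "((\<lambda>s. f (x + s *\<^sub>R ?e)) has_real_derivative g (x + s *\<^sub>R ?e)) (at s)" for x s
    using D[of "x + s *\<^sub>R ?e"] DERIV_shift[of "\<lambda>r. f (x + r *\<^sub>R ?e)" _ 0 s]
    by (simp add: algebra_simps)
  have "((\<lambda>s. integral unit_cube (\<lambda>x. f (x + s *\<^sub>R ?e))) has_real_derivative
      integral unit_cube (\<lambda>x. g (x + 0 *\<^sub>R ?e))) (at 0 within UNIV)"
  proof (rule leibniz_rule_field_derivative)
    show "continuous_on (UNIV \<times> unit_cube) (\<lambda>(s, x). g (x + s *\<^sub>R ?e))"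
      unfolding split_beta by (intro continuous_on_compose2[OF g] continuous_intros) auto
    show "(\<lambda>x. f (x + s *\<^sub>R ?e)) integrable_on unit_cube" for s
      by (intro integrable_continuous continuous_on_compose2[OF f(1)] continuous_intros) auto
  qed (auto simp: Ds)
  then have "((\<lambda>s. integral unit_cube f) has_real_derivative integral unit_cube g) (at 0)"
    by (simp add: integral_torus_shift[OF f])
  then show ?thesis using DERIV_unique[OF DERIV_const] by metis
qed

lemma smooth_partial_line:
  "smooth f \<Longrightarrow> ((\<lambda>s. f (x + s *\<^sub>R v)) has_real_derivative dird v f (x + r *\<^sub>R v)) (at r within S)"
  by (rule smooth_vd) (auto intro!: derivative_eq_intros)

text \<open>The factor \<phi> is given with its derivative along the axis \<open>k\<close> alone: in
  the applications it is a slice of a test function, for which such a line derivative is at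
  hand.\<close>

lemma integral_torus_parts:
  fixes f \<phi> \<psi> :: "real^'n \<Rightarrow> real"
  assumes f: "smooth f" "periodic f" and \<phi>: "continuous_on UNIV \<phi>" "periodic \<phi>" "continuous_on UNIV \<psi>"
    and D: "\<And>x. ((\<lambda>s. \<phi> (x + s *\<^sub>R axis k 1)) has_real_derivative \<psi> x) (at 0)"
  shows "integral unit_cube (\<lambda>x. partial k f x * \<phi> x) = - integral unit_cube (\<lambda>x. f x * \<psi> x)"
proof -
  have c: "continuous_on S f" "continuous_on S (partial k f)" "continuous_on S \<phi>" "continuous_on S \<psi>" for S
    using f \<phi> by (auto intro: smooth_cont smooth_dird continuous_on_subset simp: partial_eq_dird)
  have "integral unit_cube (\<lambda>x. partial k f x * \<phi> x + f x * \<psi> x) = 0"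
  proof (rule integral_torus_derivative)
    show "periodic (\<lambda>x. f x * \<phi> x)" by (rule periodic_mult[OF f(2) \<phi>(2)])
    fix x
    have "((\<lambda>s. f (x + s *\<^sub>R axis k 1)) has_real_derivative partial k f x) (at 0)"
      using smooth_partial_line[OF f(1), of x "axis k 1" 0] by (simp add: partial_eq_dird)
    from DERIV_mult[OF this D]
    show "((\<lambda>s. f (x + s *\<^sub>R axis k 1) * \<phi> (x + s *\<^sub>R axis k 1)) has_real_derivative
      partial k f x * \<phi> x + f x * \<psi> x) (at 0)" by (simp add: mult.commute add.commute)
  qed (intro continuous_intros c)+
  then show ?thesis
    by (subst (asm) integral_add) (auto intro!: integrable_continuous continuous_intros c)
qed

text \<open>The derivative of the integral over \<open>{c..c+1}\<close> with respect to
  \<open>c\<close> is \<open>F (c + 1) - F c = 0\<close>.\<close>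

lemma integral_periodic_shift:
  fixes F :: "real \<Rightarrow> real"
  assumes F: "continuous_on UNIV F" "\<And>y. F (y + 1) = F y"
  shows "integral {0..1} (\<lambda>s. F (c + s)) = integral {0..1} F"
proof -
  have "((\<lambda>c. integral {c..c+1} F) has_real_derivative F (c + 1) - F c) (at c)" for c
  proof -
    have cF: "continuous_on S F" for S using F(1) by (rule continuous_on_subset) simp
    have FTC: "((\<lambda>u. integral {c-1..u} F) has_real_derivative F u) (at u)" if "c - 1 < u" "u < c + 2" for u
    proof -
      have "((\<lambda>u. integral {c-1..u} F) has_real_derivative F u) (at u within {c-1..c+2})"
        by (rule integral_has_real_derivative[OF cF]) (use that in auto)
      then show ?thesis using that by (simp add: at_within_Icc_at)
    qed
    have "((\<lambda>d. integral {c-1..d+1} F - integral {c-1..d} F) has_real_derivative F (c + 1) * 1 - F c) (at c)"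
      by (intro DERIV_diff DERIV_chain2[OF FTC] FTC) (auto intro!: derivative_eq_intros)
    note D = this
    have "\<forall>\<^sub>F d in nhds c. d > c - 1"
      using eventually_nhds_in_open[of "{c-1<..}" c] by simp
    then have "\<forall>\<^sub>F d in nhds c. integral {c-1..d+1} F - integral {c-1..d} F = integral {d..d+1} F"
    proof eventually_elim
      case (elim d)
      then show ?case using Henstock_Kurzweil_Integration.integral_combine[of "c-1" d "d+1" F]
        integrable_continuous_interval[OF cF] by simp
    qed
    from DERIV_cong_ev[THEN iffD1, OF refl this refl D] show ?thesis by simp
  qed
  then have "((\<lambda>c. integral {c..c+1} F) has_real_derivative 0) (at c)" for c using F(2) by simp
  then have "integral {c..c+1} F = integral {0..0+1} F" by (rule DERIV_isconst_all[rule_format])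
  moreover have "integral {0..1} (\<lambda>s. F (c + s)) = integral {0+c..1+c} F"
    unfolding integral_shift_Icc_real[symmetric] by (simp add: o_def)
  ultimately show ?thesis by (simp add: add.commute)
qed

text \<open>A rapidly oscillating factor may be replaced by its mean. A shift by
  \<open>s / \<sigma>\<close> along the axis \<open>l\<close> leaves the integral unchanged, moves
  the phase of \<open>F\<close> by \<open>s\<close>, and increases \<open>w\<close> by at most
  \<open>\<Lambda> / \<sigma>\<close>; averaging over \<open>s\<close> in the unit interval leaves
  the mean of \<open>F\<close>.\<close>

lemma integral_torus_average:
  fixes w :: "real^'n \<Rightarrow> real" and F :: "real \<Rightarrow> real" and \<sigma> :: nat
  assumes w: "continuous_on UNIV w" "periodic w"
    and F: "continuous_on UNIV F" "\<And>y. F (y + 1) = F y" "\<And>y. 0 \<le> F y" and \<sigma>: "\<sigma> > 0"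
    and L: "\<And>x s. 0 \<le> s \<Longrightarrow> w (x + s *\<^sub>R axis l 1) \<le> w x + \<Lambda> * s" "0 \<le> \<Lambda>"
  shows "integral unit_cube (\<lambda>x. w x * F (real \<sigma> * x $ l)) \<le> (integral unit_cube w + \<Lambda> / \<sigma>) * integral {0..1} F"
proof -
  let ?J = "integral unit_cube (\<lambda>x. w x * F (real \<sigma> * x $ l))"
  have cw: "continuous_on S (\<lambda>x. w (h x))" if "continuous_on S h" for h and S :: "'a::topological_space set"
    by (rule continuous_on_compose2[OF w(1) that]) auto
  have cF: "continuous_on S (\<lambda>x. F (h x))" if "continuous_on S h" for h and S :: "'a::topological_space set"
    by (rule continuous_on_compose2[OF F(1) that]) auto
  have pF: "F (y + real n) = F y" for y n
    by (induction n) (simp_all add: F(2) add.assoc[symmetric], metis F(2) add.commute add.left_commute)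
  define H where "H s = integral unit_cube (\<lambda>x. (w x + \<Lambda> / \<sigma>) * F (real \<sigma> * x $ l + s))" for s
  have JH: "?J \<le> H s" if s: "s \<in> cbox 0 1" for s
  proof -
    let ?d = "(s / \<sigma>) *\<^sub>R axis l 1 :: real^'n"
    have co: "continuous_on UNIV (\<lambda>x. w x * F (real \<sigma> * x $ l))" by (intro continuous_intros cw cF)
    have "periodic (\<lambda>x. F (real \<sigma> * x $ l))"
      by (rule periodic_coord) (simp add: distrib_left pF)
    then have pe: "periodic (\<lambda>x. w x * F (real \<sigma> * x $ l))" by (rule periodic_mult[OF w(2)])
    have "?J = integral unit_cube (\<lambda>x. w (x + ?d) * F (real \<sigma> * (x + ?d) $ l))"
      by (rule integral_torus_shift[OF co pe, symmetric])
    also have "\<dots> \<le> H s" unfolding H_def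
    proof (rule integral_le)
      show "(\<lambda>x. w (x + ?d) * F (real \<sigma> * (x + ?d) $ l)) integrable_on unit_cube"
        by (intro integrable_continuous continuous_intros cw cF)
      show "(\<lambda>x. (w x + \<Lambda> / \<sigma>) * F (real \<sigma> * x $ l + s)) integrable_on unit_cube"
        by (intro integrable_continuous continuous_intros cw cF)
      fix x :: "real^'n"
      have "w (x + ?d) \<le> w x + \<Lambda> * (s / \<sigma>)" using s \<sigma> by (intro L) auto
      also have "\<Lambda> * (s / \<sigma>) \<le> \<Lambda> / \<sigma>" using s \<sigma> L(2) by (simp add: divide_simps mult_left_le)
      finally have "w (x + ?d) \<le> w x + \<Lambda> / \<sigma>" by simp
      then show "w (x + ?d) * F (real \<sigma> * (x + ?d) $ l) \<le> (w x + \<Lambda> / \<sigma>) * F (real \<sigma> * x $ l + s)"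
        using \<sigma> F(3) by (simp add: distrib_left mult_right_mono)
    qed
    finally show ?thesis .
  qed
  have cz: "continuous_on S (\<lambda>z. (w (snd z) + \<Lambda> / \<sigma>) * F (real \<sigma> * snd z $ l + fst z))" for S
    by (intro continuous_intros cw cF)
  have iH: "H integrable_on cbox 0 1" unfolding H_def
    using integral_integrable_2dim[OF cz, where a=0 and b=1 and c=0 and d=1] by simp
  have "?J = integral (cbox 0 (1::real)) (\<lambda>s. ?J)" by simp
  also have "\<dots> \<le> integral (cbox 0 1) H" by (rule integral_le[OF _ iH JH]) auto
  also have "\<dots> = integral unit_cube (\<lambda>x. integral (cbox 0 1) (\<lambda>s. (w x + \<Lambda> / \<sigma>) * F (real \<sigma> * x $ l + s)))"
    unfolding H_def using cz[of "cbox (0,0) (1,1)"]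
    by (intro integral_swap_continuous) (simp add: split_beta)
  also have "\<dots> = integral unit_cube (\<lambda>x. (w x + \<Lambda> / \<sigma>) * integral {0..1} F)"
    using integral_periodic_shift[OF F(1,2)] by simp
  also have "\<dots> = (integral unit_cube w + \<Lambda> / \<sigma>) * integral {0..1} F"
    using cw[of unit_cube "\<lambda>x. x"]
    by (simp add: integral_add integrable_continuous content_unit_cube)
  finally show ?thesis .
qed

text \<open>The temporal support is defined by vanishing almost everywhere. For continuous slices
  this lemma turns it into vanishing at every point.\<close>

lemma periodic_AE_zero:
  fixes f :: "real^'n \<Rightarrow> real"
  assumes f: "continuous_on UNIV f" "periodic f" and "AE x in torus. f x = 0"
  shows "f x = 0"
proof -
  have c: "continuous_on S f" for S using f(1) by (rule continuous_on_subset) simp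
  have "(LINT x|torus. \<bar>f x\<bar>) = (LINT x|(torus :: (real^'n) measure). 0)"
  proof (rule Bochner_Integration.integral_cong_AE)
    show "(\<lambda>x. \<bar>f x\<bar>) \<in> borel_measurable torus"
      by (intro borel_measurable_integrable integrable_torus continuous_intros c)
    show "AE x in torus. \<bar>f x\<bar> = 0" using assms(3) by eventually_elim simp
  qed simp
  then have "integral unit_cube (\<lambda>x. \<bar>f x\<bar>) = 0"
    by (subst (asm) LINT_torus) (auto intro!: continuous_intros c)
  then have "((\<lambda>x. \<bar>f x\<bar>) has_integral 0) unit_cube"
    by (metis c continuous_on_rabs integrable_continuous integrable_integral)
  then have "\<bar>f (torus_rep x)\<bar> = 0"
  proof (rule has_integral_0_cbox_imp_0[rotated 2])
    have "(\<chi> i. 1/2) \<in> box 0 (1 :: real^'n)" by (simp add: mem_box_cart)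
    then show "box 0 (1 :: real^'n) \<noteq> {}" by blast
  qed (auto intro!: continuous_intros c simp: torus_rep_in)
  then show ?thesis using periodic_torus_rep[OF f(2)] by simp
qed

section \<open>Norms of smooth periodic functions\<close>

lemma smooth_partial: "smooth f \<Longrightarrow> smooth (partial i f)"
  and periodic_partial: "periodic f \<Longrightarrow> smooth f \<Longrightarrow> periodic (partial i f)"
  and partial_add: "smooth f \<Longrightarrow> smooth g \<Longrightarrow> partial i (\<lambda>x. f x + g x) = (\<lambda>x. partial i f x + partial i g x)"
  and partial_diff: "smooth f \<Longrightarrow> smooth g \<Longrightarrow> partial i (\<lambda>x. f x - g x) = (\<lambda>x. partial i f x - partial i g x)"
  and partial_minus: "smooth f \<Longrightarrow> partial i (\<lambda>x. - f x) = (\<lambda>x. - partial i f x)"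
  and partial_mult: "smooth f \<Longrightarrow> smooth g \<Longrightarrow> partial i (\<lambda>x. f x * g x) = (\<lambda>x. f x * partial i g x + partial i f x * g x)"
  and partial_const: "partial i (\<lambda>x. c) = (\<lambda>x. 0)"
  and partial_commute: "smooth f \<Longrightarrow> partial i (partial j f) = partial j (partial i f)"
  unfolding partial_eq_dird
  by (auto intro: smooth_dird periodic_dird dird_commute simp: dird_add dird_diff dird_minus dird_mult)

lemma smooth_foldr_partial: "smooth f \<Longrightarrow> smooth (foldr partial is f)"
  by (induction "is") (auto intro: smooth_partial)

lemma periodic_foldr_partial: "smooth f \<Longrightarrow> periodic f \<Longrightarrow> periodic (foldr partial is f)"
  by (induction "is") (auto intro: periodic_partial smooth_foldr_partial)

lemma foldr_partial_diff:
  "smooth f \<Longrightarrow> smooth g \<Longrightarrow>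
    foldr partial is (\<lambda>x. f x - g x) = (\<lambda>x. foldr partial is f x - foldr partial is g x)"
  by (induction "is") (auto simp: partial_diff smooth_foldr_partial)

lemma foldr_partial_zero: "foldr partial is (\<lambda>x. 0) = (\<lambda>x. 0)"
  by (induction "is") (auto simp: partial_const)

lemma Ck_norm_zero [simp]: "Ck_norm k (\<lambda>x. 0) = 0"
  by (simp add: Ck_norm_def foldr_partial_zero bot_ennreal[symmetric] SUP_constant)

lemma Ck_norm_leI:
  "(\<And>is x. length is \<le> k \<Longrightarrow> \<bar>foldr partial is f x\<bar> \<le> K) \<Longrightarrow> Ck_norm k f \<le> ennreal K"
  unfolding Ck_norm_def by (intro SUP_least) (auto intro: ennreal_leI)

lemma Ck_norm_ge: "length is \<le> k \<Longrightarrow> ennreal \<bar>foldr partial is f x\<bar> \<le> Ck_norm k f"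
  unfolding Ck_norm_def by (rule order_trans[OF SUP_upper[of x] SUP_upper[of "is"]]) auto

lemma Ck_norm_mono: "j \<le> k \<Longrightarrow> Ck_norm j f \<le> Ck_norm k f"
  unfolding Ck_norm_def by (rule SUP_subset_mono) auto

lemma Ck_norm_triangle:
  fixes f g :: "real^'a \<Rightarrow> real"
  assumes "smooth f" "smooth g"
  shows "Ck_norm k (\<lambda>x. f x - g x) \<le> Ck_norm k f + Ck_norm k g"
  unfolding Ck_norm_def[of k "\<lambda>x. f x - g x"]
proof (intro SUP_least)
  fix x and "is" :: "'a list" assume "is \<in> {is. length is \<le> k}"
  then have "ennreal \<bar>foldr partial is f x\<bar> + ennreal \<bar>foldr partial is g x\<bar> \<le> Ck_norm k f + Ck_norm k g"
    by (intro add_mono Ck_norm_ge) auto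
  moreover have "ennreal \<bar>foldr partial is (\<lambda>x. f x - g x) x\<bar>
      \<le> ennreal \<bar>foldr partial is f x\<bar> + ennreal \<bar>foldr partial is g x\<bar>"
    unfolding foldr_partial_diff[OF assms]
    using ennreal_leI[OF abs_triangle_ineq4[of "foldr partial is f x" "foldr partial is g x"]]
    by (simp add: ennreal_plus)
  ultimately show "ennreal \<bar>foldr partial is (\<lambda>x. f x - g x) x\<bar> \<le> Ck_norm k f + Ck_norm k g" by simp
qed

text \<open>Spatial derivatives of a function of time and space together. Iterated derivatives of
  time slices thus become slices of one jointly smooth function, to which compactness in time and
  space applies.\<close>

definition spart :: "'n \<Rightarrow> (real \<times> (real^'n) \<Rightarrow> real) \<Rightarrow> real \<times> (real^'n) \<Rightarrow> real" where
  "spart i = dird (0, axis i 1)"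

lemma smooth_spart: "smooth F \<Longrightarrow> smooth (foldr spart is F)"
  by (induction "is") (auto simp: spart_def intro: smooth_dird)

lemma smooth_slice: "smooth F \<Longrightarrow> smooth (\<lambda>x. F (t, x))"
  for F :: "real \<times> 'a::euclidean_space \<Rightarrow> real"
  by (rule smooth_compose) (auto simp: inner_Pair intro!: smooth_add smooth_const smooth_inner)

lemma dird_slice: "smooth F \<Longrightarrow> dird v (\<lambda>x. F (t, x)) = (\<lambda>x. dird (0, v) F (t, x))"
  for F :: "real \<times> 'a::euclidean_space \<Rightarrow> real"
proof
  fix x assume F: "smooth F"
  have "((\<lambda>x. F (t, x)) has_derivative (\<lambda>v. dird (0, v) F (t, x))) (at x)"
    by (rule has_derivative_compose[OF _ smooth_has_derivative[OF F]])
      (auto intro!: derivative_eq_intros)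
  then show "dird v (\<lambda>x. F (t, x)) x = dird (0, v) F (t, x)" by (rule dird_eqI)
qed

lemma foldr_partial_slice:
  "smooth F \<Longrightarrow> foldr partial is (\<lambda>x. F (t, x)) = (\<lambda>x. foldr spart is F (t, x))"
proof (induction "is")
  case (Cons i "is")
  have "dird (axis i 1) (\<lambda>x. foldr spart is F (t, x)) = (\<lambda>x. spart i (foldr spart is F) (t, x))"
    unfolding spart_def[of i] by (rule dird_slice[OF smooth_spart[OF Cons.prems]])
  then show ?case using Cons by (simp add: partial_eq_dird)
qed simp

lemma periodic_slice_partial:
  assumes "smooth F" "\<And>t. periodic (\<lambda>x. F (t, x))"
  shows "foldr spart is F (t, torus_rep x) = foldr spart is F (t, x)"
proof -
  have "periodic (\<lambda>x. foldr spart is F (t, x))"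
    unfolding foldr_partial_slice[OF assms(1), symmetric]
    by (rule periodic_foldr_partial[OF smooth_slice[OF assms(1)] assms(2)])
  from periodic_torus_rep[OF this] show ?thesis .
qed

lemma finite_multi_indices: "finite {is :: 'n::finite list. length is \<le> k}"
  using finite_lists_length_le[of "UNIV :: 'n set" k] by simp

text \<open>Compactness of \<open>{c..d} \<times> unit_cube\<close> bounds the derivative for each
  multi-index; there are finitely many of them, and the sum of the bounds serves for all.\<close>

lemma Ck_norm_joint_bounded:
  fixes F :: "real \<times> (real^'n) \<Rightarrow> real"
  assumes F: "smooth F" "\<And>t. periodic (\<lambda>x. F (t, x))"
  shows "\<exists>K\<ge>0. \<forall>t\<in>{c..d}. Ck_norm k (\<lambda>x. F (t, x)) \<le> ennreal K"
proof -
  have "\<exists>K\<ge>0. \<forall>z\<in>{c..d} \<times> unit_cube. \<bar>foldr spart is F z\<bar> \<le> K" for "is"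
  proof -
    have "bounded (foldr spart is F ` ({c..d} \<times> unit_cube))"
      by (intro compact_imp_bounded compact_continuous_image smooth_cont smooth_spart F compact_Times) auto
    then obtain K where "\<forall>y\<in>foldr spart is F ` ({c..d} \<times> unit_cube). norm y \<le> K"
      unfolding bounded_iff by blast
    then show ?thesis by (intro exI[of _ "max K 0"]) force
  qed
  then obtain K where K: "\<And>is. K is \<ge> 0" "\<And>is t x. t \<in> {c..d} \<Longrightarrow> x \<in> unit_cube \<Longrightarrow> \<bar>foldr spart is F (t, x)\<bar> \<le> K is"
    by (metis mem_Sigma_iff)
  let ?I = "{is :: 'n list. length is \<le> k}"
  show ?thesis
  proof (intro exI conjI ballI Ck_norm_leI)
    show "0 \<le> sum K ?I" by (intro sum_nonneg K)
    fix t x and "is" :: "'n list" assume t: "t \<in> {c..d}" "length is \<le> k"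
    have "\<bar>foldr partial is (\<lambda>x. F (t, x)) x\<bar> = \<bar>foldr spart is F (t, torus_rep x)\<bar>"
      unfolding foldr_partial_slice[OF F(1)] periodic_slice_partial[OF F] ..
    also have "\<dots> \<le> K is" by (rule K(2)[OF t(1) torus_rep_in])
    also have "\<dots> \<le> sum K ?I" by (rule member_le_sum) (auto simp: t K finite_multi_indices)
    finally show "\<bar>foldr partial is (\<lambda>x. F (t, x)) x\<bar> \<le> sum K ?I" .
  qed
qed

text \<open>Uniform continuity on the compact cylinder, for each of the finitely many multi-indices.
  It permits freezing a density on a short time interval and gives continuity in time with values in
  C^k.\<close>

lemma Ck_norm_joint_continuous:
  fixes F :: "real \<times> (real^'n) \<Rightarrow> real"
  assumes F: "smooth F" "\<And>t. periodic (\<lambda>x. F (t, x))" and e: "e > 0"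
  shows "\<exists>\<delta>>0. \<forall>s\<in>{c..d}. \<forall>t\<in>{c..d}. \<bar>s - t\<bar> < \<delta> \<longrightarrow> Ck_norm k (\<lambda>x. F (s, x) - F (t, x)) \<le> ennreal e"
proof -
  have "\<exists>\<delta>>0. \<forall>s\<in>{c..d}. \<forall>t\<in>{c..d}. \<forall>x\<in>unit_cube. \<bar>s - t\<bar> < \<delta> \<longrightarrow>
      \<bar>foldr spart is F (s, x) - foldr spart is F (t, x)\<bar> \<le> e" for "is"
  proof -
    have "uniformly_continuous_on ({c..d} \<times> unit_cube) (foldr spart is F)"
      by (intro compact_uniformly_continuous smooth_cont smooth_spart F compact_Times) auto
    then obtain \<delta> where d: "\<delta> > 0" "\<And>z z'. z \<in> {c..d} \<times> unit_cube \<Longrightarrow> z' \<in> {c..d} \<times> unit_cube \<Longrightarrow>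
        dist z' z < \<delta> \<Longrightarrow> dist (foldr spart is F z') (foldr spart is F z) < e"
      unfolding uniformly_continuous_on_def using e by meson
    show ?thesis
    proof (intro exI[of _ \<delta>] conjI ballI impI d)
      fix s t and x :: "real^'n" assume "s \<in> {c..d}" "t \<in> {c..d}" "x \<in> unit_cube" "\<bar>s - t\<bar> < \<delta>"
      then show "\<bar>foldr spart is F (s, x) - foldr spart is F (t, x)\<bar> \<le> e"
        using d(2)[of "(t, x)" "(s, x)"] by (simp add: dist_Pair_Pair dist_real_def)
    qed
  qed
  then obtain \<delta> where d: "\<And>is. \<delta> is > 0" "\<And>is s t (x :: real^'n). s \<in> {c..d} \<Longrightarrow> t \<in> {c..d} \<Longrightarrow> x \<in> unit_cube \<Longrightarrow>
      \<bar>s - t\<bar> < \<delta> is \<Longrightarrow> \<bar>foldr spart is F (s, x) - foldr spart is F (t, x)\<bar> \<le> e"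
    by metis
  let ?I = "{is :: 'n list. length is \<le> k}"
  have I: "finite (\<delta> ` ?I)" "\<delta> ` ?I \<noteq> {}" using finite_multi_indices by (auto intro: exI[of _ "[]"])
  show ?thesis
  proof (intro exI conjI ballI impI Ck_norm_leI)
    show "0 < Min (\<delta> ` ?I)" using I d(1) by auto
    fix s t x and "is" :: "'n list"
    assume t: "s \<in> {c..d}" "t \<in> {c..d}" "\<bar>s - t\<bar> < Min (\<delta> ` ?I)" "length is \<le> k"
    have "Min (\<delta> ` ?I) \<le> \<delta> is" by (rule Min_le[OF I(1)]) (use t(4) in simp)
    then have "\<bar>s - t\<bar> < \<delta> is" using t(3) by linarith
    have "\<bar>foldr partial is (\<lambda>x. F (s, x) - F (t, x)) x\<bar> = \<bar>foldr spart is F (s, torus_rep x) - foldr spart is F (t, torus_rep x)\<bar>"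
      unfolding foldr_partial_diff[OF smooth_slice[OF F(1)] smooth_slice[OF F(1)]]
        foldr_partial_slice[OF F(1)] periodic_slice_partial[OF F] ..
    also have "\<dots> \<le> e" by (rule d(2)[OF t(1,2) torus_rep_in]) fact
    finally show "\<bar>foldr partial is (\<lambda>x. F (s, x) - F (t, x)) x\<bar> \<le> e" .
  qed
qed

lemma smooth_periodic_bounded:
  assumes "smooth f" "periodic (f :: real^'n \<Rightarrow> real)"
  shows "\<exists>K\<ge>0. Ck_norm k f \<le> ennreal K"
proof -
  have "smooth (\<lambda>z::real\<times>(real^'n). f (snd z))"
  proof (rule smooth_compose[OF assms(1)])
    fix c :: "real^'n"
    have "bounded_linear (\<lambda>z::real\<times>(real^'n). snd z \<bullet> c)"
      by (rule bounded_linear_compose[OF bounded_linear_inner_left bounded_linear_snd])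
    then show "smooth (\<lambda>z::real\<times>(real^'n). snd z \<bullet> c)" by (rule smooth_linear)
  qed
  then show ?thesis using Ck_norm_joint_bounded[of "\<lambda>z. f (snd z)" 0 0 k] assms(2) by auto
qed

section \<open>Concentrated profiles\<close>

text \<open>Mean zero makes the primitive periodic, and a primitive that vanishes at 0 is bounded by
  the L^1 norm of \<open>h\<close> over a period. It is this bound, insensitive to the height of
  \<open>h\<close>, that makes concentrated profiles useful.\<close>

lemma smooth_antiderivative:
  assumes h: "smooth h" "\<And>y. h (y + 1) = h y" "integral {0..1} h = 0"
  shows "\<exists>H. smooth H \<and> (\<forall>y. H (y + 1) = H y) \<and> (\<forall>y. (H has_real_derivative h y) (at y)) \<and>
    (\<forall>y. \<bar>H y\<bar> \<le> integral {0..1} (\<lambda>y. \<bar>h y\<bar>))"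
proof -
  have ch: "continuous_on S h" for S using h(1) by (rule smooth_cont)
  \<comment> \<open>The substitution of \<open>s * y\<close> for the integration variable fixes the
    interval of integration, so that smoothness of the primitive follows from
    \<open>smooth_integral_parameter\<close>.\<close>
  define F where "F = (\<lambda>z::real\<times>real. snd z * h (fst z * snd z))"
  define H where "H y = integral {0..1} (\<lambda>s. F (s, y))" for y
  have snd: "smooth (\<lambda>z::real\<times>real. snd z)" by (rule smooth_linear) (rule bounded_linear_snd)
  have F: "smooth F" unfolding F_def
    by (intro smooth_mult snd smooth_compose_real[OF h(1)] smooth_fst)
  have D: "(H has_real_derivative h y) (at y)" for y
  proof -
    have dF: "dird (0, 1) F (s, y) = h (s * y) + y * (s * dird 1 h (s * y))" for s
    proof -
      have "((\<lambda>y. F (s, y)) has_real_derivative dird (0, 1) F (s, y)) (at y)"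
        by (rule smooth_vd[OF F]) (auto intro!: derivative_eq_intros)
      moreover have "((\<lambda>y. F (s, y)) has_real_derivative h (s * y) + y * (s * dird 1 h (s * y))) (at y)"
        unfolding F_def fst_conv snd_conv
        by (auto intro!: derivative_eq_intros DERIV_chain2[OF smooth_real_deriv(1)[OF h(1)]])
      ultimately show ?thesis by (rule DERIV_unique)
    qed
    have "((\<lambda>s. dird (0, 1) F (s, y)) has_integral 1 * h (1 * y) - 0 * h (0 * y)) {0..1}"
      unfolding dF
      by (rule fundamental_theorem_of_calculus[of 0 1 "\<lambda>s. s * h (s * y)"])
        (auto simp: has_real_derivative_iff_has_vector_derivative[symmetric]
          intro!: derivative_eq_intros DERIV_chain2[OF smooth_real_deriv(1)[OF h(1)]])
    then have i: "integral {0..1} (\<lambda>s. dird (0, 1) F (s, y)) = h y" by (simp add: integral_unique)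
    have "smooth H" unfolding H_def by (rule smooth_integral_parameter[OF F])
    from smooth_real_deriv(1)[OF this, of y]
    show ?thesis unfolding H_def dird_integral_parameter[OF F] i .
  qed
  have sH: "smooth H" unfolding H_def by (rule smooth_integral_parameter[OF F])
  have H0: "H 0 = 0" by (simp add: H_def F_def)
  have FTC: "(h has_integral H y - H 0) {0..y}" if "0 \<le> y" for y
    by (rule fundamental_theorem_of_calculus[OF that])
      (auto simp: has_real_derivative_iff_has_vector_derivative[symmetric] intro: has_field_derivative_at_within D)
  have H1: "H 1 = 0" using FTC[of 1] h(3) H0 by (simp add: integral_unique)
  have "((\<lambda>y. H (y + 1) - H y) has_real_derivative 0) (at y)" for y
  proof -
    have "((\<lambda>y. H (y + 1)) has_real_derivative h (y + 1) * 1) (at y)"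
      by (rule DERIV_chain2[OF D]) (auto intro!: derivative_eq_intros)
    from DERIV_diff[OF this D] show ?thesis using h(2) by simp
  qed
  then have "H (y + 1) - H y = H (0 + 1) - H 0" for y by (rule DERIV_isconst_all[rule_format])
  then have per: "H (y + 1) = H y" for y using H0 H1 by simp
  have bd: "\<bar>H y\<bar> \<le> integral {0..1} (\<lambda>y. \<bar>h y\<bar>)" if "0 \<le> y" "y \<le> 1" for y
  proof -
    have "H y = integral {0..y} h" using FTC[OF that(1)] H0 by (simp add: integral_unique)
    also have "\<bar>\<dots>\<bar> \<le> integral {0..y} (\<lambda>y. \<bar>h y\<bar>)"
      using integral_norm_bound_integral[of h "{0..y}" "\<lambda>y. \<bar>h y\<bar>"]
      by (auto intro!: integrable_continuous_interval continuous_intros ch)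
    also have "\<dots> \<le> integral {0..1} (\<lambda>y. \<bar>h y\<bar>)"
      using that by (intro integral_subset_le integrable_continuous_interval continuous_intros ch) auto
    finally show ?thesis .
  qed
  have "H y = H (frac y)" for y
  proof -
    have "H (z + of_int n) = H z" for z n
    proof (induction n rule: int_induct[of _ 0])
      case (step1 i) then show ?case using per[of "z + of_int i"] by (simp add: algebra_simps)
    next
      case (step2 i) then show ?case using per[of "z + of_int (i - 1)"] by (simp add: algebra_simps)
    qed simp
    from this[of "frac y" "\<lfloor>y\<rfloor>"] show ?thesis by (simp add: frac_def)
  qed
  then have "\<bar>H y\<bar> \<le> integral {0..1} (\<lambda>y. \<bar>h y\<bar>)" for y
    using bd[of "frac y"] by (metis frac_ge_0 frac_lt_1 less_imp_le)
  then show ?thesis using sH per D by blast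
qed

section \<open>Wallis integrals, the normalising constants of the periodic bumps
  \<open>sin (pi * y) ^ (2 * m)\<close>\<close>

definition wallis :: "nat \<Rightarrow> real" where "wallis m = integral {0..1} (\<lambda>y. sin (pi * y) ^ (2 * m))"

text \<open>Integration by parts: the derivative of
  \<open>- cos (pi * y) * sin (pi * y) ^ (2 * m + 1) / pi\<close> is integrated over the unit
  interval, where the boundary terms vanish.\<close>

lemma wallis_Suc: "wallis (Suc m) = (1 - 1 / (2 * real m + 2)) * wallis m"
proof -
  let ?s = "\<lambda>y. sin (pi * y) :: real"
  have ii: "(\<lambda>y. ?s y ^ k) integrable_on {0..1}" for k
    by (intro integrable_continuous_interval continuous_intros)
  have e: "(2 * real m + 2) * sin y ^ (2 * Suc m) - (2 * real m + 1) * sin y ^ (2 * m)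
      = sin y * sin y ^ (2 * m + 1) - cos y * ((2 * real m + 1) * sin y ^ (2 * m) * cos y)" for y :: real
  proof -
    have 1: "sin y ^ (2 * Suc m) = sin y ^ (2*m) * (sin y)^2" "sin y * sin y ^ (2 * m + 1) = sin y ^ (2*m) * (sin y)^2"
      by (simp_all add: power2_eq_square)
    have 2: "cos y * ((2 * real m + 1) * sin y ^ (2 * m) * cos y) = (2 * real m + 1) * sin y ^ (2 * m) * (cos y)^2"
      by (simp add: power2_eq_square)
    show ?thesis unfolding 1 2 cos_squared_eq by (simp add: algebra_simps)
  qed
  have "((\<lambda>y. (2 * real m + 2) * ?s y ^ (2 * Suc m) - (2 * real m + 1) * ?s y ^ (2 * m)) has_integral
      (- cos (pi * 1) * ?s 1 ^ (2 * m + 1) / pi) - (- cos (pi * 0) * ?s 0 ^ (2 * m + 1) / pi)) {0..1}"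
    unfolding e
  proof (rule fundamental_theorem_of_calculus)
    fix y :: real
    have D: "((\<lambda>y. ?s y ^ (2 * m + 1)) has_real_derivative (2 * real m + 1) * ?s y ^ (2 * m) * (cos (pi * y) * pi)) (at y within {0..1})"
      by (rule DERIV_cong[OF DERIV_power[where D = "cos (pi * y) * pi"]]) (auto intro!: derivative_eq_intros)
    have C: "((\<lambda>y. - cos (pi * y) / pi) has_real_derivative ?s y) (at y within {0..1})"
      by (auto intro!: derivative_eq_intros)
    show "((\<lambda>y. - cos (pi * y) * ?s y ^ (2 * m + 1) / pi) has_vector_derivative
        ?s y * ?s y ^ (2 * m + 1) - cos (pi * y) * ((2 * real m + 1) * ?s y ^ (2 * m) * cos (pi * y))) (at y within {0..1})"
      unfolding has_real_derivative_iff_has_vector_derivative[symmetric]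
      using DERIV_cong[OF DERIV_mult[OF C D], of "?s y * ?s y ^ (2 * m + 1) - cos (pi * y) * ((2 * real m + 1) * ?s y ^ (2 * m) * cos (pi * y))"]
      by (simp add: mult_ac)
  qed simp
  then have "integral {0..1} (\<lambda>y. (2 * real m + 2) * ?s y ^ (2 * Suc m) - (2 * real m + 1) * ?s y ^ (2 * m)) = 0"
    by (simp add: integral_unique)
  then have "(2 * real m + 2) * wallis (Suc m) - (2 * real m + 1) * wallis m = 0"
    unfolding wallis_def by (subst (asm) integral_diff) (auto intro!: integrable_on_mult_right ii simp del: mult_Suc_right)
  then show ?thesis by (simp add: field_simps)
qed

lemma wallis_0: "wallis 0 = 1" by (simp add: wallis_def)

lemma wallis_pos: "wallis m > 0"
  by (induction m) (auto simp: wallis_0 wallis_Suc)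

text \<open>Squaring keeps the induction rational: the squared factor of the recursion is at most
  \<open>(m + 1) / (m + 2)\<close>. The decay makes the heights of the normalised bumps
  unbounded.\<close>

lemma wallis_upper: "(wallis m)\<^sup>2 \<le> 1 / (real m + 1)"
proof (induction m)
  case (Suc m)
  have "(wallis (Suc m))\<^sup>2 = (1 - 1 / (2 * real m + 2))\<^sup>2 * (wallis m)\<^sup>2" by (simp add: wallis_Suc power_mult_distrib)
  also have "\<dots> \<le> (1 - 1 / (2 * real m + 2))\<^sup>2 * (1 / (real m + 1))" by (rule mult_left_mono[OF Suc]) simp
  also have "\<dots> \<le> 1 / (real (Suc m) + 1)"
  proof -
    define r where "r = real m"
    have r: "r \<ge> 0" by (simp add: r_def)
    have "(1 - 1 / (2 * r + 2))\<^sup>2 * (1 / (r + 1)) = (2 * r + 1)\<^sup>2 / (4 * (r + 1) ^ 3)"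
      using r by (simp add: power2_eq_square power3_eq_cube divide_simps) (simp add: algebra_simps)
    also have "\<dots> \<le> 1 / (r + 2)"
      using r by (simp add: power2_eq_square power3_eq_cube divide_simps) (simp add: algebra_simps)
    finally show ?thesis by (simp add: r_def add_ac)
  qed
  finally show ?case .
qed (simp add: wallis_0)

text \<open>The factors of the recursion between \<open>m\<close> and \<open>2 * m\<close> are all
  at least \<open>1 - 1 / (2 * m + 2)\<close>, so their product is at least
  \<open>1 - m / (2 * m + 2)\<close> by Bernoulli's inequality.\<close>

lemma wallis_double: "wallis (2 * m) \<ge> wallis m / 2"
proof -
  define r where "r = 1 / (2 * real m + 2)"
  have r: "0 \<le> r" "r \<le> 1" by (simp_all add: r_def)
  have "wallis (m + j) \<ge> wallis m * (1 - j * r)" for j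
  proof (induction j)
    case (Suc j)
    have "wallis m * (1 - Suc j * r) \<le> wallis m * ((1 - r) * (1 - j * r))"
      using r by (intro mult_left_mono less_imp_le[OF wallis_pos]) (simp add: algebra_simps)
    also have "\<dots> = (1 - r) * (wallis m * (1 - j * r))" by simp
    also have "\<dots> \<le> (1 - r) * wallis (m + j)"
      using Suc r by (intro mult_left_mono) auto
    also have "\<dots> \<le> (1 - 1 / (2 * real (m + j) + 2)) * wallis (m + j)"
      by (intro mult_right_mono less_imp_le[OF wallis_pos]) (auto simp: r_def frac_le)
    also have "\<dots> = wallis (m + Suc j)" using wallis_Suc[of "m + j"] by simp
    finally show ?case .
  qed simp
  from this[of m] have "wallis m * (1 - m * r) \<le> wallis (2 * m)" by (simp add: mult_2)
  moreover have "wallis m * (1 / 2) \<le> wallis m * (1 - m * r)"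
    by (intro mult_left_mono less_imp_le[OF wallis_pos]) (simp add: r_def divide_simps)
  ultimately show ?thesis by simp
qed

text \<open>A normalised even power of the sine, of height \<open>B = 1 / wallis m\<close>, behaves
  like a bump of width 1/B: the square has integral \<open>B * B * wallis (2 * m)\<close>,
  comparable to \<open>B\<close> by \<open>wallis_double\<close>, and since the bump rises up to 1/2
  and then falls, its variation is at most twice its height.\<close>

lemma concentrated_bump:
  "\<exists>B (b :: real \<Rightarrow> real). B \<ge> M \<and> smooth b \<and> (\<forall>y. b (y + 1) = b y) \<and> (\<forall>y. 0 \<le> b y \<and> b y \<le> B) \<and>
    integral {0..1} b = 1 \<and> B / 2 \<le> integral {0..1} (\<lambda>y. b y * b y) \<and>
    integral {0..1} (\<lambda>y. \<bar>dird 1 b y\<bar>) \<le> 2 * B"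
proof -
  obtain m0 :: nat where m0: "real m0 \<ge> M\<^sup>2" using real_arch_simple by blast
  define m where "m = m0 + 1"
  define B where "B = 1 / wallis m"
  define b where "b y = B * sin (pi * y) ^ (2 * m)" for y
  have B0: "B > 0" using wallis_pos by (simp add: B_def)
  have "M \<le> B"
  proof (rule ccontr)
    assume "\<not> M \<le> B"
    then have "B\<^sup>2 < M\<^sup>2" using B0 by (intro power_strict_mono) auto
    also have "M\<^sup>2 \<le> real m + 1" using m0 by (simp add: m_def)
    also have "\<dots> \<le> B\<^sup>2" using wallis_upper[of m] wallis_pos[of m] unfolding B_def power_divide
      by (simp add: field_simps)
    finally show False by simp
  qed
  have sb: "smooth b" unfolding b_def
    by (intro smooth_mult smooth_const smooth_power smooth_compose_real[OF smooth_sin] smooth_id)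
  have "sin (pi * (y + 1)) = - sin (pi * y)" for y by (simp add: distrib_left)
  then have per: "b (y + 1) = b y" for y by (simp add: b_def)
  have b0: "0 \<le> b y \<and> b y \<le> B" for y
  proof -
    have "\<bar>sin (pi * y)\<bar> ^ (2 * m) \<le> 1" by (intro power_le_one) auto
    then have "sin (pi * y) ^ (2 * m) \<le> 1" by (simp add: power_even_abs)
    then show ?thesis using B0 by (simp add: b_def)
  qed
  have i1: "integral {0..1} b = 1" using wallis_pos[of m] by (simp add: b_def[abs_def] B_def wallis_def)
  have "integral {0..1} (\<lambda>y. b y * b y) = B * B * wallis (2 * m)"
    by (simp add: b_def wallis_def power_add[symmetric] mult_2 mult_ac)
  also have "\<dots> \<ge> B * B * (wallis m / 2)" using B0 wallis_double by (intro mult_left_mono) auto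
  moreover have "B * B * (wallis m / 2) = B * (B * wallis m) / 2" by simp
  moreover have "B * wallis m = 1" using wallis_pos[of m] by (simp add: B_def)
  ultimately have i2: "B / 2 \<le> integral {0..1} (\<lambda>y. b y * b y)" by (metis mult.right_neutral)
  have Db: "(b has_real_derivative B * (2 * m * sin (pi * y) ^ (2 * m - 1) * (cos (pi * y) * pi))) (at y)" for y
    unfolding b_def by (auto intro!: derivative_eq_intros)
  then have db: "dird 1 b y = B * (2 * m * sin (pi * y) ^ (2 * m - 1) * (cos (pi * y) * pi))" for y
    using dird_real[OF Db, where v = 1] by simp
  have FTC: "(dird 1 b has_integral b d - b c) {c..d}" if "c \<le> d" for c d
    by (rule fundamental_theorem_of_calculus[OF that])
      (auto simp: has_real_derivative_iff_has_vector_derivative[symmetric]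
        intro: has_field_derivative_at_within smooth_real_deriv(1)[OF sb])
  have "((\<lambda>y. \<bar>dird 1 b y\<bar>) has_integral b (1/2) - b 0) {0..1/2}"
  proof (rule has_integral_eq[OF _ FTC])
    fix y :: real assume y: "y \<in> {0..1/2}"
    have "0 \<le> sin (pi * y)" using y by (intro sin_ge_zero) (auto intro: mult_left_le)
    moreover have "0 \<le> cos (pi * y)" using y by (intro cos_ge_zero) (auto intro: order_trans[of _ 0])
    ultimately show "dird 1 b y = \<bar>dird 1 b y\<bar>" using B0 by (simp add: db abs_mult)
  qed simp
  moreover have "((\<lambda>y. \<bar>dird 1 b y\<bar>) has_integral - (b 1 - b (1/2))) {1/2..1}"
  proof (rule has_integral_eq[OF _ has_integral_neg[OF FTC]])
    fix y :: real assume y: "y \<in> {1/2..1}"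
    have "0 \<le> sin (pi * y)" using y by (intro sin_ge_zero) (auto intro: mult_left_le)
    moreover have "cos (pi * y) \<le> 0"
    proof -
      have "0 \<le> cos (pi * (1 - y))" using y by (intro cos_ge_zero) (auto intro: order_trans[of _ 0])
      then show ?thesis by (simp add: right_diff_distrib)
    qed
    ultimately have "dird 1 b y \<le> 0" using B0 unfolding db
      by (intro mult_nonneg_nonpos mult_nonpos_nonneg) auto
    then show "- dird 1 b y = \<bar>dird 1 b y\<bar>" by simp
  qed simp
  ultimately have "((\<lambda>y. \<bar>dird 1 b y\<bar>) has_integral (b (1/2) - b 0) + - (b 1 - b (1/2))) {0..1}"
    by (intro has_integral_combine[of 0 "1/2" 1]) auto
  then have i3: "integral {0..1} (\<lambda>y. \<bar>dird 1 b y\<bar>) \<le> 2 * B"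
    using b0[of "1/2"] b0[of 0] b0[of 1] by (simp add: integral_unique)
  show ?thesis
    by (rule exI[of _ B], rule exI[of _ b]) (simp only: \<open>M \<le> B\<close> sb per b0 i1 i2 i3 simp_thms)
qed

section \<open>Shear flows\<close>

declare content_unit_cube [simp]

lemma dird_cmult: "smooth f \<Longrightarrow> dird v (\<lambda>x. c * f x) = (\<lambda>x. c * dird v f x)"
  using dird_mult[OF smooth_const] by simp

lemma dird_divide: "smooth f \<Longrightarrow> dird v (\<lambda>x. f x / c) = (\<lambda>x. dird v f x / c)"
  using dird_cmult[of f v "1 / c"] by simp

text \<open>For \<open>k \<noteq> l\<close> this is the inverse of the flow map at time
  \<open>s\<close> of the velocity \<open>g (x $ l) *\<^sub>R axis k 1\<close>, so that composing a
  function with it transports the function.\<close>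

definition shear :: "'n \<Rightarrow> 'n \<Rightarrow> (real \<Rightarrow> real) \<Rightarrow> real \<Rightarrow> real^'n \<Rightarrow> real^'n" where
  "shear k l g s x = x - (s * g (x $ l)) *\<^sub>R axis k 1"

lemma smooth_coord: "smooth F \<Longrightarrow> smooth (\<lambda>x::real^'n. F (x $ l))"
  by (rule smooth_compose_real[OF _ smooth_nth])

lemma partial_coord:
  assumes "smooth F"
  shows "partial i (\<lambda>x::real^'n. F (x $ l)) = (\<lambda>x. if i = l then dird 1 F (x $ l) else 0)"
proof
  fix x :: "real^'n"
  have "((\<lambda>x::real^'n. F (x $ l)) has_derivative (\<lambda>v. dird 1 F (x $ l) * v $ l)) (at x)"
    using has_derivative_compose[OF bounded_linear_imp_has_derivative[OF bounded_linear_vec_nth[of l]]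
      smooth_real_deriv(1)[OF assms, unfolded has_field_derivative_def]] .
  from dird_eqI[OF this, of "axis i 1"]
  show "partial i (\<lambda>x::real^'n. F (x $ l)) x = (if i = l then dird 1 F (x $ l) else 0)"
    by (simp add: partial_eq_dird axis_def)
qed

lemma smooth_shear_joint:
  fixes f :: "real^'n \<Rightarrow> real"
  assumes f: "smooth f" and g: "smooth g"
  shows "smooth (\<lambda>z::real\<times>(real^'n). f (shear k l g (fst z) (snd z)))"
proof (rule smooth_compose[OF f])
  fix c :: "real^'n"
  have lin: "smooth (\<lambda>z::real\<times>(real^'n). snd z \<bullet> c)"
    by (rule smooth_linear) (rule bounded_linear_compose[OF bounded_linear_inner_left bounded_linear_snd])
  have "smooth (\<lambda>z::real\<times>(real^'n). snd z $ l)"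
    by (rule smooth_linear) (rule bounded_linear_compose[OF bounded_linear_vec_nth bounded_linear_snd])
  then have "smooth (\<lambda>z::real\<times>(real^'n). g (snd z $ l))" by (rule smooth_compose_real[OF g])
  then show "smooth (\<lambda>z::real\<times>(real^'n). shear k l g (fst z) (snd z) \<bullet> c)"
    unfolding shear_def inner_diff_left inner_scaleR_left
    by (intro smooth_diff' lin smooth_mult smooth_fst smooth_const)
qed

lemma smooth_shear:
  assumes "smooth f" "smooth g"
  shows "smooth (\<lambda>x. f (shear k l g s x))"
  using smooth_slice[OF smooth_shear_joint[OF assms, of k l], of s] by simp

lemma shear_periodic:
  assumes "periodic f" "\<And>y. g (y + 1) = g y"
  shows "periodic (\<lambda>x. f (shear k l g s x))"
proof -
  have "shear k l g s (x + axis i 1) = shear k l g s x + axis i 1" for x i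
    using assms(2) by (auto simp: shear_def axis_def)
  then show ?thesis using assms(1) by (simp add: periodic_def)
qed

text \<open>All derivatives except the one in direction \<open>l\<close> commute with the shear. In
  direction \<open>l\<close> the tilt contributes a multiple of the derivative in direction
  \<open>k\<close>; this conversion of one derivative into another drives the basic step.\<close>

lemma shear_partial:
  fixes f :: "real^'n \<Rightarrow> real"
  assumes f: "smooth f" and g: "smooth g"
  shows "partial i (\<lambda>x. f (shear k l g s x)) =
    (\<lambda>x. partial i f (shear k l g s x) - (if i = l then s * dird 1 g (x $ l) else 0) * partial k f (shear k l g s x))"
proof
  fix x :: "real^'n"
  let ?y = "shear k l g s x"
  have "((\<lambda>x. shear k l g s x) has_derivative (\<lambda>v. v - (s * (dird 1 g (x $ l) * v $ l)) *\<^sub>R axis k 1)) (at x)"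
    unfolding shear_def
    by (auto intro!: derivative_eq_intros has_derivative_compose[OF bounded_linear_imp_has_derivative[OF bounded_linear_vec_nth[of l]]
      smooth_real_deriv(1)[OF g, unfolded has_field_derivative_def]])
  from has_derivative_compose[OF this smooth_has_derivative[OF f]]
  have "((\<lambda>x. f (shear k l g s x)) has_derivative
    (\<lambda>v. dird (v - (s * (dird 1 g (x $ l) * v $ l)) *\<^sub>R axis k 1) f ?y)) (at x)" .
  then have "partial i (\<lambda>x. f (shear k l g s x)) x =
      dird (axis i 1 - (s * (dird 1 g (x $ l) * (axis i 1 :: real^'n) $ l)) *\<^sub>R axis k 1) f ?y"
    unfolding partial_eq_dird by (rule dird_eqI)
  also have "\<dots> = dird (axis i 1) f ?y - (s * (dird 1 g (x $ l) * (axis i 1 :: real^'n) $ l)) *\<^sub>R dird (axis k 1) f ?y"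
    unfolding linear_diff[OF dird_linear[OF smooth_diff[OF f]]] linear_cmul[OF dird_linear[OF smooth_diff[OF f]]] ..
  also have "\<dots> = partial i f ?y - (if i = l then s * dird 1 g (x $ l) else 0) * partial k f ?y"
    by (simp add: partial_eq_dird axis_def)
  finally show "partial i (\<lambda>x. f (shear k l g s x)) x =
    partial i f ?y - (if i = l then s * dird 1 g (x $ l) else 0) * partial k f ?y" .
qed

text \<open>Together with \<open>shear_partial\<close> in the direction \<open>k \<noteq> l\<close>,
  this is the transport equation for the sheared function.\<close>

lemma shear_time_derivative:
  assumes f: "smooth f"
  shows "((\<lambda>s. f (shear k l g s x)) has_real_derivative - g (x $ l) * partial k f (shear k l g s x)) (at s within S)"
proof -
  have "((\<lambda>s. f (shear k l g s x)) has_real_derivative dird ((- g (x $ l)) *\<^sub>R axis k 1) f (shear k l g s x)) (at s within S)"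
    unfolding shear_def by (rule smooth_vd[OF f]) (auto intro!: derivative_eq_intros)
  then show ?thesis
    unfolding linear_cmul[OF dird_linear[OF smooth_diff[OF f]]] by (simp add: partial_eq_dird)
qed

lemma smooth_periodic_bound:
  assumes "smooth f" "periodic (f :: real^'n \<Rightarrow> real)"
  shows "\<exists>K\<ge>0. \<forall>x. \<bar>f x\<bar> \<le> K"
proof -
  obtain K where K: "K \<ge> 0" "Ck_norm 0 f \<le> ennreal K" using smooth_periodic_bounded[OF assms] by blast
  have "ennreal \<bar>f x\<bar> \<le> ennreal K" for x using Ck_norm_ge[of "[]" 0 f x] K(2) by simp
  then show ?thesis using K(1) by (auto simp: ennreal_le_iff)
qed

lemma partial_Lipschitz:
  assumes "smooth f" "\<And>x. \<bar>partial i f x\<bar> \<le> D"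
  shows "\<bar>f (x + s *\<^sub>R axis i 1) - f x\<bar> \<le> D * \<bar>s\<bar>"
proof -
  have "norm (f (x + s *\<^sub>R axis i 1) - f (x + 0 *\<^sub>R axis i 1)) \<le> D * norm (s - 0)"
    by (rule field_differentiable_bound[of UNIV "\<lambda>r. f (x + r *\<^sub>R axis i 1)" "\<lambda>r. partial i f (x + r *\<^sub>R axis i 1)"])
      (auto simp: assms(2) partial_eq_dird[THEN fun_cong, THEN fun_cong] assms(2)[unfolded partial_eq_dird] intro!: smooth_partial_line[OF assms(1)])
  then show ?thesis by simp
qed

lemma integral_torus_mono:
  fixes u v :: "real^'n \<Rightarrow> real"
  assumes "continuous_on UNIV u" "continuous_on UNIV v" "\<And>x. u x \<le> v x"
  shows "integral unit_cube u \<le> integral unit_cube v"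
  using assms by (intro integral_le integrable_continuous) (auto intro: continuous_on_subset)

section \<open>The basic step\<close>

text \<open>
  A jump \<open>\<partial>\<^sub>k a\<close> on top of \<open>A\<close> is replaced by three jumps and one shear in direction \<open>k\<close>, whose
  displacement \<open>g\<close> depends on \<open>x\<^sub>l\<close> only. The first jump \<open>\<partial>\<^sub>l (a G / h)\<close> is transported by the shear
  into \<open>\<partial>\<^sub>l\<close> and \<open>\<partial>\<^sub>k\<close> of small functions plus \<open>\<partial>\<^sub>k (\<eta>' G a)\<close>, and \<open>\<eta>' G\<close> has mean one.
\<close>

lemma step_exists:
  fixes A a :: "real^'n \<Rightarrow> real" and q :: nat
  assumes kl: "k \<noteq> l" and A: "smooth A" "periodic A" and a: "smooth a" "periodic a" and \<delta>: "\<delta> > 0"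
  shows "\<exists>g a1 a2 a3. smooth g \<and> (\<forall>y. g (y + 1) = g y) \<and>
    smooth a1 \<and> periodic a1 \<and> smooth a2 \<and> periodic a2 \<and> smooth a3 \<and> periodic a3 \<and>
    (\<forall>x. A (shear k l g 1 x) + partial l a1 (shear k l g 1 x) + partial l a2 x + partial k a3 x = A x + partial k a x) \<and>
    integral unit_cube (\<lambda>x. \<bar>a1 x\<bar>) \<le> \<delta> \<and> integral unit_cube (\<lambda>x. \<bar>a2 x\<bar>) \<le> \<delta> \<and>
    integral unit_cube (\<lambda>x. \<bar>a3 x\<bar>) \<le> \<delta> \<and>
    (\<forall>p. 1 \<le> p \<and> p \<le> real q \<longrightarrow>
      integral unit_cube (\<lambda>x::real^'n. \<bar>g (x $ l)\<bar> powr p) + integral unit_cube (\<lambda>x::real^'n. \<bar>dird 1 g (x $ l)\<bar> powr p) \<le> \<delta> powr p) \<and>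
    (\<forall>s\<in>{0..1}. integral unit_cube (\<lambda>x. \<bar>(A (shear k l g s x) + partial l a1 (shear k l g s x)) * g (x $ l)\<bar>)
       \<le> 16 * integral unit_cube (\<lambda>x. \<bar>a x\<bar>) + \<delta>)"
proof -
  have sk: "smooth (partial k a)" "periodic (partial k a)" and sl: "smooth (partial l a)" "periodic (partial l a)"
    by (intro smooth_partial periodic_partial a)+
  obtain D1 D2 D3 D4 where DD: "D1 \<ge> 0" "\<And>x. \<bar>A x\<bar> \<le> D1" "D2 \<ge> 0" "\<And>x. \<bar>a x\<bar> \<le> D2"
    "D3 \<ge> 0" "\<And>x. \<bar>partial k a x\<bar> \<le> D3" "D4 \<ge> 0" "\<And>x. \<bar>partial l a x\<bar> \<le> D4"
    using smooth_periodic_bound[OF A] smooth_periodic_bound[OF a] smooth_periodic_bound[OF sk] smooth_periodic_bound[OF sl]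
    by blast
  \<comment> \<open>One bound for all the data. The summand 1 gives \<open>D \<ge> 1\<close>, so
    that \<open>h\<close> is dominated by \<open>h * D\<close>.\<close>
  define D where "D = 1 + D1 + D2 + D3 + D4"
  have D: "D \<ge> 1" "\<And>x. \<bar>A x\<bar> \<le> D" "\<And>x. \<bar>a x\<bar> \<le> D" "\<And>x. \<bar>partial k a x\<bar> \<le> D" "\<And>x. \<bar>partial l a x\<bar> \<le> D"
    using DD(1,3,5,7) by (auto simp: D_def intro: order_trans[OF DD(2)] order_trans[OF DD(4)] order_trans[OF DD(6)] order_trans[OF DD(8)])
  \<comment> \<open>\<open>L\<close> is the order of the slope of \<open>g\<close> on its peaks. The
    L^1 norm of \<open>a1\<close> will be at most \<open>4 * D / L\<close>, which dictates the
    second entry of the maximum; \<open>L \<ge> \<delta>\<close> makes powers of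
    \<open>L / \<delta>\<close> increasing in the exponent.\<close>
  define L where "L = max \<delta> (16 * D / \<delta>)"
  have L: "L > 0" "L \<ge> \<delta>" "16 * D / L \<le> \<delta>"
  proof -
    show "L > 0" "L \<ge> \<delta>" using \<delta> by (auto simp: L_def)
    have "16 * D / \<delta> \<le> L" by (simp add: L_def)
    then show "16 * D / L \<le> \<delta>" using \<delta> \<open>L > 0\<close> by (simp add: field_simps)
  qed
  \<comment> \<open>The concentration is chosen after the slope: the p-th power of the derivative of
    \<open>g\<close> will integrate to at most \<open>2 * L powr p / B\<close>, and the bound on
    \<open>B\<close> beats this for all \<open>p \<le> q\<close> at once. \<open>B \<ge> 4\<close>
    keeps \<open>S - 1\<close> comparable to \<open>B\<close>.\<close>
  obtain B and b :: "real \<Rightarrow> real" where B: "B \<ge> max 4 (4 * (L / \<delta>) ^ q)" and b: "smooth b" "\<And>y. b (y + 1) = b y"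
    "\<And>y. 0 \<le> b y" "\<And>y. b y \<le> B" "integral {0..1} b = 1" "B / 2 \<le> integral {0..1} (\<lambda>y. b y * b y)"
    "integral {0..1} (\<lambda>y. \<bar>dird 1 b y\<bar>) \<le> 2 * B"
    using concentrated_bump[of "max 4 (4 * (L / \<delta>) ^ q)"] by blast
  \<comment> \<open>The frequency comes last. All remaining errors are of order \<open>h * D\<close>
    or \<open>D / \<sigma>\<close>, with \<open>h \<le> L / \<sigma>\<close>.\<close>
  obtain \<sigma> :: nat where \<sigma>: "real \<sigma> \<ge> 100 * D * (L + 1) / \<delta>" using real_arch_simple by blast
  have \<sigma>0: "real \<sigma> > 0"
    by (rule less_le_trans[OF _ \<sigma>]) (use D(1) L(1) \<delta> in \<open>auto intro!: divide_pos_pos mult_pos_pos\<close>)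
  have B4: "B \<ge> 4" using B by simp
  have cb: "continuous_on S b" "continuous_on S (dird 1 b)" for S
    by (intro smooth_cont smooth_dird b)+
  define S where "S = integral {0..1} (\<lambda>y. b y * b y)"
  have S: "S \<ge> B / 2" "S \<ge> 2" using b(6) B4 by (auto simp: S_def)
  \<comment> \<open>The integral of \<open>(b y - 1) * b y\<close> is \<open>S - 1\<close>, so that
    this choice of \<open>c\<close> normalises the product to mean one.\<close>
  define c where "c = 1 / (S - 1)"
  have c: "c > 0" "c * B \<le> 4" "c * (S - 1) = 1" "c * (S + 1) \<le> 3"
    using S B4 by (auto simp: c_def field_simps)
  have ii: "f integrable_on {0..1::real}" if "continuous_on {0..1} f" for f :: "real \<Rightarrow> real"
    using that by (rule integrable_continuous_interval)
  have i1: "integral {0..1} (\<lambda>y. b y - 1) = 0"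
    using b(5) by (simp add: integral_diff ii cb)
  have "smooth (\<lambda>y. b y - 1)" "\<And>y. b (y + 1) - 1 = b y - 1"
    by (intro smooth_diff' smooth_const b) (simp add: b(2))
  \<comment> \<open>\<open>e\<close> is the profile of the shear. Its slope \<open>b - 1\<close> is
    a peak of mass one minus a constant, so that \<open>e\<close> stays bounded by 2 however high
    the peak is.\<close>
  from smooth_antiderivative[OF this i1]
  obtain e where e': "smooth e \<and> (\<forall>y. e (y + 1) = e y) \<and> (\<forall>y. (e has_real_derivative b y - 1) (at y)) \<and>
     (\<forall>y. \<bar>e y\<bar> \<le> integral {0..1} (\<lambda>y. \<bar>b y - 1\<bar>))"
    by (rule exE)
  then have e: "smooth e" "\<And>y. e (y + 1) = e y" "\<And>y. (e has_real_derivative b y - 1) (at y)"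
     "\<And>y. \<bar>e y\<bar> \<le> integral {0..1} (\<lambda>y. \<bar>b y - 1\<bar>)"
    by simp_all
  have b1: "integral {0..1} (\<lambda>y. \<bar>b y - 1\<bar>) \<le> 2"
  proof -
    have "integral {0..1} (\<lambda>y. \<bar>b y - 1\<bar>) \<le> integral {0..1} (\<lambda>y. b y + 1)"
      by (intro integral_le ii continuous_intros cb) (use b(3) in \<open>auto simp: abs_if\<close>)
    then show ?thesis using b(5) by (simp add: integral_add ii cb)
  qed
  have e2: "\<bar>e y\<bar> \<le> 2" for y :: real using e(4) b1 by (rule order_trans)
  have i2: "integral {0..1} (\<lambda>y. 1 - c * ((b y - 1) * b y)) = 0"
  proof -
    have "integral {0..1} (\<lambda>y. (b y - 1) * b y) = S - 1"
      unfolding S_def left_diff_distrib using b(5) by (subst integral_diff) (auto intro!: ii continuous_intros cb)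
    then show ?thesis using c(3) by (subst integral_diff) (auto intro!: ii continuous_intros cb)
  qed
  have i3: "integral {0..1} (\<lambda>y. \<bar>c * ((b y - 1) * b y)\<bar>) \<le> 3"
  proof -
    have "integral {0..1} (\<lambda>y. \<bar>c * ((b y - 1) * b y)\<bar>) \<le> integral {0..1} (\<lambda>y. c * (b y * b y + b y))"
    proof (intro integral_le ii continuous_intros cb)
      fix y
      have "\<bar>b y - 1\<bar> * b y \<le> (b y + 1) * b y" using b(3)[of y] by (intro mult_right_mono) auto
      then show "\<bar>c * ((b y - 1) * b y)\<bar> \<le> c * (b y * b y + b y)"
        using c(1) b(3)[of y] by (simp add: abs_mult distrib_right)
    qed
    also have "\<dots> = c * (S + 1)"
      unfolding S_def using b(5) by (simp add: integral_add ii cb continuous_intros)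
    finally show ?thesis using c(4) by simp
  qed
  have "smooth (\<lambda>y. 1 - c * ((b y - 1) * b y))"
    "\<And>y. 1 - c * ((b (y + 1) - 1) * b (y + 1)) = 1 - c * ((b y - 1) * b y)"
    by (intro smooth_diff' smooth_const smooth_mult b) (simp add: b(2))
  \<comment> \<open>\<open>r\<close> is the corrector for replacing the oscillating coefficient
    \<open>c * ((b y - 1) * b y)\<close> by its mean one; it too has a bound independent of
    \<open>B\<close>.\<close>
  from smooth_antiderivative[OF this i2]
  obtain r where r': "smooth r \<and> (\<forall>y. r (y + 1) = r y) \<and> (\<forall>y. (r has_real_derivative 1 - c * ((b y - 1) * b y)) (at y)) \<and>
     (\<forall>y. \<bar>r y\<bar> \<le> integral {0..1} (\<lambda>y. \<bar>1 - c * ((b y - 1) * b y)\<bar>))"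
    by (rule exE)
  then have r: "smooth r" "\<And>y. r (y + 1) = r y" "\<And>y. (r has_real_derivative 1 - c * ((b y - 1) * b y)) (at y)"
     "\<And>y. \<bar>r y\<bar> \<le> integral {0..1} (\<lambda>y. \<bar>1 - c * ((b y - 1) * b y)\<bar>)"
    by simp_all
  have r4: "\<bar>r y\<bar> \<le> 4" for y :: real
  proof -
    have "integral {0..1} (\<lambda>y. \<bar>1 - c * ((b y - 1) * b y)\<bar>) \<le> integral {0..1} (\<lambda>y. 1 + \<bar>c * ((b y - 1) * b y)\<bar>)"
      by (intro integral_le ii continuous_intros cb) auto
    also have "\<dots> = 1 + integral {0..1} (\<lambda>y. \<bar>c * ((b y - 1) * b y)\<bar>)"
      by (subst integral_add) (auto intro!: ii continuous_intros cb)
    finally show ?thesis using r(4)[of y] i3 by linarith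
  qed
  \<comment> \<open>With this amplitude the slope \<open>h * \<sigma> * (b - 1)\<close> of
    \<open>g\<close> equals \<open>(L / B) * (b - 1)\<close>, of order \<open>L\<close> at the top
    of the peaks and independent of \<sigma>.\<close>
  define h where "h = L / (\<sigma> * B)"
  have h0: "h > 0" using L(1) \<sigma>0 B4 by (simp add: h_def)
  have hL: "h \<le> L / \<sigma>" using L(1) \<sigma>0 B4 by (simp add: h_def field_simps)
  have pern: "F (y + real n) = F y" if "\<And>y. F (y + 1) = F y" for F :: "real \<Rightarrow> real" and y n
    by (induction n) (use that in \<open>simp_all add: add.assoc[symmetric]\<close>, metis that add.commute add.left_commute)
  define sc where "sc F y = F (real \<sigma> * y)" for F :: "real \<Rightarrow> real" and y
  have sc_s: "smooth (sc F)" if "smooth F" for F unfolding sc_def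
    by (intro smooth_compose_real[OF that] smooth_mult smooth_const smooth_id)
  have sc_p: "sc F (y + 1) = sc F y" if "\<And>y. F (y + 1) = F y" for F and y :: real
    unfolding sc_def distrib_left using pern[of F "\<sigma> * y" \<sigma>, OF that] by simp
  have sc_d: "dird 1 (sc F) y = \<sigma> * f (\<sigma> * y)" if "\<And>y. (F has_real_derivative f y) (at y)" for F f :: "real \<Rightarrow> real" and y :: real
  proof -
    have "(sc F has_real_derivative f (\<sigma> * y) * \<sigma>) (at y)" unfolding sc_def
      by (rule DERIV_chain2[OF that]) (auto intro!: derivative_eq_intros)
    from dird_real[OF this, of 1] show ?thesis by simp
  qed
  define g where "g y = h * sc e y" for y :: real
  have g: "smooth g" "\<And>y. g (y + 1) = g y" unfolding g_def[abs_def]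
    using e(1,2) by (auto intro!: smooth_mult sc_s simp: sc_p)
  have g2: "\<bar>g y\<bar> \<le> 2 * h" for y :: real using h0 e2[of "\<sigma> * y"] by (simp add: g_def sc_def abs_mult mult.commute)
  have dg: "dird 1 g y = h * (\<sigma> * (b (\<sigma> * y) - 1))" for y :: real
    unfolding g_def[abs_def] using sc_d[OF e(3), of y] by (simp add: dird_cmult sc_s e(1))
  define G where "G y = (c / \<sigma>) * sc b y" for y :: real
  have G: "smooth G" "\<And>y. G (y + 1) = G y" unfolding G_def[abs_def]
    using b(1,2) by (auto intro!: smooth_mult sc_s simp: sc_p)
  have dG: "dird 1 G y = c * dird 1 b (\<sigma> * y)" for y :: real
    unfolding G_def[abs_def] dird_cmult[OF sc_s[OF b(1)]] sc_d[OF smooth_real_deriv(1)[OF b(1)]]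
    using \<sigma>0 by simp
  have G0: "0 \<le> G y" for y :: real using c(1) b(3) by (simp add: G_def sc_def)
  define Q where "Q y = sc r y / \<sigma>" for y :: real
  have Q: "smooth Q" "\<And>y. Q (y + 1) = Q y" unfolding Q_def[abs_def]
    using r(1,2) by (auto intro!: smooth_divide sc_s simp: sc_p)
  have Q4: "\<bar>Q y\<bar> \<le> 4 / \<sigma>" for y :: real using r4[of "\<sigma> * y"] \<sigma>0 by (simp add: Q_def sc_def divide_right_mono)
  have dQ: "dird 1 Q y = 1 - dird 1 g y * (G y / h)" for y :: real
  proof -
    have "dird 1 Q y = dird 1 (sc r) y / \<sigma>"
      by (simp add: Q_def[abs_def] dird_divide[OF sc_s[OF r(1)]])
    then show ?thesis using sc_d[OF r(3), of y] \<sigma>0 h0 by (simp add: dg G_def sc_def)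
  qed
  let ?S = "shear k l g"
  define a1 where "a1 x = a x * (G (x $ l) / h)" for x
  \<comment> \<open>The transported jump is \<open>partial l\<close> of \<open>a1\<close> composed
    with the shear, which \<open>a2\<close> subtracts, plus \<open>partial k\<close> of
    \<open>dird 1 g * G / h\<close> times the sheared \<open>a\<close>. In \<open>a3\<close>, the
    middle term undoes the shear of \<open>a\<close>, and \<open>Z\<close> undoes the displacement
    of \<open>A\<close>. The coefficient differs from one by the derivative of \<open>Q\<close>, and
    \<open>Q' * partial k a\<close> equals
    \<open>partial l (Q * partial k a) - partial k (Q * partial l a)\<close>, which explains the
    terms with \<open>Q\<close>.\<close>
  define a2 where "a2 x = partial k a x * Q (x $ l) - a1 (?S 1 x)" for x
  define Z where "Z x = integral {0..1} (\<lambda>s. g (x $ l) * A (?S s x))" for x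
  define a3 where "a3 x = Z x + dird 1 g (x $ l) * (G (x $ l) / h) * (a x - a (?S 1 x)) - partial l a x * Q (x $ l)" for x
  have sG: "smooth (\<lambda>x::real^'n. G (x $ l) / h)" "periodic (\<lambda>x::real^'n. G (x $ l) / h)"
    by (rule smooth_divide, rule smooth_coord[OF G(1)], rule periodic_coord) (simp add: G(2))
  have sQ: "smooth (\<lambda>x::real^'n. Q (x $ l))" "periodic (\<lambda>x::real^'n. Q (x $ l))"
    by (rule smooth_coord[OF Q(1)], rule periodic_coord) (rule Q(2))
  have sg: "smooth (\<lambda>x::real^'n. g (x $ l))" "periodic (\<lambda>x::real^'n. g (x $ l))"
    by (rule smooth_coord[OF g(1)], rule periodic_coord) (rule g(2))
  have dgp: "dird 1 g (y + 1) = dird 1 g y" for y :: real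
    using b(2) pern[of b "\<sigma> * y" \<sigma>] by (simp add: dg distrib_left)
  have sdg: "smooth (\<lambda>x::real^'n. dird 1 g (x $ l))" "periodic (\<lambda>x::real^'n. dird 1 g (x $ l))"
    by (rule smooth_coord[OF smooth_dird[OF g(1)]], rule periodic_coord) (rule dgp)
  have sa1: "smooth a1" "periodic a1" unfolding a1_def[abs_def]
    by (intro smooth_mult periodic_mult a sG)+
  have sa1S: "smooth (\<lambda>x. a1 (?S s x))" "periodic (\<lambda>x. a1 (?S s x))" for s
    by (intro smooth_shear shear_periodic sa1 g)+
  have saS: "smooth (\<lambda>x. a (?S s x))" "periodic (\<lambda>x. a (?S s x))" for s
    by (intro smooth_shear shear_periodic a g)+
  have sAS: "smooth (\<lambda>x. A (?S s x))" "periodic (\<lambda>x. A (?S s x))" for s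
    by (intro smooth_shear shear_periodic A g)+
  have sa2: "smooth a2" "periodic a2" unfolding a2_def[abs_def]
    by (intro smooth_diff' smooth_mult periodic_diff periodic_mult sk sQ sa1S)+
  define FZ where "FZ = (\<lambda>z::real\<times>(real^'n). g (snd z $ l) * A (?S (fst z) (snd z)))"
  have sFZ: "smooth FZ" unfolding FZ_def
  proof (rule smooth_mult[OF _ smooth_shear_joint[OF A(1) g(1)]])
    have "smooth (\<lambda>z::real\<times>(real^'n). snd z $ l)"
      by (rule smooth_linear) (rule bounded_linear_compose[OF bounded_linear_vec_nth bounded_linear_snd])
    then show "smooth (\<lambda>z::real\<times>(real^'n). g (snd z $ l))" by (rule smooth_compose_real[OF g(1)])
  qed
  have Z_FZ: "Z = (\<lambda>x. integral {0..1} (\<lambda>s. FZ (s, x)))" by (simp add: Z_def FZ_def fun_eq_iff)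
  have sZ: "smooth Z" unfolding Z_FZ by (rule smooth_integral_parameter[OF sFZ])
  have pZ: "periodic Z"
  proof -
    have "Z (x + axis i 1) = Z x" for x i
      unfolding Z_def using periodicD[OF sg(2)] periodicD[OF sAS(2)] by simp
    then show ?thesis by (simp add: periodic_def)
  qed
  \<comment> \<open>The derivative of the sheared \<open>A\<close> in the time \<open>s\<close> is
    \<open>- g * partial k A\<close>, so that the integral over \<open>s\<close> of
    \<open>g * partial k A\<close> along the shear is a difference of end values.\<close>
  have dZ: "partial k Z x = A x - A (?S 1 x)" for x
  proof -
    have "dird (0, axis k 1) FZ (s, x) = g (x $ l) * partial k A (?S s x)" for s
    proof -
      have "dird (0, axis k 1) FZ (s, x) = partial k (\<lambda>x. FZ (s, x)) x"
        unfolding partial_eq_dird dird_slice[OF sFZ] ..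
      also have "(\<lambda>x. FZ (s, x)) = (\<lambda>x. g (x $ l) * A (?S s x))" by (simp add: FZ_def)
      also have "partial k \<dots> x = g (x $ l) * partial k A (?S s x)"
        using kl by (simp add: partial_mult[OF sg(1) sAS(1)] partial_coord[OF g(1)] shear_partial[OF A(1) g(1)])
      finally show ?thesis .
    qed
    then have Zeq: "partial k Z x = integral {0..1} (\<lambda>s. g (x $ l) * partial k A (?S s x))"
      unfolding partial_eq_dird Z_FZ dird_integral_parameter[OF sFZ] by simp
    have "((\<lambda>s. g (x $ l) * partial k A (?S s x)) has_integral A (?S 0 x) - A (?S 1 x)) {0..1}"
    proof (rule has_integral_eq_rhs[OF fundamental_theorem_of_calculus])
      fix s :: real
      show "((\<lambda>s. - A (?S s x)) has_vector_derivative g (x $ l) * partial k A (?S s x)) (at s within {0..1})"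
        unfolding has_real_derivative_iff_has_vector_derivative[symmetric]
        using DERIV_minus[OF shear_time_derivative[OF A(1), of k l g x s "{0..1}"]] by simp
    qed simp_all
    from integral_unique[OF this] have "integral {0..1} (\<lambda>s. g (x $ l) * partial k A (?S s x)) = A (?S 0 x) - A (?S 1 x)" .
    moreover have "?S 0 x = x" by (simp add: shear_def)
    ultimately show ?thesis using Zeq by simp
  qed
  have sa3: "smooth a3" "periodic a3" unfolding a3_def[abs_def]
    by (intro smooth_diff' smooth_add smooth_mult periodic_diff periodic_add periodic_mult sl sQ sZ pZ sdg sG a saS)+
  have identity: "A (?S 1 x) + partial l a1 (?S 1 x) + partial l a2 x + partial k a3 x = A x + partial k a x" for x
  proof -
    have pa2: "partial l a2 x = partial k a x * dird 1 Q (x $ l) + partial l (partial k a) x * Q (x $ l)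
        - (partial l a1 (?S 1 x) - dird 1 g (x $ l) * partial k a1 (?S 1 x))"
      unfolding a2_def[abs_def]
      by (simp add: partial_diff smooth_mult sk sQ sa1S partial_mult partial_coord Q shear_partial[OF sa1(1) g(1)])
    have pka1: "partial k a1 (?S 1 x) = partial k a (?S 1 x) * (G (x $ l) / h)"
    proof -
      have "partial k a1 = (\<lambda>x. partial k a x * (G (x $ l) / h))"
        unfolding a1_def[abs_def] partial_mult[OF a(1) sG(1)]
        using partial_coord[OF smooth_divide[OF G(1), of h], of k l] kl by simp
      moreover have "?S 1 x $ l = x $ l" using kl by (simp add: shear_def axis_def)
      ultimately show ?thesis by simp
    qed
    have s1: "smooth (\<lambda>x::real^'n. dird 1 g (x $ l) * (G (x $ l) / h))" by (intro smooth_mult sdg sG)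
    have p1: "partial k (\<lambda>x::real^'n. dird 1 g (x $ l) * (G (x $ l) / h)) = (\<lambda>x. 0)"
      using partial_coord[OF smooth_divide[OF G(1), of h], of k l] kl
      unfolding partial_mult[OF sdg(1) sG(1)] partial_coord[OF smooth_dird[OF g(1)]] by simp
    have pa3: "partial k a3 x = (A x - A (?S 1 x)) + dird 1 g (x $ l) * (G (x $ l) / h) * (partial k a x - partial k a (?S 1 x))
        - partial k (partial l a) x * Q (x $ l)"
    proof -
      have "partial k a3 x = partial k Z x + partial k (\<lambda>x. dird 1 g (x $ l) * (G (x $ l) / h) * (a x - a (?S 1 x))) x
         - partial k (\<lambda>x. partial l a x * Q (x $ l)) x"
        unfolding a3_def[abs_def]
        by (subst partial_diff, intro smooth_add sZ smooth_mult[OF s1] smooth_diff' a saS, intro smooth_mult sl sQ,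
            subst partial_add, intro sZ, intro smooth_mult[OF s1] smooth_diff' a saS) simp
      also have "partial k (\<lambda>x. dird 1 g (x $ l) * (G (x $ l) / h) * (a x - a (?S 1 x))) x
          = dird 1 g (x $ l) * (G (x $ l) / h) * (partial k a x - partial k a (?S 1 x))"
        unfolding partial_mult[OF s1 smooth_diff'[OF a(1) saS(1)]] p1 partial_diff[OF a(1) saS(1)]
        using kl by (simp add: shear_partial[OF a(1) g(1)])
      also have "partial k (\<lambda>x. partial l a x * Q (x $ l)) x = partial k (partial l a) x * Q (x $ l)"
        using kl by (simp add: partial_mult[OF sl(1) sQ(1)] partial_coord[OF Q(1)])
      finally show ?thesis by (simp add: dZ)
    qed
    have com: "partial l (partial k a) x = partial k (partial l a) x"
      by (simp add: partial_commute[OF a(1), of l k])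
    show ?thesis unfolding pa2 pka1 pa3 dQ com by (simp add: algebra_simps)
  qed
  have small: "h * D \<le> \<delta> / 100" "D / \<sigma> \<le> \<delta> / 100" "h \<le> \<delta> / 100" "c / \<sigma> \<le> 1 / \<sigma>" "c / (\<sigma> * h) * D \<le> \<delta> / 4"
  proof -
    have 1: "100 * D * (L + 1) \<le> \<sigma> * \<delta>" using \<sigma> \<delta> by (simp add: divide_le_eq)
    then have "100 * (D * L) + 100 * D \<le> \<sigma> * \<delta>" by (simp add: distrib_left)
    moreover have "0 \<le> D * L" "0 \<le> D" using D(1) L(1) by simp_all
    ultimately have 2: "100 * (D * L) \<le> \<sigma> * \<delta>" "100 * D \<le> \<sigma> * \<delta>" by linarith+
    have "h * D \<le> L / \<sigma> * D" using hL D(1) by (intro mult_right_mono) auto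
    also have "\<dots> \<le> \<delta> / 100" using 2(1) \<sigma>0 by (simp add: field_simps)
    finally show 3: "h * D \<le> \<delta> / 100" .
    show "D / \<sigma> \<le> \<delta> / 100" using 2(2) \<sigma>0 by (simp add: field_simps)
    have "h * 1 \<le> h * D" using h0 D(1) by (intro mult_left_mono) auto
    then show "h \<le> \<delta> / 100" using 3 by simp
    have "c * 4 \<le> c * B" using c(1) B4 by (intro mult_left_mono) auto
    then have "c \<le> 1" using c(2) by simp
    then show "c / \<sigma> \<le> 1 / \<sigma>" using \<sigma>0 by (intro divide_right_mono) auto
    have "c / (\<sigma> * h) * D = c * B * D / L" using \<sigma>0 B4 by (simp add: h_def)
    also have "\<dots> \<le> 4 * D / L" using c(2) D(1) L(1) by (intro divide_right_mono mult_right_mono) auto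
    also have "\<dots> \<le> \<delta> / 4" using L(3) by simp
    finally show "c / (\<sigma> * h) * D \<le> \<delta> / 4" .
  qed
  \<comment> \<open>The averaging lemma for a constant weight, whose Lipschitz constant is
    0.\<close>
  have av: "integral unit_cube (\<lambda>x::real^'n. K + C * F (real \<sigma> * x $ l)) \<le> K + C * integral {0..1} F"
    if F: "continuous_on UNIV F" "\<And>y. F (y + 1) = F y" "\<And>y. 0 \<le> F y" and C: "0 \<le> C" for K C :: real and F :: "real \<Rightarrow> real"
  proof -
    have "continuous_on unit_cube (\<lambda>x::real^'n. C * F (real \<sigma> * x $ l))"
      by (intro continuous_intros continuous_on_compose2[OF F(1)]) auto
    then have "integral unit_cube (\<lambda>x::real^'n. K + C * F (real \<sigma> * x $ l)) = K + integral unit_cube (\<lambda>x::real^'n. C * F (real \<sigma> * x $ l))"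
      by (subst integral_add) (auto intro: integrable_continuous)
    also have "integral unit_cube (\<lambda>x::real^'n. C * F (real \<sigma> * x $ l)) \<le> (integral unit_cube (\<lambda>x::real^'n. C) + 0 / \<sigma>) * integral {0..1} F"
      using \<sigma>0 by (intro integral_torus_average F continuous_intros periodic_const) auto
    finally show ?thesis by simp
  qed
  have cc: "continuous_on T (\<lambda>x::real^'n. F (real \<sigma> * x $ l))" if "continuous_on UNIV F" for F :: "real \<Rightarrow> real" and T
    by (rule continuous_on_compose2[OF that]) (auto intro!: continuous_intros)
  have cbx: "continuous_on T (\<lambda>x::real^'n. b (real \<sigma> * x $ l))" for T
    by (rule cc) (rule cb(1))
  have cs: "continuous_on T f" if "smooth f" for f :: "real^'n \<Rightarrow> real" and T
    using that by (rule smooth_cont)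
  have Sl: "?S s x $ l = x $ l" for s x using kl by (simp add: shear_def axis_def)
  have a1b: "\<bar>a1 (?S s x)\<bar> \<le> c / (\<sigma> * h) * D * b (real \<sigma> * x $ l)" for s x
  proof -
    have "\<bar>a1 (?S s x)\<bar> = \<bar>a (?S s x)\<bar> * (c / (\<sigma> * h) * b (real \<sigma> * x $ l))"
      using c(1) b(3)[of "real \<sigma> * x $ l"] \<sigma>0 h0 by (simp add: a1_def Sl G_def sc_def abs_mult)
    also have "\<dots> \<le> D * (c / (\<sigma> * h) * b (real \<sigma> * x $ l))"
      using c(1) b(3)[of "real \<sigma> * x $ l"] \<sigma>0 h0 by (intro mult_right_mono D) auto
    finally show ?thesis by (simp add: mult_ac)
  qed
  have cpos: "0 \<le> c / (\<sigma> * h) * D" using c(1) \<sigma>0 h0 D(1) by simp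
  have S0: "?S 0 x = x" for x by (simp add: shear_def)
  have I1: "integral unit_cube (\<lambda>x. \<bar>a1 x\<bar>) \<le> \<delta>"
  proof -
    have "integral unit_cube (\<lambda>x. \<bar>a1 x\<bar>) \<le> integral unit_cube (\<lambda>x::real^'n. 0 + c / (\<sigma> * h) * D * b (real \<sigma> * x $ l))"
      using a1b[of 0] S0 by (intro integral_torus_mono continuous_intros cbx cs[OF sa1(1)]) simp
    also have "\<dots> \<le> 0 + c / (\<sigma> * h) * D * integral {0..1} b" by (rule av[OF cb(1) b(2,3) cpos])
    finally show ?thesis using small(5) \<delta> unfolding b(5) by linarith
  qed
  have I2: "integral unit_cube (\<lambda>x. \<bar>a2 x\<bar>) \<le> \<delta>"
  proof -
    have "integral unit_cube (\<lambda>x. \<bar>a2 x\<bar>) \<le> integral unit_cube (\<lambda>x::real^'n. 4 * (D / \<sigma>) + c / (\<sigma> * h) * D * b (real \<sigma> * x $ l))"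
    proof (intro integral_torus_mono continuous_intros cbx cs[OF sa2(1)])
      fix x
      have "\<bar>partial k a x * Q (x $ l)\<bar> \<le> D * (4 / \<sigma>)"
        unfolding abs_mult using D(1) by (intro mult_mono D Q4) auto
      then show "\<bar>a2 x\<bar> \<le> 4 * (D / \<sigma>) + c / (\<sigma> * h) * D * b (real \<sigma> * x $ l)"
        using a1b[of 1 x] unfolding a2_def by (simp add: mult.commute)
    qed
    also have "\<dots> \<le> 4 * (D / \<sigma>) + c / (\<sigma> * h) * D * integral {0..1} b" by (rule av[OF cb(1) b(2,3) cpos])
    also have "\<dots> \<le> \<delta>" using small(2,5) \<delta> unfolding b(5) by linarith
    finally show ?thesis .
  qed
  have aS: "\<bar>a (?S s x) - a x\<bar> \<le> 2 * (h * D)" if "s \<in> {0..1}" for s x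
  proof -
    have "\<bar>a (?S s x) - a x\<bar> = \<bar>a (x + (- (s * g (x $ l))) *\<^sub>R axis k 1) - a x\<bar>" by (simp add: shear_def)
    also have "\<dots> \<le> D * \<bar>- (s * g (x $ l))\<bar>" by (rule partial_Lipschitz[OF a(1) D(4)])
    also have "\<bar>- (s * g (x $ l))\<bar> \<le> 1 * (2 * h)"
      unfolding abs_minus abs_mult using that by (intro mult_mono g2) auto
    finally show ?thesis using D(1) by (simp add: mult_ac)
  qed
  have I3: "integral unit_cube (\<lambda>x. \<bar>a3 x\<bar>) \<le> \<delta>"
  proof -
    let ?F = "\<lambda>y. \<bar>c * ((b y - 1) * b y)\<bar>"
    have cF: "continuous_on UNIV ?F" by (intro continuous_intros cb)
    have "integral unit_cube (\<lambda>x. \<bar>a3 x\<bar>) \<le> integral unit_cube (\<lambda>x::real^'n. (2 * (h * D) + 4 * (D / \<sigma>)) + 2 * (h * D) * ?F (real \<sigma> * x $ l))"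
    proof (intro integral_torus_mono continuous_intros cbx cs[OF sa3(1)])
      fix x
      have 1: "\<bar>partial l a x * Q (x $ l)\<bar> \<le> D * (4 / \<sigma>)"
        unfolding abs_mult using D(1) by (intro mult_mono D Q4) auto
      have "dird 1 g (x $ l) * (G (x $ l) / h) = c * ((b (real \<sigma> * x $ l) - 1) * b (real \<sigma> * x $ l))"
        using \<sigma>0 h0 by (simp add: dg G_def sc_def)
      then have 2: "\<bar>dird 1 g (x $ l) * (G (x $ l) / h) * (a x - a (?S 1 x))\<bar> \<le> ?F (real \<sigma> * x $ l) * (2 * (h * D))"
        using aS[of 1 x] unfolding abs_mult[of _ "a x - a (?S 1 x)"]
        by (intro mult_mono) (auto simp: abs_minus_commute)
      have 3: "\<bar>Z x\<bar> \<le> 2 * (h * D)"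
      proof -
        have "norm (Z x) \<le> integral {0..1} (\<lambda>s::real. 2 * (h * D))"
          unfolding Z_def
        proof (rule integral_norm_bound_integral)
          show "(\<lambda>s. g (x $ l) * A (?S s x)) integrable_on {0..1}"
            unfolding shear_def
            by (intro integrable_continuous_interval continuous_intros continuous_on_compose2[OF smooth_cont[OF A(1), of UNIV]]) auto
          fix s
          have "\<bar>g (x $ l)\<bar> * \<bar>A (?S s x)\<bar> \<le> (2 * h) * D" using h0 by (intro mult_mono g2 D) auto
          then show "norm (g (x $ l) * A (?S s x)) \<le> 2 * (h * D)" by (simp add: abs_mult)
        qed auto
        then show ?thesis by simp
      qed
      show "\<bar>a3 x\<bar> \<le> (2 * (h * D) + 4 * (D / \<sigma>)) + 2 * (h * D) * ?F (real \<sigma> * x $ l)"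
      proof -
        have "\<bar>u + v - w\<bar> \<le> \<bar>u\<bar> + \<bar>v\<bar> + \<bar>w\<bar>" for u v w :: real by linarith
        then have "\<bar>a3 x\<bar> \<le> \<bar>Z x\<bar> + \<bar>dird 1 g (x $ l) * (G (x $ l) / h) * (a x - a (?S 1 x))\<bar> + \<bar>partial l a x * Q (x $ l)\<bar>"
          unfolding a3_def .
        also have "\<dots> \<le> 2 * (h * D) + ?F (real \<sigma> * x $ l) * (2 * (h * D)) + D * (4 / \<sigma>)"
          by (intro add_mono 1 2 3)
        finally show ?thesis by (simp add: mult_ac)
      qed
    qed
    also have "\<dots> \<le> (2 * (h * D) + 4 * (D / \<sigma>)) + 2 * (h * D) * integral {0..1} ?F"
      using h0 D(1) by (intro av cF) (auto simp: b(2))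
    also have "\<dots> \<le> (2 * (h * D) + 4 * (D / \<sigma>)) + 2 * (h * D) * 3"
      using h0 D(1) by (intro add_left_mono mult_left_mono i3) auto
    also have "\<dots> \<le> \<delta>" using small(1,2) \<delta> by linarith
    finally show ?thesis .
  qed
  have I4: "integral unit_cube (\<lambda>x::real^'n. \<bar>g (x $ l)\<bar> powr p) + integral unit_cube (\<lambda>x::real^'n. \<bar>dird 1 g (x $ l)\<bar> powr p) \<le> \<delta> powr p"
    if p: "1 \<le> p" "p \<le> real q" for p
  proof -
    have "integral unit_cube (\<lambda>x::real^'n. \<bar>g (x $ l)\<bar> powr p) \<le> integral unit_cube (\<lambda>x::real^'n. (2 * h) powr p)"
      using p by (intro integral_torus_mono continuous_on_powr' continuous_intros cs sg powr_mono2 g2) auto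
    also have "\<dots> \<le> (\<delta> * (1/4)) powr p" using p small(3) h0 \<delta> by (auto intro!: powr_mono2)
    also have "\<dots> = \<delta> powr p * (1/4) powr p" by (rule powr_mult)
    also have "\<dots> \<le> \<delta> powr p * (1/4) powr 1" using p by (intro mult_left_mono powr_mono') auto
    finally have 1: "integral unit_cube (\<lambda>x::real^'n. \<bar>g (x $ l)\<bar> powr p) \<le> \<delta> powr p / 4" by simp
    let ?C = "(h * \<sigma>) powr p * B powr (p - 1)"
    have cF: "continuous_on UNIV (\<lambda>y. \<bar>b y - 1\<bar>)" by (intro continuous_intros cb)
    have "integral unit_cube (\<lambda>x::real^'n. \<bar>dird 1 g (x $ l)\<bar> powr p) \<le> integral unit_cube (\<lambda>x::real^'n. 0 + ?C * \<bar>b (real \<sigma> * x $ l) - 1\<bar>)"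
    proof (rule integral_torus_mono)
      show "continuous_on UNIV (\<lambda>x::real^'n. \<bar>dird 1 g (x $ l)\<bar> powr p)"
        using p by (intro continuous_on_powr' continuous_intros cs sdg) auto
      show "continuous_on UNIV (\<lambda>x::real^'n. 0 + ?C * \<bar>b (real \<sigma> * x $ l) - 1\<bar>)"
        by (intro continuous_intros cbx)
      fix x :: "real^'n"
      let ?y = "real \<sigma> * x $ l"
      have "\<bar>dird 1 g (x $ l)\<bar> powr p = (h * \<sigma>) powr p * \<bar>b ?y - 1\<bar> powr p"
        using h0 \<sigma>0 by (simp add: dg abs_mult powr_mult)
      \<comment> \<open>Interpolation: the power \<open>p - 1\<close> is bounded by the height
        \<open>B\<close>, and the remaining factor by its L^1 norm, which is at most 2 whatever
        \<open>B\<close> is.\<close>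
      also have "\<bar>b ?y - 1\<bar> powr p = \<bar>b ?y - 1\<bar> powr (p - 1) * \<bar>b ?y - 1\<bar>"
        using powr_add[of "\<bar>b ?y - 1\<bar>" "p - 1" 1] by (cases "b ?y = 1") auto
      also have "(h * \<sigma>) powr p * \<dots> \<le> (h * \<sigma>) powr p * (B powr (p - 1) * \<bar>b ?y - 1\<bar>)"
        using p b(3)[of ?y] b(4)[of ?y] B4
        by (intro mult_left_mono mult_right_mono powr_mono2) auto
      finally show "\<bar>dird 1 g (x $ l)\<bar> powr p \<le> 0 + ?C * \<bar>b ?y - 1\<bar>" by (simp add: mult.assoc)
    qed
    also have "\<dots> \<le> 0 + ?C * integral {0..1} (\<lambda>y. \<bar>b y - 1\<bar>)"
      by (intro av cF) (auto simp: b(2))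
    also have "\<dots> \<le> ?C * 2" using b1 by (simp add: mult_left_mono)
    also have "?C = L powr p / B"
    proof -
      have "h * \<sigma> = L / B" using \<sigma>0 by (simp add: h_def)
      then show ?thesis using L(1) B4 by (simp add: powr_divide powr_diff)
    qed
    also have "L powr p / B * 2 \<le> \<delta> powr p / 2"
    proof -
      have "4 * (L / \<delta>) powr p \<le> 4 * (L / \<delta>) powr (real q)" using p L(2) \<delta> by (intro mult_left_mono powr_mono) auto
      also have "\<dots> = 4 * (L / \<delta>) ^ q" using L(1) \<delta> by (simp add: powr_realpow)
      also have "\<dots> \<le> B" using B by simp
      finally show ?thesis using \<delta> B4 L(1) by (simp add: powr_divide field_simps)
    qed
    finally have 2: "integral unit_cube (\<lambda>x::real^'n. \<bar>dird 1 g (x $ l)\<bar> powr p) \<le> \<delta> powr p / 2" .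
    have "0 \<le> \<delta> powr p" by simp
    then show ?thesis using 1 2 by linarith
  qed
  \<comment> \<open>The constant 16: \<open>\<bar>g\<bar> \<le> 2 * h\<close> cancels the
    \<open>1 / h\<close> in the derivative of \<open>a1\<close>, which leaves
    \<open>2 * \<bar>a\<bar>\<close> times the oscillating factor
    \<open>\<bar>c * dird 1 b\<bar>\<close>, of mean at most \<open>c * 2 * B \<le> 8\<close>.
    Everything else is small because of the high frequency.\<close>
  have I5: "integral unit_cube (\<lambda>x. \<bar>(A (?S s x) + partial l a1 (?S s x)) * g (x $ l)\<bar>)
       \<le> 16 * integral unit_cube (\<lambda>x. \<bar>a x\<bar>) + \<delta>" if s: "s \<in> {0..1}" for s
  proof -
    let ?F = "\<lambda>y. \<bar>c * dird 1 b y\<bar>"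
    have cF: "continuous_on UNIV ?F" by (intro continuous_intros cb)
    have dbp: "dird 1 b (y + 1) = dird 1 b y" for y :: real
    proof -
      have "((\<lambda>y. b (y + 1)) has_real_derivative dird 1 b (y + 1) * 1) (at y)"
        by (rule DERIV_chain2[OF smooth_real_deriv(1)[OF b(1)]]) (auto intro!: derivative_eq_intros)
      then have "(b has_real_derivative dird 1 b (y + 1) * 1) (at y)" by (simp add: b(2))
      from DERIV_unique[OF this smooth_real_deriv(1)[OF b(1)]] show ?thesis by simp
    qed
    have iF: "integral {0..1} ?F \<le> 8"
    proof -
      have "integral {0..1} ?F = c * integral {0..1} (\<lambda>y. \<bar>dird 1 b y\<bar>)" using c(1) by (simp add: abs_mult)
      also have "\<dots> \<le> c * (2 * B)" using c(1) b(7) by (intro mult_left_mono) auto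
      finally show ?thesis using c(2) by simp
    qed
    have iF0: "0 \<le> integral {0..1} ?F" by (rule integral_nonneg) (auto intro!: ii continuous_intros cb)
    have da1: "partial l a1 y = (a y * (c * dird 1 b (real \<sigma> * y $ l)) + partial l a y * (c / \<sigma> * b (real \<sigma> * y $ l))) / h" for y
    proof -
      have dGh: "dird 1 (\<lambda>y. G y / h) z = dird 1 G z / h" for z :: real
        by (simp add: dird_divide[OF G(1)])
      show ?thesis
        unfolding a1_def[abs_def] partial_mult[OF a(1) sG(1)] partial_coord[OF smooth_divide[OF G(1), of h]] dGh dG
        by (simp add: G_def sc_def add_divide_distrib)
    qed
    let ?w = "\<lambda>x. \<bar>a x\<bar> + 2 * (h * D)"
    have cb': "continuous_on UNIV (\<lambda>x::real^'n. ?w x * ?F (real \<sigma> * x $ l))"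
      by (intro continuous_intros cc[OF cF] cs[OF a(1)])
    have "integral unit_cube (\<lambda>x. \<bar>(A (?S s x) + partial l a1 (?S s x)) * g (x $ l)\<bar>)
      \<le> integral unit_cube (\<lambda>x. 2 * (?w x * ?F (real \<sigma> * x $ l)) + (2 * (h * D) + 2 * D * (c / \<sigma>) * b (real \<sigma> * x $ l)))"
    proof (rule integral_torus_mono)
      show "continuous_on UNIV (\<lambda>x. \<bar>(A (?S s x) + partial l a1 (?S s x)) * g (x $ l)\<bar>)"
        by (intro continuous_intros cs sAS sg smooth_shear smooth_partial sa1 g)
      show "continuous_on UNIV (\<lambda>x. 2 * (?w x * ?F (real \<sigma> * x $ l)) + (2 * (h * D) + 2 * D * (c / \<sigma>) * b (real \<sigma> * x $ l)))"
        by (intro continuous_intros cc[OF cF] cs[OF a(1)] cbx)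
      fix x
      let ?z = "real \<sigma> * x $ l"
      have 1: "\<bar>A (?S s x) * g (x $ l)\<bar> \<le> D * (2 * h)"
        unfolding abs_mult using D(1) by (intro mult_mono D g2) auto
      have "\<bar>a (?S s x)\<bar> \<le> ?w x" using aS[OF s, of x] by linarith
      then have 2: "\<bar>a (?S s x) * (c * dird 1 b ?z)\<bar> \<le> ?w x * ?F ?z"
        unfolding abs_mult[of "a (?S s x)"] by (rule mult_right_mono) simp
      have 3: "\<bar>partial l a (?S s x) * (c / \<sigma> * b ?z)\<bar> \<le> D * (c / \<sigma> * b ?z)"
        unfolding abs_mult[of "partial l a (?S s x)"] using D(1) c(1) b(3)[of ?z] \<sigma>0 by (intro mult_mono D) (auto simp: abs_mult)
      have "\<bar>partial l a1 (?S s x) * g (x $ l)\<bar> \<le> ((?w x * ?F ?z + D * (c / \<sigma> * b ?z)) / h) * (2 * h)"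
        unfolding da1 abs_mult[of _ "g (x $ l)"] abs_divide Sl using h0 2 3
        by (intro mult_mono g2 divide_mono order_trans[OF abs_triangle_ineq add_mono]) (auto intro!: divide_nonneg_nonneg add_nonneg_nonneg mult_nonneg_nonneg simp: D(1) order_trans[OF _ D(1)] b(3) less_imp_le[OF c(1)])
      also have "\<dots> = 2 * (?w x * ?F ?z) + 2 * D * (c / \<sigma>) * b ?z" using h0 by (simp add: field_simps)
      finally show "\<bar>(A (?S s x) + partial l a1 (?S s x)) * g (x $ l)\<bar>
         \<le> 2 * (?w x * ?F ?z) + (2 * (h * D) + 2 * D * (c / \<sigma>) * b ?z)"
        using 1 unfolding distrib_right[of "A (?S s x)"] by (simp add: mult_ac)
    qed
    also have "\<dots> = 2 * integral unit_cube (\<lambda>x. ?w x * ?F (real \<sigma> * x $ l)) + integral unit_cube (\<lambda>x::real^'n. 2 * (h * D) + 2 * D * (c / \<sigma>) * b (real \<sigma> * x $ l))"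
      by (subst integral_add) (auto intro!: integrable_continuous continuous_intros continuous_on_subset[OF cb'] cbx simp del: times_divide_eq_right times_divide_eq_left)
    also have "integral unit_cube (\<lambda>x. ?w x * ?F (real \<sigma> * x $ l)) \<le> (integral unit_cube ?w + D / \<sigma>) * integral {0..1} ?F"
    proof (rule integral_torus_average)
      show "continuous_on UNIV ?w" by (intro continuous_intros cs a)
      show "periodic ?w" using a(2) by (simp add: periodic_def)
      fix x and r :: real assume "0 \<le> r"
      then show "?w (x + r *\<^sub>R axis l 1) \<le> ?w x + D * r"
        using partial_Lipschitz[OF a(1) D(5), of x r] by simp
    qed (use cF dbp \<sigma>0 D(1) in auto)
    also have "(integral unit_cube ?w + D / \<sigma>) * integral {0..1} ?F \<le> (integral unit_cube ?w + D / \<sigma>) * 8"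
    proof (rule mult_left_mono[OF iF])
      have "0 \<le> integral unit_cube ?w"
        using D(1) h0 by (intro integral_nonneg integrable_continuous continuous_intros cs a) auto
      then show "0 \<le> integral unit_cube ?w + D / \<sigma>" using D(1) by simp
    qed
    also have "integral unit_cube ?w = integral unit_cube (\<lambda>x. \<bar>a x\<bar>) + 2 * (h * D)"
      by (subst integral_add) (auto intro!: integrable_continuous continuous_intros cs[OF a(1)])
    also have "integral unit_cube (\<lambda>x::real^'n. 2 * (h * D) + 2 * D * (c / \<sigma>) * b (real \<sigma> * x $ l)) \<le> 2 * (h * D) + 2 * D * (c / \<sigma>) * integral {0..1} b"
      using D(1) c(1) by (intro av[OF cb(1) b(2,3)]) auto
    also have "2 * D * (c / \<sigma>) * integral {0..1} b \<le> 2 * D * (1 / \<sigma>)"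
      unfolding b(5) using D(1) small(4) by (simp add: mult_left_mono del: times_divide_eq_right times_divide_eq_left)
    also have "2 * ((integral unit_cube (\<lambda>x. \<bar>a x\<bar>) + 2 * (h * D) + D / \<sigma>) * 8) + (2 * (h * D) + 2 * D * (1 / \<sigma>))
       = 16 * integral unit_cube (\<lambda>x. \<bar>a x\<bar>) + 34 * (h * D) + 18 * (D / \<sigma>)" by simp
    finally show ?thesis using small(1,2) \<delta> by linarith
  qed
  have I4': "\<forall>p. 1 \<le> p \<and> p \<le> real q \<longrightarrow>
      integral unit_cube (\<lambda>x::real^'n. \<bar>g (x $ l)\<bar> powr p) + integral unit_cube (\<lambda>x::real^'n. \<bar>dird 1 g (x $ l)\<bar> powr p) \<le> \<delta> powr p"
    using I4 by simp
  have I5': "\<forall>s\<in>{0..1}. integral unit_cube (\<lambda>x. \<bar>(A (?S s x) + partial l a1 (?S s x)) * g (x $ l)\<bar>)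
       \<le> 16 * integral unit_cube (\<lambda>x. \<bar>a x\<bar>) + \<delta>"
    using I5 by (rule ballI)
  show ?thesis
    by (rule exI[of _ g], rule exI[of _ a1], rule exI[of _ a2], rule exI[of _ a3])
      (intro conjI allI g sa1 sa2 sa3 identity I1 I2 I3 I4' I5')
qed

section \<open>Pieces and nodes\<close>

text \<open>
  A piece is an exact solution on a time interval: the density \<open>pf\<close> is transported by the
  time independent shear velocity \<open>pg (x\<^sub>l) e\<^sub>k\<close>. A node is a time interval on which the density
  still has to be brought from \<open>nA\<close> to \<open>nA + \<partial>\<^sub>k nc\<close>.
\<close>

datatype ('n::finite) piece = Piece (pa: real) (pb: real) (pf: "real^'n \<Rightarrow> real") (pk: 'n) (pl: 'n) (pg: "real \<Rightarrow> real")

datatype ('n::finite) node = Node (na: real) (nb: real) (nA: "real^'n \<Rightarrow> real") (nk: 'n) (nc: "real^'n \<Rightarrow> real")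

definition prho :: "'n::finite piece \<Rightarrow> real \<Rightarrow> real^'n \<Rightarrow> real" where
  "prho P t x = pf P (shear (pk P) (pl P) (pg P) (t - pa P) x)"

definition pu :: "'n::finite piece \<Rightarrow> real^'n \<Rightarrow> real^'n" where
  "pu P x = pg P (x $ pl P) *\<^sub>R axis (pk P) 1"

definition nB :: "'n::finite node \<Rightarrow> real^'n \<Rightarrow> real" where
  "nB \<nu> x = nA \<nu> x + partial (nk \<nu>) (nc \<nu>) x"

definition pok :: "'n::finite piece \<Rightarrow> bool" where
  "pok P \<longleftrightarrow> pa P < pb P \<and> smooth (pf P) \<and> periodic (pf P) \<and> pk P \<noteq> pl P \<and> smooth (pg P) \<and> (\<forall>y. pg P (y + 1) = pg P y)"

definition nok :: "'n::finite node \<Rightarrow> bool" where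
  "nok \<nu> \<longleftrightarrow> na \<nu> < nb \<nu> \<and> smooth (nA \<nu>) \<and> periodic (nA \<nu>) \<and> smooth (nc \<nu>) \<and> periodic (nc \<nu>)"

definition ivP :: "'n::finite piece \<Rightarrow> real set" where "ivP P = {pa P<..<pb P}"

definition ivN :: "'n::finite node \<Rightarrow> real set" where "ivN \<nu> = {na \<nu><..<nb \<nu>}"

text \<open>Written for arbitrary \<open>\<Phi>\<close> in place of the pairing with a test function, the boundary terms telescope.\<close>

definition bdP :: "(real \<Rightarrow> (real^'n \<Rightarrow> real) \<Rightarrow> real) \<Rightarrow> 'n::finite piece \<Rightarrow> real" where
  "bdP \<Phi> P = \<Phi> (pb P) (prho P (pb P)) - \<Phi> (pa P) (prho P (pa P))"

definition bdN :: "(real \<Rightarrow> (real^'n \<Rightarrow> real) \<Rightarrow> real) \<Rightarrow> 'n::finite node \<Rightarrow> real" where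
  "bdN \<Phi> \<nu> = \<Phi> (nb \<nu>) (nB \<nu>) - \<Phi> (na \<nu>) (nA \<nu>)"

text \<open>
  In the costs of a piece the letters \<open>R\<close>, \<open>U\<close> and \<open>L\<close> refer to the norms of \<open>\<rho>\<close>, of \<open>u\<close> and of the flux \<open>\<rho> u\<close>, integrated in time.
  Both the order of the derivatives and the power in \<open>cR\<close> are \<open>q\<close>, so that a bound along \<open>q \<rightarrow> \<infinity>\<close> covers
  every \<open>L\<^sup>p\<close> norm in time of every \<open>C\<^sup>k\<close> norm.
\<close>

definition shear_norm :: "real \<Rightarrow> 'n::finite piece \<Rightarrow> ennreal" where
  "shear_norm p P = enn_powr (ennreal (integral unit_cube (\<lambda>x::real^'n. \<bar>pg P (x $ pl P)\<bar> powr p) +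
      integral unit_cube (\<lambda>x::real^'n. \<bar>dird 1 (pg P) (x $ pl P)\<bar> powr p))) (1 / p)"

definition cR :: "nat \<Rightarrow> 'n::finite piece \<Rightarrow> ennreal" where
  "cR q P = ennreal (pb P - pa P) * (1 + (SUP t\<in>{pa P..pb P}. Ck_norm q (prho P t))) ^ q"

definition cU :: "nat \<Rightarrow> 'n::finite piece \<Rightarrow> ennreal" where
  "cU q P = ennreal (pb P - pa P) * (SUP p\<in>{1..real q}. shear_norm p P)"

definition cL :: "'n::finite piece \<Rightarrow> ennreal" where
  "cL P = ennreal (pb P - pa P) * (SUP t\<in>{pa P..pb P}. ennreal (integral unit_cube (\<lambda>x. \<bar>prho P t x * pg P (x $ pl P)\<bar>)))"

text \<open>The cost of resting at the initial density \<open>nA\<close> during the whole interval,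
  which is what the main piece of the refinement does for most of the time.\<close>

definition nR :: "nat \<Rightarrow> 'n::finite node \<Rightarrow> ennreal" where
  "nR q \<nu> = ennreal (nb \<nu> - na \<nu>) * (1 + Ck_norm q (nA \<nu>)) ^ q"

text \<open>The norm of the potential and not of the jump: the jump itself becomes large along the
  iteration, but tested against a smooth function it is seen through its potential only.\<close>

definition nL :: "'n::finite node \<Rightarrow> ennreal" where
  "nL \<nu> = ennreal (integral unit_cube (\<lambda>x. \<bar>nc \<nu> x\<bar>))"

lemma enn_powr_ennreal: "0 \<le> x \<Longrightarrow> enn_powr (ennreal x) a = ennreal (x powr a)"
  by (simp add: enn_powr_def)

lemma enn_powr_mono: "x \<le> y \<Longrightarrow> 0 \<le> a \<Longrightarrow> enn_powr x a \<le> enn_powr y a"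
  by (cases x; cases y) (auto simp: enn_powr_def ennreal_le_iff top_unique intro!: ennreal_leI powr_mono2 top_greatest)

text \<open>One step of the iteration: the nodes \<open>N\<close> are replaced by finished pieces
  \<open>Ps\<close> and new nodes \<open>Cs\<close> within the same time set. The costs of
  \<open>Ps\<close> are charged to \<open>N\<close>, with the factor 16 of the basic step for the
  flux. The new nodes are measured with \<open>Suc q\<close> because the next step is taken with
  that order.\<close>

definition node_refinement :: "nat \<Rightarrow> real \<Rightarrow> 'n::finite node set \<Rightarrow> 'n piece set \<Rightarrow> 'n node set \<Rightarrow> bool" where
  "node_refinement q \<delta> N Ps Cs \<longleftrightarrow> finite Ps \<and> finite Cs \<and>
    (\<forall>P\<in>Ps. pok P \<and> ivP P \<subseteq> \<Union> (ivN ` N)) \<and> (\<forall>\<mu>\<in>Cs. nok \<mu> \<and> ivN \<mu> \<subseteq> \<Union> (ivN ` N)) \<and>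
    (\<forall>P\<in>Ps. \<forall>P'\<in>Ps. P \<noteq> P' \<longrightarrow> ivP P \<inter> ivP P' = {}) \<and> (\<forall>\<mu>\<in>Cs. \<forall>\<mu>'\<in>Cs. \<mu> \<noteq> \<mu>' \<longrightarrow> ivN \<mu> \<inter> ivN \<mu>' = {}) \<and>
    (\<forall>P\<in>Ps. \<forall>\<mu>\<in>Cs. ivP P \<inter> ivN \<mu> = {}) \<and>
    (\<forall>\<Phi>. (\<Sum>P\<in>Ps. bdP \<Phi> P) + (\<Sum>\<mu>\<in>Cs. bdN \<Phi> \<mu>) = (\<Sum>\<nu>\<in>N. bdN \<Phi> \<nu>)) \<and>
    (\<Sum>P\<in>Ps. cR q P) \<le> (\<Sum>\<nu>\<in>N. nR q \<nu>) + ennreal \<delta> \<and> (\<Sum>P\<in>Ps. cU q P) \<le> ennreal \<delta> \<and>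
    (\<Sum>P\<in>Ps. cL P) \<le> 16 * (\<Sum>\<nu>\<in>N. nL \<nu>) + ennreal \<delta> \<and>
    (\<Sum>\<mu>\<in>Cs. nL \<mu>) \<le> ennreal \<delta> \<and> (\<Sum>\<mu>\<in>Cs. nR (Suc q) \<mu>) \<le> ennreal \<delta>"

text \<open>The density rests at \<open>nA\<close> until shortly before the end. Four intervals of
  length \<tau> follow: a node for the first jump, the shear, and nodes for the two remaining jumps.
  As the intermediate densities do not depend on \<tau>, a short duration makes their costs
  small.\<close>

lemma node_step:
  fixes \<nu> :: "'n::finite node"
  assumes card: "CARD('n) \<ge> 2" and \<nu>: "nok \<nu>" and \<delta>: "\<delta> > 0"
  shows "\<exists>Ps Cs. node_refinement q \<delta> {\<nu>} Ps Cs"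
proof -
  obtain \<alpha> \<beta> A k a where \<nu>_eq: "\<nu> = Node \<alpha> \<beta> A k a" by (cases \<nu>)
  have ok: "\<alpha> < \<beta>" "smooth A" "periodic A" "smooth a" "periodic a" using \<nu> by (auto simp: nok_def \<nu>_eq)
  \<comment> \<open>The velocity has direction \<open>k\<close> and depends on another coordinate;
    this is where the dimension has to be at least two.\<close>
  obtain l where kl: "k \<noteq> l"
  proof -
    have "\<not> (UNIV :: 'n set) \<subseteq> {k}" using card card_mono[of "{k}" "UNIV :: 'n set"] by auto
    then obtain l where "l \<noteq> k" by auto
    then show ?thesis using that[of l] by simp
  qed
  \<comment> \<open>A third for each of the three new nodes.\<close>
  define d where "d = \<delta> / 3"
  have d: "d > 0" "3 * d = \<delta>" using \<delta> by (auto simp: d_def)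
  obtain g a1 a2 a3 where st: "smooth g \<and> (\<forall>y. g (y + 1) = g y) \<and>
    smooth a1 \<and> periodic a1 \<and> smooth a2 \<and> periodic a2 \<and> smooth a3 \<and> periodic a3 \<and>
    (\<forall>x. A (shear k l g 1 x) + partial l a1 (shear k l g 1 x) + partial l a2 x + partial k a3 x = A x + partial k a x) \<and>
    integral unit_cube (\<lambda>x. \<bar>a1 x\<bar>) \<le> d \<and> integral unit_cube (\<lambda>x. \<bar>a2 x\<bar>) \<le> d \<and>
    integral unit_cube (\<lambda>x. \<bar>a3 x\<bar>) \<le> d \<and>
    (\<forall>p. 1 \<le> p \<and> p \<le> real q \<longrightarrow>
      integral unit_cube (\<lambda>x::real^'n. \<bar>g (x $ l)\<bar> powr p) + integral unit_cube (\<lambda>x::real^'n. \<bar>dird 1 g (x $ l)\<bar> powr p) \<le> d powr p) \<and>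
    (\<forall>s\<in>{0..1}. integral unit_cube (\<lambda>x. \<bar>(A (shear k l g s x) + partial l a1 (shear k l g s x)) * g (x $ l)\<bar>)
       \<le> 16 * integral unit_cube (\<lambda>x. \<bar>a x\<bar>) + d)"
    using step_exists[OF kl ok(2-5) d(1), of q] by (elim exE)
  have g: "smooth g" "\<And>y. g (y + 1) = g y"
    and sa: "smooth a1" "periodic a1" "smooth a2" "periodic a2" "smooth a3" "periodic a3"
    and identity: "\<And>x. A (shear k l g 1 x) + partial l a1 (shear k l g 1 x) + partial l a2 x + partial k a3 x = A x + partial k a x"
    and small: "integral unit_cube (\<lambda>x. \<bar>a1 x\<bar>) \<le> d" "integral unit_cube (\<lambda>x. \<bar>a2 x\<bar>) \<le> d" "integral unit_cube (\<lambda>x. \<bar>a3 x\<bar>) \<le> d"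
    using st by simp_all
  have gp: "integral unit_cube (\<lambda>x::real^'n. \<bar>g (x $ l)\<bar> powr p) + integral unit_cube (\<lambda>x::real^'n. \<bar>dird 1 g (x $ l)\<bar> powr p) \<le> d powr p"
    if "1 \<le> p" "p \<le> real q" for p using st that by simp
  have gL: "integral unit_cube (\<lambda>x. \<bar>(A (shear k l g s x) + partial l a1 (shear k l g s x)) * g (x $ l)\<bar>)
       \<le> 16 * integral unit_cube (\<lambda>x. \<bar>a x\<bar>) + d" if "s \<in> {0..1}" for s using st that by blast
  define f where "f x = A x + partial l a1 x" for x
  define E where "E x = f (shear k l g 1 x)" for x
  define E2 where "E2 x = E x + partial l a2 x" for x
  have sf: "smooth f" "periodic f" unfolding f_def[abs_def]
    by (intro smooth_add periodic_add ok smooth_partial periodic_partial sa)+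
  have sE: "smooth E" "periodic E" unfolding E_def[abs_def]
    by (intro smooth_shear shear_periodic sf g)+
  have sE2: "smooth E2" "periodic E2" unfolding E2_def[abs_def]
    by (intro smooth_add periodic_add sE smooth_partial periodic_partial sa)+
  have fin: "E2 x + partial k a3 x = A x + partial k a x" for x
    using identity[of x] by (simp add: E2_def E_def f_def)
  obtain K0 where K0: "K0 \<ge> 0" "\<And>s. s \<in> {0..1} \<Longrightarrow> Ck_norm q (\<lambda>x. f (shear k l g s x)) \<le> ennreal K0"
  proof -
    have "periodic (\<lambda>x. f (shear k l g s x))" for s by (rule shear_periodic[of f, of g]) (rule sf, rule g)
    then show ?thesis
      using that Ck_norm_joint_bounded[OF smooth_shear_joint[OF sf(1) g(1), of k l], of 0 1 q] by auto
  qed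
  obtain K1 K2 K3 where K: "K1 \<ge> 0" "Ck_norm (Suc q) A \<le> ennreal K1" "K2 \<ge> 0" "Ck_norm (Suc q) E \<le> ennreal K2"
      "K3 \<ge> 0" "Ck_norm (Suc q) E2 \<le> ennreal K3"
    using smooth_periodic_bounded[OF ok(2,3)] smooth_periodic_bounded[OF sE] smooth_periodic_bounded[OF sE2] by metis
  define K where "K = K0 + K1 + K2 + K3"
  have KK: "K \<ge> 0" "K0 \<le> K" "K1 \<le> K" "K2 \<le> K" "K3 \<le> K" using K0(1) K(1,3,5) by (auto simp: K_def)
  \<comment> \<open>Chosen after all densities and their norms are known. The first entry leaves at
    least half of the interval to the resting piece; the second pays for the norms, with the
    exponent \<open>Suc q\<close> at which the new nodes are measured.\<close>
  define \<tau> where "\<tau> = min ((\<beta> - \<alpha>) / 8) (d / (1 + K) ^ Suc q)"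
  have \<tau>: "\<tau> > 0" "8 * \<tau> \<le> \<beta> - \<alpha>" "\<tau> * (1 + K) ^ Suc q \<le> d"
  proof -
    have pos: "(1 + K) ^ Suc q > 0" using KK(1) by (intro zero_less_power) auto
    then have "0 < d / (1 + K) ^ Suc q" using d(1) by simp
    then show "\<tau> > 0" using ok(1) by (simp add: \<tau>_def)
    have "\<tau> \<le> (\<beta> - \<alpha>) / 8" unfolding \<tau>_def by (rule min.cobounded1)
    then show "8 * \<tau> \<le> \<beta> - \<alpha>" by simp
    have "\<tau> \<le> d / (1 + K) ^ Suc q" by (simp add: \<tau>_def)
    then show "\<tau> * (1 + K) ^ Suc q \<le> d" using pos by (simp only: pos_le_divide_eq)
  qed
  have sup_bd: "ennreal \<tau> * (1 + X) ^ j \<le> ennreal d" if "X \<le> ennreal K'" "0 \<le> K'" "K' \<le> K" "j \<le> Suc q" for X K' j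
  proof -
    have "1 + X \<le> ennreal (1 + K)"
      using that KK(1) by (subst ennreal_plus) (auto intro: order_trans ennreal_leI)
    then have "(1 + X) ^ j \<le> ennreal (1 + K) ^ j" by (rule power_mono) simp
    then have "ennreal \<tau> * (1 + X) ^ j \<le> ennreal \<tau> * ennreal (1 + K) ^ j" by (rule mult_left_mono) simp
    also have "\<dots> = ennreal (\<tau> * (1 + K) ^ j)" using KK(1) \<tau>(1) by (simp add: ennreal_mult ennreal_power del: ennreal_plus)
    also have "\<dots> \<le> ennreal (\<tau> * (1 + K) ^ Suc q)"
      using KK(1) \<tau>(1) that(4) by (intro ennreal_leI mult_left_mono power_increasing) auto
    also have "\<dots> \<le> ennreal d" by (rule ennreal_leI) (rule \<tau>(3))
    finally show ?thesis .
  qed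
  define P0 where "P0 = Piece \<alpha> (\<beta> - 4 * \<tau>) A k l (\<lambda>_. 0)"
  \<comment> \<open>The velocity \<open>g / \<tau>\<close> acting during a time \<tau> realises
    exactly the displacement \<open>g\<close>, so that the integrals over time of its norms and of
    the flux do not involve \<tau>.\<close>
  define P1 where "P1 = Piece (\<beta> - 3 * \<tau>) (\<beta> - 2 * \<tau>) f k l (\<lambda>y. g y / \<tau>)"
  define N1 where "N1 = Node (\<beta> - 4 * \<tau>) (\<beta> - 3 * \<tau>) A l a1"
  define N2 where "N2 = Node (\<beta> - 2 * \<tau>) (\<beta> - \<tau>) E l a2"
  define N3 where "N3 = Node (\<beta> - \<tau>) \<beta> E2 k a3"
  have sel: "pa P0 = \<alpha>" "pb P0 = \<beta> - 4 * \<tau>" "pg P0 = (\<lambda>_. 0)" "pa P1 = \<beta> - 3 * \<tau>" "pb P1 = \<beta> - 2 * \<tau>"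
    by (simp_all add: P0_def P1_def)
  have r0: "prho P0 t = A" for t by (simp add: prho_def P0_def fun_eq_iff shear_def)
  have r1: "prho P1 t = (\<lambda>x. f (shear k l g ((t - (\<beta> - 3 * \<tau>)) / \<tau>) x))" for t
    by (simp add: prho_def P1_def fun_eq_iff shear_def)
  have r1a: "prho P1 (\<beta> - 3 * \<tau>) = f" by (simp add: r1 fun_eq_iff shear_def)
  have r1b: "prho P1 (\<beta> - 2 * \<tau>) = E" using \<tau>(1) by (simp add: r1 fun_eq_iff E_def)
  have nB: "nB N1 = f" "nB N2 = E2" "nB N3 = (\<lambda>x. A x + partial k a x)" "nB \<nu> = (\<lambda>x. A x + partial k a x)"
    by (simp_all add: nB_def fun_eq_iff N1_def N2_def N3_def \<nu>_eq f_def E2_def[symmetric] fin)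
  have dist: "P0 \<noteq> P1" "N1 \<noteq> N2" "N1 \<noteq> N3" "N2 \<noteq> N3"
    using \<tau> by (auto simp: P0_def P1_def N1_def N2_def N3_def)
  let ?Ps = "{P0, P1}" and ?Cs = "{N1, N2, N3}"
  have pok: "pok P0" "pok P1" using \<tau> ok kl sf g
    by (auto simp: pok_def P0_def P1_def)
  have nok: "nok N1" "nok N2" "nok N3" using \<tau> ok sa sE sE2
    by (auto simp: nok_def N1_def N2_def N3_def)
  have iv: "ivP P0 = {\<alpha><..<\<beta> - 4 * \<tau>}" "ivP P1 = {\<beta> - 3 * \<tau><..<\<beta> - 2 * \<tau>}" "ivN N1 = {\<beta> - 4 * \<tau><..<\<beta> - 3 * \<tau>}"
    "ivN N2 = {\<beta> - 2 * \<tau><..<\<beta> - \<tau>}" "ivN N3 = {\<beta> - \<tau><..<\<beta>}" "ivN \<nu> = {\<alpha><..<\<beta>}"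
    by (simp_all add: ivP_def ivN_def P0_def P1_def N1_def N2_def N3_def \<nu>_eq)
  have bd: "(\<Sum>P\<in>?Ps. bdP \<Phi> P) + (\<Sum>\<mu>\<in>?Cs. bdN \<Phi> \<mu>) = bdN \<Phi> \<nu>" for \<Phi>
  proof -
    have "bdP \<Phi> P0 = \<Phi> (\<beta> - 4 * \<tau>) A - \<Phi> \<alpha> A" "bdP \<Phi> P1 = \<Phi> (\<beta> - 2 * \<tau>) E - \<Phi> (\<beta> - 3 * \<tau>) f"
      unfolding bdP_def sel by (simp_all add: r0 r1a r1b)
    moreover have "bdN \<Phi> N1 = \<Phi> (\<beta> - 3 * \<tau>) f - \<Phi> (\<beta> - 4 * \<tau>) A" "bdN \<Phi> N2 = \<Phi> (\<beta> - \<tau>) E2 - \<Phi> (\<beta> - 2 * \<tau>) E"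
      "bdN \<Phi> N3 = \<Phi> \<beta> (nB \<nu>) - \<Phi> (\<beta> - \<tau>) E2" "bdN \<Phi> \<nu> = \<Phi> \<beta> (nB \<nu>) - \<Phi> \<alpha> A"
      unfolding bdN_def nB by (simp_all add: N1_def N2_def N3_def \<nu>_eq)
    ultimately show ?thesis using dist by simp
  qed
  have R0: "cR q P0 \<le> nR q \<nu>"
  proof -
    have "cR q P0 = ennreal (\<beta> - 4 * \<tau> - \<alpha>) * (1 + (SUP t\<in>{\<alpha>..\<beta> - 4 * \<tau>}. Ck_norm q A)) ^ q"
      by (simp add: cR_def r0) (simp add: P0_def)
    also have "(SUP t\<in>{\<alpha>..\<beta> - 4 * \<tau>}. Ck_norm q A) = Ck_norm q A" using \<tau> by (intro cSUP_const) auto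
    also have "ennreal (\<beta> - 4 * \<tau> - \<alpha>) * (1 + Ck_norm q A) ^ q \<le> nR q \<nu>"
      unfolding nR_def \<nu>_eq node.sel using \<tau>(1) by (intro mult_right_mono ennreal_leI) auto
    finally show ?thesis .
  qed
  have R1: "cR q P1 \<le> ennreal d"
  proof -
    have "(SUP t\<in>{\<beta> - 3 * \<tau>..\<beta> - 2 * \<tau>}. Ck_norm q (prho P1 t)) \<le> ennreal K0"
      unfolding r1 using \<tau>(1) by (intro SUP_least K0(2)) (auto simp: divide_simps)
    from sup_bd[OF this K0(1) KK(2)] show ?thesis by (simp add: cR_def) (simp add: P1_def)
  qed
  have U0: "cU q P0 = 0"
  proof -
    have "shear_norm p P0 = 0" if "p \<ge> 1" for p
      using that by (simp add: shear_norm_def P0_def) (simp add: enn_powr_def)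
    then have "(SUP p\<in>{1..real q}. shear_norm p P0) = 0" by (intro antisym SUP_least) auto
    then show ?thesis by (simp add: cU_def)
  qed
  have U1: "cU q P1 \<le> ennreal d"
  proof -
    have "shear_norm p P1 \<le> ennreal (d / \<tau>)" if p: "1 \<le> p" "p \<le> real q" for p
    proof -
      have dg: "dird 1 (\<lambda>y. g y / \<tau>) y = dird 1 g y / \<tau>" for y by (simp add: dird_divide[OF g(1)])
      have "integral unit_cube (\<lambda>x::real^'n. \<bar>g (x $ l) / \<tau>\<bar> powr p) + integral unit_cube (\<lambda>x::real^'n. \<bar>dird 1 g (x $ l) / \<tau>\<bar> powr p)
        = (integral unit_cube (\<lambda>x::real^'n. \<bar>g (x $ l)\<bar> powr p) + integral unit_cube (\<lambda>x::real^'n. \<bar>dird 1 g (x $ l)\<bar> powr p)) / \<tau> powr p"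
        using \<tau>(1) by (simp add: abs_divide powr_divide add_divide_distrib)
      also have "\<dots> \<le> d powr p / \<tau> powr p" using \<tau>(1) by (intro divide_right_mono gp p) auto
      also have "\<dots> = (d / \<tau>) powr p" using d(1) \<tau>(1) by (simp add: powr_divide)
      finally have "shear_norm p P1 \<le> enn_powr (ennreal ((d / \<tau>) powr p)) (1 / p)"
        unfolding shear_norm_def using p by (intro enn_powr_mono ennreal_leI) (auto simp: P1_def dg)
      also have "\<dots> = ennreal (d / \<tau>)" using p d(1) \<tau>(1) by (simp add: enn_powr_ennreal powr_powr)
      finally show ?thesis .
    qed
    then have "cU q P1 \<le> ennreal \<tau> * ennreal (d / \<tau>)"
      unfolding cU_def by (intro mult_mono SUP_least) (auto simp: P1_def)
    also have "\<dots> = ennreal d" using \<tau>(1) d(1) by (subst ennreal_mult[symmetric]) auto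
    finally show ?thesis .
  qed
  have L0: "cL P0 = 0"
  proof -
    have "(SUP t\<in>{pa P0..pb P0}. ennreal (integral unit_cube (\<lambda>x. \<bar>prho P0 t x * pg P0 (x $ pl P0)\<bar>))) = 0"
      by (intro antisym SUP_least) (auto simp: sel)
    then show ?thesis by (simp add: cL_def)
  qed
  have L1: "cL P1 \<le> 16 * nL \<nu> + ennreal d"
  proof -
    let ?X = "16 * integral unit_cube (\<lambda>x. \<bar>a x\<bar>) + d"
    have ia: "0 \<le> integral unit_cube (\<lambda>x. \<bar>a x\<bar>)"
      by (intro integral_nonneg integrable_continuous continuous_intros smooth_cont ok) auto
    have "integral unit_cube (\<lambda>x. \<bar>prho P1 t x * pg P1 (x $ pl P1)\<bar>) \<le> ?X / \<tau>" if t: "t \<in> {\<beta> - 3 * \<tau>..\<beta> - 2 * \<tau>}" for t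
    proof -
      let ?s = "(t - (\<beta> - 3 * \<tau>)) / \<tau>"
      have s: "?s \<in> {0..1}" using t \<tau>(1) by (auto simp: divide_simps)
      have "integral unit_cube (\<lambda>x. \<bar>prho P1 t x * pg P1 (x $ pl P1)\<bar>)
         = integral unit_cube (\<lambda>x. \<bar>f (shear k l g ?s x) * g (x $ l)\<bar> / \<tau>)"
        using \<tau>(1) by (simp add: r1) (simp add: P1_def abs_mult)
      also have "\<dots> = integral unit_cube (\<lambda>x. \<bar>f (shear k l g ?s x) * g (x $ l)\<bar>) / \<tau>" by (rule integral_divide)
      also have "\<dots> \<le> ?X / \<tau>" using gL[OF s] \<tau>(1) by (intro divide_right_mono) (simp_all add: f_def)
      finally show ?thesis .
    qed
    then have "cL P1 \<le> ennreal \<tau> * ennreal (?X / \<tau>)"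
      unfolding cL_def by (intro mult_mono SUP_least ennreal_leI) (auto simp: P1_def)
    also have "\<dots> = ennreal ?X" using \<tau>(1) d(1) ia by (subst ennreal_mult[symmetric]) auto
    also have "\<dots> = 16 * nL \<nu> + ennreal d"
      using d(1) ia by (simp add: nL_def \<nu>_eq ennreal_plus ennreal_mult)
    finally show ?thesis .
  qed
  have CL: "(\<Sum>\<mu>\<in>?Cs. nL \<mu>) \<le> ennreal \<delta>"
  proof -
    have "(\<Sum>\<mu>\<in>?Cs. nL \<mu>) \<le> ennreal d + (ennreal d + ennreal d)"
      using dist small by (simp add: nL_def) (intro add_mono ennreal_leI, simp_all add: N1_def N2_def N3_def)
    also have "\<dots> = ennreal \<delta>" using d by (simp add: ennreal_plus[symmetric] del: ennreal_plus)
    finally show ?thesis .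
  qed
  have CR: "(\<Sum>\<mu>\<in>?Cs. nR (Suc q) \<mu>) \<le> ennreal \<delta>"
  proof -
    have "nR (Suc q) N1 \<le> ennreal d" "nR (Suc q) N2 \<le> ennreal d" "nR (Suc q) N3 \<le> ennreal d"
      unfolding nR_def N1_def N2_def N3_def node.sel
      using sup_bd[OF K(2,1) KK(3) order.refl] sup_bd[OF K(4,3) KK(4) order.refl] sup_bd[OF K(6,5) KK(5) order.refl] by simp_all
    then have "(\<Sum>\<mu>\<in>?Cs. nR (Suc q) \<mu>) \<le> ennreal d + (ennreal d + ennreal d)"
      using dist by (simp add: add_mono)
    also have "\<dots> = ennreal \<delta>" using d by (simp add: ennreal_plus[symmetric] del: ennreal_plus)
    finally show ?thesis .
  qed
  have d\<delta>: "ennreal d \<le> ennreal \<delta>" using d by (intro ennreal_leI) auto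
  have SR: "(\<Sum>P\<in>?Ps. cR q P) \<le> nR q \<nu> + ennreal \<delta>"
    using dist add_mono[OF R0 order_trans[OF R1 d\<delta>]] by simp
  have SU: "(\<Sum>P\<in>?Ps. cU q P) \<le> ennreal \<delta>"
    using dist U0 order_trans[OF U1 d\<delta>] by simp
  have SL: "(\<Sum>P\<in>?Ps. cL P) \<le> 16 * nL \<nu> + ennreal \<delta>"
    using dist L0 order_trans[OF L1 add_left_mono[OF d\<delta>]] by simp
  have sum_single: "(\<Sum>\<nu>\<in>{\<nu>}. F \<nu>) = F \<nu>" for F :: "'n node \<Rightarrow> 'b::comm_monoid_add" and \<nu> by simp
  have D1: "\<forall>P\<in>?Ps. pok P \<and> ivP P \<subseteq> \<Union> (ivN ` {\<nu>})" using pok \<tau> by (auto simp: iv)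
  have D2: "\<forall>\<mu>\<in>?Cs. nok \<mu> \<and> ivN \<mu> \<subseteq> \<Union> (ivN ` {\<nu>})" using nok \<tau> by (auto simp: iv)
  have D3: "\<forall>P\<in>?Ps. \<forall>P'\<in>?Ps. P \<noteq> P' \<longrightarrow> ivP P \<inter> ivP P' = {}" using \<tau> by (auto simp: iv)
  have D4: "\<forall>\<mu>\<in>?Cs. \<forall>\<mu>'\<in>?Cs. \<mu> \<noteq> \<mu>' \<longrightarrow> ivN \<mu> \<inter> ivN \<mu>' = {}" using \<tau> by (auto simp: iv)
  have D5: "\<forall>P\<in>?Ps. \<forall>\<mu>\<in>?Cs. ivP P \<inter> ivN \<mu> = {}" using \<tau> by (auto simp: iv)
  have "node_refinement q \<delta> {\<nu>} ?Ps ?Cs"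
    unfolding node_refinement_def sum_single
    by (intro conjI D1 D2 D3 D4 D5 allI bd SR SU SL CL CR finite.intros)
  then show ?thesis by blast
qed

section \<open>Iteration\<close>

definition nodes_ok :: "'n::finite node set \<Rightarrow> bool" where
  "nodes_ok N \<longleftrightarrow> finite N \<and> (\<forall>\<nu>\<in>N. nok \<nu>) \<and> (\<forall>\<mu>\<in>N. \<forall>\<mu>'\<in>N. \<mu> \<noteq> \<mu>' \<longrightarrow> ivN \<mu> \<inter> ivN \<mu>' = {})"

lemma ivP_nonempty: "pok P \<Longrightarrow> ivP P \<noteq> {}" by (auto simp: pok_def ivP_def)

lemma ivN_nonempty: "nok P \<Longrightarrow> ivN P \<noteq> {}" by (auto simp: nok_def ivN_def)

lemma refinement_nodes_ok: "node_refinement q \<delta> N Ps Cs \<Longrightarrow> nodes_ok Cs"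
  by (simp add: node_refinement_def nodes_ok_def)

text \<open>Nodes have disjoint intervals and everything that replaces a node lies over its
  interval. As the intervals of pieces and nodes are nonempty, the sets \<open>Pf \<nu>\<close>, and
  likewise \<open>Cf \<nu>\<close>, are disjoint for different nodes, and all sums split. The
  tolerances add up.\<close>

lemma refinement_UN:
  fixes N :: "'n::finite node set" and d :: real
  assumes N: "nodes_ok N" and r: "\<And>\<nu>. \<nu> \<in> N \<Longrightarrow> node_refinement q d {\<nu>} (Pf \<nu>) (Cf \<nu>)" and d: "d \<ge> 0"
  shows "node_refinement q (real (card N) * d) N (\<Union>\<nu>\<in>N. Pf \<nu>) (\<Union>\<nu>\<in>N. Cf \<nu>)"
proof -
  have fN: "finite N" and dN: "\<And>\<mu> \<mu>'. \<mu> \<in> N \<Longrightarrow> \<mu>' \<in> N \<Longrightarrow> \<mu> \<noteq> \<mu>' \<Longrightarrow> ivN \<mu> \<inter> ivN \<mu>' = {}"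
    using N by (auto simp: nodes_ok_def)
  have fP: "finite (Pf \<nu>)" and fC: "finite (Cf \<nu>)" if "\<nu> \<in> N" for \<nu> using r[OF that] by (auto simp: node_refinement_def)
  have P: "pok P" "ivP P \<subseteq> ivN \<nu>" if "\<nu> \<in> N" "P \<in> Pf \<nu>" for \<nu> P using r[OF that(1)] that(2) by (auto simp: node_refinement_def)
  have C: "nok \<mu>" "ivN \<mu> \<subseteq> ivN \<nu>" if "\<nu> \<in> N" "\<mu> \<in> Cf \<nu>" for \<nu> \<mu> using r[OF that(1)] that(2) by (auto simp: node_refinement_def)
  have dP: "\<forall>\<nu>\<in>N. \<forall>\<nu>'\<in>N. \<nu> \<noteq> \<nu>' \<longrightarrow> Pf \<nu> \<inter> Pf \<nu>' = {}"
  proof (intro ballI impI, rule ccontr)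
    fix \<nu> \<nu>' assume n: "\<nu> \<in> N" "\<nu>' \<in> N" "\<nu> \<noteq> \<nu>'" "Pf \<nu> \<inter> Pf \<nu>' \<noteq> {}"
    then obtain P where p: "P \<in> Pf \<nu>" "P \<in> Pf \<nu>'" by auto
    have "ivP P \<subseteq> ivN \<nu> \<inter> ivN \<nu>'" by (rule Int_greatest[OF P(2)[OF n(1) p(1)] P(2)[OF n(2) p(2)]])
    then have "ivP P = {}" using dN[OF n(1-3)] by simp
    then show False using ivP_nonempty[OF P(1)[OF n(1) p(1)]] by simp
  qed
  have dC: "\<forall>\<nu>\<in>N. \<forall>\<nu>'\<in>N. \<nu> \<noteq> \<nu>' \<longrightarrow> Cf \<nu> \<inter> Cf \<nu>' = {}"
  proof (intro ballI impI, rule ccontr)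
    fix \<nu> \<nu>' assume n: "\<nu> \<in> N" "\<nu>' \<in> N" "\<nu> \<noteq> \<nu>'" "Cf \<nu> \<inter> Cf \<nu>' \<noteq> {}"
    then obtain P where p: "P \<in> Cf \<nu>" "P \<in> Cf \<nu>'" by auto
    have "ivN P \<subseteq> ivN \<nu> \<inter> ivN \<nu>'" by (rule Int_greatest[OF C(2)[OF n(1) p(1)] C(2)[OF n(2) p(2)]])
    then have "ivN P = {}" using dN[OF n(1-3)] by simp
    then show False using ivN_nonempty[OF C(1)[OF n(1) p(1)]] by simp
  qed
  have sP: "(\<Sum>P\<in>(\<Union>\<nu>\<in>N. Pf \<nu>). F P) = (\<Sum>\<nu>\<in>N. \<Sum>P\<in>Pf \<nu>. F P)" for F :: "'n piece \<Rightarrow> 'b::comm_monoid_add"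
    using fN fP dP by (intro sum.UNION_disjoint) auto
  have sC: "(\<Sum>P\<in>(\<Union>\<nu>\<in>N. Cf \<nu>). F P) = (\<Sum>\<nu>\<in>N. \<Sum>P\<in>Cf \<nu>. F P)" for F :: "'n node \<Rightarrow> 'b::comm_monoid_add"
    using fN fC dC by (intro sum.UNION_disjoint) auto
  have cd: "(\<Sum>\<nu>\<in>N. ennreal d) = ennreal (card N * d)"
    using d by (simp add: ennreal_mult ennreal_of_nat_eq_real_of_nat)
  have le: "(\<Sum>\<nu>\<in>N. F \<nu>) \<le> (\<Sum>\<nu>\<in>N. X \<nu>) + ennreal (card N * d)" if "\<And>\<nu>. \<nu> \<in> N \<Longrightarrow> F \<nu> \<le> X \<nu> + ennreal d" for F X
    using sum_mono[of N F "\<lambda>\<nu>. X \<nu> + ennreal d", OF that] unfolding sum.distrib cd .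
  have disj: "S \<inter> S' = {}" if "S \<subseteq> ivN \<nu>" "S' \<subseteq> ivN \<nu>'" "\<nu> \<in> N" "\<nu>' \<in> N" "\<nu> \<noteq> \<nu>'" for S S' \<nu> \<nu>'
    using dN[OF that(3-5)] that(1,2) by blast
  have PP: "ivP P \<inter> ivP P' = {}" if "\<nu> \<in> N" "P \<in> Pf \<nu>" "\<nu>' \<in> N" "P' \<in> Pf \<nu>'" "P \<noteq> P'" for \<nu> \<nu>' P P'
  proof (cases "\<nu> = \<nu>'")
    case True
    then show ?thesis using r[OF that(1)] that by (simp add: node_refinement_def)
  qed (rule disj[OF P(2) P(2)], use that in auto)
  have CC: "ivN P \<inter> ivN P' = {}" if "\<nu> \<in> N" "P \<in> Cf \<nu>" "\<nu>' \<in> N" "P' \<in> Cf \<nu>'" "P \<noteq> P'" for \<nu> \<nu>' P P'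
  proof (cases "\<nu> = \<nu>'")
    case True
    then show ?thesis using r[OF that(1)] that by (simp add: node_refinement_def)
  qed (rule disj[OF C(2) C(2)], use that in auto)
  have PC: "ivP P \<inter> ivN P' = {}" if "\<nu> \<in> N" "P \<in> Pf \<nu>" "\<nu>' \<in> N" "P' \<in> Cf \<nu>'" for \<nu> \<nu>' P P'
  proof (cases "\<nu> = \<nu>'")
    case True
    then show ?thesis using r[OF that(1)] that by (simp add: node_refinement_def)
  qed (rule disj[OF P(2) C(2)], use that in auto)
  show ?thesis
    unfolding node_refinement_def sP sC
  proof (intro conjI allI ballI impI)
    fix \<Phi> :: "real \<Rightarrow> (real^'n \<Rightarrow> real) \<Rightarrow> real"
    show "(\<Sum>\<nu>\<in>N. \<Sum>P\<in>Pf \<nu>. bdP \<Phi> P) + (\<Sum>\<nu>\<in>N. \<Sum>P\<in>Cf \<nu>. bdN \<Phi> P) = (\<Sum>\<nu>\<in>N. bdN \<Phi> \<nu>)"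
      unfolding sum.distrib[symmetric] using r by (intro sum.cong refl) (simp add: node_refinement_def)
    show "(\<Sum>\<nu>\<in>N. \<Sum>P\<in>Pf \<nu>. cR q P) \<le> (\<Sum>\<nu>\<in>N. nR q \<nu>) + ennreal (card N * d)"
      using r by (intro le) (simp add: node_refinement_def)
    show "(\<Sum>\<nu>\<in>N. \<Sum>P\<in>Pf \<nu>. cL P) \<le> 16 * (\<Sum>\<nu>\<in>N. nL \<nu>) + ennreal (card N * d)"
      unfolding sum_distrib_left using r by (intro le) (simp add: node_refinement_def)
    show "(\<Sum>\<nu>\<in>N. \<Sum>P\<in>Pf \<nu>. cU q P) \<le> ennreal (card N * d)"
      unfolding cd[symmetric] using r by (intro sum_mono) (simp add: node_refinement_def)
    show "(\<Sum>\<nu>\<in>N. \<Sum>P\<in>Cf \<nu>. nL P) \<le> ennreal (card N * d)"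
      unfolding cd[symmetric] using r by (intro sum_mono) (simp add: node_refinement_def)
    show "(\<Sum>\<nu>\<in>N. \<Sum>P\<in>Cf \<nu>. nR (Suc q) P) \<le> ennreal (card N * d)"
      unfolding cd[symmetric] using r by (intro sum_mono) (simp add: node_refinement_def)
  next
    show "finite (\<Union>\<nu>\<in>N. Pf \<nu>)" "finite (\<Union>\<nu>\<in>N. Cf \<nu>)" using fN fP fC by auto
  next
    fix R assume "R \<in> (\<Union>\<nu>\<in>N. Pf \<nu>)"
    then obtain \<nu> where n: "\<nu> \<in> N" "R \<in> Pf \<nu>" by auto
    show "pok R" by (rule P(1)[OF n])
    show "ivP R \<subseteq> \<Union> (ivN ` N)" using P(2)[OF n] n(1) by auto
    {
      fix R' assume "R' \<in> (\<Union>\<nu>\<in>N. Pf \<nu>)" "R \<noteq> R'"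
      then show "ivP R \<inter> ivP R' = {}" using PP[OF n] by auto
    }
    {
      fix R' assume "R' \<in> (\<Union>\<nu>\<in>N. Cf \<nu>)"
      then show "ivP R \<inter> ivN R' = {}" using PC[OF n] by auto
    }
  next
    fix R assume "R \<in> (\<Union>\<nu>\<in>N. Cf \<nu>)"
    then obtain \<nu> where n: "\<nu> \<in> N" "R \<in> Cf \<nu>" by auto
    show "nok R" by (rule C(1)[OF n])
    show "ivN R \<subseteq> \<Union> (ivN ` N)" using C(2)[OF n] n(1) by auto
    {
      fix R' assume "R' \<in> (\<Union>\<nu>\<in>N. Cf \<nu>)" "R \<noteq> R'"
      then show "ivN R \<inter> ivN R' = {}" using CC[OF n] by auto
    }
  qed
qed

lemma refinement_mono:
  assumes "node_refinement q d N Ps Cs" "d \<le> \<delta>"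
  shows "node_refinement q \<delta> N Ps Cs"
proof -
  have "X + ennreal d \<le> X + ennreal \<delta>" "ennreal d \<le> ennreal \<delta>" for X
    using assms(2) by (auto intro: add_left_mono ennreal_leI)
  note le = order_trans[OF _ this(1)] order_trans[OF _ this(2)]
  show ?thesis using assms(1) unfolding node_refinement_def
    by (elim conjE, intro conjI) (assumption | erule le)+
qed

lemma level_step:
  fixes N :: "'n::finite node set"
  assumes card: "CARD('n) \<ge> 2" and N: "nodes_ok N" and \<delta>: "\<delta> > 0"
  shows "\<exists>Ps Cs. node_refinement q \<delta> N Ps Cs"
proof -
  \<comment> \<open>One more than the number of nodes, so that the quotient is sensible for the
    empty set as well.\<close>
  define d where "d = \<delta> / (card N + 1)"
  have d: "d > 0" "card N * d \<le> \<delta>" using \<delta> by (auto simp: d_def field_simps)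
  have "\<forall>\<nu>\<in>N. \<exists>z. node_refinement q d {\<nu>} (fst z) (snd z)"
    using node_step[OF card _ d(1), of _ q] N by (auto simp: nodes_ok_def)
  then obtain z where z: "\<And>\<nu>. \<nu> \<in> N \<Longrightarrow> node_refinement q d {\<nu>} (fst (z \<nu>)) (snd (z \<nu>))" by metis
  have "node_refinement q (card N * d) N (\<Union>\<nu>\<in>N. fst (z \<nu>)) (\<Union>\<nu>\<in>N. snd (z \<nu>))"
    by (rule refinement_UN[OF N z]) (use d in auto)
  from refinement_mono[OF this d(2)] show ?thesis by (intro exI)
qed

text \<open>Dependent choice. The order \<open>M + n\<close> exceeds any given exponent in the end,
  while the tolerances stay summable.\<close>

lemma iteration:
  fixes N0 :: "'n::finite node set"
  assumes card: "CARD('n) \<ge> 2" and N0: "nodes_ok N0" and \<delta>: "\<delta> > 0"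
  shows "\<exists>NN PP. NN 0 = N0 \<and> (\<forall>n. node_refinement (M + n) (\<delta> / 2 ^ n) (NN n) (PP n) (NN (Suc n)))"
proof -
  \<comment> \<open>The invariant also pins the first set of nodes, since the choice principle by
    itself only gives some initial element.\<close>
  define Q where "Q n N = (nodes_ok N \<and> (n = 0 \<longrightarrow> N = N0))" for n :: nat and N
  have "\<exists>NN. \<forall>n. Q n (NN n) \<and> (\<exists>Ps. node_refinement (M + n) (\<delta> / 2 ^ n) (NN n) Ps (NN (Suc n)))"
  proof (rule dependent_nat_choice)
    show "\<exists>N. Q 0 N" using N0 by (auto simp: Q_def)
    fix N n assume "Q n N"
    then have "nodes_ok N" by (simp add: Q_def)
    from level_step[OF card this, of "\<delta> / 2 ^ n" "M + n"] \<delta>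
    obtain Ps Cs where "node_refinement (M + n) (\<delta> / 2 ^ n) N Ps Cs" by auto
    then show "\<exists>N'. Q (Suc n) N' \<and> (\<exists>Ps. node_refinement (M + n) (\<delta> / 2 ^ n) N Ps N')"
      using refinement_nodes_ok[of "M + n" _ N Ps Cs] by (auto simp: Q_def intro!: exI[of _ Cs])
  qed
  then obtain NN where NN: "\<And>n. Q n (NN n)" "\<And>n. \<exists>Ps. node_refinement (M + n) (\<delta> / 2 ^ n) (NN n) Ps (NN (Suc n))" by blast
  from NN(2) obtain PP where "\<And>n. node_refinement (M + n) (\<delta> / 2 ^ n) (NN n) (PP n) (NN (Suc n))" by metis
  moreover have "NN 0 = N0" using NN(1)[of 0] by (simp add: Q_def)
  ultimately show ?thesis by blast
qed

text \<open>For fixed exponents the costs are dominated only from the level on at which the growing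
  order has passed them; the finitely many earlier levels merely have to be finite.\<close>

lemma suminf_ennreal_eventually_le:
  fixes f g :: "nat \<Rightarrow> ennreal"
  assumes "\<And>n. f n < top" "\<And>n. n \<ge> n0 \<Longrightarrow> f n \<le> g n" "suminf g < top"
  shows "suminf f < top"
proof -
  have "suminf f \<le> (\<Sum>n. (if n < n0 then f n else 0) + g n)"
    using assms(2) by (intro suminf_le summableI) (auto simp: not_less add_increasing2)
  also have "\<dots> = (\<Sum>n. (if n < n0 then f n else 0)) + suminf g"
    by (rule suminf_add[OF summableI summableI, symmetric])
  also have "(\<Sum>n. (if n < n0 then f n else 0)) = (\<Sum>n<n0. f n)"
    by (subst suminf_finite[of "{..<n0}"]) auto
  also have "\<dots> + suminf g < top" using assms(1,3) by (simp add: less_top[symmetric])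
  finally show ?thesis .
qed

lemma suminf_geometric_ennreal: "c \<ge> 0 \<Longrightarrow> (\<Sum>n. ennreal (c / 2 ^ n)) = ennreal (2 * c)"
proof -
  assume c: "c \<ge> 0"
  have "(\<lambda>n. c * (1/2) ^ n) sums (c * (1 / (1 - 1/2)))" by (intro sums_mult geometric_sums) simp
  then have "(\<lambda>n. c / 2 ^ n) sums (2 * c)" by (simp add: power_divide mult.commute)
  then show ?thesis using c by (intro suminf_ennreal_eq) auto
qed

section \<open>Disjointness, telescoping and total costs along the iteration\<close>

locale iterated =
  fixes NN :: "nat \<Rightarrow> 'n::finite node set" and PP :: "nat \<Rightarrow> 'n piece set" and M :: nat and \<delta> :: real
  assumes ref: "\<And>n. node_refinement (M + n) (\<delta> / 2 ^ n) (NN n) (PP n) (NN (Suc n))" and \<delta>: "\<delta> > 0"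
begin

lemma PP_fin: "finite (PP n)"
  using ref[of n] by (simp add: node_refinement_def)

lemma PP_ok: "P \<in> PP n \<Longrightarrow> pok P"
  and PP_sub: "P \<in> PP n \<Longrightarrow> ivP P \<subseteq> \<Union> (ivN ` NN n)"
  using ref[of n] by (simp_all add: node_refinement_def)

lemma NN_sub1: "\<Union> (ivN ` NN (Suc n)) \<subseteq> \<Union> (ivN ` NN n)"
  using ref[of n] unfolding node_refinement_def by (intro UN_least) simp

lemma PP_disj1: "P \<in> PP n \<Longrightarrow> P' \<in> PP n \<Longrightarrow> P \<noteq> P' \<Longrightarrow> ivP P \<inter> ivP P' = {}"
  using ref[of n] by (simp add: node_refinement_def)

lemma PP_NN: "P \<in> PP n \<Longrightarrow> ivP P \<inter> \<Union> (ivN ` NN (Suc n)) = {}"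
  using ref[of n] by (simp add: node_refinement_def Int_UN_distrib)

lemma NN_Suc_ok: "nodes_ok (NN (Suc n))" by (rule refinement_nodes_ok[OF ref])

lemma NN_sub: "n \<le> m \<Longrightarrow> \<Union> (ivN ` NN m) \<subseteq> \<Union> (ivN ` NN n)"
  by (rule lift_Suc_antimono_le[of "\<lambda>n. \<Union> (ivN ` NN n)", OF NN_sub1])

text \<open>Pieces of a later level lie over the nodes that were left after level \<open>n\<close>,
  and those avoid the pieces of level \<open>n\<close>.\<close>

lemma PP_disj_less: "n < m \<Longrightarrow> P \<in> PP n \<Longrightarrow> P' \<in> PP m \<Longrightarrow> ivP P \<inter> ivP P' = {}"
proof -
  assume a: "n < m" "P \<in> PP n" "P' \<in> PP m"
  have "ivP P' \<subseteq> \<Union> (ivN ` NN (Suc n))"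
    by (rule order_trans[OF PP_sub[OF a(3)] NN_sub]) (use a in simp)
  then have "ivP P \<inter> ivP P' \<subseteq> ivP P \<inter> \<Union> (ivN ` NN (Suc n))" by (rule Int_mono[OF order.refl])
  then show ?thesis unfolding PP_NN[OF a(2)] by simp
qed

lemma PP_disj:
  assumes "P \<in> PP n" "P' \<in> PP m" "P \<noteq> P'"
  shows "ivP P \<inter> ivP P' = {}"
proof (cases rule: linorder_cases[of n m])
  case less
  then show ?thesis by (rule PP_disj_less[OF _ assms(1,2)])
next
  case equal
  then show ?thesis using PP_disj1 assms by simp
next
  case greater
  then show ?thesis using PP_disj_less[OF _ assms(2,1)] by (simp add: Int_commute)
qed

lemma PP_level_disj:
  assumes "n \<noteq> m"
  shows "PP n \<inter> PP m = {}"
proof (rule ccontr)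
  assume "PP n \<inter> PP m \<noteq> {}"
  then obtain P where P: "P \<in> PP n" "P \<in> PP m" by auto
  have "ivP P \<inter> ivP P = {}"
  proof (cases "n < m")
    case True
    then show ?thesis by (rule PP_disj_less[OF _ P])
  next
    case False
    with assms have "m < n" by simp
    then show ?thesis by (rule PP_disj_less[OF _ P(2,1)])
  qed
  then show False using ivP_nonempty[OF PP_ok[OF P(1)]] by simp
qed

text \<open>Each refinement conserves the total of the boundary terms, so that the sum over levels
  telescopes and only the nodes not yet resolved remain.\<close>

lemma bd_sum: "(\<Sum>m<n. \<Sum>P\<in>PP m. bdP \<Phi> P) = (\<Sum>\<nu>\<in>NN 0. bdN \<Phi> \<nu>) - (\<Sum>\<nu>\<in>NN n. bdN \<Phi> \<nu>)"
proof (induction n)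
  case (Suc n)
  have "(\<Sum>P\<in>PP n. bdP \<Phi> P) + (\<Sum>\<mu>\<in>NN (Suc n). bdN \<Phi> \<mu>) = (\<Sum>\<nu>\<in>NN n. bdN \<Phi> \<nu>)"
    using ref[of n] by (simp add: node_refinement_def)
  then show ?case using Suc by simp
qed simp

lemma NN_L: "(\<Sum>\<nu>\<in>NN (Suc n). nL \<nu>) \<le> ennreal (\<delta> / 2 ^ n)"
  and NN_R: "(\<Sum>\<nu>\<in>NN (Suc n). nR (Suc (M + n)) \<nu>) \<le> ennreal (\<delta> / 2 ^ n)"
  and PP_U: "(\<Sum>P\<in>PP n. cU (M + n) P) \<le> ennreal (\<delta> / 2 ^ n)"
  and PP_L: "(\<Sum>P\<in>PP n. cL P) \<le> 16 * (\<Sum>\<nu>\<in>NN n. nL \<nu>) + ennreal (\<delta> / 2 ^ n)"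
  and PP_R: "(\<Sum>P\<in>PP n. cR (M + n) P) \<le> (\<Sum>\<nu>\<in>NN n. nR (M + n) \<nu>) + ennreal (\<delta> / 2 ^ n)"
  using ref[of n] by (simp_all add: node_refinement_def)

lemma geometric: "(\<Sum>n. ennreal (\<delta> / 2 ^ n)) = ennreal (2 * \<delta>)"
  using \<delta> by (intro suminf_geometric_ennreal) simp

lemma suminf_add_geometric: "(\<Sum>n. f n + ennreal (\<delta> / 2 ^ n)) = suminf f + ennreal (2 * \<delta>)"
  unfolding geometric[symmetric] by (rule suminf_add[OF summableI summableI, symmetric])

text \<open>The refinement controls nodes from level 1 on; the initial nodes are split off and keep
  their own cost.\<close>

lemma suminf_shift_le:
  assumes "\<And>n. (\<Sum>\<nu>\<in>NN (Suc n). F (Suc n) \<nu>) \<le> ennreal (\<delta> / 2 ^ n)"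
  shows "(\<Sum>n. \<Sum>\<nu>\<in>NN n. F n \<nu>) \<le> (\<Sum>\<nu>\<in>NN 0. F 0 \<nu>) + ennreal (2 * \<delta>)"
proof -
  have "(\<Sum>n. \<Sum>\<nu>\<in>NN n. F n \<nu>) = (\<Sum>\<nu>\<in>NN 0. F 0 \<nu>) + (\<Sum>n. \<Sum>\<nu>\<in>NN (Suc n). F (Suc n) \<nu>)"
    using suminf_offset[OF summableI, of "\<lambda>n. \<Sum>\<nu>\<in>NN n. F n \<nu>" 1] by simp
  also have "(\<Sum>n. \<Sum>\<nu>\<in>NN (Suc n). F (Suc n) \<nu>) \<le> (\<Sum>n. ennreal (\<delta> / 2 ^ n))"
    by (intro suminf_le assms summableI)
  finally show ?thesis unfolding geometric by (simp add: add_left_mono)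
qed

text \<open>The flux of a level is bounded by the potentials of its nodes, and these are
  geometrically small after the first level. The constant is \<open>34 = 16 * 2 + 2\<close>.\<close>

lemma sum_L: "(\<Sum>n. \<Sum>P\<in>PP n. cL P) \<le> 16 * (\<Sum>\<nu>\<in>NN 0. nL \<nu>) + ennreal (34 * \<delta>)"
proof -
  have "(\<Sum>n. \<Sum>P\<in>PP n. cL P) \<le> (\<Sum>n. 16 * (\<Sum>\<nu>\<in>NN n. nL \<nu>) + ennreal (\<delta> / 2 ^ n))"
    by (intro suminf_le PP_L summableI)
  also have "\<dots> = 16 * (\<Sum>n. \<Sum>\<nu>\<in>NN n. nL \<nu>) + ennreal (2 * \<delta>)"
    unfolding suminf_add_geometric by simp
  also have "16 * (\<Sum>n. \<Sum>\<nu>\<in>NN n. nL \<nu>) \<le> 16 * ((\<Sum>\<nu>\<in>NN 0. nL \<nu>) + ennreal (2 * \<delta>))"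
    by (intro mult_left_mono suminf_shift_le NN_L) simp
  also have "16 * ((\<Sum>\<nu>\<in>NN 0. nL \<nu>) + ennreal (2 * \<delta>)) + ennreal (2 * \<delta>) = 16 * (\<Sum>\<nu>\<in>NN 0. nL \<nu>) + ennreal (34 * \<delta>)"
  proof -
    have "16 * ennreal (2 * \<delta>) + ennreal (2 * \<delta>) = ennreal (34 * \<delta>)"
      using \<delta> by (simp add: ennreal_mult[symmetric] ennreal_plus[symmetric] ennreal_numeral[symmetric] del: ennreal_plus ennreal_numeral)
    then show ?thesis by (simp add: distrib_left add.assoc)
  qed
  finally show ?thesis by simp
qed

lemma sum_R: "(\<Sum>n. \<Sum>P\<in>PP n. cR (M + n) P) \<le> (\<Sum>\<nu>\<in>NN 0. nR M \<nu>) + ennreal (4 * \<delta>)"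
proof -
  have "(\<Sum>n. \<Sum>P\<in>PP n. cR (M + n) P) \<le> (\<Sum>n. (\<Sum>\<nu>\<in>NN n. nR (M + n) \<nu>) + ennreal (\<delta> / 2 ^ n))"
    by (intro suminf_le PP_R summableI)
  also have "\<dots> = (\<Sum>n. \<Sum>\<nu>\<in>NN n. nR (M + n) \<nu>) + ennreal (2 * \<delta>)"
    by (rule suminf_add_geometric)
  also have "(\<Sum>n. \<Sum>\<nu>\<in>NN n. nR (M + n) \<nu>) \<le> (\<Sum>\<nu>\<in>NN 0. nR M \<nu>) + ennreal (2 * \<delta>)"
    using suminf_shift_le[of "\<lambda>n. nR (M + n)"] NN_R by simp
  also have "(\<Sum>\<nu>\<in>NN 0. nR M \<nu>) + ennreal (2 * \<delta>) + ennreal (2 * \<delta>) = (\<Sum>\<nu>\<in>NN 0. nR M \<nu>) + ennreal (4 * \<delta>)"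
    using \<delta> by (simp add: add.assoc ennreal_plus[symmetric] del: ennreal_plus)
  finally show ?thesis by simp
qed

lemma sum_U: "(\<Sum>n. \<Sum>P\<in>PP n. cU (M + n) P) \<le> ennreal (2 * \<delta>)"
  unfolding geometric[symmetric] by (intro suminf_le PP_U summableI)

end

text \<open>An upper bound for the contribution of the piece to the p-th power of the Bochner norm
  in C^k, with the supremum over the interval in place of the integral. In contrast to
  \<open>cR\<close>, the exponents are fixed.\<close>

definition rho_cost :: "nat \<Rightarrow> real \<Rightarrow> 'n::finite piece \<Rightarrow> ennreal" where
  "rho_cost k p P = ennreal (pb P - pa P) * enn_powr (SUP t\<in>{pa P..pb P}. Ck_norm k (prho P t)) p"

definition u_cost :: "real \<Rightarrow> 'n::finite piece \<Rightarrow> ennreal" where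
  "u_cost p P = ennreal (pb P - pa P) * shear_norm p P"

lemma enn_powr_finite: "x < top \<Longrightarrow> enn_powr x a < top"
  by (simp add: enn_powr_def less_top)

lemma prho_joint:
  assumes "pok P"
  shows "smooth (\<lambda>z. prho P (fst z) (snd z))" "periodic (prho P t)"
proof -
  let ?G = "\<lambda>z. pf P (shear (pk P) (pl P) (pg P) (fst z) (snd z))"
  have G: "smooth ?G" using assms by (intro smooth_shear_joint) (auto simp: pok_def)
  have "smooth (\<lambda>z::real\<times>(real^'a). ?G (fst z - pa P, snd z))"
  proof (rule smooth_compose[OF G])
    fix c :: "real \<times> (real^'a)"
    have "bounded_linear (\<lambda>z::real\<times>(real^'a). fst z * fst c + snd z \<bullet> snd c)"
      by (intro bounded_linear_intros bounded_linear_add bounded_linear_compose[OF bounded_linear_mult_left bounded_linear_fst]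
          bounded_linear_compose[OF bounded_linear_inner_left bounded_linear_snd])
    from smooth_diff'[OF smooth_linear[OF this] smooth_const[of "pa P * fst c"]]
    show "smooth (\<lambda>z::real\<times>(real^'a). (fst z - pa P, snd z) \<bullet> c)"
      by (simp add: inner_prod_def algebra_simps)
  qed
  then show "smooth (\<lambda>z. prho P (fst z) (snd z))" by (simp add: prho_def)
  have "periodic (\<lambda>x. pf P (shear (pk P) (pl P) (pg P) (t - pa P) x))"
    by (rule shear_periodic[of "pf P" "pg P"]) (use assms in \<open>auto simp: pok_def\<close>)
  then show "periodic (prho P t)" by (simp add: prho_def[abs_def])
qed

lemma prho_norm_finite:
  assumes "pok P"
  shows "(SUP t\<in>{c..d}. Ck_norm k (prho P t)) < top"
proof -
  obtain K where "K \<ge> 0" "\<forall>t\<in>{c..d}. Ck_norm k (prho P t) \<le> ennreal K"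
    using Ck_norm_joint_bounded[OF prho_joint(1)[OF assms], of c d k] prho_joint(2)[OF assms] by auto
  then have "(SUP t\<in>{c..d}. Ck_norm k (prho P t)) \<le> ennreal K" by (intro SUP_least) auto
  then show ?thesis using ennreal_less_top order_le_less_trans by blast
qed

lemma rho_cost_finite: "pok P \<Longrightarrow> rho_cost k p P < top"
  unfolding rho_cost_def ennreal_mult_less_top
  by (intro disjI2 conjI enn_powr_finite prho_norm_finite ennreal_less_top)

lemma u_cost_finite: "u_cost p P < top"
  unfolding u_cost_def shear_norm_def by (auto simp: ennreal_mult_less_top intro: enn_powr_finite)

text \<open>This is the purpose of the summand 1 in \<open>cR\<close>: with base at least one, the
  single power \<open>q\<close> dominates all smaller exponents.\<close>

lemma enn_powr_le_power:
  assumes "p > 0" "p \<le> real q" shows "enn_powr x p \<le> (1 + x) ^ q"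
proof (cases x)
  case (real r)
  have "r powr p \<le> (1 + r) powr p" using real assms by (intro powr_mono2) auto
  also have "\<dots> \<le> (1 + r) powr (real q)" using real assms by (intro powr_mono) auto
  also have "\<dots> = (1 + r) ^ q" using real by (simp add: powr_realpow)
  finally have "ennreal (r powr p) \<le> ennreal ((1 + r) ^ q)" by (rule ennreal_leI)
  then show ?thesis using real by (simp add: enn_powr_ennreal ennreal_power[symmetric])
next
  case top
  then show ?thesis using assms by (cases q) (auto simp: enn_powr_def)
qed

lemma rho_cost_le_cR:
  assumes "p \<ge> 1" "p \<le> real q" "k \<le> q"
  shows "rho_cost k p P \<le> cR q P"
  unfolding rho_cost_def cR_def
proof (rule mult_left_mono)
  have "enn_powr (SUP t\<in>{pa P..pb P}. Ck_norm k (prho P t)) p \<le> enn_powr (SUP t\<in>{pa P..pb P}. Ck_norm q (prho P t)) p"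
    using assms by (intro enn_powr_mono SUP_mono') (auto intro: Ck_norm_mono)
  also have "\<dots> \<le> (1 + (SUP t\<in>{pa P..pb P}. Ck_norm q (prho P t))) ^ q"
    using assms by (intro enn_powr_le_power) auto
  finally show "enn_powr (SUP t\<in>{pa P..pb P}. Ck_norm k (prho P t)) p \<le> (1 + (SUP t\<in>{pa P..pb P}. Ck_norm q (prho P t))) ^ q" .
qed simp

lemma u_cost_le_cU: "1 \<le> p \<Longrightarrow> p \<le> real q \<Longrightarrow> u_cost p P \<le> cU q P"
  unfolding u_cost_def cU_def by (intro mult_left_mono SUP_upper) auto

context iterated
begin

lemma sum_rho_cost:
  assumes "p \<ge> 1" and N0: "(\<Sum>\<nu>\<in>NN 0. nR M \<nu>) < top"
  shows "(\<Sum>n. \<Sum>P\<in>PP n. rho_cost k p P) < top"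
proof (rule suminf_ennreal_eventually_le)
  show "(\<Sum>P\<in>PP n. rho_cost k p P) < top" for n
  proof -
    have "rho_cost k p P \<noteq> top" if "P \<in> PP n" for P using rho_cost_finite[OF PP_ok[OF that], of k p] by simp
    then show ?thesis using PP_fin by (simp add: less_top[symmetric])
  qed
  \<comment> \<open>From this level on the order \<open>M + n\<close> is at least both
    \<open>p\<close> and \<open>k\<close>.\<close>
  show "(\<Sum>P\<in>PP n. rho_cost k p P) \<le> (\<Sum>P\<in>PP n. cR (M + n) P)" if "n \<ge> nat \<lceil>p\<rceil> + k" for n
    using that assms by (intro sum_mono rho_cost_le_cR) linarith+
  show "(\<Sum>n. \<Sum>P\<in>PP n. cR (M + n) P) < top"
    by (rule order_le_less_trans[OF sum_R]) (use N0 in simp)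
qed

lemma sum_u_cost:
  assumes "p \<ge> 1"
  shows "(\<Sum>n. \<Sum>P\<in>PP n. u_cost p P) < top"
proof (rule suminf_ennreal_eventually_le)
  show "(\<Sum>P\<in>PP n. u_cost p P) < top" for n
  proof -
    have "u_cost p P \<noteq> top" for P :: "'n piece" using u_cost_finite[of p P] by simp
    then show ?thesis using PP_fin by (simp add: less_top[symmetric])
  qed
  show "(\<Sum>P\<in>PP n. u_cost p P) \<le> (\<Sum>P\<in>PP n. cU (M + n) P)" if "n \<ge> nat \<lceil>p\<rceil>" for n
    using that assms by (intro sum_mono u_cost_le_cU) linarith+
  show "(\<Sum>n. \<Sum>P\<in>PP n. cU (M + n) P) < top"
    using sum_U by (rule order_le_less_trans) simp
qed

end

section \<open>Assembling the pieces\<close>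

text \<open>Intervals are open and, in the use made of them, pairwise disjoint, so that at most one
  piece is selected. Times in no interval, the end points of the pieces included, receive the zero
  function.\<close>

definition patch :: "(nat \<Rightarrow> 'n::finite piece set) \<Rightarrow> ('n piece \<Rightarrow> real \<Rightarrow> real^'n \<Rightarrow> 'b::zero) \<Rightarrow> real \<Rightarrow> real^'n \<Rightarrow> 'b" where
  "patch S h t = (if \<exists>P. P \<in> \<Union> (range S) \<and> t \<in> ivP P then h (THE P. P \<in> \<Union> (range S) \<and> t \<in> ivP P) t else (\<lambda>x. 0))"

text \<open>Countably many disjoint pieces, grouped into finite levels. The interface is kept apart
  from \<open>iterated\<close> because the pieces of the first approximation have to be added to
  those of the iteration.\<close>

locale assembly =
  fixes S :: "nat \<Rightarrow> 'n::finite piece set" and T :: real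
  assumes S_fin: "finite (S n)" and S_ok: "P \<in> S n \<Longrightarrow> pok P"
    and S_in: "P \<in> S n \<Longrightarrow> 0 < pa P \<and> pb P < T"
    and S_disj: "P \<in> S n \<Longrightarrow> P' \<in> S m \<Longrightarrow> P \<noteq> P' \<Longrightarrow> ivP P \<inter> ivP P' = {}"
    and S_level: "n \<noteq> m \<Longrightarrow> S n \<inter> S m = {}" and T_pos: "T > 0"
begin

lemma patch_in:
  assumes "P \<in> S n" "t \<in> ivP P"
  shows "patch S h t = h P t"
proof -
  have "(THE P. P \<in> \<Union> (range S) \<and> t \<in> ivP P) = P"
  proof (rule the_equality)
    show "P \<in> \<Union> (range S) \<and> t \<in> ivP P" using assms by auto
    fix P' assume "P' \<in> \<Union> (range S) \<and> t \<in> ivP P'"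
    then obtain m where "P' \<in> S m" "t \<in> ivP P'" by auto
    then show "P' = P" using S_disj[OF assms(1), of P' m] assms(2) by blast
  qed
  moreover have "\<exists>P. P \<in> \<Union> (range S) \<and> t \<in> ivP P" using assms by auto
  ultimately show ?thesis by (simp add: patch_def)
qed

lemma patch_out: "(\<And>n P. P \<in> S n \<Longrightarrow> t \<notin> ivP P) \<Longrightarrow> patch S h t = (\<lambda>x. 0)"
  by (auto simp: patch_def)

lemma patch_cases:
  obtains n P where "P \<in> S n" "t \<in> ivP P" | "\<And>n P. P \<in> S n \<Longrightarrow> t \<notin> ivP P"
  by blast

lemma ivP_sub: "P \<in> S n \<Longrightarrow> ivP P \<subseteq> {0<..<T}"
  using S_in[of P n] by (auto simp: ivP_def)

lemma ivP_lebesgue_on: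
  assumes "P \<in> S n" "{0<..<T} \<subseteq> J" "J \<in> sets lebesgue"
  shows "ivP P \<in> sets (lebesgue_on J)" "emeasure (lebesgue_on J) (ivP P) = ennreal (pb P - pa P)"
proof -
  have sub: "ivP P \<subseteq> J" using ivP_sub[OF assms(1)] assms(2) by (rule order_trans)
  have "J \<inter> space lebesgue \<in> sets lebesgue" using assms(3) by simp
  from sets_restrict_space_iff[OF this] show "ivP P \<in> sets (lebesgue_on J)"
    using sub by (simp add: ivP_def)
  have "pa P \<le> pb P" using S_ok[OF assms(1)] by (simp add: pok_def)
  moreover have "emeasure (lebesgue_on J) (ivP P) = emeasure lebesgue (ivP P)"
    using sub assms(3) by (intro emeasure_restrict_space) auto
  ultimately show "emeasure (lebesgue_on J) (ivP P) = ennreal (pb P - pa P)" by (simp add: ivP_def)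
qed

text \<open>\<open>F\<close> is dominated at every time by a countable sum of step functions, which
  is integrated term by term. The measure is a parameter because the lemma serves for
  \<open>lborel\<close> and for restrictions of \<open>lebesgue\<close> alike.\<close>

lemma nn_integral_pieces:
  assumes F: "\<And>n P t. P \<in> S n \<Longrightarrow> t \<in> ivP P \<Longrightarrow> F t \<le> c P"
    and F0: "\<And>t. (\<And>n P. P \<in> S n \<Longrightarrow> t \<notin> ivP P) \<Longrightarrow> F t = 0"
    and M: "\<And>n P. P \<in> S n \<Longrightarrow> ivP P \<in> sets M" "\<And>n P. P \<in> S n \<Longrightarrow> emeasure M (ivP P) = ennreal (pb P - pa P)"
  shows "(\<integral>\<^sup>+t. F t \<partial>M) \<le> (\<Sum>n. \<Sum>P\<in>S n. ennreal (pb P - pa P) * c P)"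
proof -
  have le: "F t \<le> (\<Sum>n. \<Sum>P\<in>S n. c P * indicator (ivP P) t)" for t
  proof (cases rule: patch_cases[of t])
    case (1 n P)
    have "F t \<le> c P * indicator (ivP P) t" using F[OF 1] 1(2) by simp
    also have "\<dots> \<le> (\<Sum>P\<in>S n. c P * indicator (ivP P) t)"
      by (rule member_le_sum[OF 1(1)]) (simp_all add: S_fin)
    also have "\<dots> \<le> (\<Sum>n. \<Sum>P\<in>S n. c P * indicator (ivP P) t)"
      using sum_le_suminf[OF summableI, of "{n}" "\<lambda>n. \<Sum>P\<in>S n. c P * indicator (ivP P) t"] by simp
    finally show ?thesis .
  next
    case 2
    then show ?thesis using F0 by simp
  qed
  have "(\<integral>\<^sup>+t. F t \<partial>M) \<le> (\<integral>\<^sup>+t. (\<Sum>n. \<Sum>P\<in>S n. c P * indicator (ivP P) t) \<partial>M)"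
    by (intro nn_integral_mono le)
  also have "\<dots> = (\<Sum>n. \<integral>\<^sup>+t. (\<Sum>P\<in>S n. c P * indicator (ivP P) t) \<partial>M)"
    by (intro nn_integral_suminf borel_measurable_sum borel_measurable_times_ennreal borel_measurable_const borel_measurable_indicator M)
  also have "\<dots> = (\<Sum>n. \<Sum>P\<in>S n. ennreal (pb P - pa P) * c P)"
  proof (intro suminf_cong)
    fix n
    have "(\<integral>\<^sup>+t. (\<Sum>P\<in>S n. c P * indicator (ivP P) t) \<partial>M) = (\<Sum>P\<in>S n. \<integral>\<^sup>+t. c P * indicator (ivP P) t \<partial>M)"
      by (intro nn_integral_sum borel_measurable_times_ennreal borel_measurable_const borel_measurable_indicator M)
    also have "\<dots> = (\<Sum>P\<in>S n. ennreal (pb P - pa P) * c P)"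
      by (intro sum.cong refl) (simp add: nn_integral_cmult_indicator M mult.commute)
    finally show "(\<integral>\<^sup>+t. (\<Sum>P\<in>S n. c P * indicator (ivP P) t) \<partial>M) = (\<Sum>P\<in>S n. ennreal (pb P - pa P) * c P)" .
  qed
  finally show ?thesis .
qed

section \<open>Finite stages of the patched functions and simple approximations in time\<close>

definition stage :: "nat \<Rightarrow> 'n piece set" where "stage n = (\<Union>m<n. S m)"

lemma stage_fin: "finite (stage n)" by (simp add: stage_def S_fin)

lemma stage_S: "P \<in> stage n \<Longrightarrow> \<exists>m. P \<in> S m" by (auto simp: stage_def)

lemma stage_disj: "P \<in> stage n \<Longrightarrow> P' \<in> stage n \<Longrightarrow> P \<noteq> P' \<Longrightarrow> ivP P \<inter> ivP P' = {}"
  by (metis stage_S S_disj)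

lemma sum_stage: "(\<Sum>P\<in>stage n. F P) = (\<Sum>m<n. \<Sum>P\<in>S m. F P)"
  for F :: "'n piece \<Rightarrow> 'b::comm_monoid_add"
  unfolding stage_def by (rule sum.UNION_disjoint) (auto simp: S_fin S_level)

definition dyadic :: "nat \<Rightarrow> real \<Rightarrow> real" where "dyadic n t = of_int \<lfloor>2 ^ n * t\<rfloor> / 2 ^ n"

lemma dyadic_tendsto: "(\<lambda>n. dyadic n t) \<longlonglongrightarrow> t"
proof (rule real_tendsto_sandwich)
  have lo: "t - (1/2) ^ n \<le> dyadic n t" and up: "dyadic n t \<le> t" for n
  proof -
    have "2 ^ n * t - 1 \<le> of_int \<lfloor>2 ^ n * t\<rfloor>" "of_int \<lfloor>2 ^ n * t\<rfloor> \<le> 2 ^ n * t" by linarith+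
    then have "(2 ^ n * t - 1) / 2 ^ n \<le> dyadic n t" "dyadic n t \<le> (2 ^ n * t) / 2 ^ n"
      unfolding dyadic_def by (intro divide_right_mono; simp)+
    then show "t - (1/2) ^ n \<le> dyadic n t" "dyadic n t \<le> t" by (simp_all add: diff_divide_distrib power_divide)
  qed
  show "\<forall>\<^sub>F n in sequentially. t - (1/2) ^ n \<le> dyadic n t" "\<forall>\<^sub>F n in sequentially. dyadic n t \<le> t"
    using lo up by auto
  have "(\<lambda>n. t - (1/2) ^ n) \<longlonglongrightarrow> t - 0" by (intro tendsto_intros LIMSEQ_realpow_zero) auto
  then show "(\<lambda>n. t - (1/2) ^ n) \<longlonglongrightarrow> t" by simp
qed auto

text \<open>The active piece among the first \<open>n\<close> levels as a function of time. With
  finitely many values and measurable level sets it is a simple function, although its values are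
  not numbers; combined with the rounded time it yields simple functions with values in a function
  space.\<close>

definition current :: "nat \<Rightarrow> real \<Rightarrow> 'n piece option" where
  "current n t = (if \<exists>P\<in>stage n. t \<in> ivP P then Some (THE P. P \<in> stage n \<and> t \<in> ivP P) else None)"

lemma current_eq: "P \<in> stage n \<Longrightarrow> t \<in> ivP P \<Longrightarrow> current n t = Some P"
proof -
  assume a: "P \<in> stage n" "t \<in> ivP P"
  have "(THE P. P \<in> stage n \<and> t \<in> ivP P) = P"
    using a stage_disj[OF a(1)] by (intro the_equality) auto
  then show ?thesis using a by (auto simp: current_def)
qed

lemma current_Some: "current n t = Some P \<longleftrightarrow> P \<in> stage n \<and> t \<in> ivP P"
proof
  assume a: "current n t = Some P"
  then obtain Q where Q: "Q \<in> stage n" "t \<in> ivP Q" by (auto simp: current_def split: if_splits)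
  with current_eq[OF Q] a show "P \<in> stage n \<and> t \<in> ivP P" by simp
qed (use current_eq in blast)

lemma simple_current: "simple_function (lebesgue_on {0<..<T}) (current n)"
  unfolding simple_function_def
proof (intro conjI ballI)
  have "current n t \<in> insert None (Some ` stage n)" for t
    by (cases "current n t") (auto simp: current_Some)
  then have "current n ` space (lebesgue_on {0<..<T}) \<subseteq> insert None (Some ` stage n)" by (rule image_subsetI)
  then show "finite (current n ` space (lebesgue_on {0<..<T}))"
    by (rule finite_subset) (simp add: stage_fin)
  have S: "current n -` {Some P} \<inter> {0<..<T} \<in> sets (lebesgue_on {0<..<T})" for P
  proof (cases "P \<in> stage n")
    case True
    then have "current n -` {Some P} = ivP P" by (auto simp: current_Some)
    then show ?thesis by (auto simp: sets_restrict_space_iff ivP_def)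
  next
    case False
    then have "current n -` {Some P} = {}" by (auto simp: current_Some)
    then show ?thesis by simp
  qed
  have N: "current n -` {None} \<inter> {0<..<T} \<in> sets (lebesgue_on {0<..<T})"
  proof -
    have "current n -` {None} = - (\<Union>P\<in>stage n. ivP P)" by (auto simp: current_def split: if_splits)
    moreover have "(\<Union>P\<in>stage n. ivP P) \<in> sets borel" using stage_fin by (intro sets.finite_UN) (auto simp: ivP_def)
    ultimately have "current n -` {None} \<in> sets lborel" by (simp only: sets_lborel borel_comp)
    then have "current n -` {None} \<in> sets lebesgue" by (rule sets_completionI_sets)
    then show ?thesis by (auto simp: sets_restrict_space_iff)
  qed
  fix x show "current n -` {x} \<inter> space (lebesgue_on {0<..<T}) \<in> sets (lebesgue_on {0<..<T})"
    using S N by (cases x) auto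
qed

lemma simple_floor: "simple_function (lebesgue_on {0<..<T}) (\<lambda>t. \<lfloor>2 ^ n * t\<rfloor>)"
  unfolding simple_function_def
proof (intro conjI ballI)
  have "\<lfloor>2 ^ n * t\<rfloor> \<in> {0..\<lfloor>2 ^ n * T\<rfloor>}" if "t \<in> {0<..<T}" for t
    using that by (auto intro!: floor_mono mult_left_mono)
  then have "(\<lambda>t. \<lfloor>2 ^ n * t\<rfloor>) ` space (lebesgue_on {0<..<T}) \<subseteq> {0..\<lfloor>2 ^ n * T\<rfloor>}"
    by (intro image_subsetI) simp
  then show "finite ((\<lambda>t. \<lfloor>2 ^ n * t\<rfloor>) ` space (lebesgue_on {0<..<T}))"
    by (rule finite_subset) simp
  fix i
  have "(\<lambda>t::real. \<lfloor>2 ^ n * t\<rfloor>) -` {i} = {of_int i / 2 ^ n..<(of_int i + 1) / 2 ^ n}"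
    unfolding vimage_def singleton_iff floor_eq_iff by (auto simp: field_simps)
  then show "(\<lambda>t. \<lfloor>2 ^ n * t\<rfloor>) -` {i} \<inter> space (lebesgue_on {0<..<T}) \<in> sets (lebesgue_on {0<..<T})"
    by (auto simp: sets_restrict_space_iff)
qed

text \<open>The approximating simple function evaluates the active piece at the time rounded down to
  a dyadic number. At a fixed time the piece has entered the stages from some level on, and
  continuity of \<open>h P\<close> gives convergence. The rounded time may leave the interval of the
  piece, hence the assumptions on \<open>h P\<close> concern all times.\<close>

lemma strongly_measurable_patch:
  fixes h :: "'n piece \<Rightarrow> real \<Rightarrow> real^'n \<Rightarrow> 'b::real_normed_vector"
  assumes X: "(\<lambda>x. 0) \<in> X" "\<And>n P t. P \<in> S n \<Longrightarrow> h P t \<in> X" and nrm0: "nrm (\<lambda>x. 0) = 0"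
    and cont: "\<And>n P t s. P \<in> S n \<Longrightarrow> s \<longlonglongrightarrow> t \<Longrightarrow> (\<lambda>j. nrm (\<lambda>x. h P (s j) x - h P t x)) \<longlonglongrightarrow> 0"
  shows "strongly_measurable {0<..<T} X nrm (patch S h)"
proof -
  define s where "s n t = (case current n t of None \<Rightarrow> (\<lambda>x. 0) | Some P \<Rightarrow> h P (of_int \<lfloor>2 ^ n * t\<rfloor> / 2 ^ n))" for n t
  have simple: "simple_function (lebesgue_on {0<..<T}) (s n)" for n
    unfolding s_def
    by (rule simple_function_compose2[OF simple_current simple_floor,
        of "\<lambda>K i. case K of None \<Rightarrow> (\<lambda>x. 0) | Some P \<Rightarrow> h P (of_int i / 2 ^ n)" n n])
  have sX: "s n t \<in> X" for n t
    using X by (auto simp: s_def current_Some stage_def split: option.split)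
  have lim: "patch S h t \<in> X \<and> (\<lambda>n. nrm (\<lambda>x. s n t x - patch S h t x)) \<longlonglongrightarrow> 0" for t
  proof (cases rule: patch_cases[of t])
    case (1 m P)
    have p: "patch S h t = h P t" by (rule patch_in[OF 1])
    have "s n t = h P (dyadic n t)" if "n > m" for n
    proof -
      have "P \<in> stage n" using 1(1) that by (auto simp: stage_def)
      then have "current n t = Some P" using 1(2) by (rule current_eq)
      then show ?thesis by (simp add: s_def dyadic_def)
    qed
    then have "\<forall>\<^sub>F n in sequentially. nrm (\<lambda>x. h P (dyadic n t) x - h P t x) = nrm (\<lambda>x. s n t x - patch S h t x)"
      unfolding p by (intro eventually_sequentiallyI[of "Suc m"]) simp
    with cont[OF 1(1) dyadic_tendsto[of t]] show ?thesis
      using X(2)[OF 1(1)] p by (auto intro: Lim_transform_eventually)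
  next
    case 2
    have p: "patch S h t = (\<lambda>x. 0)" by (rule patch_out) (rule 2)
    have "current n t = None" for n using 2 by (auto simp: current_def stage_def)
    then show ?thesis using p X(1) by (simp add: s_def nrm0)
  qed
  show ?thesis
    unfolding strongly_measurable_def
    by (rule exI[of _ s]) (use simple sX lim in auto)
qed

text \<open>The patched function is a pointwise limit of finite sums over the stages, which are
  Borel because the pieces are jointly continuous. Tonelli's theorem on \<open>lborel\<close> then
  reduces its norm to the slices, which \<open>nn_integral_pieces\<close> sums up.\<close>

lemma L1_spacetime_patch:
  fixes h :: "'n piece \<Rightarrow> real \<Rightarrow> real^'n \<Rightarrow> 'b::euclidean_space"
  assumes cont: "\<And>n P. P \<in> S n \<Longrightarrow> continuous_on UNIV (\<lambda>(t, x). h P t x)"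
    and bound: "\<And>n P t. P \<in> S n \<Longrightarrow> t \<in> ivP P \<Longrightarrow> ennreal (integral unit_cube (\<lambda>x. norm (h P t x))) \<le> c P"
    and fin: "(\<Sum>n. \<Sum>P\<in>S n. ennreal (pb P - pa P) * c P) < top"
  shows "L1_spacetime T (patch S h)"
proof -
  let ?f = "\<lambda>z. patch S h (fst z) (snd z)"
  define f where "f n z = (\<Sum>P\<in>stage n. indicator (ivP P) (fst z) *\<^sub>R h P (fst z) (snd z))" for n z
  have hc: "(\<lambda>z. h P (fst z) (snd z)) \<in> borel_measurable borel" if "P \<in> S n" for n P
    using cont[OF that] by (intro borel_measurable_continuous_onI) (simp add: case_prod_beta')
  have fm: "f n \<in> borel_measurable borel" for n
    unfolding f_def
  proof (intro borel_measurable_sum borel_measurable_scaleR)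
    fix P assume "P \<in> stage n"
    then obtain m where "P \<in> S m" using stage_S by blast
    then show "(\<lambda>z. h P (fst z) (snd z)) \<in> borel_measurable borel" by (rule hc)
    have "indicator (ivP P) \<in> borel_measurable (borel :: real measure)" by (simp add: ivP_def)
    then show "(\<lambda>z::real \<times> (real^'n). indicator (ivP P) (fst z) :: real) \<in> borel_measurable borel"
      by (rule measurable_compose[rotated]) (simp add: borel_prod[symmetric])
  qed
  have flim: "(\<lambda>n. f n z) \<longlonglongrightarrow> ?f z" for z
  proof (cases rule: patch_cases[of "fst z"])
    case (1 m P)
    have "f n z = ?f z" if "n > m" for n
    proof -
      have P: "P \<in> stage n" using 1(1) that by (auto simp: stage_def)
      have "f n z = (\<Sum>P'\<in>stage n. if P' = P then h P (fst z) (snd z) else 0)"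
        unfolding f_def using stage_disj[OF P] 1(2) by (intro sum.cong refl) (auto simp: indicator_def)
      then show ?thesis using P stage_fin patch_in[OF 1, of h] by simp
    qed
    then have "\<forall>\<^sub>F n in sequentially. ?f z = f n z" by (intro eventually_sequentiallyI[of "Suc m"]) simp
    then show ?thesis by (rule Lim_transform_eventually[OF tendsto_const])
  next
    case 2
    have "patch S h (fst z) = (\<lambda>x. 0)" by (rule patch_out) (rule 2)
    moreover have "f n z = 0" for n unfolding f_def using 2 by (intro sum.neutral) (auto simp: indicator_def stage_def)
    ultimately show ?thesis by simp
  qed
  have fmeas: "?f \<in> borel_measurable borel"
    by (rule borel_measurable_LIMSEQ_metric[OF fm flim])
  let ?g = "\<lambda>z. indicator ({0..T} \<times> unit_cube) z *\<^sub>R ?f z"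
  have gmeas: "?g \<in> borel_measurable borel"
    by (intro borel_measurable_scaleR borel_measurable_indicator fmeas) (auto intro!: borel_closed closed_Times)
  have bnd: "(\<integral>\<^sup>+x. ennreal (norm (?g (t, x))) \<partial>lborel) \<le> c P" if P: "P \<in> S n" "t \<in> ivP P" for n P t
  proof -
    have cP: "continuous_on unit_cube (\<lambda>x. norm (h P t x))"
    proof -
      have "continuous_on unit_cube (\<lambda>x. (\<lambda>(t, x). h P t x) (t, x))"
        by (rule continuous_on_compose2[OF cont[OF P(1)]]) (auto intro!: continuous_intros)
      then show ?thesis by (simp add: continuous_on_norm)
    qed
    have "(\<integral>\<^sup>+x. ennreal (norm (?g (t, x))) \<partial>lborel) \<le> (\<integral>\<^sup>+x. ennreal (norm (h P t x)) * indicator unit_cube x \<partial>lborel)"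
      by (intro nn_integral_mono) (auto simp: indicator_def patch_in[OF P, of h])
    also have "\<dots> = (\<integral>\<^sup>+x. ennreal (norm (h P t x)) * indicator unit_cube x \<partial>lebesgue)"
      by (rule nn_integral_completion[symmetric])
    also have "\<dots> = (\<integral>\<^sup>+x. ennreal (norm (h P t x)) \<partial>torus)"
      by (simp add: nn_integral_restrict_space)
    also have "\<dots> = ennreal (LINT x|torus. norm (h P t x))"
      by (rule nn_integral_eq_integral[OF integrable_torus[OF cP]]) simp
    also have "\<dots> \<le> c P" unfolding LINT_torus[OF cP] by (rule bound[OF P])
    finally show ?thesis .
  qed
  have "?g \<in> borel_measurable (lborel \<Otimes>\<^sub>M lborel)" unfolding lborel_prod using gmeas by simp
  from measurable_compose[OF measurable_compose[OF this borel_measurable_norm] measurable_ennreal]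
  have gm: "(\<lambda>z. ennreal (norm (?g z))) \<in> borel_measurable (lborel \<Otimes>\<^sub>M lborel)" .
  have "(\<integral>\<^sup>+z. ennreal (norm (?g z)) \<partial>lborel) = (\<integral>\<^sup>+t. \<integral>\<^sup>+x. ennreal (norm (?g (t, x))) \<partial>lborel \<partial>lborel)"
    unfolding lborel_prod[symmetric]
    by (rule lborel.nn_integral_fst[symmetric, OF gm])
  also have "\<dots> \<le> (\<Sum>n. \<Sum>P\<in>S n. ennreal (pb P - pa P) * c P)"
  proof (rule nn_integral_pieces[OF bnd])
    fix t :: real assume "\<And>n P. P \<in> S n \<Longrightarrow> t \<notin> ivP P"
    then have "patch S h t = (\<lambda>x. 0)" by (rule patch_out)
    then show "(\<integral>\<^sup>+x. ennreal (norm (?g (t, x))) \<partial>lborel) = 0" by simp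
  next
    fix n P assume "P \<in> S n"
    then have "pa P \<le> pb P" using S_ok[of P n] by (simp add: pok_def)
    then show "emeasure lborel (ivP P) = ennreal (pb P - pa P)" by (simp add: ivP_def)
  qed (auto simp: ivP_def)
  also note fin
  finally have "integrable lborel ?g"
    using gmeas by (intro integrableI_bounded) simp_all
  \<comment> \<open>The product structure is available for the Borel-Lebesgue measure; the
    definition of integrability in space-time refers to its completion.\<close>
  then have "integrable lebesgue ?g"
    using gmeas by (subst integrable_completion) simp_all
  then show ?thesis
    by (simp add: L1_spacetime_def set_integrable_def case_prod_beta')
qed

lemma bochner_space_patch:
  fixes h :: "'n piece \<Rightarrow> real \<Rightarrow> real^'n \<Rightarrow> 'b::real_normed_vector"
  assumes "strongly_measurable {0<..<T} X nrm (patch S h)" "nrm (\<lambda>x. 0) = 0" "p \<ge> 1"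
    and c: "\<And>n P t. P \<in> S n \<Longrightarrow> t \<in> ivP P \<Longrightarrow> enn_powr (nrm (h P t)) p \<le> c P"
    and fin: "(\<Sum>n. \<Sum>P\<in>S n. ennreal (pb P - pa P) * c P) < top"
  shows "patch S h \<in> bochner_space p {0<..<T} X nrm"
proof -
  have "(\<integral>\<^sup>+t. enn_powr (nrm (patch S h t)) p \<partial>(lebesgue_on {0<..<T})) \<le> (\<Sum>n. \<Sum>P\<in>S n. ennreal (pb P - pa P) * c P)"
  proof (rule nn_integral_pieces)
    fix n P t assume P: "P \<in> S n" "t \<in> ivP P"
    show "enn_powr (nrm (patch S h t)) p \<le> c P" unfolding patch_in[OF P] by (rule c[OF P])
  next
    fix t :: real assume "\<And>n P. P \<in> S n \<Longrightarrow> t \<notin> ivP P"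
    then have "patch S h t = (\<lambda>x. 0)" by (rule patch_out)
    then show "enn_powr (nrm (patch S h t)) p = 0" using assms(2,3) by (simp add: enn_powr_def)
  qed (auto intro!: ivP_lebesgue_on)
  then have "bochner_norm p {0<..<T} nrm (patch S h) < \<infinity>"
    unfolding bochner_norm_def using fin enn_powr_finite by (auto dest: order_le_less_trans)
  then show ?thesis using assms(1) by (simp add: bochner_space_def)
qed

lemma rho_bochner:
  assumes p: "p \<ge> 1" and fin: "(\<Sum>n. \<Sum>P\<in>S n. rho_cost k p P) < top"
  shows "patch S prho \<in> bochner_space p {0<..<T} (Ck_torus k) (Ck_norm k)"
proof (rule bochner_space_patch[OF _ _ p])
  show "strongly_measurable {0<..<T} (Ck_torus k) (Ck_norm k) (patch S prho)"
  proof (rule strongly_measurable_patch)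
    show "(\<lambda>x. 0) \<in> Ck_torus k" by (auto simp: Ck_torus_def periodic_const intro: Ck_const)
    fix n P t assume P: "P \<in> S n"
    note ok = S_ok[OF P]
    have "smooth (prho P t)" using smooth_slice[OF prho_joint(1)[OF ok], of t] by simp
    then show "prho P t \<in> Ck_torus k" using prho_joint(2)[OF ok] by (simp add: Ck_torus_def Cinf_on_def)
    fix s :: "nat \<Rightarrow> real" assume s: "s \<longlonglongrightarrow> t"
    show "(\<lambda>j. Ck_norm k (\<lambda>x. prho P (s j) x - prho P t x)) \<longlonglongrightarrow> 0"
    proof (rule order_tendstoI)
      fix a :: ennreal assume a: "0 < a"
      obtain e where e: "e > 0" "ennreal e < a"
      proof -
        obtain b where "0 < b" "b < a" using dense[OF a] by auto
        then show ?thesis using that[of "enn2real b"] by (cases b) (auto simp: ennreal_zero_less_top top_unique)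
      qed
      obtain d where d: "d > 0" "\<forall>r\<in>{t-1..t+1}. \<forall>t'\<in>{t-1..t+1}. \<bar>r - t'\<bar> < d \<longrightarrow> Ck_norm k (\<lambda>x. prho P r x - prho P t' x) \<le> ennreal e"
        using Ck_norm_joint_continuous[OF prho_joint(1)[OF ok] _ e(1), of "t-1" "t+1" k] prho_joint(2)[OF ok] by auto
      have "\<forall>\<^sub>F j in sequentially. dist (s j) t < min d 1" using s d(1) by (intro tendstoD) auto
      then show "\<forall>\<^sub>F j in sequentially. Ck_norm k (\<lambda>x. prho P (s j) x - prho P t x) < a"
      proof eventually_elim
        case (elim j)
        then have "s j \<in> {t-1..t+1}" "t \<in> {t-1..t+1}" "\<bar>s j - t\<bar> < d" by (auto simp: dist_real_def)
        then have "Ck_norm k (\<lambda>x. prho P (s j) x - prho P t x) \<le> ennreal e" using d(2) by blast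
        then show ?case using e(2) by (rule order_le_less_trans)
      qed
    qed simp
  qed simp
  show "enn_powr (Ck_norm k (prho P t)) p \<le> enn_powr (SUP t\<in>{pa P..pb P}. Ck_norm k (prho P t)) p"
    if "t \<in> ivP P" for P t
    using that p by (intro enn_powr_mono SUP_upper) (auto simp: ivP_def)
  show "(\<Sum>n. \<Sum>P\<in>S n. ennreal (pb P - pa P) * enn_powr (SUP t\<in>{pa P..pb P}. Ck_norm k (prho P t)) p) < top"
    using fin by (simp add: rho_cost_def)
qed simp

end

section \<open>Weak derivatives\<close>

lemma smooth_prod: "finite I \<Longrightarrow> (\<And>i. i \<in> I \<Longrightarrow> smooth (h i)) \<Longrightarrow> smooth (\<lambda>x. \<Prod>i\<in>I. h i x)"
  by (induction I rule: finite_induct) auto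

text \<open>The functions \<open>exp (- exp (- n z))\<close> converge to the indicator of \<open>z > 0\<close>; they are applied to a
  cosine that is positive exactly on the interval.\<close>

lemma smooth_indicator_approx:
  fixes \<alpha> \<beta> :: real
  shows "\<exists>f :: nat \<Rightarrow> real \<Rightarrow> real. \<forall>n. smooth (f n) \<and> (\<forall>y. f n (y + 1) = f n y \<and> 0 \<le> f n y \<and> f n y \<le> 1) \<and>
    (\<forall>y\<in>{0..1}. y \<notin> {\<alpha>, \<beta>, 0, 1} \<longrightarrow> (\<lambda>n. f n y) \<longlonglongrightarrow> indicator {\<alpha><..<\<beta>} y)"
proof (cases "max \<alpha> 0 < min \<beta> 1")
  case False
  then have "indicator {\<alpha><..<\<beta>} y = (0::real)" if "y \<in> {0..1}" "y \<notin> {0, 1}" for y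
    using that by (auto simp: indicator_def)
  then show ?thesis by (intro exI[of _ "\<lambda>n y. 0"]) auto
next
  case True
  \<comment> \<open>The interval is clipped to one period. The cosine below peaks at the midpoint
    \<open>m\<close>, and the subtracted constant is its value at distance \<open>w / 2\<close> from
    there.\<close>
  define a b where "a = max \<alpha> 0" and "b = min \<beta> 1"
  define m w where "m = (a + b) / 2" and "w = b - a"
  have ab: "0 \<le> a" "a < b" "b \<le> 1" using True by (auto simp: a_def b_def)
  define z where "z y = cos (2 * pi * (y - m)) - cos (pi * w)" for y
  define f where "f n y = exp (- exp (- (real n * z y)))" for n y
  have z: "smooth z" unfolding z_def[abs_def]
    by (intro smooth_diff' smooth_compose_real[OF smooth_cos] smooth_mult smooth_const smooth_id)
  have s: "smooth (f n)" for n unfolding f_def[abs_def]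
    by (intro smooth_compose_real[OF smooth_exp] smooth_minus smooth_mult smooth_const z)
  have "2 * pi * (y + 1 - m) = 2 * pi * (y - m) + 2 * pi" for y by (simp add: algebra_simps)
  then have "z (y + 1) = z y" for y by (simp add: z_def)
  then have per: "f n (y + 1) = f n y" for n y by (simp add: f_def)
  have pos: "(\<lambda>n. f n y) \<longlonglongrightarrow> 1" if "z y > 0" for y
  proof -
    have "filterlim (\<lambda>n. z y * real n) at_top sequentially"
      using that by (intro filterlim_tendsto_pos_mult_at_top[OF tendsto_const]) (auto intro: filterlim_real_sequentially)
    then have "filterlim (\<lambda>n. - (real n * z y)) at_bot sequentially"
      by (simp add: filterlim_uminus_at_top mult.commute)
    then have "(\<lambda>n. exp (- (real n * z y))) \<longlonglongrightarrow> 0" by (rule filterlim_compose[OF exp_at_bot])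
    then have "(\<lambda>n. exp (- exp (- (real n * z y)))) \<longlonglongrightarrow> exp (- 0)" by (intro tendsto_intros)
    then show ?thesis by (simp add: f_def)
  qed
  have neg: "(\<lambda>n. f n y) \<longlonglongrightarrow> 0" if "z y < 0" for y
  proof -
    have "filterlim (\<lambda>n. - z y * real n) at_top sequentially"
      using that by (intro filterlim_tendsto_pos_mult_at_top[OF tendsto_const]) (auto intro: filterlim_real_sequentially)
    then have "filterlim (\<lambda>n. - (real n * z y)) at_top sequentially" by (simp add: mult.commute)
    then have "filterlim (\<lambda>n. exp (- (real n * z y))) at_top sequentially" by (rule filterlim_compose[OF exp_at_top])
    then have "filterlim (\<lambda>n. - exp (- (real n * z y))) at_bot sequentially" by (simp add: filterlim_uminus_at_top)
    then show ?thesis unfolding f_def by (rule filterlim_compose[OF exp_at_bot])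
  qed
  have cosd: "cos (2 * pi * (y - m)) = cos (2 * pi * \<bar>y - m\<bar>)" for y
  proof (cases "y \<ge> m")
    case False
    then have "2 * pi * \<bar>y - m\<bar> = - (2 * pi * (y - m))" by (simp add: abs_if algebra_simps)
    then show ?thesis by (simp only: cos_minus)
  qed simp
  have lim: "(\<lambda>n. f n y) \<longlonglongrightarrow> indicator {\<alpha><..<\<beta>} y" if y: "y \<in> {0..1}" "y \<notin> {\<alpha>, \<beta>, 0, 1}" for y
  proof (cases "a < y \<and> y < b")
    case True
    have "\<bar>y - m\<bar> < w / 2" using True by (auto simp: m_def w_def abs_if field_simps)
    then have "2 * pi * \<bar>y - m\<bar> < pi * w" by (simp add: field_simps)
    then have "cos (pi * w) < cos (2 * pi * \<bar>y - m\<bar>)" using ab by (intro cos_monotone_0_pi) (auto simp: w_def)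
    then have "z y > 0" by (simp add: z_def cosd)
    moreover have "indicator {\<alpha><..<\<beta>} y = (1::real)" using True by (auto simp: a_def b_def)
    ultimately show ?thesis using pos by simp
  next
    case False
    have ne: "y \<noteq> a" "y \<noteq> b" using y by (auto simp: a_def b_def max_def min_def split: if_splits)
    have 1: "w / 2 < \<bar>y - m\<bar>" using False ne by (auto simp: m_def w_def abs_if field_simps)
    have 2: "\<bar>y - m\<bar> < 1 - w / 2" using y ab by (auto simp: m_def w_def abs_if field_simps)
    have "cos (2 * pi * \<bar>y - m\<bar>) < cos (pi * w)"
    proof (cases "\<bar>y - m\<bar> \<le> 1 / 2")
      case True
      have "pi * (w / 2) < pi * \<bar>y - m\<bar>" "pi * \<bar>y - m\<bar> \<le> pi * (1 / 2)"
        using 1 True by (auto intro: mult_strict_left_mono mult_left_mono)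
      then show ?thesis using ab by (intro cos_monotone_0_pi) (auto simp: w_def mult.assoc)
    next
      \<comment> \<open>Beyond half a period the cosine increases again; reflection,
        \<open>cos (2 * pi * t) = cos (2 * pi * (1 - t))\<close>, brings the argument back into the
        range of monotonicity.\<close>
      case False
      have "2 * pi * (1 - \<bar>y - m\<bar>) = 2 * pi - 2 * pi * \<bar>y - m\<bar>" by (simp add: right_diff_distrib)
      then have "cos (2 * pi * \<bar>y - m\<bar>) = cos (2 * pi * (1 - \<bar>y - m\<bar>))" by simp
      also have "\<dots> < cos (pi * w)"
      proof (intro cos_monotone_0_pi)
        show "0 \<le> pi * w" using ab by (simp add: w_def)
        have "w < 2 * (1 - \<bar>y - m\<bar>)" using 2 by simp
        then show "pi * w < 2 * pi * (1 - \<bar>y - m\<bar>)" by (metis mult.assoc mult.commute mult_strict_left_mono pi_gt_zero)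
        have "2 * (1 - \<bar>y - m\<bar>) \<le> 1" using False by simp
        then have "pi * (2 * (1 - \<bar>y - m\<bar>)) \<le> pi * 1" by (intro mult_left_mono) auto
        then show "2 * pi * (1 - \<bar>y - m\<bar>) \<le> pi" by (simp add: mult_ac)
      qed
      finally show ?thesis .
    qed
    then have "z y < 0" by (simp add: z_def cosd)
    moreover have "indicator {\<alpha><..<\<beta>} y = (0::real)" using False y by (auto simp: a_def b_def indicator_def)
    ultimately show ?thesis using neg by simp
  qed
  show ?thesis
    by (rule exI[of _ f]) (use s per lim in \<open>auto simp: f_def\<close>)
qed

section \<open>Integrable functions on the torus are determined by smooth periodic test
  functions\<close>

lemma AE_torus_coord_notin:
  assumes "finite C"
  shows "AE x in torus. \<forall>i. (x :: real^'n) $ i \<notin> C"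
proof -
  have "AE x in lebesgue. (x :: real^'n) $ i \<noteq> c" for i c
  proof (rule AE_I')
    show "{x :: real^'n. x $ i = c} \<in> null_sets lebesgue"
    proof -
      have "axis i 1 \<in> (Basis :: (real^'n) set)" by (auto simp: Basis_vec_def)
      from negligible_standard_hyperplane[OF this, of c] show ?thesis
        by (simp add: negligible_iff_null_sets inner_axis)
    qed
  qed auto
  then have "AE x in lebesgue. \<forall>c\<in>C. (x :: real^'n) $ i \<noteq> c" for i
    using assms by (intro AE_finite_allI) auto
  then have "AE x in lebesgue. \<forall>i. \<forall>c\<in>C. (x :: real^'n) $ i \<noteq> c"
    by (simp add: AE_all_countable)
  then have "AE x in torus. \<forall>i. \<forall>c\<in>C. (x :: real^'n) $ i \<noteq> c"
    by (subst AE_restrict_space_iff) auto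
  then show ?thesis by eventually_elim blast
qed

text \<open>Products of the one-dimensional approximations are smooth periodic functions between 0
  and 1 that converge to the indicator of the box away from finitely many hyperplanes. Dominated
  convergence applies with the bound \<open>\<bar>g x\<bar>\<close>.\<close>

lemma integral_box_eq_0:
  fixes g :: "real^'n \<Rightarrow> real"
  assumes g: "integrable torus g"
    and z: "\<And>\<phi>. periodic \<phi> \<Longrightarrow> smooth \<phi> \<Longrightarrow> (LINT x|torus. \<phi> x * g x) = 0"
  shows "(LINT x|torus. indicator (box a b) x * g x) = 0"
proof -
  obtain f where f: "\<And>i n. smooth (f i n)" "\<And>i n y. f i n (y + 1) = f i n y" "\<And>i n y. 0 \<le> f i n y" "\<And>i n y. f i n y \<le> 1"
    "\<And>i y. y \<in> {0..1} \<Longrightarrow> y \<notin> {a $ i, b $ i, 0, 1} \<Longrightarrow> (\<lambda>n. f i n y) \<longlonglongrightarrow> indicator {a $ i<..<b $ i} y"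
  proof -
    have "\<forall>i. \<exists>f :: nat \<Rightarrow> real \<Rightarrow> real. \<forall>n. smooth (f n) \<and> (\<forall>y. f n (y + 1) = f n y \<and> 0 \<le> f n y \<and> f n y \<le> 1) \<and>
      (\<forall>y\<in>{0..1}. y \<notin> {a $ i, b $ i, 0, 1} \<longrightarrow> (\<lambda>n. f n y) \<longlonglongrightarrow> indicator {a $ i<..<b $ i} y)"
      by (intro allI smooth_indicator_approx)
    from choice[OF this] obtain f :: "'n \<Rightarrow> nat \<Rightarrow> real \<Rightarrow> real" where
      F: "\<forall>i n. smooth (f i n) \<and> (\<forall>y. f i n (y + 1) = f i n y \<and> 0 \<le> f i n y \<and> f i n y \<le> 1) \<and>
      (\<forall>y\<in>{0..1}. y \<notin> {a $ i, b $ i, 0, 1} \<longrightarrow> (\<lambda>n. f i n y) \<longlonglongrightarrow> indicator {a $ i<..<b $ i} y)"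
      by (rule exE)
    show ?thesis by (rule that[of f]) (use F in simp_all)
  qed
  define \<phi> where "\<phi> n x = (\<Prod>i\<in>UNIV. f i n (x $ i))" for n and x :: "real^'n"
  have \<phi>: "smooth (\<phi> n)" "periodic (\<phi> n)" "0 \<le> \<phi> n x" "\<phi> n x \<le> 1" for n x
  proof -
    show "smooth (\<phi> n)" unfolding \<phi>_def[abs_def] by (intro smooth_prod smooth_coord f) simp
    have "periodic (\<lambda>x::real^'n. f i n (x $ i))" for i by (rule periodic_coord) (rule f)
    then show "periodic (\<phi> n)" unfolding \<phi>_def[abs_def] periodic_def by simp
    show "0 \<le> \<phi> n x" "\<phi> n x \<le> 1" unfolding \<phi>_def using f by (auto intro: prod_nonneg prod_le_1)
  qed
  have g': "g \<in> borel_measurable torus" using g by (rule borel_measurable_integrable)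
  have "(\<lambda>n. LINT x|torus. \<phi> n x * g x) \<longlonglongrightarrow> (LINT x|torus. indicator (box a b) x * g x)"
  proof (rule integral_dominated_convergence[where w = "\<lambda>x. \<bar>g x\<bar>"])
    have "box a b \<inter> unit_cube \<in> sets (torus :: (real^'n) measure)" by (simp add: sets_restrict_space_iff)
    then have "(\<lambda>x. indicator (box a b \<inter> unit_cube) x * g x) \<in> borel_measurable torus" using g' by (intro borel_measurable_times borel_measurable_indicator)
    then show "(\<lambda>x. indicator (box a b) x * g x) \<in> borel_measurable torus"
      by (rule measurable_cong[THEN iffD1, rotated]) (auto simp: indicator_def)
    show "(\<lambda>x. \<phi> n x * g x) \<in> borel_measurable torus" for n
      by (rule borel_measurable_times[OF borel_measurable_integrable[OF integrable_torus[OF smooth_cont[OF \<phi>(1)]]] g'])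
    show "integrable torus (\<lambda>x. \<bar>g x\<bar>)" using g by simp
    show "AE x in torus. norm (\<phi> n x * g x) \<le> \<bar>g x\<bar>" for n
      using \<phi>(3,4) by (intro AE_I2) (simp add: abs_mult mult_left_le_one_le)
    have "AE x in torus. \<forall>i. (x :: real^'n) $ i \<notin> (\<Union>i. {a $ i, b $ i, 0, 1})"
      by (rule AE_torus_coord_notin) auto
    moreover have "AE x in torus. x \<in> (unit_cube :: (real^'n) set)" by (rule AE_I2) simp
    ultimately show "AE x in torus. (\<lambda>n. \<phi> n x * g x) \<longlonglongrightarrow> indicator (box a b) x * g x"
    proof eventually_elim
      case (elim x)
      have "(\<lambda>n. f i n (x $ i)) \<longlonglongrightarrow> indicator {a $ i<..<b $ i} (x $ i)" for i
        using elim by (intro f(5)) (auto simp: mem_box_cart)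
      then have "(\<lambda>n. \<phi> n x) \<longlonglongrightarrow> (\<Prod>i\<in>UNIV. indicator {a $ i<..<b $ i} (x $ i))"
        unfolding \<phi>_def by (intro tendsto_prod)
      also have "(\<Prod>i\<in>UNIV. indicator {a $ i<..<b $ i} (x $ i)) = (indicator (box a b) x :: real)"
      proof (cases "x \<in> box a b")
        case True
        then show ?thesis by (simp add: mem_box_cart)
      next
        case False
        then obtain i where "x $ i \<notin> {a $ i<..<b $ i}" by (auto simp: mem_box_cart)
        then have "indicator {a $ i<..<b $ i} (x $ i) = (0::real)" by (simp add: indicator_def)
        then have "(\<Prod>i\<in>UNIV. indicator {a $ i<..<b $ i} (x $ i)) = (0::real)"
          by (intro prod_zero bexI[of _ i]) auto
        then show ?thesis using False by simp
      qed
      finally show ?case by (intro tendsto_mult tendsto_const)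
    qed
  qed
  then show ?thesis unfolding z[OF \<phi>(2,1)] by (simp add: LIMSEQ_const_iff)
qed

text \<open>The positive and the negative part of \<open>g\<close> are densities of finite measures
  that agree on open boxes. These form a generating family stable under intersection, so that the
  measures coincide; then both parts agree almost everywhere, which forces \<open>g\<close> to
  vanish there.\<close>

lemma integral_boxes_AE_0:
  fixes g :: "real^'n \<Rightarrow> real"
  assumes g: "integrable lborel g" and z: "\<And>a b. (LINT x|lborel. indicator (box a b) x * g x) = 0"
  shows "AE x in lborel. g x = 0"
proof -
  let ?p = "\<lambda>x. ennreal (g x)" and ?m = "\<lambda>x. ennreal (- g x)"
  have gm: "g \<in> borel_measurable borel" using g by (simp add: borel_measurable_integrable)
  have fin: "(\<integral>\<^sup>+x. ?p x \<partial>lborel) \<noteq> top" "(\<integral>\<^sup>+x. ?m x \<partial>lborel) \<noteq> top"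
    using g unfolding real_integrable_def by auto
  have eq: "emeasure (density lborel ?p) (box a b) = emeasure (density lborel ?m) (box a b)" for a b
  proof -
    have i: "integrable lborel (\<lambda>x. indicator (box a b) x * g x)"
      using integrable_mult_indicator[OF _ g, of "box a b"] by simp
    define X Y where "X = (\<integral>\<^sup>+x. ennreal (indicator (box a b) x * g x) \<partial>lborel)"
      and "Y = (\<integral>\<^sup>+x. ennreal (- (indicator (box a b) x * g x)) \<partial>lborel)"
    have XY: "X \<noteq> top" "Y \<noteq> top" using i unfolding real_integrable_def X_def Y_def by auto
    have "enn2real X = enn2real Y"
      using real_lebesgue_integral_def[OF i] z[of a b] by (simp add: X_def Y_def)
    moreover have "X = ennreal (enn2real X)" "Y = ennreal (enn2real Y)"
      using XY by (simp_all add: ennreal_enn2real_if)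
    ultimately have "X = Y" by (simp only:)
    then have "(\<integral>\<^sup>+x. ennreal (indicator (box a b) x * g x) \<partial>lborel) = (\<integral>\<^sup>+x. ennreal (- (indicator (box a b) x * g x)) \<partial>lborel)"
      by (simp only: X_def Y_def)
    moreover have "ennreal (indicator (box a b) x * g x) = ?p x * indicator (box a b) x"
      "ennreal (- (indicator (box a b) x * g x)) = ?m x * indicator (box a b) x" for x by (auto simp: indicator_def)
    ultimately show ?thesis using gm by (simp add: emeasure_density)
  qed
  have "density lborel ?p = density lborel ?m"
  proof (rule measure_eqI_generator_eq[where E = "range (\<lambda>(a, b). box a b)" and \<Omega> = UNIV and A = "\<lambda>n. box (- real n *\<^sub>R One) (real n *\<^sub>R One)"])
    show "Int_stable (range (\<lambda>(a, b). box a (b :: real^'n)))"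
      by (auto simp: Int_stable_def box_Int_box)
    show "sets (density lborel ?p) = sigma_sets UNIV (range (\<lambda>(a, b). box a b))"
      "sets (density lborel ?m) = sigma_sets UNIV (range (\<lambda>(a, b). box a b))"
    proof -
      have "sets (borel :: (real^'n) measure) = sigma_sets UNIV (range (\<lambda>(a, b). box a b))"
        by (subst borel_eq_box) (simp add: sets_measure_of)
      then show "sets (density lborel ?p) = sigma_sets UNIV (range (\<lambda>(a, b). box a b))"
        "sets (density lborel ?m) = sigma_sets UNIV (range (\<lambda>(a, b). box a b))" by simp_all
    qed
    show "emeasure (density lborel ?p) X = emeasure (density lborel ?m) X" if "X \<in> range (\<lambda>(a, b). box a b)" for X
      using that eq by auto
    show "(\<Union>n. box (- real n *\<^sub>R One) (real n *\<^sub>R (One :: real^'n))) = UNIV"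
      using UN_box_eq_UNIV[where 'a = "real^'n"] by simp
    show "emeasure (density lborel ?p) (box (- real n *\<^sub>R One) (real n *\<^sub>R One)) \<noteq> \<infinity>" for n
    proof -
      have "emeasure (density lborel ?p) (box (- real n *\<^sub>R One) (real n *\<^sub>R One)) \<le> emeasure (density lborel ?p) (space (density lborel ?p))"
        by (rule emeasure_space)
      also have "\<dots> = (\<integral>\<^sup>+x. ?p x \<partial>lborel)" using gm by (simp add: emeasure_density)
      also have "\<dots> < top" using fin(1) by (simp add: less_top)
      finally show ?thesis by simp
    qed
  qed auto
  then have "AE x in lborel. ?p x = ?m x"
    using finite_density_unique[of ?p lborel ?m] gm fin by auto
  then show ?thesis
    by eventually_elim (smt (verit) ennreal_eq_0_iff ennreal_eq_zero_iff ennreal_neg)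
qed

text \<open>The function, extended by zero outside the cube, is replaced by a Borel function that
  agrees with it almost everywhere, since the criterion with boxes concerns
  \<open>lborel\<close>.\<close>

lemma smooth_test_AE_0_real:
  fixes g :: "real^'n \<Rightarrow> real"
  assumes g: "integrable torus g"
    and z: "\<And>\<phi>. periodic \<phi> \<Longrightarrow> smooth \<phi> \<Longrightarrow> (LINT x|torus. \<phi> x * g x) = 0"
  shows "AE x in torus. g x = 0"
proof -
  let ?G = "\<lambda>x. indicator unit_cube x * g x"
  have G: "integrable lebesgue ?G" using g by (simp add: integrable_restrict_space)
  obtain G' where G': "G' \<in> borel_measurable lborel" "AE x in lborel. ?G x = G' x"
    using completion_ex_borel_measurable_real[OF borel_measurable_integrable[OF G]] by blast
  have ae: "AE x in lebesgue. ?G x = G' x" using G'(2) by (rule AE_completion)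
  have G'm: "G' \<in> borel_measurable lebesgue" using G'(1) by (rule measurable_completion)
  have "integrable lebesgue G'"
    using G ae G'm integrable_cong_AE[OF borel_measurable_integrable[OF G] G'm ae] by simp
  then have iG': "integrable lborel G'" using G'(1) by (simp add: integrable_completion)
  have "(LINT x|lborel. indicator (box a b) x * G' x) = 0" for a b
  proof -
    have m: "(\<lambda>x. indicator (box a b) x * G' x) \<in> borel_measurable lborel" using G'(1) by simp
    have "(LINT x|lborel. indicator (box a b) x * G' x) = (LINT x|lebesgue. indicator (box a b) x * G' x)"
      using integral_completion[OF m] by simp
    also have "\<dots> = (LINT x|lebesgue. indicator (box a b) x * ?G x)"
    proof (rule integral_cong_AE)
      show "(\<lambda>x. indicator (box a b) x * G' x) \<in> borel_measurable lebesgue" using m by (rule measurable_completion)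
      show "(\<lambda>x. indicator (box a b) x * ?G x) \<in> borel_measurable lebesgue"
        by (rule borel_measurable_times[OF borel_measurable_indicator borel_measurable_integrable[OF G]]) simp
      show "AE x in lebesgue. indicator (box a b) x * G' x = indicator (box a b) x * ?G x"
        using ae by eventually_elim simp
    qed
    also have "\<dots> = (LINT x|torus. indicator (box a b) x * g x)"
      by (simp add: integral_restrict_space mult.left_commute)
    also have "\<dots> = 0" by (rule integral_box_eq_0[OF g z])
    finally show ?thesis .
  qed
  from integral_boxes_AE_0[OF iG' this] have "AE x in lebesgue. G' x = 0" by (rule AE_completion)
  with ae have "AE x in lebesgue. ?G x = 0" by eventually_elim simp
  then show ?thesis by (subst AE_restrict_space_iff) (auto elim!: eventually_mono)
qed

lemma integrable_smooth_scaleR: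
  fixes g :: "real^'n \<Rightarrow> 'b::euclidean_space"
  assumes \<phi>: "periodic \<phi>" "smooth \<phi>" and g: "integrable torus g"
  shows "integrable torus (\<lambda>x. \<phi> x *\<^sub>R g x)"
proof -
  obtain K where K: "\<And>x. \<bar>\<phi> x\<bar> \<le> K" using smooth_periodic_bound[OF \<phi>(2,1)] by blast
  show ?thesis
  proof (rule Bochner_Integration.integrable_bound[of _ "\<lambda>x. K *\<^sub>R norm (g x)"])
    show "integrable torus (\<lambda>x. K *\<^sub>R norm (g x))" using g by simp
    show "(\<lambda>x. \<phi> x *\<^sub>R g x) \<in> borel_measurable torus"
      by (rule borel_measurable_scaleR[OF borel_measurable_integrable[OF integrable_torus[OF smooth_cont[OF \<phi>(2)]]]
        borel_measurable_integrable[OF g]])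
    have "\<bar>\<phi> x\<bar> * norm (g x) \<le> K * norm (g x)" for x by (rule mult_right_mono[OF K]) simp
    then show "AE x in torus. norm (\<phi> x *\<^sub>R g x) \<le> norm (K *\<^sub>R norm (g x))"
      using order_trans[OF abs_ge_zero K] by (intro AE_I2) (simp add: abs_mult)
  qed
qed

lemma smooth_test_AE_0:
  fixes g :: "real^'n \<Rightarrow> 'b::euclidean_space"
  assumes g: "integrable torus g"
    and z: "\<And>\<phi>. periodic \<phi> \<Longrightarrow> smooth \<phi> \<Longrightarrow> (LINT x|torus. \<phi> x *\<^sub>R g x) = 0"
  shows "AE x in torus. g x = 0"
proof -
  note gi = integrable_smooth_scaleR[OF _ _ g]
  have "AE x in torus. g x \<bullet> b = 0" if "b \<in> Basis" for b
  proof (rule smooth_test_AE_0_real)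
    show "integrable torus (\<lambda>x. g x \<bullet> b)" using g by simp
    fix \<phi> :: "real^'n \<Rightarrow> real" assume p: "periodic \<phi>" "smooth \<phi>"
    have "(LINT x|torus. \<phi> x * (g x \<bullet> b)) = (LINT x|torus. (\<phi> x *\<^sub>R g x) \<bullet> b)" by simp
    also have "\<dots> = (LINT x|torus. \<phi> x *\<^sub>R g x) \<bullet> b" by (rule integral_inner_left) (use gi[OF p] in simp)
    finally show "(LINT x|torus. \<phi> x * (g x \<bullet> b)) = 0" using z[OF p] by simp
  qed
  then have "AE x in torus. \<forall>b\<in>Basis. g x \<bullet> b = 0" by (intro AE_finite_allI) auto
  then show ?thesis by eventually_elim (simp add: euclidean_all_zero_iff)
qed

section \<open>Shear velocities as elements of W^(1,p)\<close>

lemma continuous_Lp_torus: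
  fixes f :: "real^'n \<Rightarrow> 'b::euclidean_space"
  assumes f: "continuous_on UNIV f" "periodic f" and p: "p \<ge> 1"
  shows "f \<in> Lp_torus p"
    and "(\<integral>\<^sup>+x. ennreal (norm (f x) powr p) \<partial>torus) = ennreal (integral unit_cube (\<lambda>x. norm (f x) powr p))"
proof -
  have c: "continuous_on unit_cube (\<lambda>x. norm (f x) powr p)"
    using p f(1) by (intro continuous_on_powr' continuous_intros) (auto intro: continuous_on_subset)
  have "(\<integral>\<^sup>+x. ennreal (norm (f x) powr p) \<partial>torus) = ennreal (LINT x|torus. norm (f x) powr p)"
    by (rule nn_integral_eq_integral[OF integrable_torus[OF c]]) simp
  then show *: "(\<integral>\<^sup>+x. ennreal (norm (f x) powr p) \<partial>torus) = ennreal (integral unit_cube (\<lambda>x. norm (f x) powr p))"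
    by (simp add: LINT_torus[OF c])
  have "f \<in> borel_measurable torus"
    using f(1) by (intro borel_measurable_integrable integrable_torus) (auto intro: continuous_on_subset)
  then show "f \<in> Lp_torus p"
    using f(2) * by (simp add: Lp_torus_def Lp_norm_def enn_powr_finite)
qed

lemma Lp1_integrable: "f \<in> Lp_torus 1 \<Longrightarrow> integrable torus f"
  by (simp add: Lp_torus_def Lp_norm_def integrable_iff_bounded enn_powr_def less_top split: if_splits)

text \<open>The norm of W^(1,p) is defined with an arbitrary choice of weak derivatives. By
  uniqueness it may be computed from any known weak derivative.\<close>

lemma has_weak_partial_unique:
  assumes "has_weak_partial i f g" "has_weak_partial i f h"
  shows "AE x in torus. g x = h x"
proof -
  have gh: "integrable torus g" "integrable torus h" using assms by (auto simp: has_weak_partial_def intro: Lp1_integrable)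
  note gi = integrable_smooth_scaleR
  have "AE x in torus. g x - h x = 0"
  proof (rule smooth_test_AE_0)
    show "integrable torus (\<lambda>x. g x - h x)" using gh by simp
    fix \<phi> :: "real^'a \<Rightarrow> real" assume p: "periodic \<phi>" "smooth \<phi>"
    have "(LINT x|torus. \<phi> x *\<^sub>R (g x - h x)) = (LINT x|torus. \<phi> x *\<^sub>R g x) - (LINT x|torus. \<phi> x *\<^sub>R h x)"
      unfolding scaleR_diff_right using gi[OF p] gh by (intro Bochner_Integration.integral_diff) auto
    also have "(LINT x|torus. \<phi> x *\<^sub>R g x) = (LINT x|torus. \<phi> x *\<^sub>R h x)"
    proof -
      have "(LINT x|torus. partial i \<phi> x *\<^sub>R f x) = - (LINT x|torus. \<phi> x *\<^sub>R g x)"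
        "(LINT x|torus. partial i \<phi> x *\<^sub>R f x) = - (LINT x|torus. \<phi> x *\<^sub>R h x)"
        using assms p by (simp_all add: has_weak_partial_def)
      then show ?thesis by simp
    qed
    finally show "(LINT x|torus. \<phi> x *\<^sub>R (g x - h x)) = 0" by simp
  qed
  then show ?thesis by eventually_elim simp
qed

text \<open>The classical derivatives are weak derivatives by integration by parts, and only the one
  in direction \<open>l\<close> is nonzero. Uniqueness transfers this to the chosen weak derivatives
  in the norm.\<close>

lemma shear_W1p:
  fixes g :: "real \<Rightarrow> real" and k l :: "'n::finite"
  defines "u \<equiv> (\<lambda>x::real^'n. g (x $ l) *\<^sub>R axis k 1 :: real^'n)"
  assumes g: "smooth g" "\<And>y. g (y + 1) = g y" and p: "p \<ge> 1"
  shows "u \<in> W1p_torus p"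
    and "W1p_norm p u = enn_powr (ennreal (integral unit_cube (\<lambda>x::real^'n. \<bar>g (x $ l)\<bar> powr p) +
      integral unit_cube (\<lambda>x::real^'n. \<bar>dird 1 g (x $ l)\<bar> powr p))) (1 / p)"
proof -
  define d where "d i x = (if i = l then dird 1 g (x $ l) else 0) *\<^sub>R (axis k 1 :: real^'n)" for i and x :: "real^'n"
  have sg: "smooth (\<lambda>x::real^'n. g (x $ l))" "periodic (\<lambda>x::real^'n. g (x $ l))"
    by (rule smooth_coord[OF g(1)], rule periodic_coord) (rule g(2))
  have pg: "partial i (\<lambda>x::real^'n. g (x $ l)) = (\<lambda>x. if i = l then dird 1 g (x $ l) else 0)" for i
    by (rule partial_coord[OF g(1)])
  have sd: "smooth (\<lambda>x::real^'n. if i = l then dird 1 g (x $ l) else 0)" "periodic (\<lambda>x::real^'n. if i = l then dird 1 g (x $ l) else 0)" for i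
    using smooth_partial[OF sg(1), of i] periodic_partial[OF sg(2,1), of i] unfolding pg by simp_all
  have cu: "continuous_on UNIV u" "periodic u"
    using smooth_cont[OF sg(1), of UNIV] sg(2) by (auto simp: u_def periodic_def intro!: continuous_intros)
  have cd: "continuous_on UNIV (d i)" "periodic (d i)" for i
    using smooth_cont[OF sd(1), of UNIV i] sd(2)[of i] by (auto simp: d_def[abs_def] periodic_def intro!: continuous_intros)
  have wp: "has_weak_partial i u (d i)" for i
    unfolding has_weak_partial_def
  proof (intro conjI allI impI)
    show "u \<in> Lp_torus 1" "d i \<in> Lp_torus 1" by (intro continuous_Lp_torus cu cd order.refl)+
    fix \<phi> :: "real^'n \<Rightarrow> real" assume "periodic \<phi> \<and> smooth \<phi>"
    then have \<phi>: "periodic \<phi>" "smooth \<phi>" by auto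
    have c: "continuous_on S (\<lambda>x. partial i \<phi> x * g (x $ l))" "continuous_on S (\<lambda>x. \<phi> x * (if i = l then dird 1 g (x $ l) else 0))" for S
      by (intro smooth_cont smooth_mult smooth_partial \<phi> sg sd)+
    have D: "((\<lambda>s. g ((x + s *\<^sub>R axis i 1) $ l)) has_real_derivative (if i = l then dird 1 g (x $ l) else 0)) (at 0)" for x :: "real^'n"
      using smooth_partial_line[OF sg(1), of x "axis i 1" 0 UNIV] pg[of i] by (simp add: partial_eq_dird fun_eq_iff)
    have "(LINT x|torus. partial i \<phi> x *\<^sub>R u x) = (LINT x|torus. (partial i \<phi> x * g (x $ l)) *\<^sub>R axis k 1)"
      by (simp add: u_def)
    also have "\<dots> = (LINT x|torus. partial i \<phi> x * g (x $ l)) *\<^sub>R axis k 1"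
      by (rule integral_scaleR_left) (use integrable_torus[OF c(1)] in simp)
    also have "(LINT x|torus. partial i \<phi> x * g (x $ l)) = - (LINT x|torus. \<phi> x * (if i = l then dird 1 g (x $ l) else 0))"
      unfolding LINT_torus[OF c(1)] LINT_torus[OF c(2)]
      by (rule integral_torus_parts[OF \<phi>(2,1) smooth_cont[OF sg(1)] sg(2) smooth_cont[OF sd(1)] D])
    also have "\<dots> *\<^sub>R (axis k 1 :: real^'n) = - (LINT x|torus. (\<phi> x * (if i = l then dird 1 g (x $ l) else 0)) *\<^sub>R axis k 1)"
      by (subst integral_scaleR_left) (use integrable_torus[OF c(2)] in simp_all)
    finally show "(LINT x|torus. partial i \<phi> x *\<^sub>R u x) = - (LINT x|torus. \<phi> x *\<^sub>R d i x)"
      by (simp add: d_def)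
  qed
  show "u \<in> W1p_torus p"
    using wp continuous_Lp_torus(1)[OF cu p] continuous_Lp_torus(1)[OF cd p] by (auto simp: W1p_torus_def)
  have nu: "(\<integral>\<^sup>+x. ennreal (norm (u x) powr p) \<partial>torus) = ennreal (integral unit_cube (\<lambda>x::real^'n. \<bar>g (x $ l)\<bar> powr p))"
    using continuous_Lp_torus(2)[OF cu p] by (simp add: u_def norm_axis_1)
  have nd: "(\<integral>\<^sup>+x. ennreal (norm (weak_partial i u x) powr p) \<partial>torus) =
      (if i = l then ennreal (integral unit_cube (\<lambda>x::real^'n. \<bar>dird 1 g (x $ l)\<bar> powr p)) else 0)" for i
  proof -
    have "has_weak_partial i u (weak_partial i u)" unfolding weak_partial_def by (rule someI[of "has_weak_partial i u", OF wp])
    from has_weak_partial_unique[OF this wp]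
    have "(\<integral>\<^sup>+x. ennreal (norm (weak_partial i u x) powr p) \<partial>torus) = (\<integral>\<^sup>+x. ennreal (norm (d i x) powr p) \<partial>torus)"
      by (intro nn_integral_cong_AE) (auto elim!: eventually_mono)
    also have "\<dots> = ennreal (integral unit_cube (\<lambda>x. norm (d i x) powr p))"
      by (rule continuous_Lp_torus(2)[OF cd p])
    finally show ?thesis using p by (simp add: d_def norm_axis_1)
  qed
  have nonneg: "0 \<le> integral unit_cube (\<lambda>x::real^'n. \<bar>h (x $ l)\<bar> powr p)" for h :: "real \<Rightarrow> real"
    by (cases "(\<lambda>x::real^'n. \<bar>h (x $ l)\<bar> powr p) integrable_on unit_cube") (auto intro: integral_nonneg simp: not_integrable_integral)
  show "W1p_norm p u = enn_powr (ennreal (integral unit_cube (\<lambda>x::real^'n. \<bar>g (x $ l)\<bar> powr p) +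
      integral unit_cube (\<lambda>x::real^'n. \<bar>dird 1 g (x $ l)\<bar> powr p))) (1 / p)"
    unfolding W1p_norm_def nu nd using nonneg by (simp add: ennreal_plus)
qed

lemma pu_W1p:
  assumes "pok P" "p \<ge> 1"
  shows "pu P \<in> W1p_torus p" "W1p_norm p (pu P) = shear_norm p P"
  using shear_W1p[where g = "pg P" and k = "pk P" and l = "pl P" and p = p] assms
  by (simp_all add: pok_def pu_def[abs_def] shear_norm_def)

text \<open>Read off from the velocity with profile zero, which settles the weak derivatives chosen
  for the zero function.\<close>

lemma W1p_zero:
  assumes "p \<ge> 1"
  shows "(\<lambda>x. 0) \<in> (W1p_torus p :: (real^'n \<Rightarrow> real^'n) set)" "W1p_norm p (\<lambda>x::real^'n. 0::real^'n) = 0"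
proof -
  have s: "smooth (\<lambda>y::real. 0)" by (rule smooth_const)
  note w = shear_W1p[where g = "\<lambda>y. 0" and k = "undefined :: 'n" and l = "undefined :: 'n" and p = p, OF s refl assms]
  show "(\<lambda>x. 0) \<in> (W1p_torus p :: (real^'n \<Rightarrow> real^'n) set)" using w(1) by simp
  show "W1p_norm p (\<lambda>x::real^'n. 0::real^'n) = 0" using w(2) assms by (simp add: enn_powr_def)
qed

context assembly
begin

lemma u_bochner:
  assumes p: "p \<ge> 1" and fin: "(\<Sum>n. \<Sum>P\<in>S n. u_cost p P) < top"
  shows "patch S (\<lambda>P t. pu P) \<in> bochner_space 1 {0<..<T} (W1p_torus p) (W1p_norm p)"
proof (rule bochner_space_patch)
  show "strongly_measurable {0<..<T} (W1p_torus p) (W1p_norm p) (patch S (\<lambda>P t. pu P))"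
  proof (rule strongly_measurable_patch)
    show "(\<lambda>x. 0) \<in> (W1p_torus p :: (real^'n \<Rightarrow> real^'n) set)" by (rule W1p_zero(1)[OF p])
    show "pu P \<in> W1p_torus p" if "P \<in> S n" for n P by (rule pu_W1p(1)[OF S_ok[OF that] p])
    show "W1p_norm p (\<lambda>x::real^'n. 0::real^'n) = 0" by (rule W1p_zero(2)[OF p])
    then show "(\<lambda>j. W1p_norm p (\<lambda>x. pu P x - pu P x)) \<longlonglongrightarrow> 0" for P :: "'n piece" by simp
  qed
  show "W1p_norm p (\<lambda>x::real^'n. 0::real^'n) = 0" by (rule W1p_zero[OF p])
  show "enn_powr (W1p_norm p (pu P)) 1 \<le> shear_norm p P" if "P \<in> S n" for n P
  proof -
    have "enn_powr x 1 = x" for x by (cases x) (auto simp: enn_powr_def)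
    then show ?thesis using pu_W1p(2)[OF S_ok[OF that] p] by simp
  qed
  show "(\<Sum>n. \<Sum>P\<in>S n. ennreal (pb P - pa P) * shear_norm p P) < top" using fin by (simp add: u_cost_def)
qed simp

end

section \<open>The weak formulation\<close>

definition joint :: "(real \<Rightarrow> real^'n \<Rightarrow> real) \<Rightarrow> real \<times> (real^'n) \<Rightarrow> real" where
  "joint \<phi> z = \<phi> (fst z) (snd z)"

text \<open>Derivatives of test functions are taken within \<open>J \<times> UNIV\<close> and may be
  one-sided at the initial time. Over the open interval they are ordinary derivatives, and the
  velocity and the density are nonzero only there.\<close>

lemma test_function_interior:
  fixes \<phi> :: "real \<Rightarrow> real^'n \<Rightarrow> real"
  assumes \<phi>: "test_function J \<phi>" and J: "{0<..<T} \<subseteq> J"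
  defines "U \<equiv> {0<..<T} \<times> (UNIV :: (real^'n) set)"
  shows "z \<in> U \<Longrightarrow> (joint \<phi> has_derivative (\<lambda>v. dird v (joint \<phi>) z)) (at z)"
    and "continuous_on U (dird v (joint \<phi>))" and "continuous_on U (joint \<phi>)"
    and "0 < t \<Longrightarrow> t < T \<Longrightarrow> dt J \<phi> t x = dird (1, 0) (joint \<phi>) (t, x)"
proof -
  have j: "joint \<phi> = (\<lambda>(t, x). \<phi> t x)" by (auto simp: joint_def)
  have "Ck_on (Suc 0) (J \<times> UNIV) (joint \<phi>)" using \<phi> unfolding test_function_def Cinf_on_def j by blast
  then have D: "\<And>z. z \<in> J \<times> UNIV \<Longrightarrow> joint \<phi> differentiable (at z within J \<times> UNIV)"
    and C: "\<And>b. b \<in> Basis \<Longrightarrow> continuous_on (J \<times> UNIV) (\<lambda>z. frechet_derivative (joint \<phi>) (at z within J \<times> UNIV) b)"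
    unfolding Ck_on.simps by blast+
  have U: "U \<subseteq> J \<times> UNIV" using J by (auto simp: U_def)
  have "open U" unfolding U_def by (intro open_Times) auto
  then have at: "at z within J \<times> UNIV = at z" if "z \<in> U" for z
    using interior_maximal[OF U] that by (intro at_within_interior) auto
  show D': "(joint \<phi> has_derivative (\<lambda>v. dird v (joint \<phi>) z)) (at z)" if "z \<in> U" for z
  proof -
    have "joint \<phi> differentiable (at z)" using D[of z] U that unfolding at[OF that] by blast
    then show ?thesis unfolding dird_def[abs_def] using frechet_derivative_works by blast
  qed
  show "continuous_on U (joint \<phi>)"
    using D' by (intro continuous_at_imp_continuous_on ballI) (rule has_derivative_continuous)
  have cb: "continuous_on U (dird b (joint \<phi>))" if "b \<in> Basis" for b
  proof -
    have "continuous_on U (\<lambda>z. frechet_derivative (joint \<phi>) (at z within J \<times> UNIV) b)"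
      by (rule continuous_on_subset[OF C[OF that] U])
    then show ?thesis by (rule continuous_on_eq) (simp add: at dird_def)
  qed
  have "continuous_on U (\<lambda>z. \<Sum>b\<in>Basis. (v \<bullet> b) * dird b (joint \<phi>) z)"
    by (intro continuous_intros cb)
  moreover have "(\<Sum>b\<in>Basis. (v \<bullet> b) * dird b (joint \<phi>) z) = dird v (joint \<phi>) z" if "z \<in> U" for z
  proof -
    have lin: "linear (\<lambda>v. dird v (joint \<phi>) z)" using has_derivative_linear[OF D'[OF that]] .
    have "dird v (joint \<phi>) z = dird (\<Sum>b\<in>Basis. (v \<bullet> b) *\<^sub>R b) (joint \<phi>) z" by (simp add: euclidean_representation)
    then show ?thesis unfolding linear_sum[OF lin] linear_cmul[OF lin] by simp
  qed
  ultimately show "continuous_on U (dird v (joint \<phi>))" by (rule continuous_on_eq)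
  show "dt J \<phi> t x = dird (1, 0) (joint \<phi>) (t, x)" if "0 < t" "t < T"
    unfolding dt_def dird_def j[symmetric] using at[of "(t, x)"] that by (simp add: U_def)
qed

lemma test_function_line:
  fixes \<phi> :: "real \<Rightarrow> real^'n \<Rightarrow> real"
  assumes \<phi>: "test_function J \<phi>" and J: "{0<..<T} \<subseteq> J" and t: "0 < t" "t < T"
  shows "((\<lambda>s. \<phi> s x) has_real_derivative dird (1, 0) (joint \<phi>) (t, x)) (at t within A)"
    and "((\<lambda>s. \<phi> t (x + s *\<^sub>R axis i 1)) has_real_derivative dird (0, axis i 1) (joint \<phi>) (t, x)) (at 0)"
    and "partial i (\<phi> t) x = dird (0, axis i 1) (joint \<phi>) (t, x)"
proof -
  have D: "(joint \<phi> has_derivative (\<lambda>v. dird v (joint \<phi>) (t, x))) (at (t, x))"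
    by (rule test_function_interior(1)[OF \<phi> J]) (use t in auto)
  have lin: "linear (\<lambda>v. dird v (joint \<phi>) (t, x))" using has_derivative_linear[OF D] .
  have "((\<lambda>s. joint \<phi> (s, x)) has_derivative (\<lambda>h. dird (h, 0) (joint \<phi>) (t, x))) (at t within A)"
    by (rule has_derivative_compose[where f = "\<lambda>s. (s, x)" and x = t, OF _ D]) (auto intro!: derivative_eq_intros)
  moreover have "(\<lambda>h. dird (h, 0) (joint \<phi>) (t, x)) = (*) (dird (1, 0) (joint \<phi>) (t, x))"
  proof
    fix h show "dird (h, 0) (joint \<phi>) (t, x) = dird (1, 0) (joint \<phi>) (t, x) * h"
      using linear_cmul[OF lin, of h "(1, 0)"] by (simp only: scaleR_Pair scaleR_zero_right real_scaleR_def mult.commute mult_1_right mult_1_left)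
  qed
  moreover have "(\<lambda>s. joint \<phi> (s, x)) = (\<lambda>s. \<phi> s x)" by (simp add: joint_def)
  ultimately show "((\<lambda>s. \<phi> s x) has_real_derivative dird (1, 0) (joint \<phi>) (t, x)) (at t within A)"
    unfolding has_field_derivative_def by (simp only:)
  have X: "((\<lambda>y. joint \<phi> (t, y)) has_derivative (\<lambda>h. dird (0, h) (joint \<phi>) (t, x))) (at x)"
    by (rule has_derivative_compose[where f = "\<lambda>y. (t, y)" and x = x, OF _ D]) (auto intro!: derivative_eq_intros)
  from dird_eqI[OF this] show "partial i (\<phi> t) x = dird (0, axis i 1) (joint \<phi>) (t, x)"
    by (simp add: partial_eq_dird joint_def)
  have "((\<lambda>s. joint \<phi> (t, x + s *\<^sub>R axis i 1)) has_derivative (\<lambda>h. dird (0, h *\<^sub>R axis i 1) (joint \<phi>) (t, x))) (at 0)"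
    by (rule has_derivative_compose[where f = "\<lambda>s. x + s *\<^sub>R axis i 1"]) (use X in \<open>auto intro!: derivative_eq_intros\<close>)
  moreover have "(\<lambda>h. dird (0, h *\<^sub>R axis i 1) (joint \<phi>) (t, x)) = (*) (dird (0, axis i 1) (joint \<phi>) (t, x))"
  proof
    fix h show "dird (0, h *\<^sub>R axis i 1) (joint \<phi>) (t, x) = dird (0, axis i 1) (joint \<phi>) (t, x) * h"
      using linear_cmul[OF lin, of h "(0, axis i 1)"] by (simp only: scaleR_Pair scaleR_zero_right real_scaleR_def mult_zero_left mult_zero_right mult.commute)
  qed
  moreover have "(\<lambda>s. joint \<phi> (t, x + s *\<^sub>R axis i 1)) = (\<lambda>s. \<phi> t (x + s *\<^sub>R axis i 1))" by (simp add: joint_def)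
  ultimately show "((\<lambda>s. \<phi> t (x + s *\<^sub>R axis i 1)) has_real_derivative dird (0, axis i 1) (joint \<phi>) (t, x)) (at 0)"
    unfolding has_field_derivative_def by (simp only:)
qed

definition pairing :: "(real \<Rightarrow> real^'n \<Rightarrow> real) \<Rightarrow> real \<Rightarrow> (real^'n \<Rightarrow> real) \<Rightarrow> real" where
  "pairing \<phi> t f = integral unit_cube (\<lambda>x. f x * \<phi> t x)"

text \<open>The spatial integral of the weak formulation during the piece. By
  \<open>piece_identity\<close> it is the time derivative of the pairing of the density with the
  test function.\<close>

definition piece_rate :: "'n::finite piece \<Rightarrow> (real \<Rightarrow> real^'n \<Rightarrow> real) \<Rightarrow> real \<Rightarrow> real" where
  "piece_rate P \<phi> t = integral unit_cube (\<lambda>x. prho P t x *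
     (dird (1, 0) (joint \<phi>) (t, x) + pg P (x $ pl P) * dird (0, axis (pk P) 1) (joint \<phi>) (t, x)))"

lemma shear_const_along: "k \<noteq> l \<Longrightarrow> (x + s *\<^sub>R axis k 1) $ l = x $ l" for x :: "real^'n"
  by (simp add: axis_def)

text \<open>The pairing of density and test function is differentiated in time. The transport
  equation turns the time derivative of the density into \<open>- pg P\<close> times its derivative
  in direction \<open>pk P\<close>, which integration by parts moves to the test function; the
  factor \<open>pg P\<close> does not vary in that direction. The fundamental theorem of calculus
  then leaves the boundary terms.\<close>

lemma piece_identity:
  fixes P :: "'n::finite piece"
  assumes P: "pok P" "0 < pa P" "pb P < T" and \<phi>: "test_function J \<phi>" and J: "{0<..<T} \<subseteq> J"
  shows "continuous_on {pa P..pb P} (piece_rate P \<phi>)"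
    and "integral {pa P..pb P} (piece_rate P \<phi>) = bdP (pairing \<phi>) P"
proof -
  let ?I = "{pa P..pb P}" and ?O = "{0<..<T} \<times> (UNIV :: (real^'n) set)"
  let ?k = "pk P" and ?l = "pl P"
  define R where "R z = prho P (fst z) (snd z)" for z
  have R: "smooth R" unfolding R_def[abs_def] by (rule prho_joint(1)[OF P(1)])
  have cR: "continuous_on A R" "continuous_on A (dird v R)" for A v by (intro smooth_cont smooth_dird R)+
  have g: "smooth (pg P)" "\<And>y. pg P (y + 1) = pg P y" and kl: "?k \<noteq> ?l" and sf: "smooth (pf P)" using P(1) by (auto simp: pok_def)
  have sg: "smooth (\<lambda>x::real^'n. pg P (x $ ?l))" by (rule smooth_coord[OF g(1)])
  have cg: "continuous_on A (\<lambda>x::real^'n. pg P (x $ ?l))" for A by (rule smooth_cont[OF sg])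
  have pgp: "periodic (\<lambda>x::real^'n. pg P (x $ ?l))" by (rule periodic_coord) (rule g(2))
  have IO: "?I \<times> (unit_cube :: (real^'n) set) \<subseteq> ?O" using P(2,3) by auto
  note c = test_function_interior(2,3)[OF \<phi> J]
  have cI: "continuous_on (?I \<times> unit_cube) (dird v (joint \<phi>))" "continuous_on (?I \<times> unit_cube) (joint \<phi>)" for v
    by (rule continuous_on_subset[OF c(1) IO], rule continuous_on_subset[OF c(2) IO])
  have cgs: "continuous_on A (\<lambda>z::real\<times>(real^'n). pg P (snd z $ ?l))" for A
    by (rule continuous_on_compose2[OF cg[of UNIV]]) (auto intro!: continuous_intros)
  have slice: "continuous_on UNIV (\<lambda>x. h (t, x))" if "continuous_on ?O h" "t \<in> ?I" for h :: "real\<times>(real^'n) \<Rightarrow> real" and t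
    by (rule continuous_on_compose2[OF that(1)]) (use that(2) P(2,3) in \<open>auto intro!: continuous_intros\<close>)
  show cont: "continuous_on ?I (piece_rate P \<phi>)"
  proof -
    have "continuous_on (?I \<times> unit_cube) (\<lambda>z. R z * (dird (1, 0) (joint \<phi>) z + pg P (snd z $ ?l) * dird (0, axis ?k 1) (joint \<phi>) z))"
      by (intro continuous_intros cR cI cgs)
    then show ?thesis unfolding piece_rate_def[abs_def]
      by (intro integral_continuous_on_param) (simp add: R_def case_prod_beta')
  qed
  define m where "m t = integral unit_cube (\<lambda>x. prho P t x * \<phi> t x)" for t
  have "((\<lambda>t. integral unit_cube (\<lambda>x. prho P t x * \<phi> t x)) has_real_derivative
      integral unit_cube (\<lambda>x. dird (1, 0) R (t, x) * \<phi> t x + prho P t x * dird (1, 0) (joint \<phi>) (t, x))) (at t within ?I)"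
    if t: "t \<in> ?I" for t
  proof (rule leibniz_rule_field_derivative)
    fix s x assume s: "s \<in> ?I"
    have "((\<lambda>s. R (s, x)) has_real_derivative dird (1, 0) R (s, x)) (at s within ?I)"
      by (rule smooth_vd[OF R]) (auto intro!: derivative_eq_intros)
    moreover have "((\<lambda>s. \<phi> s x) has_real_derivative dird (1, 0) (joint \<phi>) (s, x)) (at s within ?I)"
      by (rule test_function_line(1)[OF \<phi> J]) (use s P(2,3) in auto)
    ultimately show "((\<lambda>s. prho P s x * \<phi> s x) has_real_derivative
       dird (1, 0) R (s, x) * \<phi> s x + prho P s x * dird (1, 0) (joint \<phi>) (s, x)) (at s within ?I)"
      by (auto intro!: derivative_eq_intros simp: R_def)
  next
    fix s assume s: "s \<in> ?I"
    have "continuous_on UNIV (\<lambda>x. R (s, x) * joint \<phi> (s, x))"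
      by (intro continuous_on_mult slice[OF _ s] cR c)
    then show "(\<lambda>x. prho P s x * \<phi> s x) integrable_on unit_cube"
      by (intro integrable_continuous) (auto simp: R_def joint_def intro: continuous_on_subset)
  next
    have "continuous_on (?I \<times> unit_cube) (\<lambda>z. dird (1, 0) R z * joint \<phi> z + R z * dird (1, 0) (joint \<phi>) z)"
      by (intro continuous_intros cR cI)
    then show "continuous_on (?I \<times> unit_cube) (\<lambda>(t, x). dird (1, 0) R (t, x) * \<phi> t x + prho P t x * dird (1, 0) (joint \<phi>) (t, x))"
      by (simp add: R_def joint_def case_prod_beta')
  qed (use t in auto)
  moreover have "integral unit_cube (\<lambda>x. dird (1, 0) R (t, x) * \<phi> t x + prho P t x * dird (1, 0) (joint \<phi>) (t, x)) = piece_rate P \<phi> t"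
    if t: "t \<in> ?I" for t
  proof -
    have tT: "0 < t" "t < T" using t P(2,3) by auto
    have sp: "smooth (prho P t)" using smooth_slice[OF R, of t] by (simp add: R_def)
    have c1: "continuous_on A (\<lambda>x. \<phi> t x)" "continuous_on A (\<lambda>x. dird v (joint \<phi>) (t, x))" for A v
      using slice[OF c(2) t] slice[OF c(1) t, of v] by (auto simp: joint_def intro: continuous_on_subset)
    have c2: "continuous_on A (prho P t)" "continuous_on A (partial ?k (prho P t))" for A by (intro smooth_cont sp smooth_partial)+
    have dR: "dird (1, 0) R (t, x) = - pg P (x $ ?l) * partial ?k (prho P t) x" for x
    proof -
      have "((\<lambda>s. R (s, x)) has_real_derivative dird (1, 0) R (t, x)) (at t)"
        by (rule smooth_vd[OF R]) (auto intro!: derivative_eq_intros)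
      moreover have "((\<lambda>s. pf P (shear ?k ?l (pg P) (s - pa P) x)) has_real_derivative
          - pg P (x $ ?l) * partial ?k (pf P) (shear ?k ?l (pg P) (t - pa P) x) * 1) (at t)"
        by (rule DERIV_chain2[OF shear_time_derivative[OF sf]]) (auto intro!: derivative_eq_intros)
      moreover have "partial ?k (prho P t) x = partial ?k (pf P) (shear ?k ?l (pg P) (t - pa P) x)"
        using shear_partial[OF sf g(1), of ?k ?k ?l "t - pa P"] kl by (simp add: prho_def[abs_def])
      ultimately show ?thesis
        using DERIV_unique[of "\<lambda>s. R (s, x)" "dird (1, 0) R (t, x)" t "- pg P (x $ ?l) * partial ?k (pf P) (shear ?k ?l (pg P) (t - pa P) x) * 1"]
        by (simp add: R_def prho_def)
    qed
    have "integral unit_cube (\<lambda>x. partial ?k (prho P t) x * (pg P (x $ ?l) * \<phi> t x))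
        = - integral unit_cube (\<lambda>x. prho P t x * (pg P (x $ ?l) * dird (0, axis ?k 1) (joint \<phi>) (t, x)))"
    proof (rule integral_torus_parts[OF sp prho_joint(2)[OF P(1)]])
      show "periodic (\<lambda>x. pg P (x $ ?l) * \<phi> t x)"
        using \<phi> by (intro periodic_mult pgp) (simp add: test_function_def)
      fix x
      have "((\<lambda>s. pg P (x $ ?l) * \<phi> t (x + s *\<^sub>R axis ?k 1)) has_real_derivative pg P (x $ ?l) * dird (0, axis ?k 1) (joint \<phi>) (t, x)) (at 0)"
        by (intro DERIV_cmult test_function_line(2)[OF \<phi> J tT])
      then show "((\<lambda>s. pg P ((x + s *\<^sub>R axis ?k 1) $ ?l) * \<phi> t (x + s *\<^sub>R axis ?k 1)) has_real_derivative pg P (x $ ?l) * dird (0, axis ?k 1) (joint \<phi>) (t, x)) (at 0)"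
        by (simp only: shear_const_along[OF kl])
    qed (intro continuous_intros c1 cg)+
    then have parts: "integral unit_cube (\<lambda>x. dird (1, 0) R (t, x) * \<phi> t x) =
        integral unit_cube (\<lambda>x. prho P t x * (pg P (x $ ?l) * dird (0, axis ?k 1) (joint \<phi>) (t, x)))"
      by (simp add: dR mult_ac)
    have "integral unit_cube (\<lambda>x. dird (1, 0) R (t, x) * \<phi> t x + prho P t x * dird (1, 0) (joint \<phi>) (t, x))
      = integral unit_cube (\<lambda>x. dird (1, 0) R (t, x) * \<phi> t x) + integral unit_cube (\<lambda>x. prho P t x * dird (1, 0) (joint \<phi>) (t, x))"
      unfolding dR by (intro integral_add integrable_continuous continuous_intros c1 c2 cg)
    also have "\<dots> = integral unit_cube (\<lambda>x. prho P t x * (pg P (x $ ?l) * dird (0, axis ?k 1) (joint \<phi>) (t, x)) + prho P t x * dird (1, 0) (joint \<phi>) (t, x))"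
      unfolding parts by (intro integral_add[symmetric] integrable_continuous continuous_intros c1 c2 cg)
    finally show ?thesis by (simp add: piece_rate_def distrib_left add.commute)
  qed
  ultimately have "(m has_real_derivative piece_rate P \<phi> t) (at t within ?I)" if "t \<in> ?I" for t
    using that unfolding m_def[abs_def] by simp
  then have "(piece_rate P \<phi> has_integral m (pb P) - m (pa P)) ?I"
    using P(1) by (intro fundamental_theorem_of_calculus) (auto simp: pok_def has_real_derivative_iff_has_vector_derivative[symmetric])
  then show "integral ?I (piece_rate P \<phi>) = bdP (pairing \<phi>) P"
    by (simp add: integral_unique bdP_def pairing_def m_def)
qed

lemma indicator_interval_integral:
  fixes h :: "real \<Rightarrow> real"
  assumes h: "continuous_on {a..b} h" and ab: "0 \<le> a" "b \<le> T"
  shows "integrable (lebesgue_on {0..T}) (\<lambda>t. indicator {a<..<b} t * h t)"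
    and "(LINT t|lebesgue_on {0..T}. indicator {a<..<b} t * h t) = integral {a..b} h"
proof -
  have "h absolutely_integrable_on {a..b}" by (rule absolutely_integrable_continuous_real[OF h])
  then have s: "h absolutely_integrable_on {a<..<b}"
    by (rule set_integrable_subset) auto
  have e: "indicator {0..T} t *\<^sub>R (indicator {a<..<b} t * h t) = indicator {a<..<b} t *\<^sub>R h t" for t
    using ab by (auto simp: indicator_def)
  show "integrable (lebesgue_on {0..T}) (\<lambda>t. indicator {a<..<b} t * h t)"
    by (subst integrable_restrict_space) (use s in \<open>simp_all add: e set_integrable_def del: real_scaleR_def\<close>)
  have "(LINT t|lebesgue_on {0..T}. indicator {a<..<b} t * h t) = (LINT t:{a<..<b}|lebesgue. h t)"
    by (subst integral_restrict_space) (simp_all add: e set_lebesgue_integral_def del: real_scaleR_def)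
  also have "\<dots> = integral {a<..<b} h" by (rule set_lebesgue_integral_eq_integral(2)[OF s])
  also have "\<dots> = integral {a..b} h" using integral_open_interval_real[of a b h] by simp
  finally show "(LINT t|lebesgue_on {0..T}. indicator {a<..<b} t * h t) = integral {a..b} h" .
qed

context assembly
begin

lemma grad_shear: "pu P x \<bullet> grad f x = pg P (x $ pl P) * partial (pk P) f x"
  by (simp add: pu_def grad_def inner_axis')

lemma rate_eq:
  assumes P: "P \<in> S n" "t \<in> ivP P" and \<phi>: "test_function J \<phi>" and J: "{0<..<T} \<subseteq> J"
  shows "(LINT x|torus. patch S prho t x * (dt J \<phi> t x + patch S (\<lambda>P t. pu P) t x \<bullet> grad (\<phi> t) x)) = piece_rate P \<phi> t"
proof -
  have t: "0 < t" "t < T" using ivP_sub[OF P(1)] P(2) by auto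
  note ok = S_ok[OF P(1)]
  have e: "patch S prho t x * (dt J \<phi> t x + patch S (\<lambda>P t. pu P) t x \<bullet> grad (\<phi> t) x) = prho P t x *
     (dird (1, 0) (joint \<phi>) (t, x) + pg P (x $ pl P) * dird (0, axis (pk P) 1) (joint \<phi>) (t, x))" for x
    by (simp add: patch_in[OF P] test_function_interior(4)[OF \<phi> J t] grad_shear test_function_line(3)[OF \<phi> J t])
  have c: "continuous_on unit_cube (\<lambda>x. prho P t x *
     (dird (1, 0) (joint \<phi>) (t, x) + pg P (x $ pl P) * dird (0, axis (pk P) 1) (joint \<phi>) (t, x)))"
  proof -
    have c1: "continuous_on unit_cube (prho P t)"
      using smooth_cont[OF smooth_slice[OF prho_joint(1)[OF ok], of t]] by simp
    have c2: "continuous_on unit_cube (\<lambda>x::real^'n. pg P (x $ pl P))"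
      by (rule smooth_cont[OF smooth_coord]) (use ok in \<open>simp add: pok_def\<close>)
    have c3: "continuous_on unit_cube (\<lambda>x. dird v (joint \<phi>) (t, x))" for v
      by (rule continuous_on_compose2[OF test_function_interior(2)[OF \<phi> J]]) (use t in \<open>auto intro!: continuous_intros\<close>)
    show ?thesis by (intro continuous_intros c1 c2 c3)
  qed
  show ?thesis unfolding e LINT_torus[OF c] piece_rate_def ..
qed

text \<open>Up to a finite stage the integral is the sum of the boundary terms, which tends to zero
  by assumption. The passage to all levels is dominated convergence, for which the integrability of
  the density and of the flux is needed. Keeping all pieces within \<open>{c..d}\<close> makes the
  derivatives of the test function bounded there.\<close>

lemma weak_formulation:
  assumes \<phi>: "test_function J \<phi>" and J: "{0<..<T} \<subseteq> J" and cd: "0 < c" "d < T"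
    and S_cd: "\<And>n P. P \<in> S n \<Longrightarrow> c \<le> pa P \<and> pb P \<le> d"
    and bd: "(\<lambda>n. \<Sum>m<n. \<Sum>P\<in>S m. bdP (pairing \<phi>) P) \<longlonglongrightarrow> 0"
    and fin: "(\<Sum>n. \<Sum>P\<in>S n. rho_cost 0 1 P) < top" "(\<Sum>n. \<Sum>P\<in>S n. cL P) < top"
  shows "(LINT t|lebesgue_on {0..T}. LINT x|torus. patch S prho t x * (dt J \<phi> t x + patch S (\<lambda>P t. pu P) t x \<bullet> grad (\<phi> t) x)) = 0"
proof -
  define H where "H t = (LINT x|torus. patch S prho t x * (dt J \<phi> t x + patch S (\<lambda>P t. pu P) t x \<bullet> grad (\<phi> t) x))" for t
  have HP: "H t = piece_rate P \<phi> t" if "P \<in> S n" "t \<in> ivP P" for n P t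
    unfolding H_def by (rule rate_eq[OF that \<phi> J])
  have H0: "H t = 0" if "\<And>n P. P \<in> S n \<Longrightarrow> t \<notin> ivP P" for t
  proof -
    have "patch S prho t = (\<lambda>x. 0)" by (rule patch_out) (rule that)
    then show ?thesis by (simp add: H_def)
  qed
  \<comment> \<open>\<open>s n\<close> is \<open>H\<close> restricted to the times covered by the
    first \<open>n\<close> levels, so that \<open>\<bar>H\<bar>\<close> itself is the dominating
    function.\<close>
  define s where "s n t = (\<Sum>P\<in>stage n. indicator (ivP P) t * piece_rate P \<phi> t)" for n t
  have inI: "0 < pa P" "pb P < T" "pok P" if "P \<in> stage n" for n P
    using stage_S[OF that] S_in S_ok by blast+
  have s_eq: "s n t = (if \<exists>P\<in>stage n. t \<in> ivP P then H t else 0)" for n t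
  proof (cases "\<exists>P\<in>stage n. t \<in> ivP P")
    case True
    then obtain P where P: "P \<in> stage n" "t \<in> ivP P" by blast
    have "s n t = (\<Sum>P'\<in>stage n. if P' = P then piece_rate P \<phi> t else 0)"
      unfolding s_def using stage_disj[OF P(1)] P(2) by (intro sum.cong refl) (auto simp: indicator_def)
    also have "\<dots> = piece_rate P \<phi> t" using P(1) stage_fin by simp
    also obtain m where "P \<in> S m" using stage_S[OF P(1)] by blast
    then have "piece_rate P \<phi> t = H t" using HP P(2) by simp
    finally show ?thesis using True by simp
  next
    case False
    then show ?thesis unfolding s_def by (auto intro!: sum.neutral simp: indicator_def)
  qed
  have lim: "(\<lambda>n. s n t) \<longlonglongrightarrow> H t" for t
  proof (cases rule: patch_cases[of t])
    case (1 m P)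
    have "s n t = H t" if "n > m" for n
    proof -
      have "P \<in> stage n" using 1(1) that by (auto simp: stage_def)
      then show ?thesis using 1(2) by (auto simp: s_eq)
    qed
    then have "\<forall>\<^sub>F n in sequentially. H t = s n t" by (intro eventually_sequentiallyI[of "Suc m"]) simp
    then show ?thesis by (rule Lim_transform_eventually[OF tendsto_const])
  next
    case 2
    have "H t = 0" by (rule H0) (rule 2)
    moreover have "\<not> (\<exists>P\<in>stage n. t \<in> ivP P)" for n using 2 by (auto simp: stage_def)
    ultimately show ?thesis by (simp add: s_eq)
  qed
  have int: "integrable (lebesgue_on {0..T}) (\<lambda>t. indicator (ivP P) t * piece_rate P \<phi> t)"
    "(LINT t|lebesgue_on {0..T}. indicator (ivP P) t * piece_rate P \<phi> t) = bdP (pairing \<phi>) P" if "P \<in> stage n" for P n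
    using indicator_interval_integral[OF piece_identity(1)[OF inI(3,1,2)[OF that] \<phi> J], of T] inI[OF that]
      piece_identity(2)[OF inI(3,1,2)[OF that] \<phi> J] by (simp_all add: ivP_def)
  have s_int: "integrable (lebesgue_on {0..T}) (s n)" for n
    unfolding s_def by (intro Bochner_Integration.integrable_sum int)
  have s_val: "integral\<^sup>L (lebesgue_on {0..T}) (s n) = (\<Sum>m<n. \<Sum>P\<in>S m. bdP (pairing \<phi>) P)" for n
  proof -
    have "integral\<^sup>L (lebesgue_on {0..T}) (s n) = (\<Sum>P\<in>stage n. LINT t|lebesgue_on {0..T}. indicator (ivP P) t * piece_rate P \<phi> t)"
      unfolding s_def by (rule Bochner_Integration.integral_sum) (rule int)
    also have "\<dots> = (\<Sum>P\<in>stage n. bdP (pairing \<phi>) P)" by (intro sum.cong refl int)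
    finally show ?thesis by (simp add: sum_stage)
  qed
  have H_meas: "H \<in> borel_measurable (lebesgue_on {0..T})"
    by (rule borel_measurable_LIMSEQ_metric[OF borel_measurable_integrable[OF s_int] lim])
  obtain C where C: "C \<ge> 0" "\<And>t x. t \<in> {c..d} \<Longrightarrow> x \<in> unit_cube \<Longrightarrow> \<bar>dird (1, 0) (joint \<phi>) (t, x)\<bar> \<le> C"
    "\<And>t x i. t \<in> {c..d} \<Longrightarrow> x \<in> unit_cube \<Longrightarrow> \<bar>dird (0, axis i 1) (joint \<phi>) (t, x)\<bar> \<le> C"
  proof -
    have "\<exists>K. \<forall>z\<in>{c..d} \<times> unit_cube. \<bar>dird v (joint \<phi>) z\<bar> \<le> K" for v
    proof -
      have "compact (dird v (joint \<phi>) ` ({c..d} \<times> unit_cube))"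
        using cd by (intro compact_continuous_image continuous_on_subset[OF test_function_interior(2)[OF \<phi> J]] compact_Times) auto
      from compact_imp_bounded[OF this] obtain K where "\<forall>y\<in>dird v (joint \<phi>) ` ({c..d} \<times> unit_cube). norm y \<le> K"
        unfolding bounded_iff by blast
      then show ?thesis by (intro exI[of _ K]) auto
    qed
    then obtain K where K: "\<And>v z. z \<in> {c..d} \<times> unit_cube \<Longrightarrow> \<bar>dird v (joint \<phi>) z\<bar> \<le> K v" by metis
    define C where "C = max 0 (max (K (1, 0)) (Max (range (\<lambda>i. K (0, axis i 1)))))"
    have "K (0, axis i 1) \<le> Max (range (\<lambda>i. K (0, axis i 1)))" for i by (intro Max_ge) auto
    then have "K (0, axis i 1) \<le> C" "K (1, 0) \<le> C" "0 \<le> C" for i by (auto simp: C_def le_max_iff_disj)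
    note Cb = this
    show ?thesis
    proof (rule that[of C])
      fix t :: real and x :: "real^'n" and i assume "t \<in> {c..d}" "x \<in> unit_cube"
      then have z: "(t, x) \<in> {c..d} \<times> unit_cube" by simp
      show "\<bar>dird (1, 0) (joint \<phi>) (t, x)\<bar> \<le> C" by (rule order_trans[OF K[OF z] Cb(2)])
      show "\<bar>dird (0, axis i 1) (joint \<phi>) (t, x)\<bar> \<le> C" by (rule order_trans[OF K[OF z] Cb(1)])
    qed (rule Cb(3))
  qed
  \<comment> \<open>The time derivative of the test function meets the density, and its spatial
    derivative meets the flux. Estimating the product \<open>prho * pg\<close> as a whole is
    essential, since the two factors have no useful separate bounds.\<close>
  define c' where "c' P = ennreal C * ((SUP t\<in>{pa P..pb P}. Ck_norm 0 (prho P t)) +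
    (SUP t\<in>{pa P..pb P}. ennreal (integral unit_cube (\<lambda>x. \<bar>prho P t x * pg P (x $ pl P)\<bar>))))" for P :: "'n piece"
  have Hb: "ennreal \<bar>H t\<bar> \<le> c' P" if P: "P \<in> S n" "t \<in> ivP P" for n P t
  proof -
    note ok = S_ok[OF P(1)]
    have tI: "t \<in> {pa P..pb P}" using P(2) by (auto simp: ivP_def)
    have tcd: "t \<in> {c..d}" using S_cd[OF P(1)] tI by auto
    have t: "0 < t" "t < T" using tcd cd by auto
    have sp: "smooth (prho P t)" using smooth_slice[OF prho_joint(1)[OF ok], of t] by simp
    have sg: "smooth (\<lambda>x::real^'n. pg P (x $ pl P))"
      by (rule smooth_coord) (use ok in \<open>simp add: pok_def\<close>)
    note cc = smooth_cont[OF sp] smooth_cont[OF sg]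
    have cdird: "continuous_on unit_cube (\<lambda>x. dird v (joint \<phi>) (t, x))" for v
      by (rule continuous_on_compose2[OF test_function_interior(2)[OF \<phi> J]]) (use t in \<open>auto intro!: continuous_intros\<close>)
    obtain K where K: "K \<ge> 0" "Ck_norm 0 (prho P t) = ennreal K"
    proof -
      obtain K' where "Ck_norm 0 (prho P t) \<le> ennreal K'" using smooth_periodic_bounded[OF sp prho_joint(2)[OF ok], of 0] by blast
      then have "Ck_norm 0 (prho P t) < top" using ennreal_less_top by (rule order_le_less_trans)
      then show ?thesis using that[of "enn2real (Ck_norm 0 (prho P t))"] by simp
    qed
    have Kx: "\<bar>prho P t x\<bar> \<le> K" for x
      using Ck_norm_ge[of "[]" 0 "prho P t" x] K by (simp add: ennreal_le_iff)
    let ?L = "integral unit_cube (\<lambda>x. \<bar>prho P t x * pg P (x $ pl P)\<bar>)"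
    have "norm (piece_rate P \<phi> t) \<le> integral unit_cube (\<lambda>x. K * C + C * \<bar>prho P t x * pg P (x $ pl P)\<bar>)"
      unfolding piece_rate_def
    proof (rule integral_norm_bound_integral)
      show "(\<lambda>x. prho P t x * (dird (1, 0) (joint \<phi>) (t, x) + pg P (x $ pl P) * dird (0, axis (pk P) 1) (joint \<phi>) (t, x))) integrable_on unit_cube"
        by (intro integrable_continuous continuous_intros cc cdird)
      show "(\<lambda>x. K * C + C * \<bar>prho P t x * pg P (x $ pl P)\<bar>) integrable_on unit_cube"
        by (intro integrable_continuous continuous_intros cc)
      fix x :: "real^'n" assume x: "x \<in> unit_cube"
      have 1: "\<bar>prho P t x * dird (1, 0) (joint \<phi>) (t, x)\<bar> \<le> K * C"
        unfolding abs_mult using K(1) by (intro mult_mono Kx C(2) tcd x) auto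
      have 2: "\<bar>dird (0, axis (pk P) 1) (joint \<phi>) (t, x)\<bar> * \<bar>prho P t x * pg P (x $ pl P)\<bar> \<le> C * \<bar>prho P t x * pg P (x $ pl P)\<bar>"
        by (intro mult_right_mono C(3) tcd x) auto
      show "norm (prho P t x * (dird (1, 0) (joint \<phi>) (t, x) + pg P (x $ pl P) * dird (0, axis (pk P) 1) (joint \<phi>) (t, x)))
         \<le> K * C + C * \<bar>prho P t x * pg P (x $ pl P)\<bar>"
      proof -
        have "prho P t x * (dird (1, 0) (joint \<phi>) (t, x) + pg P (x $ pl P) * dird (0, axis (pk P) 1) (joint \<phi>) (t, x))
          = prho P t x * dird (1, 0) (joint \<phi>) (t, x) + dird (0, axis (pk P) 1) (joint \<phi>) (t, x) * (prho P t x * pg P (x $ pl P))"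
          by (simp add: distrib_left)
        then show ?thesis
          using abs_triangle_ineq[of "prho P t x * dird (1, 0) (joint \<phi>) (t, x)" "dird (0, axis (pk P) 1) (joint \<phi>) (t, x) * (prho P t x * pg P (x $ pl P))"] 1 2
          unfolding real_norm_def by (simp only: abs_mult[of "dird (0, axis (pk P) 1) (joint \<phi>) (t, x)"])
      qed
    qed
    also have "\<dots> = C * (K + ?L)"
      by (subst integral_add) (auto intro!: integrable_continuous continuous_intros cc simp: distrib_left)
    finally have "ennreal \<bar>piece_rate P \<phi> t\<bar> \<le> ennreal (C * (K + ?L))" by (intro ennreal_leI) simp
    also have "\<dots> = ennreal C * (ennreal K + ennreal ?L)"
      using C(1) K(1) by (simp add: ennreal_mult ennreal_plus integral_nonneg integrable_continuous continuous_intros cc)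
    also have "\<dots> \<le> c' P"
      unfolding c'_def K(2)[symmetric] using tI by (intro mult_left_mono add_mono SUP_upper) auto
    finally show ?thesis unfolding HP[OF P] .
  qed
  have "(\<integral>\<^sup>+t. ennreal \<bar>H t\<bar> \<partial>(lebesgue_on {0..T})) \<le> (\<Sum>n. \<Sum>P\<in>S n. ennreal (pb P - pa P) * c' P)"
    by (rule nn_integral_pieces[OF Hb]) (auto simp: H0 intro!: ivP_lebesgue_on)
  also have "\<dots> = (\<Sum>n. ennreal C * ((\<Sum>P\<in>S n. rho_cost 0 1 P) + (\<Sum>P\<in>S n. cL P)))"
  proof (intro suminf_cong)
    fix n
    have e1: "enn_powr x 1 = x" for x by (cases x) (auto simp: enn_powr_def)
    show "(\<Sum>P\<in>S n. ennreal (pb P - pa P) * c' P) = ennreal C * ((\<Sum>P\<in>S n. rho_cost 0 1 P) + (\<Sum>P\<in>S n. cL P))"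
      unfolding sum.distrib[symmetric] sum_distrib_left
      by (intro sum.cong refl) (simp add: c'_def rho_cost_def cL_def e1 distrib_left mult_ac)
  qed
  also have "\<dots> = ennreal C * ((\<Sum>n. \<Sum>P\<in>S n. rho_cost 0 1 P) + (\<Sum>n. \<Sum>P\<in>S n. cL P))"
    unfolding ennreal_suminf_cmult suminf_add[OF summableI summableI] ..
  also have "\<dots> < \<infinity>" using fin by (simp add: ennreal_mult_less_top)
  finally have H_int: "integrable (lebesgue_on {0..T}) (\<lambda>t. \<bar>H t\<bar>)"
    using H_meas by (intro integrableI_bounded) auto
  have "(\<lambda>n. integral\<^sup>L (lebesgue_on {0..T}) (s n)) \<longlonglongrightarrow> integral\<^sup>L (lebesgue_on {0..T}) H"
    by (rule integral_dominated_convergence[OF H_meas borel_measurable_integrable[OF s_int] H_int])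
      (use lim in \<open>auto simp: s_eq\<close>)
  then have "integral\<^sup>L (lebesgue_on {0..T}) H = 0"
    unfolding s_val using bd LIMSEQ_unique by blast
  then show ?thesis by (simp add: H_def[abs_def])
qed

text \<open>It holds at every single time: the coefficient \<open>pg P (x $ pl P)\<close> is
  constant in the direction \<open>pk P\<close>, so that the integrand is a derivative of a periodic
  function along that axis.\<close>

lemma u_divergence_free:
  assumes \<phi>: "test_function {0<..<T} \<phi>"
  shows "(LINT t|lebesgue_on {0..T}. LINT x|torus. patch S (\<lambda>P t. pu P) t x \<bullet> grad (\<phi> t) x) = 0"
proof -
  have "(LINT x|torus. patch S (\<lambda>P t. pu P) t x \<bullet> grad (\<phi> t) x) = 0" for t
  proof (cases rule: patch_cases[of t])
    case (1 n P)
    have t: "0 < t" "t < T" using ivP_sub[OF 1(1)] 1(2) by auto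
    note ok = S_ok[OF 1(1)]
    have kl: "pk P \<noteq> pl P" using ok by (simp add: pok_def)
    have sg: "smooth (\<lambda>x::real^'n. pg P (x $ pl P))" "periodic (\<lambda>x::real^'n. pg P (x $ pl P))"
      using ok by (auto simp: pok_def intro!: smooth_coord periodic_coord)
    have c: "continuous_on UNIV (\<lambda>x. h (t, x))" if "continuous_on ({0<..<T} \<times> UNIV) h" for h :: "real\<times>(real^'n) \<Rightarrow> real"
      by (rule continuous_on_compose2[OF that]) (use t in \<open>auto intro!: continuous_intros\<close>)
    have cd: "continuous_on A (\<lambda>x. pg P (x $ pl P) * dird (0, axis (pk P) 1) (joint \<phi>) (t, x))" for A
      by (rule continuous_on_subset[of UNIV]) (intro continuous_intros smooth_cont[OF sg(1)] c test_function_interior(2)[OF \<phi> order.refl], simp)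
    have "(LINT x|torus. patch S (\<lambda>P t. pu P) t x \<bullet> grad (\<phi> t) x) =
        (LINT x|torus. pg P (x $ pl P) * dird (0, axis (pk P) 1) (joint \<phi>) (t, x))"
      by (simp add: patch_in[OF 1] grad_shear test_function_line(3)[OF \<phi> order.refl t])
    also have "\<dots> = integral unit_cube (\<lambda>x. pg P (x $ pl P) * dird (0, axis (pk P) 1) (joint \<phi>) (t, x))"
      by (rule LINT_torus[OF cd])
    also have "\<dots> = 0"
    proof (rule integral_torus_derivative[OF _ _ cd])
      have "continuous_on UNIV (\<lambda>x. joint \<phi> (t, x))" by (rule c[OF test_function_interior(3)[OF \<phi> order.refl]])
      then show "continuous_on UNIV (\<lambda>x. pg P (x $ pl P) * \<phi> t x)"
        by (intro continuous_intros smooth_cont[OF sg(1)]) (simp add: joint_def)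
      show "periodic (\<lambda>x. pg P (x $ pl P) * \<phi> t x)"
        using \<phi> by (intro periodic_mult sg) (simp add: test_function_def)
      fix x
      have "((\<lambda>s. pg P (x $ pl P) * \<phi> t (x + s *\<^sub>R axis (pk P) 1)) has_real_derivative pg P (x $ pl P) * dird (0, axis (pk P) 1) (joint \<phi>) (t, x)) (at 0)"
        by (intro DERIV_cmult test_function_line(2)[OF \<phi> order.refl t])
      then show "((\<lambda>s. pg P ((x + s *\<^sub>R axis (pk P) 1) $ pl P) * \<phi> t (x + s *\<^sub>R axis (pk P) 1)) has_real_derivative pg P (x $ pl P) * dird (0, axis (pk P) 1) (joint \<phi>) (t, x)) (at 0)"
        by (simp only: shear_const_along[OF kl])
    qed
    finally show ?thesis .
  next
    case 2
    then have "patch S (\<lambda>P t. pu P) t = (\<lambda>x. 0)" by (rule patch_out)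
    then show ?thesis by simp
  qed
  then show ?thesis by simp
qed

end

section \<open>Functions of mean zero are divergences\<close>

lemma periodic_line:
  assumes "periodic f" shows "f (x + (s + 1) *\<^sub>R axis k 1) = f (x + s *\<^sub>R axis k 1)"
  using periodicD[OF assms, of "x + s *\<^sub>R axis k 1" k] by (simp add: algebra_simps)

lemma smooth_line_joint:
  fixes r :: "real^'n \<Rightarrow> real"
  assumes "smooth r"
  shows "smooth (\<lambda>z::real\<times>(real^'n). r (snd z + fst z *\<^sub>R v))"
proof (rule smooth_compose[OF assms])
  fix c :: "real^'n"
  have "smooth (\<lambda>z::real\<times>(real^'n). snd z \<bullet> c)"
    by (rule smooth_linear) (rule bounded_linear_compose[OF bounded_linear_inner_left bounded_linear_snd])
  then show "smooth (\<lambda>z::real\<times>(real^'n). (snd z + fst z *\<^sub>R v) \<bullet> c)"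
    unfolding inner_add_left inner_scaleR_left by (intro smooth_add smooth_mult smooth_fst smooth_const)
qed

text \<open>\<open>r'\<close> is the mean of \<open>r\<close> along the axis \<open>k\<close>. The
  last conclusion, that invariance in other directions survives, allows the averaging to be iterated
  over the axes.\<close>

lemma direction_average:
  fixes r :: "real^'n \<Rightarrow> real"
  assumes r: "smooth r" "periodic r"
  shows "\<exists>a r'. smooth a \<and> periodic a \<and> smooth r' \<and> periodic r' \<and> (\<forall>x. r x = partial k a x + r' x) \<and>
    (\<forall>x s. r' (x + s *\<^sub>R axis k 1) = r' x) \<and> integral unit_cube r' = integral unit_cube r \<and>
    (\<forall>j. (\<forall>x s. r (x + s *\<^sub>R axis j 1) = r x) \<longrightarrow> (\<forall>x s. r' (x + s *\<^sub>R axis j 1) = r' x))"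
proof -
  let ?e = "axis k 1 :: real^'n"
  \<comment> \<open>Integration by parts along the line explains the weight: the integral of
    \<open>(s - 1/2)\<close> times the derivative of \<open>r\<close> is the boundary term, equal to
    \<open>r x\<close> by periodicity, minus the mean.\<close>
  define F where "F = (\<lambda>z::real\<times>(real^'n). (fst z - 1/2) * r (snd z + fst z *\<^sub>R ?e))"
  define G where "G = (\<lambda>z::real\<times>(real^'n). r (snd z + fst z *\<^sub>R ?e))"
  have sG: "smooth G" unfolding G_def by (rule smooth_line_joint[OF r(1)])
  have sF: "smooth F" unfolding F_def by (intro smooth_mult smooth_diff' smooth_fst smooth_const smooth_line_joint r)
  define a where "a = (\<lambda>x. integral {0..1} (\<lambda>s. F (s, x)))"
  define r' where "r' = (\<lambda>x. integral {0..1} (\<lambda>s. G (s, x)))"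
  have sa: "smooth a" unfolding a_def by (rule smooth_integral_parameter[OF sF])
  have sr: "smooth r'" unfolding r'_def by (rule smooth_integral_parameter[OF sG])
  have sh: "r (x + axis i 1 + s *\<^sub>R ?e) = r (x + s *\<^sub>R ?e)" for x i s
    using periodicD[OF r(2), of "x + s *\<^sub>R ?e" i] by (simp add: add_ac)
  have pa: "periodic a" "periodic r'" by (simp_all add: a_def r'_def F_def G_def periodic_def sh)
  have cr: "continuous_on S (\<lambda>s. r (x + s *\<^sub>R ?e))" "continuous_on S (\<lambda>s. partial k r (x + s *\<^sub>R ?e))" for S x
    by (rule continuous_on_compose2[OF smooth_cont[OF r(1), of UNIV]], auto intro!: continuous_intros)
      (rule continuous_on_compose2[OF smooth_cont[OF smooth_partial[OF r(1)], of UNIV]], auto intro!: continuous_intros)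
  have eq: "r x = partial k a x + r' x" for x
  proof -
    have dF: "dird (0, ?e) F (s, x) = (s - 1/2) * partial k r (x + s *\<^sub>R ?e)" for s
    proof -
      have "((\<lambda>h. F (s, x + h *\<^sub>R ?e)) has_real_derivative dird (0, ?e) F (s, x + 0 *\<^sub>R ?e)) (at 0)"
        by (rule smooth_vd[OF sF]) (auto intro!: derivative_eq_intros)
      moreover have "((\<lambda>h. F (s, x + h *\<^sub>R ?e)) has_real_derivative (s - 1/2) * partial k r (x + s *\<^sub>R ?e)) (at 0)"
      proof -
        have "((\<lambda>h. r ((x + s *\<^sub>R ?e) + h *\<^sub>R ?e)) has_real_derivative partial k r (x + s *\<^sub>R ?e)) (at 0)"
          using smooth_partial_line[OF r(1), of "x + s *\<^sub>R ?e" ?e 0] by (simp add: partial_eq_dird)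
        from DERIV_cmult[OF this, of "s - 1/2"] show ?thesis by (simp add: F_def add_ac)
      qed
      ultimately show ?thesis using DERIV_unique by fastforce
    qed
    have "((\<lambda>s. r (x + s *\<^sub>R ?e) + (s - 1/2) * partial k r (x + s *\<^sub>R ?e)) has_integral
        (1 - 1/2) * r (x + 1 *\<^sub>R ?e) - (0 - 1/2) * r (x + 0 *\<^sub>R ?e)) {0..1}"
    proof (rule fundamental_theorem_of_calculus)
      fix s :: real
      have "((\<lambda>s. r (x + s *\<^sub>R ?e)) has_real_derivative partial k r (x + s *\<^sub>R ?e)) (at s within {0..1})"
        using smooth_partial_line[OF r(1), of x ?e s] by (simp add: partial_eq_dird)
      then show "((\<lambda>s. (s - 1/2) * r (x + s *\<^sub>R ?e)) has_vector_derivative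
          r (x + s *\<^sub>R ?e) + (s - 1/2) * partial k r (x + s *\<^sub>R ?e)) (at s within {0..1})"
        unfolding has_real_derivative_iff_has_vector_derivative[symmetric]
        by (auto intro!: derivative_eq_intros)
    qed simp
    then have "integral {0..1} (\<lambda>s. r (x + s *\<^sub>R ?e) + (s - 1/2) * partial k r (x + s *\<^sub>R ?e)) = r x"
      using periodicD[OF r(2), of x k] by (simp add: integral_unique)
    moreover have "integral {0..1} (\<lambda>s. r (x + s *\<^sub>R ?e) + (s - 1/2) * partial k r (x + s *\<^sub>R ?e))
        = integral {0..1} (\<lambda>s. r (x + s *\<^sub>R ?e)) + integral {0..1} (\<lambda>s. (s - 1/2) * partial k r (x + s *\<^sub>R ?e))"
      by (intro integral_add integrable_continuous_interval continuous_intros cr)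
    moreover have "partial k a x = integral {0..1} (\<lambda>s. (s - 1/2) * partial k r (x + s *\<^sub>R ?e))"
      unfolding partial_eq_dird a_def dird_integral_parameter[OF sF] dF[unfolded partial_eq_dird] ..
    ultimately show ?thesis by (simp add: r'_def G_def)
  qed
  have inv: "r' (x + t *\<^sub>R ?e) = r' x" for x t
  proof -
    have "integral {0..1} (\<lambda>s. r (x + (t + s) *\<^sub>R ?e)) = integral {0..1} (\<lambda>s. r (x + s *\<^sub>R ?e))"
      by (rule integral_periodic_shift) (use cr periodic_line[OF r(2)] in auto)
    then show ?thesis by (simp add: r'_def G_def scaleR_add_left add_ac)
  qed
  have int: "integral unit_cube r' = integral unit_cube r"
  proof -
    have "integral unit_cube (partial k a) = 0"
      by (rule integral_torus_derivative[OF smooth_cont[OF sa] pa(1) smooth_cont[OF smooth_partial[OF sa]]])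
        (use smooth_partial_line[OF sa, of _ "axis k 1" 0] in \<open>simp add: partial_eq_dird\<close>)
    moreover have "integral unit_cube r = integral unit_cube (partial k a) + integral unit_cube r'"
      unfolding eq[abs_def] by (intro integral_add integrable_continuous smooth_cont smooth_partial sa sr)
    ultimately show ?thesis by simp
  qed
  have oth: "r' (x + t *\<^sub>R axis j 1) = r' x" if "\<And>x s. r (x + s *\<^sub>R axis j 1) = r x" for j x t
  proof -
    have "r (x + t *\<^sub>R axis j 1 + s *\<^sub>R ?e) = r (x + s *\<^sub>R ?e)" for s
      using that[of "x + s *\<^sub>R ?e" t] by (simp add: add_ac)
    then show ?thesis by (simp add: r'_def G_def)
  qed
  show ?thesis
    by (rule exI[of _ a], rule exI[of _ r'], intro conjI allI impI sa sr pa eq inv int) (use oth in blast)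
qed

text \<open>The dependence on the coordinates is averaged out one axis at a time, each average
  costing one derivative of a periodic function. What remains is constant and equals the mean, hence
  zero. This replaces solving Poisson's equation.\<close>

lemma mean_zero_divergence:
  fixes f :: "real^'n \<Rightarrow> real"
  assumes f: "smooth f" "periodic f" "integral unit_cube f = 0"
  shows "\<exists>a. (\<forall>k. smooth (a k) \<and> periodic (a k)) \<and> (\<forall>x. f x = (\<Sum>k\<in>UNIV. partial k (a k) x))"
proof -
  have "\<exists>a r. (\<forall>k. smooth (a k) \<and> periodic (a k)) \<and> smooth r \<and> periodic r \<and> (\<forall>x. f x = (\<Sum>k\<in>K. partial k (a k) x) + r x) \<and>
      (\<forall>k\<in>K. \<forall>x s. r (x + s *\<^sub>R axis k 1) = r x) \<and> integral unit_cube r = 0" if "finite K" for K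
    using that
  proof (induction K rule: finite_induct)
    case empty
    show ?case by (rule exI[of _ "\<lambda>k x. 0"], rule exI[of _ f]) (use f in \<open>auto simp: periodic_const\<close>)
  next
    case (insert k K)
    from insert.IH obtain a r where ar': "(\<forall>k. smooth (a k) \<and> periodic (a k)) \<and> smooth r \<and> periodic r \<and>
      (\<forall>x. f x = (\<Sum>k\<in>K. partial k (a k) x) + r x) \<and>
      (\<forall>k\<in>K. \<forall>x s. r (x + s *\<^sub>R axis k 1) = r x) \<and> integral unit_cube r = 0" by (elim exE)
    then have ar: "\<And>k. smooth (a k)" "\<And>k. periodic (a k)" "smooth r" "periodic r"
      "\<And>x. f x = (\<Sum>k\<in>K. partial k (a k) x) + r x" "\<And>k x s. k \<in> K \<Longrightarrow> r (x + s *\<^sub>R axis k 1) = r x" "integral unit_cube r = 0"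
      by simp_all
    obtain b r' where b: "smooth b" "periodic b" "smooth r'" "periodic r'" "\<And>x. r x = partial k b x + r' x"
      "\<And>x s. r' (x + s *\<^sub>R axis k 1) = r' x" "integral unit_cube r' = integral unit_cube r"
      "\<And>j. (\<forall>x s. r (x + s *\<^sub>R axis j 1) = r x) \<Longrightarrow> (\<forall>x s. r' (x + s *\<^sub>R axis j 1) = r' x)"
      using direction_average[OF ar(3,4), of k] by auto
    have "(\<Sum>j\<in>insert k K. partial j ((a(k := b)) j) x) = partial k b x + (\<Sum>j\<in>K. partial j (a j) x)" for x
      using insert(1,2) by (simp add: sum.insert) (intro sum.cong, auto)
    then have "f x = (\<Sum>j\<in>insert k K. partial j ((a(k := b)) j) x) + r' x" for x
      using ar(5) b(5) by simp
    moreover have "\<forall>j\<in>insert k K. \<forall>x s. r' (x + s *\<^sub>R axis j 1) = r' x"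
      using b(6) b(8) ar(6) by auto
    ultimately show ?case
      using ar(1,2,7) b(1-4,7) by (intro exI[of _ "a(k := b)"] exI[of _ r']) auto
  qed
  from this[of UNIV] obtain a r where ar: "\<forall>k. smooth (a k) \<and> periodic (a k)" "smooth r"
    "\<And>x. f x = (\<Sum>k\<in>UNIV. partial k (a k) x) + r x" "\<And>k x s. r (x + s *\<^sub>R axis k 1) = r x" "integral unit_cube r = 0"
    by auto
  have "r (x + (\<Sum>i\<in>I. (y $ i) *\<^sub>R axis i 1)) = r x" if "finite I" for I x y
    using that
  proof (induction I arbitrary: x rule: finite_induct)
    case (insert i I)
    have "r (x + (\<Sum>i\<in>insert i I. (y $ i) *\<^sub>R axis i 1)) = r ((x + (\<Sum>i\<in>I. (y $ i) *\<^sub>R axis i 1)) + (y $ i) *\<^sub>R axis i 1)"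
      using insert(1,2) by (simp add: add_ac)
    then show ?case using ar(4) insert.IH by simp
  qed simp
  from this[of UNIV 0] have r0: "r x = r 0" for x
    using basis_expansion[of x, unfolded scalar_mult_eq_scaleR] by (metis add_0 finite)
  then have "r = (\<lambda>x. r 0)" by (rule ext)
  then have "integral unit_cube (\<lambda>x::real^'n. r 0) = 0" using ar(5) by simp
  then have "r x = 0" for x using r0 by simp
  then show ?thesis using ar(1,3) by (intro exI[of _ a]) simp
qed

section \<open>Creating and destroying a density\<close>

text \<open>One node for each direction, placed one after the other. The intermediate densities do
  not depend on the interval, so that a single constant \<open>D\<close> serves for all intervals
  and the cost tends to zero with their length.\<close>

lemma node_ladder:
  fixes A :: "real^'n::finite \<Rightarrow> real" and a :: "'n \<Rightarrow> real^'n \<Rightarrow> real"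
  assumes "finite K" "smooth A" "periodic A" "\<And>k. smooth (a k)" "\<And>k. periodic (a k)"
  shows "\<exists>D\<ge>0. \<forall>s e. s < e \<longrightarrow> (\<exists>N. nodes_ok N \<and> (\<forall>\<nu>\<in>N. s \<le> na \<nu> \<and> nb \<nu> \<le> e) \<and>
    (\<forall>\<Phi>. (\<Sum>\<nu>\<in>N. bdN \<Phi> \<nu>) = \<Phi> e (\<lambda>x. A x + (\<Sum>k\<in>K. partial k (a k) x)) - \<Phi> s A) \<and>
    (\<Sum>\<nu>\<in>N. nR q \<nu>) \<le> ennreal ((e - s) * D))"
  using assms
proof (induction K arbitrary: A rule: finite_induct)
  case empty
  obtain C where C: "C \<ge> 0" "Ck_norm q A \<le> ennreal C" using smooth_periodic_bounded[OF empty(1,2)] by blast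
  show ?case
  proof (intro exI[of _ "(1 + C) ^ q"] conjI allI impI)
    fix s e :: real assume se: "s < e"
    \<comment> \<open>A node with zero potential fills the rest of the interval, during which the
      density keeps its final value; its direction is arbitrary.\<close>
    define \<nu> where "\<nu> = Node s e A undefined (\<lambda>x. 0)"
    have "nodes_ok {\<nu>}" using se empty by (auto simp: nodes_ok_def nok_def \<nu>_def periodic_const)
    moreover have "nB \<nu> = A" by (simp add: nB_def fun_eq_iff \<nu>_def partial_const)
    then have "(\<Sum>\<nu>\<in>{\<nu>}. bdN \<Phi> \<nu>) = \<Phi> e (\<lambda>x. A x + (\<Sum>k\<in>{}. partial k (a k) x)) - \<Phi> s A" for \<Phi>
      by (simp add: bdN_def) (simp add: \<nu>_def)
    moreover have "(\<Sum>\<nu>\<in>{\<nu>}. nR q \<nu>) \<le> ennreal ((e - s) * (1 + C) ^ q)"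
    proof -
      have "1 + Ck_norm q A \<le> ennreal (1 + C)" using C by (simp add: ennreal_plus add_left_mono)
      then have "(1 + Ck_norm q A) ^ q \<le> ennreal ((1 + C) ^ q)"
        using power_mono[of "1 + Ck_norm q A" "ennreal (1 + C)" q] C(1) by (simp add: ennreal_power del: ennreal_plus)
      then show ?thesis using se C(1) by (simp add: nR_def \<nu>_def ennreal_mult mult_left_mono)
    qed
    ultimately show "\<exists>N. nodes_ok N \<and> (\<forall>\<nu>\<in>N. s \<le> na \<nu> \<and> nb \<nu> \<le> e) \<and>
      (\<forall>\<Phi>. (\<Sum>\<nu>\<in>N. bdN \<Phi> \<nu>) = \<Phi> e (\<lambda>x. A x + (\<Sum>k\<in>{}. partial k (a k) x)) - \<Phi> s A) \<and>
      (\<Sum>\<nu>\<in>N. nR q \<nu>) \<le> ennreal ((e - s) * (1 + C) ^ q)"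
      by (intro exI[of _ "{\<nu>}"] conjI allI) (auto simp: \<nu>_def)
  qed (use C in simp)
next
  case (insert k K)
  define B where "B x = A x + partial k (a k) x" for x
  have sB: "smooth B" "periodic B" unfolding B_def[abs_def]
    by (intro smooth_add periodic_add smooth_partial periodic_partial insert.prems)+
  obtain C where C: "C \<ge> 0" "Ck_norm q A \<le> ennreal C" using smooth_periodic_bounded[OF insert.prems(1,2)] by blast
  obtain D where D: "D \<ge> 0" "\<And>s e. s < e \<Longrightarrow> (\<exists>N. nodes_ok N \<and> (\<forall>\<nu>\<in>N. s \<le> na \<nu> \<and> nb \<nu> \<le> e) \<and>
    (\<forall>\<Phi>. (\<Sum>\<nu>\<in>N. bdN \<Phi> \<nu>) = \<Phi> e (\<lambda>x. B x + (\<Sum>k\<in>K. partial k (a k) x)) - \<Phi> s B) \<and>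
    (\<Sum>\<nu>\<in>N. nR q \<nu>) \<le> ennreal ((e - s) * D))"
    using insert.IH[OF sB insert.prems(3,4)] by auto
  show ?case
  proof (intro exI[of _ "(1 + C) ^ q + D"] conjI allI impI)
    fix s e :: real assume se: "s < e"
    define m where "m = (s + e) / 2"
    have m: "s < m" "m < e" using se by (auto simp: m_def)
    obtain N where N: "nodes_ok N" "\<And>\<nu>. \<nu> \<in> N \<Longrightarrow> m \<le> na \<nu> \<and> nb \<nu> \<le> e"
      "\<And>\<Phi>. (\<Sum>\<nu>\<in>N. bdN \<Phi> \<nu>) = \<Phi> e (\<lambda>x. B x + (\<Sum>k\<in>K. partial k (a k) x)) - \<Phi> m B"
      "(\<Sum>\<nu>\<in>N. nR q \<nu>) \<le> ennreal ((e - m) * D)"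
      using D(2)[OF m(2)] by auto
    define \<nu> where "\<nu> = Node s m A k (a k)"
    have fin: "finite N" using N(1) by (simp add: nodes_ok_def)
    have new: "\<nu> \<notin> N" using N(2)[of \<nu>] m by (auto simp: \<nu>_def)
    have ok: "nok \<nu>" using m insert.prems by (simp add: nok_def \<nu>_def)
    have dis: "ivN \<nu> \<inter> ivN \<mu> = {}" if "\<mu> \<in> N" for \<mu> using N(2)[OF that] by (auto simp: ivN_def \<nu>_def)
    have "nodes_ok (insert \<nu> N)"
      using N(1) ok dis by (auto simp: nodes_ok_def Int_commute)
    moreover have "\<forall>\<mu>\<in>insert \<nu> N. s \<le> na \<mu> \<and> nb \<mu> \<le> e" 
    proof
      fix \<mu> assume "\<mu> \<in> insert \<nu> N"
      then consider "\<mu> = \<nu>" | "\<mu> \<in> N" by blast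
      then show "s \<le> na \<mu> \<and> nb \<mu> \<le> e" using N(2)[of \<mu>] m by cases (auto simp: \<nu>_def)
    qed
    moreover have "(\<Sum>\<mu>\<in>insert \<nu> N. bdN \<Phi> \<mu>) = \<Phi> e (\<lambda>x. A x + (\<Sum>k\<in>insert k K. partial k (a k) x)) - \<Phi> s A" for \<Phi>
    proof -
      have "nB \<nu> = B" by (simp add: nB_def fun_eq_iff \<nu>_def B_def)
      then have "bdN \<Phi> \<nu> = \<Phi> m B - \<Phi> s A" by (simp add: bdN_def) (simp add: \<nu>_def)
      moreover have "(\<lambda>x. B x + (\<Sum>k\<in>K. partial k (a k) x)) = (\<lambda>x. A x + (\<Sum>k\<in>insert k K. partial k (a k) x))"
        using insert(1,2) by (simp add: B_def fun_eq_iff)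
      ultimately show ?thesis using fin new N(3)[of \<Phi>] by simp
    qed
    moreover have "(\<Sum>\<mu>\<in>insert \<nu> N. nR q \<mu>) \<le> ennreal ((e - s) * ((1 + C) ^ q + D))"
    proof -
      have "1 + Ck_norm q A \<le> ennreal (1 + C)" using C by (simp add: ennreal_plus add_left_mono)
      then have "(1 + Ck_norm q A) ^ q \<le> ennreal ((1 + C) ^ q)"
        using power_mono[of "1 + Ck_norm q A" "ennreal (1 + C)" q] C(1) by (simp add: ennreal_power del: ennreal_plus)
      then have "nR q \<nu> \<le> ennreal ((m - s) * (1 + C) ^ q)"
        using m C(1) by (simp add: nR_def \<nu>_def ennreal_mult mult_left_mono)
      also have "\<dots> \<le> ennreal ((e - s) * (1 + C) ^ q)" using m C(1) by (intro ennreal_leI mult_right_mono) auto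
      finally have "nR q \<nu> + (\<Sum>\<mu>\<in>N. nR q \<mu>) \<le> ennreal ((e - s) * (1 + C) ^ q) + ennreal ((e - s) * D)"
        using m D(1) by (intro add_mono order_trans[OF N(4)] ennreal_leI mult_right_mono) auto
      then show ?thesis using fin new se C(1) D(1) by (simp add: distrib_left ennreal_plus)
    qed
    ultimately show "\<exists>N. nodes_ok N \<and> (\<forall>\<nu>\<in>N. s \<le> na \<nu> \<and> nb \<nu> \<le> e) \<and>
      (\<forall>\<Phi>. (\<Sum>\<nu>\<in>N. bdN \<Phi> \<nu>) = \<Phi> e (\<lambda>x. A x + (\<Sum>k\<in>insert k K. partial k (a k) x)) - \<Phi> s A) \<and>
      (\<Sum>\<nu>\<in>N. nR q \<nu>) \<le> ennreal ((e - s) * ((1 + C) ^ q + D))" by blast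
  qed (use C D in simp)
qed

text \<open>A ladder with the potentials \<open>a\<close> leads from zero to \<open>f\<close>, one
  with \<open>- a\<close> leads back, and \<open>f\<close> rests in between. With the zero density
  at both ends, the cells of a mesh can be treated independently.\<close>

lemma create_and_destroy:
  fixes f :: "real^'n::finite \<Rightarrow> real"
  assumes f: "smooth f" "periodic f" "integral unit_cube f = 0" and t: "t0 < t1" and \<delta>: "\<delta> > 0" and kl: "k \<noteq> (l :: 'n)"
  shows "\<exists>\<tau> N. 0 < \<tau> \<and> 2 * \<tau> < t1 - t0 \<and> \<tau> \<le> \<delta> \<and> nodes_ok N \<and>
    (\<forall>\<nu>\<in>N. (t0 \<le> na \<nu> \<and> nb \<nu> \<le> t0 + \<tau>) \<or> (t1 - \<tau> \<le> na \<nu> \<and> nb \<nu> \<le> t1)) \<and>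
    (\<forall>\<Phi>. bdP \<Phi> (Piece (t0 + \<tau>) (t1 - \<tau>) f k l (\<lambda>_. 0)) + (\<Sum>\<nu>\<in>N. bdN \<Phi> \<nu>) = \<Phi> t1 (\<lambda>x. 0) - \<Phi> t0 (\<lambda>x. 0)) \<and>
    (\<Sum>\<nu>\<in>N. nR q \<nu>) \<le> ennreal \<delta>"
proof -
  obtain a where a: "\<And>k. smooth (a k)" "\<And>k. periodic (a k)" "\<And>x. f x = (\<Sum>k\<in>UNIV. partial k (a k) x)"
    using mean_zero_divergence[OF f] by auto
  obtain D1 where D1: "D1 \<ge> 0" "\<And>s e. s < e \<Longrightarrow> (\<exists>N. nodes_ok N \<and> (\<forall>\<nu>\<in>N. s \<le> na \<nu> \<and> nb \<nu> \<le> e) \<and>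
    (\<forall>\<Phi>. (\<Sum>\<nu>\<in>N. bdN \<Phi> \<nu>) = \<Phi> e (\<lambda>x. 0 + (\<Sum>k\<in>UNIV. partial k (a k) x)) - \<Phi> s (\<lambda>x. 0)) \<and>
    (\<Sum>\<nu>\<in>N. nR q \<nu>) \<le> ennreal ((e - s) * D1))"
    using node_ladder[of UNIV "\<lambda>x. 0" a q, OF finite smooth_const periodic_const a(1,2)] by auto
  obtain D2 where D2: "D2 \<ge> 0" "\<And>s e. s < e \<Longrightarrow> (\<exists>N. nodes_ok N \<and> (\<forall>\<nu>\<in>N. s \<le> na \<nu> \<and> nb \<nu> \<le> e) \<and>
    (\<forall>\<Phi>. (\<Sum>\<nu>\<in>N. bdN \<Phi> \<nu>) = \<Phi> e (\<lambda>x. f x + (\<Sum>k\<in>UNIV. partial k (\<lambda>x. - a k x) x)) - \<Phi> s f) \<and>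
    (\<Sum>\<nu>\<in>N. nR q \<nu>) \<le> ennreal ((e - s) * D2))"
    using node_ladder[of UNIV f "\<lambda>k x. - a k x" q, OF finite f(1,2) smooth_minus[OF a(1)] periodic_minus[OF a(2)]] by auto
  \<comment> \<open>\<open>D1\<close> and \<open>D2\<close> are known before the lengths of the
    ladders, which may therefore be taken short enough to pay for both.\<close>
  define \<tau> where "\<tau> = min (min \<delta> ((t1 - t0) / 4)) (\<delta> / (1 + D1 + D2))"
  have \<tau>: "\<tau> > 0" "\<tau> \<le> \<delta>" "4 * \<tau> \<le> t1 - t0" "\<tau> * D1 + \<tau> * D2 \<le> \<delta>"
  proof -
    show t0: "\<tau> > 0" using \<delta> t D1(1) D2(1) by (simp add: \<tau>_def)
    show "\<tau> \<le> \<delta>" by (simp add: \<tau>_def)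
    have "\<tau> \<le> (t1 - t0) / 4" unfolding \<tau>_def by (rule order_trans[OF min.cobounded1 min.cobounded2])
    then show "4 * \<tau> \<le> t1 - t0" by simp
    have "\<tau> \<le> \<delta> / (1 + D1 + D2)" unfolding \<tau>_def by (rule min.cobounded2)
    then have "\<tau> * (1 + D1 + D2) \<le> \<delta>" using D1(1) D2(1) by (simp add: pos_le_divide_eq)
    then show "\<tau> * D1 + \<tau> * D2 \<le> \<delta>" using t0 by (simp add: distrib_left)
  qed
  obtain N1 where N1: "nodes_ok N1" "\<And>\<nu>. \<nu> \<in> N1 \<Longrightarrow> t0 \<le> na \<nu> \<and> nb \<nu> \<le> t0 + \<tau>"
    "\<And>\<Phi>. (\<Sum>\<nu>\<in>N1. bdN \<Phi> \<nu>) = \<Phi> (t0 + \<tau>) (\<lambda>x. 0 + (\<Sum>k\<in>UNIV. partial k (a k) x)) - \<Phi> t0 (\<lambda>x. 0)"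
    "(\<Sum>\<nu>\<in>N1. nR q \<nu>) \<le> ennreal (\<tau> * D1)"
    using D1(2)[of t0 "t0 + \<tau>"] \<tau>(1) by auto
  obtain N2 where N2: "nodes_ok N2" "\<And>\<nu>. \<nu> \<in> N2 \<Longrightarrow> t1 - \<tau> \<le> na \<nu> \<and> nb \<nu> \<le> t1"
    "\<And>\<Phi>. (\<Sum>\<nu>\<in>N2. bdN \<Phi> \<nu>) = \<Phi> t1 (\<lambda>x. f x + (\<Sum>k\<in>UNIV. partial k (\<lambda>x. - a k x) x)) - \<Phi> (t1 - \<tau>) f"
    "(\<Sum>\<nu>\<in>N2. nR q \<nu>) \<le> ennreal (\<tau> * D2)"
    using D2(2)[of "t1 - \<tau>" t1] \<tau>(1) by auto
  have dis: "ivN \<nu> \<inter> ivN \<mu> = {}" if "\<nu> \<in> N1" "\<mu> \<in> N2" for \<nu> \<mu>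
    using N1(2)[OF that(1)] N2(2)[OF that(2)] \<tau> by (auto simp: ivN_def)
  have okN: "nok \<nu>" if "\<nu> \<in> N1 \<union> N2" for \<nu> using that N1(1) N2(1) by (auto simp: nodes_ok_def)
  have ne: "N1 \<inter> N2 = {}"
  proof (rule ccontr)
    assume "N1 \<inter> N2 \<noteq> {}"
    then obtain \<nu> where "\<nu> \<in> N1" "\<nu> \<in> N2" by blast
    then show False using dis[of \<nu> \<nu>] ivN_nonempty[OF okN, of \<nu>] by simp
  qed
  have fin: "finite N1" "finite N2" using N1(1) N2(1) by (auto simp: nodes_ok_def)
  have sum: "(\<Sum>\<nu>\<in>N1 \<union> N2. F \<nu>) = (\<Sum>\<nu>\<in>N1. F \<nu>) + (\<Sum>\<nu>\<in>N2. F \<nu>)" for F :: "'n node \<Rightarrow> 'b::comm_monoid_add"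
    by (rule sum.union_disjoint[OF fin ne])
  have e1: "(\<lambda>x. 0 + (\<Sum>k\<in>UNIV. partial k (a k) x)) = f" using a(3) by (simp add: fun_eq_iff)
  have e2: "(\<lambda>x. f x + (\<Sum>k\<in>UNIV. partial k (\<lambda>x. - a k x) x)) = (\<lambda>x. 0)"
    by (simp add: fun_eq_iff a(3) partial_minus[OF a(1)] sum_negf)
  have pr: "prho (Piece s e f k l (\<lambda>_. 0)) t = f" for s e t by (simp add: prho_def fun_eq_iff shear_def)
  show ?thesis
  proof (rule exI[of _ \<tau>], rule exI[of _ "N1 \<union> N2"], intro conjI allI)
    show "nodes_ok (N1 \<union> N2)"
      unfolding nodes_ok_def
    proof (intro conjI ballI impI okN)
      fix \<nu> \<mu> assume "\<nu> \<in> N1 \<union> N2" "\<mu> \<in> N1 \<union> N2" "\<nu> \<noteq> \<mu>"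
      then consider "\<nu> \<in> N1" "\<mu> \<in> N1" | "\<nu> \<in> N1" "\<mu> \<in> N2" | "\<mu> \<in> N1" "\<nu> \<in> N2" | "\<nu> \<in> N2" "\<mu> \<in> N2" by blast
      then show "ivN \<nu> \<inter> ivN \<mu> = {}"
      proof cases
        case 1 then show ?thesis using N1(1) \<open>\<nu> \<noteq> \<mu>\<close> by (simp add: nodes_ok_def)
      next
        case 2 then show ?thesis by (rule dis)
      next
        case 3 then have "ivN \<mu> \<inter> ivN \<nu> = {}" by (rule dis)
        then show ?thesis by (simp add: Int_commute)
      next
        case 4 then show ?thesis using N2(1) \<open>\<nu> \<noteq> \<mu>\<close> by (simp add: nodes_ok_def)
      qed
    qed (use fin in auto)
    show "\<forall>\<nu>\<in>N1 \<union> N2. (t0 \<le> na \<nu> \<and> nb \<nu> \<le> t0 + \<tau>) \<or> (t1 - \<tau> \<le> na \<nu> \<and> nb \<nu> \<le> t1)"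
      using N1(2) N2(2) by blast
    show "bdP \<Phi> (Piece (t0 + \<tau>) (t1 - \<tau>) f k l (\<lambda>_. 0)) + (\<Sum>\<nu>\<in>N1 \<union> N2. bdN \<Phi> \<nu>) = \<Phi> t1 (\<lambda>x. 0) - \<Phi> t0 (\<lambda>x. 0)" for \<Phi>
      unfolding sum N1(3) N2(3) e1 e2 bdP_def pr piece.sel by simp
    have "(\<Sum>\<nu>\<in>N1 \<union> N2. nR q \<nu>) \<le> ennreal (\<tau> * D1) + ennreal (\<tau> * D2)"
      unfolding sum by (intro add_mono N1 N2)
    also have "\<dots> = ennreal (\<tau> * D1 + \<tau> * D2)" using \<tau>(1) D1(1) D2(1) by (simp add: ennreal_plus)
    also have "\<dots> \<le> ennreal \<delta>" by (rule ennreal_leI[OF \<tau>(4)])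
    finally show "(\<Sum>\<nu>\<in>N1 \<union> N2. nR q \<nu>) \<le> ennreal \<delta>" .
  qed (use \<tau> in auto)
qed

text \<open>The jump is integrated by parts, which leaves the potential against a derivative of the
  test function: this gives \<open>nL\<close>. The rest is the initial density against an increment
  of the test function, which is at most the duration times the supremum of the density, and is
  absorbed by \<open>nR\<close> since \<open>q \<ge> 1\<close>. Thus unresolved nodes contribute
  little to the weak formulation, however large their densities are.\<close>

lemma node_boundary_bound:
  fixes \<phi> :: "real \<Rightarrow> real^'n::finite \<Rightarrow> real"
  assumes \<phi>: "test_function J \<phi>" and J: "{0<..<T} \<subseteq> J" and cd: "0 < c" "d < T"
  shows "\<exists>C\<ge>0. \<forall>\<nu> q. nok \<nu> \<and> c \<le> na \<nu> \<and> nb \<nu> \<le> d \<and> q \<ge> 1 \<longrightarrow>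
    ennreal \<bar>bdN (pairing \<phi>) \<nu>\<bar> \<le> ennreal C * (nL \<nu> + nR q \<nu>)"
proof -
  have "\<exists>K. \<forall>z\<in>{c..d} \<times> unit_cube. \<bar>dird v (joint \<phi>) z\<bar> \<le> K" for v
  proof -
    have "compact (dird v (joint \<phi>) ` ({c..d} \<times> unit_cube))"
      using cd by (intro compact_continuous_image continuous_on_subset[OF test_function_interior(2)[OF \<phi> J]] compact_Times) auto
    from compact_imp_bounded[OF this] obtain K where "\<forall>y\<in>dird v (joint \<phi>) ` ({c..d} \<times> unit_cube). norm y \<le> K"
      unfolding bounded_iff by blast
    then show ?thesis by (intro exI[of _ K]) auto
  qed
  then obtain K where K: "\<And>v z. z \<in> {c..d} \<times> unit_cube \<Longrightarrow> \<bar>dird v (joint \<phi>) z\<bar> \<le> K v" by metis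
  define C where "C = max 0 (max (K (1, 0)) (Max (range (\<lambda>i. K (0, axis i 1)))))"
  have "K (0, axis i 1) \<le> Max (range (\<lambda>i. K (0, axis i 1)))" for i by (intro Max_ge) auto
  then have C: "K (0, axis i 1) \<le> C" "K (1, 0) \<le> C" "0 \<le> C" for i by (auto simp: C_def le_max_iff_disj)
  show ?thesis
  proof (intro exI[of _ C] conjI allI impI C(3))
    fix \<nu> :: "'n node" and q :: nat assume a: "nok \<nu> \<and> c \<le> na \<nu> \<and> nb \<nu> \<le> d \<and> q \<ge> 1"
    obtain s e A k f where \<nu>: "\<nu> = Node s e A k f" by (cases \<nu>)
    have ok: "s < e" "smooth A" "periodic A" "smooth f" "periodic f" "c \<le> s" "e \<le> d" "q \<ge> 1"
      using a by (auto simp: nok_def \<nu>)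
    have I: "s \<in> {c..d}" "e \<in> {c..d}" and eT: "0 < e" "e < T" "0 < s" "s < T" using ok cd by auto
    have c\<phi>: "continuous_on UNIV (\<phi> t)" if "0 < t" "t < T" for t
    proof -
      have "continuous_on UNIV (\<lambda>x. joint \<phi> (t, x))"
        by (rule continuous_on_compose2[OF test_function_interior(3)[OF \<phi> J]]) (use that in \<open>auto intro!: continuous_intros\<close>)
      then show ?thesis by (simp add: joint_def)
    qed
    have c\<phi>': "continuous_on S (\<phi> t)" if "0 < t" "t < T" for t S by (rule continuous_on_subset[OF c\<phi>[OF that]]) simp
    have cd': "continuous_on S (\<lambda>x. dird v (joint \<phi>) (e, x))" for v S
      by (rule continuous_on_compose2[OF test_function_interior(2)[OF \<phi> J]]) (use eT in \<open>auto intro!: continuous_intros\<close>)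
    have cA: "continuous_on S A" "continuous_on S f" "continuous_on S (partial k f)" for S
      by (intro smooth_cont smooth_partial ok)+
    have "bdN (pairing \<phi>) \<nu> = integral unit_cube (\<lambda>x. (A x + partial k f x) * \<phi> e x) - integral unit_cube (\<lambda>x. A x * \<phi> s x)"
      by (simp add: bdN_def pairing_def nB_def \<nu>)
    also have "\<dots> = integral unit_cube (\<lambda>x. partial k f x * \<phi> e x) + integral unit_cube (\<lambda>x. A x * (\<phi> e x - \<phi> s x))"
    proof -
      have "integral unit_cube (\<lambda>x. (A x + partial k f x) * \<phi> e x) = integral unit_cube (\<lambda>x. A x * \<phi> e x) + integral unit_cube (\<lambda>x. partial k f x * \<phi> e x)"
        unfolding distrib_right by (intro integral_add integrable_continuous continuous_intros cA c\<phi>' eT)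
      moreover have "integral unit_cube (\<lambda>x. A x * (\<phi> e x - \<phi> s x)) = integral unit_cube (\<lambda>x. A x * \<phi> e x) - integral unit_cube (\<lambda>x. A x * \<phi> s x)"
        unfolding right_diff_distrib by (intro integral_diff integrable_continuous continuous_intros cA c\<phi>' eT)
      ultimately show ?thesis by simp
    qed
    also have "integral unit_cube (\<lambda>x. partial k f x * \<phi> e x) = - integral unit_cube (\<lambda>x. f x * dird (0, axis k 1) (joint \<phi>) (e, x))"
      using \<phi> by (intro integral_torus_parts ok c\<phi> eT cd' test_function_line(2)[OF \<phi> J]) (simp add: test_function_def)
    finally have eq: "bdN (pairing \<phi>) \<nu> = - integral unit_cube (\<lambda>x. f x * dird (0, axis k 1) (joint \<phi>) (e, x)) + integral unit_cube (\<lambda>x. A x * (\<phi> e x - \<phi> s x))" .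
    have 1: "\<bar>integral unit_cube (\<lambda>x. f x * dird (0, axis k 1) (joint \<phi>) (e, x))\<bar> \<le> C * integral unit_cube (\<lambda>x. \<bar>f x\<bar>)"
    proof -
      have "norm (integral unit_cube (\<lambda>x. f x * dird (0, axis k 1) (joint \<phi>) (e, x))) \<le> integral unit_cube (\<lambda>x. C * \<bar>f x\<bar>)"
      proof (rule integral_norm_bound_integral)
        fix x :: "real^'n" assume x: "x \<in> unit_cube"
        have "\<bar>dird (0, axis k 1) (joint \<phi>) (e, x)\<bar> \<le> C" by (rule order_trans[OF K C(1)]) (use x I in simp)
        from mult_right_mono[OF this, of "\<bar>f x\<bar>"]
        show "norm (f x * dird (0, axis k 1) (joint \<phi>) (e, x)) \<le> C * \<bar>f x\<bar>" by (simp add: abs_mult mult.commute)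
      qed (intro integrable_continuous continuous_intros cA cd')+
      then show ?thesis by simp
    qed
    obtain KA where KA: "KA \<ge> 0" "Ck_norm q A = ennreal KA"
    proof -
      obtain K' where "Ck_norm q A \<le> ennreal K'" using smooth_periodic_bounded[OF ok(2,3), of q] by blast
      then have "Ck_norm q A < top" using ennreal_less_top by (rule order_le_less_trans)
      then show ?thesis using that[of "enn2real (Ck_norm q A)"] by simp
    qed
    have Ax: "\<bar>A x\<bar> \<le> KA" for x
      using Ck_norm_ge[of "[]" q A x] KA by (simp add: ennreal_le_iff)
    have 2: "\<bar>integral unit_cube (\<lambda>x. A x * (\<phi> e x - \<phi> s x))\<bar> \<le> KA * (C * (e - s))"
    proof -
      have "norm (integral unit_cube (\<lambda>x. A x * (\<phi> e x - \<phi> s x))) \<le> integral unit_cube (\<lambda>x::real^'n. KA * (C * (e - s)))"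
      proof (rule integral_norm_bound_integral)
        fix x :: "real^'n" assume x: "x \<in> unit_cube"
        have "norm (\<phi> e x - \<phi> s x) \<le> C * norm (e - s)"
        proof (rule field_differentiable_bound[of "{s..e}" "\<lambda>t. \<phi> t x" "\<lambda>t. dird (1, 0) (joint \<phi>) (t, x)"])
          fix t assume t: "t \<in> {s..e}"
          show "((\<lambda>t. \<phi> t x) has_real_derivative dird (1, 0) (joint \<phi>) (t, x)) (at t within {s..e})"
            by (rule test_function_line(1)[OF \<phi> J]) (use t eT in auto)
          show "norm (dird (1, 0) (joint \<phi>) (t, x)) \<le> C"
            unfolding real_norm_def by (rule order_trans[OF K C(2)]) (use x I t in auto)
        qed (use ok in auto)
        then have "\<bar>A x\<bar> * \<bar>\<phi> e x - \<phi> s x\<bar> \<le> KA * (C * (e - s))" using ok(1) KA(1) by (intro mult_mono Ax) auto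
        then show "norm (A x * (\<phi> e x - \<phi> s x)) \<le> KA * (C * (e - s))" by (simp add: abs_mult)
      qed (intro integrable_continuous continuous_intros cA c\<phi>' eT)+
      then show ?thesis by simp
    qed
    have fn: "0 \<le> integral unit_cube (\<lambda>x. \<bar>f x\<bar>)" by (intro integral_nonneg integrable_continuous continuous_intros cA) auto
    have pw: "KA \<le> (1 + KA) ^ q"
    proof -
      have "(1 + KA) ^ 1 \<le> (1 + KA) ^ q" using KA(1) ok(8) by (intro power_increasing) auto
      then show ?thesis by simp
    qed
    have "\<bar>bdN (pairing \<phi>) \<nu>\<bar> \<le> C * (integral unit_cube (\<lambda>x. \<bar>f x\<bar>) + (e - s) * (1 + KA) ^ q)"
    proof -
      have "KA * (C * (e - s)) \<le> (1 + KA) ^ q * (C * (e - s))" using pw C(3) ok(1) by (intro mult_right_mono) auto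
      then show ?thesis using 1 2 unfolding eq distrib_left by (simp only: mult_ac)
    qed
    then have "ennreal \<bar>bdN (pairing \<phi>) \<nu>\<bar> \<le> ennreal (C * (integral unit_cube (\<lambda>x. \<bar>f x\<bar>) + (e - s) * (1 + KA) ^ q))"
      by (rule ennreal_leI)
    also have "\<dots> = ennreal C * (nL \<nu> + nR q \<nu>)"
      using C(3) fn ok(1) KA(1) by (simp add: nL_def nR_def \<nu> KA(2) ennreal_mult ennreal_plus ennreal_power[symmetric])
    finally show "ennreal \<bar>bdN (pairing \<phi>) \<nu>\<bar> \<le> ennreal C * (nL \<nu> + nR q \<nu>)" .
  qed
qed

section \<open>Integrability and approximation of the assembled solution\<close>

context assembly
begin

lemma periodic_patch: "(\<And>n P t. P \<in> S n \<Longrightarrow> periodic (h P t)) \<Longrightarrow> periodic (patch S h t)"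
  by (cases rule: patch_cases[of t]) (auto simp: patch_in patch_out periodic_const)

lemma patch_scaleR:
  "patch S f t x *\<^sub>R patch S g t x = patch S (\<lambda>P t x. f P t x *\<^sub>R g P t x) t x"
  for f :: "'n piece \<Rightarrow> real \<Rightarrow> real^'n \<Rightarrow> real" and g :: "'n piece \<Rightarrow> real \<Rightarrow> real^'n \<Rightarrow> 'b::real_vector"
proof (cases rule: patch_cases[of t])
  case (1 n P) then show ?thesis by (simp add: patch_in[OF 1])
next
  case 2 then show ?thesis by (simp add: patch_out[OF 2])
qed

lemma pu_continuous: "P \<in> S n \<Longrightarrow> continuous_on A (pu P)"
  unfolding pu_def[abs_def]
  by (intro continuous_intros smooth_cont smooth_coord) (use S_ok[of P n] in \<open>auto simp: pok_def intro: smooth_coord\<close>)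

lemma prho_continuous:
  assumes "P \<in> S n"
  shows "continuous_on A (\<lambda>(t, x). prho P t x)" "continuous_on B (prho P t)"
proof -
  show "continuous_on A (\<lambda>(t, x). prho P t x)"
    using smooth_cont[OF prho_joint(1)[OF S_ok[OF assms]], of A] by (simp add: case_prod_beta')
  have "smooth (prho P t)" using smooth_slice[OF prho_joint(1)[OF S_ok[OF assms]], of t] by simp
  then show "continuous_on B (prho P t)" by (rule smooth_cont)
qed

lemma pu_joint_continuous: "P \<in> S n \<Longrightarrow> continuous_on A (\<lambda>(t, x). pu P x)"
  unfolding case_prod_beta' by (rule continuous_on_compose2[OF pu_continuous[of P n UNIV]]) (auto intro!: continuous_intros)

lemma rho_L1:
  assumes "(\<Sum>n. \<Sum>P\<in>S n. rho_cost 0 1 P) < top"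
  shows "L1_spacetime T (patch S prho)"
proof (rule L1_spacetime_patch)
  show "(\<Sum>n. \<Sum>P\<in>S n. ennreal (pb P - pa P) * enn_powr (SUP t\<in>{pa P..pb P}. Ck_norm 0 (prho P t)) 1) < top"
    using assms by (simp add: rho_cost_def)
  fix n P and t :: real assume P: "P \<in> S n" "t \<in> ivP P"
  let ?X = "SUP t\<in>{pa P..pb P}. Ck_norm 0 (prho P t)"
  have fin: "?X < top" by (rule prho_norm_finite[OF S_ok[OF P(1)]])
  have pt: "\<bar>prho P t x\<bar> \<le> enn2real ?X" for x
  proof -
    have "ennreal \<bar>prho P t x\<bar> \<le> Ck_norm 0 (prho P t)" using Ck_norm_ge[of "[]" 0 "prho P t" x] by simp
    also have "\<dots> \<le> ?X" using P(2) by (intro SUP_upper) (auto simp: ivP_def)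
    finally have "ennreal \<bar>prho P t x\<bar> \<le> ennreal (enn2real ?X)" using fin by simp
    then show ?thesis by (simp add: ennreal_le_iff)
  qed
  have "integral unit_cube (\<lambda>x. norm (prho P t x)) \<le> integral unit_cube (\<lambda>x::real^'n. enn2real ?X)"
    by (intro integral_le integrable_continuous continuous_intros prho_continuous[OF P(1)]) (simp add: pt)
  then have "integral unit_cube (\<lambda>x. norm (prho P t x)) \<le> enn2real ?X" by (simp add: content_unit_cube)
  then have "ennreal (integral unit_cube (\<lambda>x. norm (prho P t x))) \<le> ennreal (enn2real ?X)" by (rule ennreal_leI)
  also have "\<dots> = enn_powr ?X 1" using fin by (simp add: enn_powr_def)
  finally show "ennreal (integral unit_cube (\<lambda>x. norm (prho P t x))) \<le> enn_powr ?X 1" .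
qed (rule prho_continuous)

lemma u_L1:
  assumes "(\<Sum>n. \<Sum>P\<in>S n. u_cost 1 P) < top"
  shows "L1_spacetime T (patch S (\<lambda>P t. pu P))"
proof (rule L1_spacetime_patch)
  show "(\<Sum>n. \<Sum>P\<in>S n. ennreal (pb P - pa P) * shear_norm 1 P) < top"
    using assms by (simp add: u_cost_def)
  fix n P and t :: real assume P: "P \<in> S n" "t \<in> ivP P"
  have ok: "smooth (pg P)" using S_ok[OF P(1)] by (simp add: pok_def)
  let ?a = "integral unit_cube (\<lambda>x::real^'n. \<bar>pg P (x $ pl P)\<bar>)" and ?b = "integral unit_cube (\<lambda>x::real^'n. \<bar>dird 1 (pg P) (x $ pl P)\<bar>)"
  have nn: "0 \<le> ?a" "0 \<le> ?b"
    by (intro integral_nonneg integrable_continuous continuous_intros smooth_cont smooth_coord smooth_dird ok; simp)+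
  have "integral unit_cube (\<lambda>x. norm (pu P x)) = ?a" by (simp add: pu_def)
  then have "ennreal (integral unit_cube (\<lambda>x. norm (pu P x))) \<le> ennreal (?a + ?b)" using nn by (intro ennreal_leI) simp
  also have "\<dots> = shear_norm 1 P" using nn by (simp add: shear_norm_def enn_powr_ennreal del: ennreal_plus)
  finally show "ennreal (integral unit_cube (\<lambda>x. norm (pu P x))) \<le> shear_norm 1 P" .
qed (rule pu_joint_continuous)

lemma flux_L1:
  assumes "(\<Sum>n. \<Sum>P\<in>S n. cL P) < top"
  shows "L1_spacetime T (\<lambda>t x. patch S prho t x *\<^sub>R patch S (\<lambda>P t. pu P) t x)"
  unfolding patch_scaleR
proof (rule L1_spacetime_patch)
  show "(\<Sum>n. \<Sum>P\<in>S n. ennreal (pb P - pa P) *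
      (SUP t\<in>{pa P..pb P}. ennreal (integral unit_cube (\<lambda>x. \<bar>prho P t x * pg P (x $ pl P)\<bar>)))) < top"
    using assms by (simp add: cL_def)
  fix n P and t :: real assume P: "P \<in> S n" "t \<in> ivP P"
  have "ennreal (integral unit_cube (\<lambda>x. norm (prho P t x *\<^sub>R pu P x))) = ennreal (integral unit_cube (\<lambda>x. \<bar>prho P t x * pg P (x $ pl P)\<bar>))"
    by (simp add: pu_def abs_mult)
  also have "\<dots> \<le> (SUP t\<in>{pa P..pb P}. ennreal (integral unit_cube (\<lambda>x. \<bar>prho P t x * pg P (x $ pl P)\<bar>)))"
    using P(2) by (intro SUP_upper2[of t]) (auto simp: ivP_def)
  finally show "ennreal (integral unit_cube (\<lambda>x. norm (prho P t x *\<^sub>R pu P x)))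
      \<le> (SUP t\<in>{pa P..pb P}. ennreal (integral unit_cube (\<lambda>x. \<bar>prho P t x * pg P (x $ pl P)\<bar>)))" .
next
  fix n P and A :: "(real \<times> (real^'n)) set" assume P: "P \<in> S n"
  show "continuous_on A (\<lambda>(t, x). prho P t x *\<^sub>R pu P x)"
    using continuous_on_scaleR[OF prho_continuous(1)[OF P] pu_joint_continuous[OF P]] by (simp add: case_prod_beta')
qed

text \<open>Times are of four kinds. On pieces outside \<open>PP\<close> the density is close to
  \<open>g\<close>. On pieces of \<open>PP\<close> both are estimated separately, and the short
  durations contained in \<open>cR\<close> pay for it. At uncovered times the density is zero:
  within \<open>W\<close> the bound \<open>R\<close> is used on a set of small measure, and
  elsewhere \<open>g\<close> itself is small.\<close>

lemma bochner_distance: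
  fixes g :: "real \<Rightarrow> real^'n \<Rightarrow> real"
  assumes N: "N \<ge> 1" and g: "\<And>t. smooth (g t)" and R: "R \<ge> 0" "\<And>t. t \<in> {0<..<T} \<Longrightarrow> Ck_norm N (g t) \<le> ennreal R"
    and PP: "\<And>n. PP n \<subseteq> S n"
    and close: "\<And>n P t. P \<in> S n \<Longrightarrow> P \<notin> PP n \<Longrightarrow> t \<in> ivP P \<Longrightarrow> Ck_norm N (\<lambda>x. prho P t x - g t x) \<le> ennreal e"
    and W: "W \<in> sets lebesgue" "emeasure lebesgue W \<le> ennreal \<delta>"
    and out: "\<And>t. t \<in> {0<..<T} \<Longrightarrow> t \<notin> W \<Longrightarrow> (\<And>n P. P \<in> S n \<Longrightarrow> t \<notin> ivP P) \<Longrightarrow> Ck_norm N (g t) \<le> ennreal e"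
    and cost: "(\<Sum>n. \<Sum>P\<in>PP n. cR (N + n) P) \<le> ennreal (5 * \<delta>)"
    and small: "e ^ N * T + (1 + R) ^ N * (6 * \<delta>) \<le> \<epsilon> ^ N" and nn: "e \<ge> 0" "\<delta> \<ge> 0" "\<epsilon> \<ge> 0"
  shows "bochner_norm (real N) {0<..<T} (Ck_norm N) (\<lambda>t x. patch S prho t x - g t x) \<le> ennreal \<epsilon>"
proof -
  let ?M = "lebesgue_on {0<..<T}"
  define b where "b n P = (1 + (SUP t\<in>{pa P..pb P}. Ck_norm (N + n) (prho P t))) ^ (N + n)" for n and P :: "'n piece"
  define B where "B t = (\<Sum>n. \<Sum>P\<in>PP n. b n P * indicator (ivP P) t)" for t
  have powe: "enn_powr x (real N) \<le> ennreal (e ^ N)" if "x \<le> ennreal e" for x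
  proof -
    have "enn_powr x (real N) \<le> enn_powr (ennreal e) (real N)" by (rule enn_powr_mono[OF that]) simp
    also have "\<dots> = ennreal (e ^ N)" using nn(1) N by (cases "e = 0") (auto simp: enn_powr_ennreal powr_realpow enn_powr_def)
    finally show ?thesis .
  qed
  have one: "1 + ennreal R = ennreal (1 + R)" using R(1) by simp
  have zero: "Ck_norm N (\<lambda>x. patch S prho t x - g t x) \<le> Ck_norm N (g t)" if "\<And>n P. P \<in> S n \<Longrightarrow> t \<notin> ivP P" for t
  proof -
    have "patch S prho t = (\<lambda>x. 0)" by (rule patch_out) (rule that)
    then have "Ck_norm N (\<lambda>x. patch S prho t x - g t x) \<le> Ck_norm N (\<lambda>x::real^'n. 0::real) + Ck_norm N (g t)"
      using Ck_norm_triangle[OF smooth_const g, of N 0 t] by simp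
    then show ?thesis by simp
  qed
  have est: "enn_powr (Ck_norm N (\<lambda>x. patch S prho t x - g t x)) (real N) \<le>
      ennreal (e ^ N) + ennreal ((1 + R) ^ N) * (B t + indicator W t)" if t: "t \<in> {0<..<T}" for t
  proof (cases rule: patch_cases[of t])
    case (1 n P)
    show ?thesis
    proof (cases "P \<in> PP n")
      case False
      have "Ck_norm N (\<lambda>x. patch S prho t x - g t x) \<le> ennreal e"
        unfolding patch_in[OF 1] by (rule close[OF 1(1) False 1(2)])
      from powe[OF this] show ?thesis by (rule add_increasing2[OF zero_le])
    next
      case True
      let ?X = "SUP t\<in>{pa P..pb P}. Ck_norm (N + n) (prho P t)"
      have sp: "smooth (prho P t)" using smooth_slice[OF prho_joint(1)[OF S_ok[OF 1(1)]], of t] by simp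
      have "Ck_norm N (\<lambda>x. patch S prho t x - g t x) \<le> Ck_norm N (prho P t) + Ck_norm N (g t)"
        unfolding patch_in[OF 1] by (rule Ck_norm_triangle[OF sp g])
      also have "\<dots> \<le> ?X + ennreal R"
      proof (intro add_mono R(2)[OF t])
        have "Ck_norm N (prho P t) \<le> Ck_norm (N + n) (prho P t)" by (rule Ck_norm_mono) simp
        also have "\<dots> \<le> ?X" using 1(2) by (intro SUP_upper) (auto simp: ivP_def)
        finally show "Ck_norm N (prho P t) \<le> ?X" .
      qed
      finally have "enn_powr (Ck_norm N (\<lambda>x. patch S prho t x - g t x)) (real N) \<le> enn_powr (?X + ennreal R) (real N)"
        by (rule enn_powr_mono) simp
      also have "\<dots> \<le> (1 + (?X + ennreal R)) ^ N" using N by (intro enn_powr_le_power) auto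
      \<comment> \<open>The bound for \<open>g\<close> is factored out, so that a multiple of the
        integrand of \<open>cR\<close> remains.\<close>
      also have "\<dots> \<le> (ennreal (1 + R) * (1 + ?X)) ^ N"
      proof (rule power_mono)
        have "1 + (?X + ennreal R) \<le> (1 + ?X + ennreal R) + ennreal R * ?X" by (simp add: add_ac)
        also have "\<dots> = ennreal (1 + R) * (1 + ?X)" unfolding one[symmetric] by (simp add: distrib_left distrib_right add_ac)
        finally show "1 + (?X + ennreal R) \<le> ennreal (1 + R) * (1 + ?X)" .
      qed simp
      also have "\<dots> = ennreal ((1 + R) ^ N) * (1 + ?X) ^ N" using R(1) by (simp add: power_mult_distrib ennreal_power del: ennreal_plus)
      also have "\<dots> \<le> ennreal ((1 + R) ^ N) * b n P" unfolding b_def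
        by (intro mult_left_mono power_increasing) simp_all
      also have "\<dots> \<le> ennreal ((1 + R) ^ N) * (B t + indicator W t)"
      proof (intro mult_left_mono)
        have "b n P = b n P * indicator (ivP P) t" using 1(2) by simp
        also have "\<dots> \<le> (\<Sum>P\<in>PP n. b n P * indicator (ivP P) t)"
          by (rule member_le_sum[OF True]) (simp_all add: finite_subset[OF PP S_fin])
        also have "\<dots> \<le> B t" unfolding B_def
          using sum_le_suminf[OF summableI, of "{n}" "\<lambda>n. \<Sum>P\<in>PP n. b n P * indicator (ivP P) t"] by simp
        finally show "b n P \<le> B t + indicator W t" by (rule order_trans) simp
      qed simp
      finally show ?thesis by (rule add_increasing[OF zero_le])
    qed
  next
    case 2
    show ?thesis
    proof (cases "t \<in> W")
      case False
      from powe[OF order_trans[OF zero[OF 2] out[OF t False 2]]] show ?thesis by (rule add_increasing2[OF zero_le])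
    next
      case True
      have "enn_powr (Ck_norm N (\<lambda>x. patch S prho t x - g t x)) (real N) \<le> enn_powr (ennreal R) (real N)"
        by (rule enn_powr_mono[OF order_trans[OF zero[OF 2] R(2)[OF t]] of_nat_0_le_iff])
      also have "\<dots> \<le> (1 + ennreal R) ^ N" using N by (intro enn_powr_le_power) auto
      also have "\<dots> = ennreal ((1 + R) ^ N)" unfolding one using R(1) by (simp add: ennreal_power del: ennreal_plus)
      also have "\<dots> = ennreal ((1 + R) ^ N) * indicator W t" using True by simp
      also have "\<dots> \<le> ennreal ((1 + R) ^ N) * (B t + indicator W t)" by (intro mult_left_mono) simp_all
      finally show ?thesis by (rule add_increasing[OF zero_le])
    qed
  qed
  have mI: "ivP P \<in> sets ?M" "emeasure ?M (ivP P) = ennreal (pb P - pa P)" if "P \<in> PP n" for n P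
  proof -
    have "P \<in> S n" using that PP by blast
    from ivP_lebesgue_on[OF this] show "ivP P \<in> sets ?M" "emeasure ?M (ivP P) = ennreal (pb P - pa P)" by simp_all
  qed
  have mS: "(\<lambda>t. \<Sum>P\<in>PP n. b n P * indicator (ivP P) t) \<in> borel_measurable ?M" for n
    by (intro borel_measurable_sum borel_measurable_times_ennreal borel_measurable_const borel_measurable_indicator mI)
  have mB: "B \<in> borel_measurable ?M" unfolding B_def[abs_def] by (intro borel_measurable_suminf_order mS)
  have iB: "(\<integral>\<^sup>+t. B t \<partial>?M) = (\<Sum>n. \<Sum>P\<in>PP n. cR (N + n) P)"
  proof -
    have "(\<integral>\<^sup>+t. B t \<partial>?M) = (\<Sum>n. \<integral>\<^sup>+t. (\<Sum>P\<in>PP n. b n P * indicator (ivP P) t) \<partial>?M)"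
      unfolding B_def by (rule nn_integral_suminf[OF mS])
    also have "\<dots> = (\<Sum>n. \<Sum>P\<in>PP n. cR (N + n) P)"
    proof (intro suminf_cong)
      fix n
      have "(\<integral>\<^sup>+t. (\<Sum>P\<in>PP n. b n P * indicator (ivP P) t) \<partial>?M) = (\<Sum>P\<in>PP n. \<integral>\<^sup>+t. b n P * indicator (ivP P) t \<partial>?M)"
        by (intro nn_integral_sum borel_measurable_times_ennreal borel_measurable_const borel_measurable_indicator mI)
      also have "\<dots> = (\<Sum>P\<in>PP n. cR (N + n) P)"
        by (intro sum.cong refl) (simp add: nn_integral_cmult_indicator mI cR_def b_def[symmetric] mult.commute)
      finally show "(\<integral>\<^sup>+t. (\<Sum>P\<in>PP n. b n P * indicator (ivP P) t) \<partial>?M) = (\<Sum>P\<in>PP n. cR (N + n) P)" .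
    qed
    finally show ?thesis .
  qed
  have mW: "(indicator W :: real \<Rightarrow> ennreal) \<in> borel_measurable ?M"
    by (rule measurable_restrict_space1) (use W(1) in simp)
  have iW: "(\<integral>\<^sup>+t. indicator W t \<partial>?M) \<le> ennreal \<delta>"
  proof -
    have "(\<integral>\<^sup>+t. indicator W t \<partial>?M) = (\<integral>\<^sup>+t. indicator W t * indicator {0<..<T} t \<partial>lebesgue)"
      by (simp add: nn_integral_restrict_space)
    also have "\<dots> \<le> (\<integral>\<^sup>+t. indicator W t \<partial>lebesgue)" by (intro nn_integral_mono) (simp add: indicator_def)
    also have "\<dots> = emeasure lebesgue W" using W(1) by simp
    finally show ?thesis using W(2) by (rule order_trans)
  qed
  have iT: "emeasure ?M (space ?M) = ennreal T"
    using T_pos by (simp add: emeasure_restrict_space)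
  have "(\<integral>\<^sup>+t. enn_powr (Ck_norm N (\<lambda>x. patch S prho t x - g t x)) (real N) \<partial>?M)
      \<le> (\<integral>\<^sup>+t. ennreal (e ^ N) + ennreal ((1 + R) ^ N) * (B t + indicator W t) \<partial>?M)"
    by (intro nn_integral_mono est) simp
  also have "\<dots> = ennreal (e ^ N) * ennreal T + ennreal ((1 + R) ^ N) * ((\<integral>\<^sup>+t. B t \<partial>?M) + (\<integral>\<^sup>+t. indicator W t \<partial>?M))"
    
  proof -
    have "(\<integral>\<^sup>+t. ennreal (e ^ N) + ennreal ((1 + R) ^ N) * (B t + indicator W t) \<partial>?M) =
        (\<integral>\<^sup>+t. ennreal (e ^ N) \<partial>?M) + ennreal ((1 + R) ^ N) * (\<integral>\<^sup>+t. B t + indicator W t \<partial>?M)"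
      using mB mW by (simp add: nn_integral_add nn_integral_cmult)
    then show ?thesis unfolding nn_integral_add[OF mB mW] nn_integral_const iT .
  qed
  also have "\<dots> \<le> ennreal (e ^ N) * ennreal T + ennreal ((1 + R) ^ N) * (ennreal (5 * \<delta>) + ennreal \<delta>)"
    unfolding iB by (intro add_mono mult_left_mono order.refl cost iW) simp_all
  also have "\<dots> = ennreal (e ^ N * T + (1 + R) ^ N * (6 * \<delta>))"
  proof -
    have "ennreal (5 * \<delta>) + ennreal \<delta> = ennreal (6 * \<delta>)" using nn(2) by (simp add: ennreal_plus[symmetric] del: ennreal_plus)
    then show ?thesis using nn R(1) T_pos by (simp add: ennreal_mult ennreal_plus)
  qed
  also have "\<dots> \<le> ennreal (\<epsilon> ^ N)" by (rule ennreal_leI[OF small])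
  finally have "bochner_norm (real N) {0<..<T} (Ck_norm N) (\<lambda>t x. patch S prho t x - g t x) \<le> enn_powr (ennreal (\<epsilon> ^ N)) (1 / real N)"
    unfolding bochner_norm_def by (rule enn_powr_mono) simp
  also have "\<dots> = ennreal \<epsilon>"
  proof (cases "\<epsilon> = 0")
    case False
    then have "(\<epsilon> ^ N) powr (1 / real N) = \<epsilon>" using nn(3) N by (simp add: powr_realpow[symmetric] powr_powr)
    then show ?thesis using nn(3) by (simp add: enn_powr_ennreal)
  qed (use N in \<open>simp add: enn_powr_def\<close>)
  finally show ?thesis .
qed

end

section \<open>The first approximation\<close>

text \<open>A cell that is not contained in \<open>K\<close> contains a time at which \<rho>'
  vanishes, so that \<rho>' is small on the whole cell and may be approximated by zero. This is why
  only cells inside \<open>K\<close> are used, and why the support does not grow.\<close>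

lemma piecewise_constant_start:
  fixes \<rho>' :: "real \<Rightarrow> real^'n::finite \<Rightarrow> real"
  assumes F: "smooth (\<lambda>z. \<rho>' (fst z) (snd z))" "\<And>t. periodic (\<rho>' t)" and mean: "\<And>t. integral unit_cube (\<rho>' t) = 0"
    and K: "K \<subseteq> {0<..<T}" "\<forall>t. t \<notin> K \<longrightarrow> \<rho>' t = (\<lambda>x. 0)"
    and T: "T > 0" and e: "e > 0" and \<delta>: "\<delta> > 0" and kl: "k \<noteq> (l :: 'n)"
  shows "\<exists>Q N0 W c d. 0 < c \<and> d < T \<and> nodes_ok N0 \<and> finite Q \<and>
    (\<forall>P\<in>Q. pok P \<and> c \<le> pa P \<and> pb P \<le> d \<and> ivP P \<subseteq> K \<and> pg P = (\<lambda>_. 0) \<and> (\<forall>t\<in>ivP P. Ck_norm q (\<lambda>x. prho P t x - \<rho>' t x) \<le> ennreal e)) \<and>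
    (\<forall>\<nu>\<in>N0. c \<le> na \<nu> \<and> nb \<nu> \<le> d \<and> ivN \<nu> \<subseteq> K) \<and>
    (\<forall>P\<in>Q. \<forall>P'\<in>Q. P \<noteq> P' \<longrightarrow> ivP P \<inter> ivP P' = {}) \<and> (\<forall>P\<in>Q. \<forall>\<nu>\<in>N0. ivP P \<inter> ivN \<nu> = {}) \<and>
    (\<forall>\<Phi>. (\<forall>t. \<Phi> t (\<lambda>x. 0) = 0) \<longrightarrow> (\<Sum>P\<in>Q. bdP \<Phi> P) + (\<Sum>\<nu>\<in>N0. bdN \<Phi> \<nu>) = 0) \<and>
    (\<Sum>\<nu>\<in>N0. nR q \<nu>) \<le> ennreal \<delta> \<and> W \<in> sets lebesgue \<and> emeasure lebesgue W \<le> ennreal \<delta> \<and>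
    (\<forall>t\<in>{0<..<T}. t \<notin> W \<longrightarrow> (\<forall>P\<in>Q. t \<notin> ivP P) \<longrightarrow> Ck_norm q (\<rho>' t) \<le> ennreal e)"
proof -
  obtain \<delta>0 where \<delta>0: "\<delta>0 > 0" "\<And>s t. s \<in> {0..T} \<Longrightarrow> t \<in> {0..T} \<Longrightarrow> \<bar>s - t\<bar> < \<delta>0 \<Longrightarrow> Ck_norm q (\<lambda>x. \<rho>' s x - \<rho>' t x) \<le> ennreal e"
    using Ck_norm_joint_continuous[OF F(1) _ e, of 0 T q] F(2) by auto
  obtain M :: nat where M: "T / \<delta>0 < real M" using reals_Archimedean2 by blast
  have M0: "M > 0" using M T \<delta>0(1) by (intro gr0I) (auto simp: divide_less_0_iff)
  define w where "w = T / real M"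
  have w: "w > 0" "w < \<delta>0" "real M * w = T" using M T \<delta>0(1) M0 by (auto simp: w_def field_simps)
  define m where "m i = real i * w" for i :: nat
  have mS: "m (Suc i) = m i + w" for i by (simp add: m_def algebra_simps)
  have m_le: "m i \<le> m j" if "i \<le> j" for i j using that w(1) by (simp add: m_def mult_right_mono)
  have mM: "m M = T" "m 0 = 0" using w(3) by (simp_all add: m_def)
  have m_in: "0 \<le> m i" "m i \<le> T" if "i \<le> M" for i using m_le[of 0 i] m_le[OF that] mM by auto
  define I where "I = {i. i < M \<and> {m i..m (Suc i)} \<subseteq> K}"
  have finI: "finite I" and I: "\<And>i. i \<in> I \<Longrightarrow> i < M" "\<And>i. i \<in> I \<Longrightarrow> {m i..m (Suc i)} \<subseteq> K" by (auto simp: I_def)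
  have Ibd: "w \<le> m i \<and> m (Suc i) \<le> T - w" if "i \<in> I" for i
  proof -
    have "m i \<in> K" "m (Suc i) \<in> K" using I(2)[OF that] w(1) by (auto simp: mS)
    then have *: "m i > 0" "m (Suc i) < T" using K(1) by auto
    then have "i \<noteq> 0" "Suc i \<noteq> M" using mM by (metis less_irrefl)+
    then have "Suc 0 \<le> i" "Suc (Suc i) \<le> M" using I(1)[OF that] by auto
    from m_le[OF this(1)] m_le[OF this(2)] show ?thesis using mM mS[of 0] mS[of "Suc i"] by simp
  qed
  have cell: "{m i<..<m (Suc i)} \<inter> {m j<..<m (Suc j)} = {}" if "i \<noteq> j" for i j
  proof (cases "i < j")
    case True then show ?thesis using m_le[of "Suc i" j] by auto
  next
    case False then show ?thesis using that m_le[of "Suc j" i] by auto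
  qed
  have s\<rho>: "smooth (\<rho>' t)" for t using smooth_slice[OF F(1), of t] by simp
  \<comment> \<open>At most \<open>M\<close> cells, each with two transition layers of length at
    most \<open>d'\<close>.\<close>
  define d' where "d' = \<delta> / (2 * real M)"
  have d': "d' > 0" "real M * (2 * d') = \<delta>" using \<delta> M0 by (auto simp: d'_def)
  define G where "G i z \<longleftrightarrow> 0 < fst z \<and> 2 * fst z < m (Suc i) - m i \<and> fst z \<le> d' \<and> nodes_ok (snd z) \<and>
    (\<forall>\<nu>\<in>snd z. (m i \<le> na \<nu> \<and> nb \<nu> \<le> m i + fst z) \<or> (m (Suc i) - fst z \<le> na \<nu> \<and> nb \<nu> \<le> m (Suc i))) \<and>
    (\<forall>\<Phi>. bdP \<Phi> (Piece (m i + fst z) (m (Suc i) - fst z) (\<rho>' (m i)) k l (\<lambda>_. 0)) + (\<Sum>\<nu>\<in>snd z. bdN \<Phi> \<nu>)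
       = \<Phi> (m (Suc i)) (\<lambda>x. 0) - \<Phi> (m i) (\<lambda>x. 0)) \<and>
    (\<Sum>\<nu>\<in>snd z. nR q \<nu>) \<le> ennreal d'" for i and z :: "real \<times> 'n node set"
  have "\<exists>z. G i z" for i
  proof -
    have "m i < m (Suc i)" using w(1) by (simp add: mS)
    from create_and_destroy[OF s\<rho> F(2) mean this d'(1) kl, of "m i" q] show ?thesis
      unfolding G_def by (simp only: split_paired_Ex fst_conv snd_conv)
  qed
  then obtain z where "\<And>i. G i (z i)" by metis
  note z = this[unfolded G_def]
  define \<tau> where "\<tau> i = fst (z i)" for i
  define NN where "NN i = snd (z i)" for i
  define p where "p i = Piece (m i + \<tau> i) (m (Suc i) - \<tau> i) (\<rho>' (m i)) k l (\<lambda>_. 0)" for i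
  have \<tau>: "0 < \<tau> i" "2 * \<tau> i < w" "\<tau> i \<le> d'" for i using z[of i] mS[of i] by (simp_all add: \<tau>_def)
  have Nok: "nodes_ok (NN i)" for i using z[of i] by (simp add: NN_def)
  have Nin: "(m i \<le> na \<nu> \<and> nb \<nu> \<le> m i + \<tau> i) \<or> (m (Suc i) - \<tau> i \<le> na \<nu> \<and> nb \<nu> \<le> m (Suc i))" if "\<nu> \<in> NN i" for i \<nu>
    using z[of i] that by (simp add: \<tau>_def NN_def)
  have bd: "bdP \<Phi> (p i) + (\<Sum>\<nu>\<in>NN i. bdN \<Phi> \<nu>) = \<Phi> (m (Suc i)) (\<lambda>x. 0) - \<Phi> (m i) (\<lambda>x. 0)" for \<Phi> i
    using z[of i] by (simp add: \<tau>_def NN_def p_def)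
  have NR: "(\<Sum>\<nu>\<in>NN i. nR q \<nu>) \<le> ennreal d'" for i using z[of i] by (simp add: NN_def)
  have Nbd: "m i \<le> na \<nu>" "nb \<nu> \<le> m (Suc i)" if "\<nu> \<in> NN i" for i \<nu>
    using Nin[OF that] \<tau>[of i] mS[of i] by auto
  have pok: "pok (p i)" for i using \<tau>[of i] mS[of i] s\<rho> F(2) kl by (simp add: pok_def p_def smooth_const)
  have pcell: "ivP (p i) \<subseteq> {m i<..<m (Suc i)}" for i using \<tau>[of i] by (auto simp: ivP_def p_def)
  have Ncell: "ivN \<nu> \<subseteq> {m i<..<m (Suc i)}" if "\<nu> \<in> NN i" for i \<nu> using Nbd[OF that] by (auto simp: ivN_def)
  have pr: "prho (p i) t = \<rho>' (m i)" for i t by (simp add: prho_def fun_eq_iff shear_def p_def)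
  have pdis: "ivP (p i) \<inter> ivP (p j) = {}" if "i \<noteq> j" for i j
    using cell[OF that] pcell[of i] pcell[of j] by blast
  have Ndis: "ivN \<nu> \<inter> ivN \<mu> = {}" if "i \<noteq> j" "\<nu> \<in> NN i" "\<mu> \<in> NN j" for i j \<nu> \<mu>
    using cell[OF that(1)] Ncell[OF that(2)] Ncell[OF that(3)] by blast
  have pNdis: "ivP (p i) \<inter> ivN \<nu> = {}" if "\<nu> \<in> NN j" for i j \<nu>
  proof (cases "i = j")
    case True
    then show ?thesis using Nin[OF that] \<tau>[of i] by (auto simp: ivP_def ivN_def p_def)
  next
    case False
    then show ?thesis using cell[OF False] pcell[of i] Ncell[OF that] by blast
  qed
  have inj: "inj_on p I"
  proof (rule inj_onI, rule ccontr)
    fix i j assume "p i = p j" "i \<noteq> j"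
    then show False using pdis[of i j] ivP_nonempty[OF pok, of i] by simp
  qed
  have NNdis: "NN i \<inter> NN j = {}" if "i \<noteq> j" for i j
  proof (rule ccontr)
    assume "NN i \<inter> NN j \<noteq> {}"
    then obtain \<nu> where \<nu>: "\<nu> \<in> NN i" "\<nu> \<in> NN j" by blast
    then have "nok \<nu>" using Nok[of i] by (simp add: nodes_ok_def)
    from ivN_nonempty[OF this] show False using Ndis[OF that \<nu>] by simp
  qed
  define N0 where "N0 = (\<Union>i\<in>I. NN i)"
  \<comment> \<open>The transition layers are taken closed, so that they contain the end points of
    the resting pieces.\<close>
  define W where "W = (\<Union>i\<in>I. {m i..m i + \<tau> i} \<union> {m (Suc i) - \<tau> i..m (Suc i)})"
  have finN: "finite (NN i)" for i using Nok[of i] by (simp add: nodes_ok_def)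
  have sumN: "(\<Sum>\<nu>\<in>N0. G \<nu>) = (\<Sum>i\<in>I. \<Sum>\<nu>\<in>NN i. G \<nu>)" for G :: "'n node \<Rightarrow> 'b::comm_monoid_add"
    unfolding N0_def by (rule sum.UNION_disjoint) (use finI finN NNdis in auto)
  have cardI: "card I \<le> M" using card_mono[of "{..<M}" I] I(1) by (auto simp: subset_iff)
  have sum\<delta>: "(\<Sum>i\<in>I. ennreal (2 * d')) \<le> ennreal \<delta>"
  proof -
    have "(\<Sum>i\<in>I. ennreal (2 * d')) = ennreal (\<Sum>i\<in>I. 2 * d')" using d'(1) by (intro sum_ennreal) simp
    also have "\<dots> \<le> ennreal (real M * (2 * d'))" using cardI d'(1) by (intro ennreal_leI) (simp add: mult_right_mono)
    finally show ?thesis unfolding d'(2) .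
  qed
  have c1: "\<forall>P\<in>p ` I. pok P \<and> w \<le> pa P \<and> pb P \<le> T - w \<and> ivP P \<subseteq> K \<and> pg P = (\<lambda>_. 0) \<and> (\<forall>t\<in>ivP P. Ck_norm q (\<lambda>x. prho P t x - \<rho>' t x) \<le> ennreal e)"
  proof (intro ballI conjI)
    fix P assume "P \<in> p ` I"
    then obtain i where i: "i \<in> I" "P = p i" by blast
    show "pok P" unfolding i(2) by (rule pok)
    show "w \<le> pa P" "pb P \<le> T - w" using Ibd[OF i(1)] \<tau>[of i] by (simp_all add: i(2) p_def)
    show "pg P = (\<lambda>_. 0)" by (simp add: i(2) p_def)
    have "{m i<..<m (Suc i)} \<subseteq> {m i..m (Suc i)}" by auto
    then show "ivP P \<subseteq> K" unfolding i(2) using pcell[of i] I(2)[OF i(1)] by blast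
    fix t assume "t \<in> ivP P"
    then have t: "t \<in> {m i<..<m (Suc i)}" unfolding i(2) using pcell[of i] by blast
    have "m i \<in> {0..T}" "m (Suc i) \<in> {0..T}" using m_in[of i] m_in[of "Suc i"] I(1)[OF i(1)] by auto
    then show "Ck_norm q (\<lambda>x. prho P t x - \<rho>' t x) \<le> ennreal e" unfolding i(2) pr
      using t mS[of i] w(2) by (intro \<delta>0(2)) auto
  qed
  have c2: "\<forall>\<nu>\<in>N0. w \<le> na \<nu> \<and> nb \<nu> \<le> T - w \<and> ivN \<nu> \<subseteq> K"
  proof
    fix \<nu> assume "\<nu> \<in> N0"
    then obtain i where i: "i \<in> I" "\<nu> \<in> NN i" by (auto simp: N0_def)
    have "{m i<..<m (Suc i)} \<subseteq> {m i..m (Suc i)}" by auto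
    then have "ivN \<nu> \<subseteq> K" using Ncell[OF i(2)] I(2)[OF i(1)] by blast
    then show "w \<le> na \<nu> \<and> nb \<nu> \<le> T - w \<and> ivN \<nu> \<subseteq> K" using Ibd[OF i(1)] Nbd[OF i(2)] by simp
  qed
  have c3: "nodes_ok N0" unfolding nodes_ok_def
  proof (intro conjI ballI impI)
    show "finite N0" by (simp add: N0_def finI finN)
    fix \<nu> assume "\<nu> \<in> N0"
    then obtain i where i: "i \<in> I" "\<nu> \<in> NN i" by (auto simp: N0_def)
    then show "nok \<nu>" using Nok[of i] by (simp add: nodes_ok_def)
    fix \<mu> assume "\<mu> \<in> N0" "\<nu> \<noteq> \<mu>"
    then obtain j where j: "\<mu> \<in> NN j" by (auto simp: N0_def)
    show "ivN \<nu> \<inter> ivN \<mu> = {}"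
    proof (cases "i = j")
      case True
      then show ?thesis using Nok[of i] i(2) j \<open>\<nu> \<noteq> \<mu>\<close> by (simp add: nodes_ok_def)
    next
      case False
      then show ?thesis by (rule Ndis[OF _ i(2) j])
    qed
  qed
  have c4: "\<forall>P\<in>p ` I. \<forall>P'\<in>p ` I. P \<noteq> P' \<longrightarrow> ivP P \<inter> ivP P' = {}"
  proof (intro ballI impI)
    fix P P' assume "P \<in> p ` I" "P' \<in> p ` I" "P \<noteq> P'"
    then obtain i j where "P = p i" "P' = p j" "i \<noteq> j" by blast
    then show "ivP P \<inter> ivP P' = {}" using pdis by simp
  qed
  have c5: "\<forall>P\<in>p ` I. \<forall>\<nu>\<in>N0. ivP P \<inter> ivN \<nu> = {}"
    unfolding N0_def by (simp add: pNdis)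
  have c6: "\<forall>\<Phi>. (\<forall>t. \<Phi> t (\<lambda>x. 0) = 0) \<longrightarrow> (\<Sum>P\<in>p ` I. bdP \<Phi> P) + (\<Sum>\<nu>\<in>N0. bdN \<Phi> \<nu>) = 0"
  proof (intro allI impI)
    fix \<Phi> :: "real \<Rightarrow> (real^'n \<Rightarrow> real) \<Rightarrow> real" assume z: "\<forall>t. \<Phi> t (\<lambda>x. 0) = 0"
    have "(\<Sum>P\<in>p ` I. bdP \<Phi> P) + (\<Sum>\<nu>\<in>N0. bdN \<Phi> \<nu>) = (\<Sum>i\<in>I. bdP \<Phi> (p i) + (\<Sum>\<nu>\<in>NN i. bdN \<Phi> \<nu>))"
      unfolding sumN sum.distrib by (simp add: sum.reindex[OF inj])
    also have "\<dots> = 0" unfolding bd by (simp add: z)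
    finally show "(\<Sum>P\<in>p ` I. bdP \<Phi> P) + (\<Sum>\<nu>\<in>N0. bdN \<Phi> \<nu>) = 0" .
  qed
  have c7: "(\<Sum>\<nu>\<in>N0. nR q \<nu>) \<le> ennreal \<delta>"
  proof -
    have "(\<Sum>\<nu>\<in>N0. nR q \<nu>) \<le> (\<Sum>i\<in>I. ennreal d')" unfolding sumN by (intro sum_mono NR)
    also have "\<dots> \<le> (\<Sum>i\<in>I. ennreal (2 * d'))" using d'(1) by (intro sum_mono ennreal_leI) simp
    finally show ?thesis using sum\<delta> by (rule order_trans)
  qed
  have c8: "W \<in> sets lebesgue" unfolding W_def using finI by (intro sets.finite_UN sets.Un) auto
  have c9: "emeasure lebesgue W \<le> ennreal \<delta>"
  proof -
    have "emeasure lebesgue W \<le> (\<Sum>i\<in>I. emeasure lebesgue ({m i..m i + \<tau> i} \<union> {m (Suc i) - \<tau> i..m (Suc i)}))"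
      unfolding W_def by (intro emeasure_subadditive_finite finI) auto
    also have "\<dots> \<le> (\<Sum>i\<in>I. ennreal (2 * d'))"
    proof (intro sum_mono)
      fix i
      have "emeasure lebesgue ({m i..m i + \<tau> i} \<union> {m (Suc i) - \<tau> i..m (Suc i)})
          \<le> emeasure lebesgue {m i..m i + \<tau> i} + emeasure lebesgue {m (Suc i) - \<tau> i..m (Suc i)}"
        by (intro emeasure_subadditive) auto
      also have "\<dots> = ennreal (\<tau> i) + ennreal (\<tau> i)" using \<tau>(1)[of i] by simp
      also have "\<dots> = ennreal (2 * \<tau> i)" using \<tau>(1)[of i] by (simp add: ennreal_plus[symmetric] del: ennreal_plus)
      also have "\<dots> \<le> ennreal (2 * d')" using \<tau>(3)[of i] by (intro ennreal_leI) simp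
      finally show "emeasure lebesgue ({m i..m i + \<tau> i} \<union> {m (Suc i) - \<tau> i..m (Suc i)}) \<le> ennreal (2 * d')" .
    qed
    finally show ?thesis using sum\<delta> by (rule order_trans)
  qed
  have c10: "\<forall>t\<in>{0<..<T}. t \<notin> W \<longrightarrow> (\<forall>P\<in>p ` I. t \<notin> ivP P) \<longrightarrow> Ck_norm q (\<rho>' t) \<le> ennreal e"
  proof (intro ballI impI)
    fix t assume t: "t \<in> {0<..<T}" "t \<notin> W" "\<forall>P\<in>p ` I. t \<notin> ivP P"
    define i where "i = nat \<lfloor>t / w\<rfloor>"
    have tw: "0 \<le> t / w" using t(1) w(1) by simp
    then have "real i = of_int \<lfloor>t / w\<rfloor>" by (simp add: i_def)
    then have "real i \<le> t / w" "t / w < real i + 1" by linarith+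
    then have ti: "m i \<le> t" "t < m (Suc i)" using w(1) by (simp_all add: m_def field_simps)
    have "i < M"
    proof (rule ccontr)
      assume "\<not> i < M"
      then have "m M \<le> m i" by (intro m_le) simp
      then show False using ti(1) t(1) mM by simp
    qed
    have "i \<notin> I"
    proof
      assume i: "i \<in> I"
      have "t \<notin> {m i..m i + \<tau> i}" "t \<notin> {m (Suc i) - \<tau> i..m (Suc i)}" using t(2) i by (auto simp: W_def)
      moreover have "t \<notin> ivP (p i)" using t(3) i by blast
      ultimately show False using ti by (auto simp: ivP_def p_def)
    qed
    then have "\<not> {m i..m (Suc i)} \<subseteq> K" using \<open>i < M\<close> by (simp add: I_def)
    \<comment> \<open>The cell sticks out of \<open>K\<close>: at the time \<open>s\<close> the
      function \<rho>' vanishes, and uniform continuity compares it with the time \<open>t\<close>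
      of the same cell.\<close>
    then obtain s where s: "s \<in> {m i..m (Suc i)}" "s \<notin> K" by blast
    have "s \<in> {0..T}" "t \<in> {0..T}" using s(1) t(1) m_in[of i] m_in[of "Suc i"] \<open>i < M\<close> by auto
    then have "Ck_norm q (\<lambda>x. \<rho>' t x - \<rho>' s x) \<le> ennreal e" using s(1) ti mS[of i] w(2) by (intro \<delta>0(2)) auto
    then show "Ck_norm q (\<rho>' t) \<le> ennreal e" by (simp add: K(2)[rule_format, OF s(2)])
  qed
  show ?thesis
    by (rule exI[of _ "p ` I"], rule exI[of _ N0], rule exI[of _ W], rule exI[of _ w], rule exI[of _ "T - w"])
      (intro conjI w(1) c3 c1 c2 c4 c5 c6 c7 c8 c9 c10 finite_imageI finI; use w(1) in simp)
qed

section \<open>Choice of tolerances and construction of the pair from the first approximation and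
  the iteration\<close>

theorem theorem1p3:
  fixes T \<epsilon> :: real and N :: nat and \<rho>' :: "real \<Rightarrow> real^'n \<Rightarrow> real"
  assumes "CARD('n) \<ge> 2" and "T > 0" and "\<epsilon> > 0" and "N \<ge> 1"
    and "Cinf_on UNIV (\<lambda>(t, x). \<rho>' t x)" and "\<And>t. periodic (\<rho>' t)"
    and "temporal_support UNIV \<rho>' \<subseteq> {0<..<T}"
    and "\<And>t. (LINT x|torus. \<rho>' t x) = 0"
  shows "\<exists>(u :: real \<Rightarrow> real^'n \<Rightarrow> real^'n) (\<rho> :: real \<Rightarrow> real^'n \<Rightarrow> real).
    (\<forall>t\<in>{0..T}. periodic (u t) \<and> periodic (\<rho> t)) \<and>
    divergence_free T u \<and>
    (\<forall>p\<ge>1. u \<in> bochner_space 1 {0<..<T} (W1p_torus p) (W1p_norm p)) \<and>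
    (\<forall>p\<ge>1. \<forall>k. \<rho> \<in> bochner_space p {0<..<T} (Ck_torus k) (Ck_norm k)) \<and>
    L1_spacetime T (\<lambda>t x. \<rho> t x *\<^sub>R u t x) \<and>
    weak_transport_solution T \<rho> u (\<lambda>x. 0) \<and>
    bochner_norm (real N) {0<..<T} (Ck_norm N) (\<lambda>t x. \<rho> t x - \<rho>' t x) \<le> ennreal \<epsilon> \<and>
    temporal_support {0..T} \<rho> \<subseteq> temporal_support UNIV \<rho>'"
proof -
  note T = assms(2) and \<epsilon> = assms(3) and N = assms(4)
  obtain k l :: 'n where kl: "k \<noteq> l"
  proof -
    have "\<not> (\<forall>k l :: 'n. k = l)"
    proof
      assume "\<forall>k l :: 'n. k = l"
      then have "UNIV = {undefined :: 'n}" by blast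
      from arg_cong[OF this, of card] show False using assms(1) by simp
    qed
    then show ?thesis using that by blast
  qed
  have F: "smooth (\<lambda>z. \<rho>' (fst z) (snd z))" using assms(5) by (simp add: case_prod_beta')
  have s\<rho>: "smooth (\<rho>' t)" for t using smooth_slice[OF F, of t] by simp
  note p\<rho> = assms(6)
  have mean: "integral unit_cube (\<rho>' t) = 0" for t
    using assms(8)[of t] LINT_torus[OF smooth_cont[OF s\<rho>], of t] by simp
  define K where "K = temporal_support UNIV \<rho>'"
  have K: "K \<subseteq> {0<..<T}" using assms(7) by (simp add: K_def)
  have K0: "\<rho>' t x = 0" if "t \<notin> K" for t x
  proof -
    have "AE x in torus. \<rho>' t x = 0"
      using that closure_subset[of "{t\<in>UNIV. \<not> (AE x in torus. \<rho>' t x = 0)}"] unfolding K_def temporal_support_def by blast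
    then show ?thesis by (rule periodic_AE_zero[OF smooth_cont[OF s\<rho>] p\<rho>])
  qed
  have K0': "\<forall>t. t \<notin> K \<longrightarrow> \<rho>' t = (\<lambda>x. 0)" using K0 by (simp add: fun_eq_iff)
  obtain R where R: "R \<ge> 0" "\<And>t. t \<in> {0..T} \<Longrightarrow> Ck_norm N (\<rho>' t) \<le> ennreal R"
    using Ck_norm_joint_bounded[OF F, of 0 T N] p\<rho> by auto
  \<comment> \<open>The two tolerances share \<open>\<epsilon> ^ N\<close> equally: closeness up to
    \<open>e\<close> during the time \<open>T\<close> takes one half, and the total measure cost
    \<open>6 * \<delta>\<close> times \<open>(1 + R) ^ N\<close> the other. The minimum with 1 lets
    the N-th power be bounded by the first.\<close>
  define e where "e = \<epsilon> * min 1 (1 / (2 * T))"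
  define \<delta> where "\<delta> = \<epsilon> ^ N / (12 * (1 + R) ^ N)"
  have e: "e > 0" using \<epsilon> T by (simp add: e_def)
  have \<delta>: "\<delta> > 0" using \<epsilon> R(1) by (simp add: \<delta>_def)
  have small: "e ^ N * T + (1 + R) ^ N * (6 * \<delta>) \<le> \<epsilon> ^ N"
  proof -
    let ?m = "min 1 (1 / (2 * T))"
    have m: "0 \<le> ?m" "?m \<le> 1" "?m \<le> 1 / (2 * T)" using T by auto
    have "?m ^ N \<le> ?m ^ 1" using N m by (intro power_decreasing) auto
    then have "?m ^ N \<le> 1 / (2 * T)" using m(3) by simp
    then have "?m ^ N * T \<le> 1 / 2" using T by (simp add: field_simps)
    then have "\<epsilon> ^ N * (?m ^ N * T) \<le> \<epsilon> ^ N * (1 / 2)" using \<epsilon> by (intro mult_left_mono) auto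
    then have 1: "e ^ N * T \<le> \<epsilon> ^ N / 2" by (simp add: e_def power_mult_distrib mult.assoc)
    have "(1 + R) ^ N \<noteq> 0" using R(1) by simp
    moreover have "y * (6 * (x / (12 * y))) = x / 2" if "y \<noteq> 0" for x y :: real using that by simp
    ultimately have "(1 + R) ^ N * (6 * \<delta>) = \<epsilon> ^ N / 2" unfolding \<delta>_def by blast
    with 1 show ?thesis by simp
  qed
  obtain Q N0 W c d where start: "0 < c \<and> d < T \<and> nodes_ok N0 \<and> finite Q \<and>
    (\<forall>P\<in>Q. pok P \<and> c \<le> pa P \<and> pb P \<le> d \<and> ivP P \<subseteq> K \<and> pg P = (\<lambda>_. 0) \<and> (\<forall>t\<in>ivP P. Ck_norm N (\<lambda>x. prho P t x - \<rho>' t x) \<le> ennreal e)) \<and>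
    (\<forall>\<nu>\<in>N0. c \<le> na \<nu> \<and> nb \<nu> \<le> d \<and> ivN \<nu> \<subseteq> K) \<and>
    (\<forall>P\<in>Q. \<forall>P'\<in>Q. P \<noteq> P' \<longrightarrow> ivP P \<inter> ivP P' = {}) \<and> (\<forall>P\<in>Q. \<forall>\<nu>\<in>N0. ivP P \<inter> ivN \<nu> = {}) \<and>
    (\<forall>\<Phi>. (\<forall>t. \<Phi> t (\<lambda>x. 0) = 0) \<longrightarrow> (\<Sum>P\<in>Q. bdP \<Phi> P) + (\<Sum>\<nu>\<in>N0. bdN \<Phi> \<nu>) = 0) \<and>
    (\<Sum>\<nu>\<in>N0. nR N \<nu>) \<le> ennreal \<delta> \<and> W \<in> sets lebesgue \<and> emeasure lebesgue W \<le> ennreal \<delta> \<and>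
    (\<forall>t\<in>{0<..<T}. t \<notin> W \<longrightarrow> (\<forall>P\<in>Q. t \<notin> ivP P) \<longrightarrow> Ck_norm N (\<rho>' t) \<le> ennreal e)"
    using piecewise_constant_start[OF F p\<rho> mean K K0' T e \<delta> kl, of N] by (elim exE)
  have cd: "0 < c" "d < T" and N0: "nodes_ok N0" and Q_fin: "finite Q" using start by simp_all
  have Q: "pok P" "c \<le> pa P" "pb P \<le> d" "ivP P \<subseteq> K" "pg P = (\<lambda>_. 0)" if "P \<in> Q" for P using start that by simp_all
  have Q_close: "Ck_norm N (\<lambda>x. prho P t x - \<rho>' t x) \<le> ennreal e" if "P \<in> Q" "t \<in> ivP P" for P t using start that by simp
  have N0_in: "c \<le> na \<nu>" "nb \<nu> \<le> d" "ivN \<nu> \<subseteq> K" if "\<nu> \<in> N0" for \<nu> using start that by simp_all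
  have Q_disj: "ivP P \<inter> ivP P' = {}" if "P \<in> Q" "P' \<in> Q" "P \<noteq> P'" for P P' using start that by simp
  have Q_N0: "ivP P \<inter> ivN \<nu> = {}" if "P \<in> Q" "\<nu> \<in> N0" for P \<nu> using start that by simp
  have bd0: "(\<Sum>P\<in>Q. bdP \<Phi> P) + (\<Sum>\<nu>\<in>N0. bdN \<Phi> \<nu>) = 0" if "\<And>t. \<Phi> t (\<lambda>x. 0) = 0" for \<Phi> using start that by simp
  have N0_R: "(\<Sum>\<nu>\<in>N0. nR N \<nu>) \<le> ennreal \<delta>" and W: "W \<in> sets lebesgue" "emeasure lebesgue W \<le> ennreal \<delta>"
    using start by blast+
  have out: "Ck_norm N (\<rho>' t) \<le> ennreal e" if "t \<in> {0<..<T}" "t \<notin> W" "\<And>P. P \<in> Q \<Longrightarrow> t \<notin> ivP P" for t using start that by simp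
  \<comment> \<open>Starting with order \<open>N\<close>, the costs of every level dominate the norm
    in which the distance to \<rho>' is measured.\<close>
  obtain NN PP where it: "NN 0 = N0" "\<And>n. node_refinement (N + n) (\<delta> / 2 ^ n) (NN n) (PP n) (NN (Suc n))"
    using iteration[OF assms(1) N0 \<delta>, of N] by blast
  interpret iterated NN PP N \<delta> by (rule iterated.intro[OF it(2) \<delta>])
  \<comment> \<open>The resting pieces of the first approximation join level 0. Their intervals
    avoid the initial nodes, and hence all pieces of the iteration.\<close>
  define S where "S n = PP n \<union> (if n = 0 then Q else {})" for n
  have PN0: "ivP P \<subseteq> \<Union> (ivN ` N0)" if "P \<in> PP n" for n P
    using order_trans[OF PP_sub[OF that] NN_sub[of 0 n]] it(1) by simp
  have PK: "ivP P \<subseteq> K" if "P \<in> PP n" for n P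
    using PN0[OF that] N0_in(3) by blast
  have PQ: "ivP P \<inter> ivP P' = {}" if "P \<in> PP n" "P' \<in> Q" for n P P'
    using PN0[OF that(1)] Q_N0[OF that(2)] by blast
  have PcdP: "c \<le> pa P \<and> pb P \<le> d" if P: "P \<in> PP n" for n P
  proof -
    have "pa P < pb P" using PP_ok[OF P] by (simp add: pok_def)
    moreover have "\<Union> (ivN ` N0) \<subseteq> {c..d}"
    proof (intro UN_least subsetI)
      fix \<nu> t assume "\<nu> \<in> N0" "t \<in> ivN \<nu>"
      then show "t \<in> {c..d}" using N0_in(1,2)[of \<nu>] by (simp add: ivN_def)
    qed
    then have "{pa P<..<pb P} \<subseteq> {c..d}" using PN0[OF P] by (simp add: ivP_def)
    ultimately show ?thesis by (simp add: greaterThanLessThan_subseteq_atLeastAtMost_iff)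
  qed
  have S_cases: "P \<in> PP n \<or> n = 0 \<and> P \<in> Q" if "P \<in> S n" for n P using that by (auto simp: S_def split: if_splits)
  have S_ok: "pok P" if "P \<in> S n" for n P using S_cases[OF that] PP_ok Q(1) by blast
  have S_cd: "c \<le> pa P \<and> pb P \<le> d" if "P \<in> S n" for n P using S_cases[OF that] PcdP Q(2,3) by blast
  have S_K: "ivP P \<subseteq> K" if "P \<in> S n" for n P using S_cases[OF that] PK Q(4) by blast
  have PQ': "P \<noteq> P'" if "P \<in> PP n" "P' \<in> Q" for n P P'
    using PQ[OF that] ivP_nonempty[OF PP_ok[OF that(1)]] by auto
  interpret assembly S T
  proof
    show "finite (S n)" for n using PP_fin Q_fin by (simp add: S_def)
    show "0 < pa P \<and> pb P < T" if "P \<in> S n" for n P using S_cd[OF that] cd by simp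
    show "ivP P \<inter> ivP P' = {}" if h: "P \<in> S n" "P' \<in> S m" "P \<noteq> P'" for n m P P'
    proof -
      consider "P \<in> PP n" "P' \<in> PP m" | "P \<in> PP n" "P' \<in> Q" | "P' \<in> PP m" "P \<in> Q" | "P \<in> Q" "P' \<in> Q"
        using S_cases[OF h(1)] S_cases[OF h(2)] by blast
      then show ?thesis
      proof cases
        case 1 then show ?thesis by (rule PP_disj[OF _ _ h(3)])
      next
        case 2 then show ?thesis by (rule PQ)
      next
        case 3 then have "ivP P' \<inter> ivP P = {}" by (rule PQ) then show ?thesis by (simp add: Int_commute)
      next
        case 4 then show ?thesis by (rule Q_disj[OF _ _ h(3)])
      qed
    qed
    show "S n \<inter> S m = {}" if h: "n \<noteq> m" for n m
    proof (rule ccontr)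
      assume "S n \<inter> S m \<noteq> {}"
      then obtain P where P: "P \<in> S n" "P \<in> S m" by blast
      consider "P \<in> PP n" "P \<in> PP m" | "P \<in> PP n" "P \<in> Q" | "P \<in> PP m" "P \<in> Q"
        using S_cases[OF P(1)] S_cases[OF P(2)] h by blast
      then show False
      proof cases
        case 1 then show ?thesis using PP_level_disj[OF h] by blast
      next
        case 2 then show ?thesis using PQ' by blast
      next
        case 3 then show ?thesis using PQ' by blast
      qed
    qed
  qed (rule S_ok, use T in simp_all)
  have Sum0: "(\<Sum>P\<in>S 0. f P) = (\<Sum>P\<in>PP 0. f P) + (\<Sum>P\<in>Q. f P)" for f :: "'n piece \<Rightarrow> 'b::comm_monoid_add"
  proof -
    have "PP 0 \<inter> Q = {}" using PQ' by blast
    then show ?thesis unfolding S_def by (simp add: sum.union_disjoint[OF PP_fin Q_fin])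
  qed
  have SumS: "(\<Sum>P\<in>S n. f P) = (\<Sum>P\<in>PP n. f P) + (if n = 0 then \<Sum>P\<in>Q. f P else 0)" for f :: "'n piece \<Rightarrow> 'b::comm_monoid_add" and n
    using Sum0[of f] by (cases "n = 0") (simp_all add: S_def)
  have fin: "(\<Sum>n. \<Sum>P\<in>S n. f P) < top" if "(\<Sum>n. \<Sum>P\<in>PP n. f P) < top" "\<And>P. P \<in> Q \<Longrightarrow> f P < top" for f :: "'n piece \<Rightarrow> ennreal"
  proof -
    have "(\<Sum>n. \<Sum>P\<in>S n. f P) = (\<Sum>n. \<Sum>P\<in>PP n. f P) + (\<Sum>n. if n = (0::nat) then \<Sum>P\<in>Q. f P else 0)"
      unfolding SumS by (rule suminf_add[OF summableI summableI, symmetric])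
    also have "(\<Sum>n. if n = (0::nat) then \<Sum>P\<in>Q. f P else 0) = (\<Sum>P\<in>Q. f P)"
      using suminf_finite[of "{0::nat}" "\<lambda>n. if n = (0::nat) then \<Sum>P\<in>Q. f P else 0"] by simp
    finally show ?thesis using that Q_fin by (simp add: less_top)
  qed
  have NR0: "(\<Sum>\<nu>\<in>NN 0. nR N \<nu>) < top" using N0_R it(1) by (auto intro: order_le_less_trans)
  have fin_rho: "(\<Sum>n. \<Sum>P\<in>S n. rho_cost j p P) < top" if "p \<ge> 1" for j p
    by (rule fin[OF sum_rho_cost[OF that NR0] rho_cost_finite[OF Q(1)]])
  have fin_u: "(\<Sum>n. \<Sum>P\<in>S n. u_cost p P) < top" if "p \<ge> 1" for p
    by (rule fin[OF sum_u_cost[OF that] u_cost_finite])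
  have fin_L: "(\<Sum>n. \<Sum>P\<in>S n. cL P) < top"
  proof (rule fin)
    \<comment> \<open>The potentials of the initial nodes are finite but not small; for the flux
      only integrability is claimed.\<close>
    have "(\<Sum>\<nu>\<in>NN 0. nL \<nu>) < top" using N0 it(1) by (simp add: nL_def nodes_ok_def less_top[symmetric])
    then have "16 * (\<Sum>\<nu>\<in>NN 0. nL \<nu>) + ennreal (34 * \<delta>) < top" by (simp add: ennreal_mult_less_top)
    with sum_L show "(\<Sum>n. \<Sum>P\<in>PP n. cL P) < top" by (rule order_le_less_trans)
    show "cL P < top" if "P \<in> Q" for P
    proof -
      have "pa P < pb P" using Q(1)[OF that] by (simp add: pok_def)
      \<comment> \<open>Resting pieces have zero velocity and carry no flux.\<close>
      then show ?thesis by (simp add: cL_def Q(5)[OF that])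
    qed
  qed
  have bd: "(\<lambda>n. \<Sum>m<n. \<Sum>P\<in>S m. bdP (pairing \<phi>) P) \<longlonglongrightarrow> 0" if \<phi>: "test_function {0..<T} \<phi>" for \<phi>
  proof -
    have J: "{0<..<T} \<subseteq> {0..<T}" by auto
    obtain C where C: "C \<ge> 0" "\<And>\<nu> q. nok \<nu> \<and> c \<le> na \<nu> \<and> nb \<nu> \<le> d \<and> q \<ge> 1 \<Longrightarrow>
        ennreal \<bar>bdN (pairing \<phi>) \<nu>\<bar> \<le> ennreal C * (nL \<nu> + nR q \<nu>)"
      using node_boundary_bound[OF \<phi> J cd] by blast
    \<comment> \<open>The boundary terms of the first approximation cancel those of the initial
      nodes, so that those of the unresolved nodes remain with opposite sign. The index is a
      successor because the first approximation sits in level 0.\<close>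
    have eq: "(\<Sum>m<Suc n. \<Sum>P\<in>S m. bdP (pairing \<phi>) P) = - (\<Sum>\<nu>\<in>NN (Suc n). bdN (pairing \<phi>) \<nu>)" for n
    proof -
      have "(\<Sum>m<Suc n. \<Sum>P\<in>S m. bdP (pairing \<phi>) P) =
          (\<Sum>m<Suc n. \<Sum>P\<in>PP m. bdP (pairing \<phi>) P) + (\<Sum>m<Suc n. if m = 0 then \<Sum>P\<in>Q. bdP (pairing \<phi>) P else 0)"
        unfolding SumS by (rule sum.distrib)
      moreover have "(\<Sum>m<Suc n. if m = 0 then \<Sum>P\<in>Q. bdP (pairing \<phi>) P else 0) = (\<Sum>P\<in>Q. bdP (pairing \<phi>) P)"
        by (simp add: sum.delta)
      moreover have "(\<Sum>P\<in>Q. bdP (pairing \<phi>) P) + (\<Sum>\<nu>\<in>N0. bdN (pairing \<phi>) \<nu>) = 0"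
        by (rule bd0) (simp add: pairing_def)
      ultimately show ?thesis unfolding bd_sum it(1) by linarith
    qed
    have le: "\<bar>\<Sum>\<nu>\<in>NN (Suc n). bdN (pairing \<phi>) \<nu>\<bar> \<le> C * (2 * (\<delta> / 2 ^ n))" for n
    proof -
      have "ennreal \<bar>\<Sum>\<nu>\<in>NN (Suc n). bdN (pairing \<phi>) \<nu>\<bar> \<le> ennreal (\<Sum>\<nu>\<in>NN (Suc n). \<bar>bdN (pairing \<phi>) \<nu>\<bar>)"
        by (intro ennreal_leI sum_abs)
      also have "\<dots> = (\<Sum>\<nu>\<in>NN (Suc n). ennreal \<bar>bdN (pairing \<phi>) \<nu>\<bar>)" by (rule sum_ennreal[symmetric]) simp
      \<comment> \<open>The order is the one at which the refinement controls the nodes of level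
        \<open>Suc n\<close>; both of their costs are at most
        \<open>\<delta> / 2 ^ n\<close>.\<close>
      also have "\<dots> \<le> (\<Sum>\<nu>\<in>NN (Suc n). ennreal C * (nL \<nu> + nR (Suc (N + n)) \<nu>))"
      proof (intro sum_mono C(2) conjI)
        fix \<nu> assume \<nu>: "\<nu> \<in> NN (Suc n)"
        show ok: "nok \<nu>" using NN_Suc_ok[of n] \<nu> by (simp add: nodes_ok_def)
        have "ivN \<nu> \<subseteq> \<Union> (ivN ` N0)" using NN_sub[of 0 "Suc n"] \<nu> it(1) by blast
        moreover have "\<Union> (ivN ` N0) \<subseteq> {c..d}"
        proof (intro UN_least subsetI)
          fix \<nu> t assume "\<nu> \<in> N0" "t \<in> ivN \<nu>"
          then show "t \<in> {c..d}" using N0_in(1,2)[of \<nu>] by (simp add: ivN_def)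
        qed
        ultimately have "{na \<nu><..<nb \<nu>} \<subseteq> {c..d}" unfolding ivN_def by (rule order_trans)
        moreover have "na \<nu> < nb \<nu>" using ok by (simp add: nok_def)
        ultimately show "c \<le> na \<nu>" "nb \<nu> \<le> d" by (simp_all add: greaterThanLessThan_subseteq_atLeastAtMost_iff)
      qed simp
      also have "\<dots> = ennreal C * ((\<Sum>\<nu>\<in>NN (Suc n). nL \<nu>) + (\<Sum>\<nu>\<in>NN (Suc n). nR (Suc (N + n)) \<nu>))"
        by (simp only: sum_distrib_left[symmetric] sum.distrib)
      also have "\<dots> \<le> ennreal C * (ennreal (\<delta> / 2 ^ n) + ennreal (\<delta> / 2 ^ n))"
        by (intro mult_left_mono add_mono NN_L NN_R) simp
      also have "\<dots> = ennreal (C * (2 * (\<delta> / 2 ^ n)))"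
      proof -
        have "ennreal (\<delta> / 2 ^ n) + ennreal (\<delta> / 2 ^ n) = ennreal (2 * (\<delta> / 2 ^ n))"
          using \<delta> by (simp add: ennreal_plus[symmetric] del: ennreal_plus)
        moreover have "0 \<le> 2 * (\<delta> / 2 ^ n)" using \<delta> by simp
        ultimately show ?thesis using C(1) by (simp only: ennreal_mult)
      qed
      finally show ?thesis using C(1) \<delta> by (subst (asm) ennreal_le_iff) auto
    qed
    have "(\<lambda>n. (1 / 2) ^ n :: real) \<longlonglongrightarrow> 0" by (rule LIMSEQ_realpow_zero) simp_all
    from tendsto_mult_right_zero[OF this, of "C * (2 * \<delta>)"]
    have lim: "(\<lambda>n. C * (2 * (\<delta> / 2 ^ n))) \<longlonglongrightarrow> 0" by (simp add: power_one_over field_simps)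
    have "(\<lambda>n. - (\<Sum>\<nu>\<in>NN (Suc n). bdN (pairing \<phi>) \<nu>)) \<longlonglongrightarrow> 0"
      by (rule Lim_null_comparison[OF _ lim], rule always_eventually) (auto simp only: real_norm_def abs_minus_cancel le)
    then have "(\<lambda>n. \<Sum>m<Suc n. \<Sum>P\<in>S m. bdP (pairing \<phi>) P) \<longlonglongrightarrow> 0" unfolding eq .
    then show ?thesis by (rule LIMSEQ_imp_Suc)
  qed
  have periodic_pu: "periodic (pu P)" if "pok P" for P :: "'n piece"
    using that by (auto simp: pu_def[abs_def] pok_def periodic_def axis_def)
  define \<rho> where "\<rho> = patch S prho"
  define u where "u = patch S (\<lambda>P t. pu P)"
  have per: "periodic (u t)" "periodic (\<rho> t)" for t
    unfolding u_def \<rho>_def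
    by (rule periodic_patch, rule periodic_pu[OF S_ok], assumption)
      (rule periodic_patch, rule prho_joint(2)[OF S_ok])
  have df: "divergence_free T u"
    unfolding divergence_free_def u_def using u_L1[OF fin_u] u_divergence_free by simp
  have flux: "L1_spacetime T (\<lambda>t x. \<rho> t x *\<^sub>R u t x)" unfolding u_def \<rho>_def by (rule flux_L1[OF fin_L])
  have weak: "weak_transport_solution T \<rho> u (\<lambda>x. 0)"
    unfolding weak_transport_solution_def
  proof (intro conjI allI impI df flux)
    show "L1_spacetime T \<rho>" unfolding \<rho>_def by (rule rho_L1[OF fin_rho]) simp
    fix \<phi> :: "real \<Rightarrow> real^'n \<Rightarrow> real" assume \<phi>: "test_function {0..<T} \<phi>"
    have "(LINT t|lebesgue_on {0..T}. LINT x|torus. \<rho> t x * (dt {0..<T} \<phi> t x + u t x \<bullet> grad (\<phi> t) x)) = 0"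
      unfolding \<rho>_def u_def by (rule weak_formulation[OF \<phi> _ cd S_cd bd[OF \<phi>] fin_rho fin_L]) auto
    then show "- (LINT x|torus. 0 * \<phi> 0 x) = (LINT t|lebesgue_on {0..T}. LINT x|torus. \<rho> t x * (dt {0..<T} \<phi> t x + u t x \<bullet> grad (\<phi> t) x))"
      by simp
  qed
  have dist: "bochner_norm (real N) {0<..<T} (Ck_norm N) (\<lambda>t x. \<rho> t x - \<rho>' t x) \<le> ennreal \<epsilon>"
    unfolding \<rho>_def
  proof (rule bochner_distance[OF N s\<rho> R(1) _ _ _ W _ _ small])
    show "Ck_norm N (\<rho>' t) \<le> ennreal R" if "t \<in> {0<..<T}" for t using that by (intro R(2)) auto
    show "PP n \<subseteq> S n" for n by (auto simp: S_def)
    show "Ck_norm N (\<lambda>x. prho P t x - \<rho>' t x) \<le> ennreal e" if "P \<in> S n" "P \<notin> PP n" "t \<in> ivP P" for n P t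
      using S_cases[OF that(1)] that(2) Q_close[OF _ that(3)] by blast
    show "Ck_norm N (\<rho>' t) \<le> ennreal e" if "t \<in> {0<..<T}" "t \<notin> W" "\<And>n P. P \<in> S n \<Longrightarrow> t \<notin> ivP P" for t
    proof (rule out[OF that(1,2)])
      fix P assume "P \<in> Q"
      then have "P \<in> S 0" by (simp add: S_def)
      then show "t \<notin> ivP P" by (rule that(3))
    qed
    have "(\<Sum>n. \<Sum>P\<in>PP n. cR (N + n) P) \<le> ennreal \<delta> + ennreal (4 * \<delta>)"
      using sum_R add_right_mono[OF N0_R, of "ennreal (4 * \<delta>)"] unfolding it(1) by (rule order_trans)
    also have "\<dots> = ennreal (5 * \<delta>)" using \<delta> by (simp add: ennreal_plus[symmetric] del: ennreal_plus)
    finally show "(\<Sum>n. \<Sum>P\<in>PP n. cR (N + n) P) \<le> ennreal (5 * \<delta>)" .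
  qed (use e \<delta> \<epsilon> in simp_all)
  have supp: "temporal_support {0..T} \<rho> \<subseteq> temporal_support UNIV \<rho>'"
    unfolding K_def[symmetric] unfolding temporal_support_def
  proof (rule closure_minimal)
    \<comment> \<open>Pieces lie over times in \<open>K\<close>, and \<open>K\<close> is closed, so
      that taking the closure of the nonzero times of \<rho> does not leave it.\<close>
    show "closed K" by (simp add: K_def temporal_support_def)
    show "{t \<in> {0..T}. \<not> (AE x in torus. \<rho> t x = 0)} \<subseteq> K"
    proof
      fix t assume "t \<in> {t \<in> {0..T}. \<not> (AE x in torus. \<rho> t x = 0)}"
      then have ne: "\<not> (AE x in torus. \<rho> t x = 0)" by simp
      show "t \<in> K"
      proof (cases rule: patch_cases[of t])
        case (1 n P)
        then show ?thesis using S_K by blast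
      next
        case 2
        then have "\<rho> t = (\<lambda>x. 0)" unfolding \<rho>_def by (rule patch_out)
        then show ?thesis using ne by simp
      qed
    qed
  qed
  show ?thesis
    by (rule exI[of _ u], rule exI[of _ \<rho>])
      (intro conjI ballI allI impI per df flux weak dist supp; unfold u_def \<rho>_def; intro u_bochner rho_bochner fin_u fin_rho)
qed

end
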